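(* Let $\theta\in(0,1)$, $T>0$, and $g=g^{(\theta)}+g^{(1)}$ with $g^{(\theta)}\in\mathrm{H\ddot ol}_{\theta,2}(\mathbb R)$ and $g^{(1)}:\mathbb R\to\mathbb R$ Lipschitz. Then there are $A,c>0$ and $\lambda_0\ge1$ such that for all $n\in\mathbb N$ and all $a\in\tau_n^\theta$ with $a<T$ it holds $$\mathbb P_{\mathcal F_a}\left(\sup_{t\in[a,T]}\big|E_t(g;\tau_n^\theta)-E_a(g;\tau_n^\theta)\big|\ge c\,\lambda\,\frac{Y_a\vee Y_a^\theta}{\sqrt n}\right)\le A\,e^{-\left(\frac{\ln\lambda}{A}\right)^2}\quad\text{a.s. for }\lambda\ge\lambda_0.$$
   Context: $W=(W_t)_{t\in[0,T]}$ is a standard Brownian motion with continuous paths and $W_0\equiv0$ on a complete probability space $(\Omega,\mathcal F,\mathbb P)$, $(\mathcal F_t)_{t\in[0,T]}$ is the augmentation of its natural filtration, $\mathcal F=\mathcal F_T$, and $Y_t:=e^{W_t-t/2}$, $t\in[0,T]$. $\mathbb P_{\mathcal G}(B):=\mathbb E[\mathbf 1_B\mid\mathcal G]$. $G(t,y):=\mathbb E\,g(yY_{T-t})$ for $(t,y)\in[0,T]\times(0,\infty)$, and $\varphi_t:=\frac{\partial G}{\partial y}(t,Y_t)$ for $t\in[0,T)$ (one has $g(Y_T)-\mathbb Eg(Y_T)=\int_{(0,T)}\varphi_t\,dY_t$ a.s.). For a time-net $\tau=\{t_i\}_{i=0}^n$, $0=t_0<\dots<t_n=T$, and $t\in[0,T]$,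 $$E_t(g;\tau):=\int_0^t\varphi_s\,dY_s-\sum_{i=1}^n\varphi_{t_{i-1}}(Y_{t_i\wedge t}-Y_{t_{i-1}\wedge t}).$$ $\tau_n^\theta:=\{T-T(1-i/n)^{1/\theta}\}_{i=0}^n$. $C_b^0(\mathbb R)$: bounded continuous functions vanishing at $0$ with sup-norm; $\mathrm{H\ddot ol}_1^0(\mathbb R)$: Lipschitz functions vanishing at $0$, normed by the Lipschitz constant; $K(v,f):=\inf\{\|f_0\|_{C_b^0}+v\|f_1\|_{\mathrm{H\ddot ol}_1^0}:f=f_0+f_1\}$, $v>0$; $\mathrm{H\ddot ol}_{\theta,2}(\mathbb R)=(C_b^0(\mathbb R),\mathrm{H\ddot ol}_1^0(\mathbb R))_{\theta,2}$ is the set of $f\in C_b^0+\mathrm{H\ddot ol}_1^0$ with $\int_0^\infty(v^{-\theta}K(v,f))^2\frac{dv}{v}<\infty$. *)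

theory Defs
  imports "HOL-Probability.Probability"
begin

subsection \<open>Brownian motion, its augmented filtration, geometric Brownian motion\<close>

definition std_brownian_motion :: "'a measure \<Rightarrow> real \<Rightarrow> (real \<Rightarrow> 'a \<Rightarrow> real) \<Rightarrow> bool" where
  "std_brownian_motion M T W \<longleftrightarrow>
     prob_space M \<and>
     (\<forall>t\<in>{0..T}. W t \<in> borel_measurable M) \<and>
     (\<forall>\<omega>\<in>space M. W 0 \<omega> = 0) \<and>
     (\<forall>\<omega>\<in>space M. continuous_on {0..T} (\<lambda>t. W t \<omega>)) \<and>
     (\<forall>s t. 0 \<le> s \<and> s < t \<and> t \<le> T \<longrightarrow>
        distributed M lborel (\<lambda>\<omega>. W t \<omega> - W s \<omega>) (normal_density 0 (sqrt (t - s)))) \<and>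
     (\<forall>(m::nat) r. 0 \<le> r 0 \<and> (\<forall>i<m. r i \<le> r (Suc i)) \<and> r m \<le> T \<longrightarrow>
        prob_space.indep_vars M (\<lambda>_. borel) (\<lambda>i \<omega>. W (r (Suc i)) \<omega> - W (r i) \<omega>) {..<m})"

text \<open>Only the space and the \<open>\<sigma>\<close>-algebra of the value matter (its measure is trivial).
  On a complete space \<^term>\<open>null_sets M\<close> contains all subsets of null sets.\<close>

definition augmented_filtration :: "'a measure \<Rightarrow> (real \<Rightarrow> 'a \<Rightarrow> real) \<Rightarrow> real \<Rightarrow> 'a measure" where
  "augmented_filtration M W t =
     sigma (space M) ({W s -` B \<inter> space M | s B. 0 \<le> s \<and> s \<le> t \<and> B \<in> sets borel} \<union> null_sets M)"

definition geom_bm :: "(real \<Rightarrow> 'a \<Rightarrow> real) \<Rightarrow> real \<Rightarrow> 'a \<Rightarrow> real" where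
  "geom_bm W t \<omega> = exp (W t \<omega> - t / 2)"


subsection \<open>The stochastic integral\<close>

definition simple_integrand ::
  "(real \<Rightarrow> 'a measure) \<Rightarrow> real \<Rightarrow> nat \<Rightarrow> (nat \<Rightarrow> real) \<Rightarrow> (nat \<Rightarrow> 'a \<Rightarrow> real) \<Rightarrow> bool" where
  "simple_integrand F T m s \<xi> \<longleftrightarrow>
     0 \<le> s 0 \<and> (\<forall>i<m. s i \<le> s (Suc i)) \<and> s m \<le> T \<and>
     (\<forall>i<m. \<xi> i \<in> borel_measurable (F (s i)) \<and> (\<exists>C. \<forall>\<omega>\<in>space (F (s i)). \<bar>\<xi> i \<omega>\<bar> \<le> C))"

definition simple_process ::
  "nat \<Rightarrow> (nat \<Rightarrow> real) \<Rightarrow> (nat \<Rightarrow> 'a \<Rightarrow> real) \<Rightarrow> real \<Rightarrow> 'a \<Rightarrow> real" where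
  "simple_process m s \<xi> t \<omega> = (\<Sum>i<m. \<xi> i \<omega> * indicator {s i<..s (Suc i)} t)"

definition simple_integral ::
  "(real \<Rightarrow> 'a \<Rightarrow> real) \<Rightarrow> nat \<Rightarrow> (nat \<Rightarrow> real) \<Rightarrow> (nat \<Rightarrow> 'a \<Rightarrow> real) \<Rightarrow> real \<Rightarrow> 'a \<Rightarrow> real" where
  "simple_integral S m s \<xi> t \<omega> =
     (\<Sum>i<m. \<xi> i \<omega> * (S (min (s (Suc i)) t) \<omega> - S (min (s i) t) \<omega>))"

text \<open>
  The Ito integral \<open>X t = \<integral>\<^sub>0\<^sup>t H dS\<close>, \<open>0 \<le> t \<le> T\<close>, against a continuous square-integrable
  martingale \<open>S\<close> whose quadratic variation has density \<open>q\<close>, i.e. \<open>d\<langle>S\<rangle>\<^sub>u = q\<^sub>u du\<close>.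
  The process \<open>X\<close> is continuous and adapted, and is the \<open>L\<^sup>2\<close>-limit of the integrals of simple
  integrands converging to \<open>H\<close> in \<open>L\<^sup>2(d\<langle>S\<rangle> \<otimes> dM)\<close>. The value of \<open>H\<close> at time \<open>T\<close> is irrelevant.
  By the Ito isometry \<open>X\<close> is unique up to indistinguishability; \<open>ito_integral\<close> picks one version.
\<close>

definition is_ito_integral ::
  "'a measure \<Rightarrow> (real \<Rightarrow> 'a measure) \<Rightarrow> real \<Rightarrow> (real \<Rightarrow> 'a \<Rightarrow> real) \<Rightarrow> (real \<Rightarrow> 'a \<Rightarrow> real) \<Rightarrow>
    (real \<Rightarrow> 'a \<Rightarrow> real) \<Rightarrow> (real \<Rightarrow> 'a \<Rightarrow> real) \<Rightarrow> bool" where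
  "is_ito_integral M F T S q H X \<longleftrightarrow>
     (\<lambda>(u, \<omega>). H u \<omega>) \<in> borel_measurable (restrict_space borel {0..<T} \<Otimes>\<^sub>M M) \<and>
     (\<forall>t\<in>{0..T}. X t \<in> borel_measurable (F t)) \<and>
     (\<forall>\<omega>\<in>space M. continuous_on {0..T} (\<lambda>t. X t \<omega>)) \<and>
     (\<exists>m s \<xi>.
        (\<forall>k::nat. simple_integrand F T (m k) (s k) (\<xi> k)) \<and>
        (\<lambda>k. \<integral>\<^sup>+\<omega>. (\<integral>\<^sup>+u\<in>{0..<T}.
            ennreal ((simple_process (m k) (s k) (\<xi> k) u \<omega> - H u \<omega>)\<^sup>2 * q u \<omega>) \<partial>lborel) \<partial>M)
          \<longlonglongrightarrow> 0 \<and>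
        (\<forall>t\<in>{0..T}.
          (\<lambda>k. \<integral>\<^sup>+\<omega>. ennreal ((simple_integral S (m k) (s k) (\<xi> k) t \<omega> - X t \<omega>)\<^sup>2) \<partial>M)
            \<longlonglongrightarrow> 0))"

definition ito_integral ::
  "'a measure \<Rightarrow> (real \<Rightarrow> 'a measure) \<Rightarrow> real \<Rightarrow> (real \<Rightarrow> 'a \<Rightarrow> real) \<Rightarrow> (real \<Rightarrow> 'a \<Rightarrow> real) \<Rightarrow>
    (real \<Rightarrow> 'a \<Rightarrow> real) \<Rightarrow> real \<Rightarrow> 'a \<Rightarrow> real" where
  "ito_integral M F T S q H = (SOME X. is_ito_integral M F T S q H X)"


subsection \<open>The discretization error\<close>

definition value_fun ::
  "'a measure \<Rightarrow> (real \<Rightarrow> 'a \<Rightarrow> real) \<Rightarrow> real \<Rightarrow> (real \<Rightarrow> real) \<Rightarrow> real \<Rightarrow> real \<Rightarrow> real" where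
  "value_fun M W T g t y = (\<integral>\<omega>. g (y * geom_bm W (T - t) \<omega>) \<partial>M)"

definition hedge ::
  "'a measure \<Rightarrow> (real \<Rightarrow> 'a \<Rightarrow> real) \<Rightarrow> real \<Rightarrow> (real \<Rightarrow> real) \<Rightarrow> real \<Rightarrow> 'a \<Rightarrow> real" where
  "hedge M W T g t \<omega> = deriv (\<lambda>y. value_fun M W T g t y) (geom_bm W t \<omega>)"

text \<open>The integrator \<open>Y = geom_bm W\<close> satisfies \<open>dY = Y dW\<close>, hence \<open>d\<langle>Y\<rangle>\<^sub>u = Y\<^sub>u\<^sup>2 du\<close>.
  The time-net is \<open>\<tau> 0, \<dots>, \<tau> n\<close>.\<close>

definition hedging_error ::
  "'a measure \<Rightarrow> (real \<Rightarrow> 'a \<Rightarrow> real) \<Rightarrow> real \<Rightarrow> (real \<Rightarrow> real) \<Rightarrow> nat \<Rightarrow> (nat \<Rightarrow> real) \<Rightarrow>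
    real \<Rightarrow> 'a \<Rightarrow> real" where
  "hedging_error M W T g n \<tau> t \<omega> =
     ito_integral M (augmented_filtration M W) T
       (geom_bm W) (\<lambda>u \<omega>. (geom_bm W u \<omega>)\<^sup>2) (hedge M W T g) t \<omega>
     - (\<Sum>i=1..n. hedge M W T g (\<tau> (i - 1)) \<omega> *
          (geom_bm W (min (\<tau> i) t) \<omega> - geom_bm W (min (\<tau> (i - 1)) t) \<omega>))"

definition theta_net :: "real \<Rightarrow> real \<Rightarrow> nat \<Rightarrow> nat \<Rightarrow> real" where
  "theta_net T \<theta> n i = T - T * (1 - real i / real n) powr (1 / \<theta>)"


subsection \<open>The interpolation space between bounded continuous and Lipschitz functions\<close>

definition Cb0 :: "(real \<Rightarrow> real) set" where
  "Cb0 = {f. continuous_on UNIV f \<and> bounded (range f) \<and> f 0 = 0}"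

definition sup_norm :: "(real \<Rightarrow> real) \<Rightarrow> real" where
  "sup_norm f = (SUP x. \<bar>f x\<bar>)"

definition Lip0 :: "(real \<Rightarrow> real) set" where
  "Lip0 = {f. (\<exists>L. L-lipschitz_on UNIV f) \<and> f 0 = 0}"

definition lip_norm :: "(real \<Rightarrow> real) \<Rightarrow> real" where
  "lip_norm f = Inf {L. L-lipschitz_on UNIV f}"

definition K_functional :: "real \<Rightarrow> (real \<Rightarrow> real) \<Rightarrow> real" where
  "K_functional v f =
     Inf {sup_norm f0 + v * lip_norm f1 | f0 f1.
            f0 \<in> Cb0 \<and> f1 \<in> Lip0 \<and> f = (\<lambda>x. f0 x + f1 x)}"

definition Hol2 :: "real \<Rightarrow> (real \<Rightarrow> real) set" where
  "Hol2 \<theta> = {f. (\<exists>f0\<in>Cb0. \<exists>f1\<in>Lip0. f = (\<lambda>x. f0 x + f1 x)) \<and>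
     (\<integral>\<^sup>+v\<in>{0<..}. ennreal ((v powr (-\<theta>) * K_functional v f)\<^sup>2 / v) \<partial>lborel) < \<infinity>}"

end

theory Submission
  imports Defs
begin

text \<open>
  In the logarithmic variable the value process is the heat flow of \<open>x \<mapsto> g (exp (x - T / 2))\<close> along
  \<open>W\<close>. Splitting \<open>g\<theta>\<close> into a bounded and a Lipschitz part and optimising over the
  splitting bounds the derivatives of the flow at time \<open>t\<close> by the K-functional at \<open>\<surd>(T - t) exp x\<close>.
  Hence the error over one interval of the net is dominated by a coefficient, known at time \<open>a\<close>, times
  exponentials of Gaussian increments, and on the \<open>\<theta>\<close>-net the squares of these coefficients add up to
  \<open>O(1 / n)\<close> times the squared weight, because they form a lower sum of the integral that defines
  \<open>Hol2\<close>.

  An induction over the net, as for Burkholder's inequality, turns this into the conditional moment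
  bounds \<open>exp (C m\<^sup>2) (C / n) ^ m\<close> of order \<open>2 m\<close>. Doob's inequality carries them over to the supremum,
  and the choice of \<open>m\<close> of order \<open>ln l\<close> gives the lognormal tail.

  The Ito integral enters only through the identity \<open>\<integral>\<^sub>0\<^sup>t \<phi> dY = G (t, Y\<^sub>t) - G (0, Y\<^sub>0)\<close>. It is proved
  by approximating \<open>\<phi>\<close> by simple integrands and estimating the \<open>L\<^sup>2\<close>-distance directly with second order
  one-step remainders, without Ito's formula.
\<close>

subsection \<open>Gaussian integrals\<close>

text \<open>In the scale \<open>r = sqrt (T - t)\<close> the second derivative of the flow is of
  size K (r exp x) / r^2, so a step from r down to r' costs about ((r - r') / r) K (r' exp x). The
  exponent 1 / \<theta> of the net makes r - r' at most of order
  \<open>r powr (1 - 2 * \<theta>) / n\<close>. Spending this on one of the two factors r - r' in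
  the squared cost leaves 1 / n times a term of a lower sum of the integral in \<open>Hol2\<close>.
  Rescaling that integral by exp x produces exp (2 \<theta> x), the Lipschitz part produces exp (2
  x): hence the two competitors in the weight.

  The last interval needs its own argument, since the bound on the second derivative explodes at T;
  there the payoff is compared with its mean, and a pointwise consequence of \<open>Hol2\<close>
  suffices.

  Moments growing like exp (C m^2) are typical of exponentials of Gaussian variables, which is why
  the exponent of the tail is (ln l)^2. As the integral is picked by \<open>SOME\<close>, any
  version of it must be identified with the explicit value process, simultaneously at all
  times.\<close>

abbreviation gauss :: "real measure" where "gauss \<equiv> std_normal_distribution"

lemma prob_space_gauss: "prob_space gauss"
  by (rule prob_space_normal_density) simp

lemma sets_gauss [measurable_cong]: "sets gauss = sets borel"
  by simp

lemma std_normal_density_shift: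
  "std_normal_density (z - a) = std_normal_density z * exp (a * z - a\<^sup>2 / 2)"
  by (simp add: std_normal_density_def exp_add [symmetric] power2_eq_square field_simps)

text \<open>Cameron-Martin in dimension one: a translation of the variable is traded for an
  exponential density. This moves derivatives in the state from f to the kernel.\<close>

lemma gauss_shift:
  fixes F :: "real \<Rightarrow> real"
  assumes [measurable]: "F \<in> borel_measurable borel"
  shows integrable_gauss_shift:
      "integrable gauss (\<lambda>z. F (z + a)) \<longleftrightarrow> integrable gauss (\<lambda>z. F z * exp (a * z - a\<^sup>2 / 2))"
    and integral_gauss_shift:
      "(\<integral>z. F (z + a) \<partial>gauss) = (\<integral>z. F z * exp (a * z - a\<^sup>2 / 2) \<partial>gauss)"
proof -
  let ?G = "\<lambda>z. std_normal_density (z - a) * F z"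
  have G: "std_normal_density z * (F z * exp (a * z - a\<^sup>2 / 2)) = ?G z" for z
    by (simp add: std_normal_density_shift)
  have aff: "std_normal_density z * F (z + a) = ?G (a + 1 * z)" for z
    by (simp add: add.commute)
  show "integrable gauss (\<lambda>z. F (z + a)) \<longleftrightarrow> integrable gauss (\<lambda>z. F z * exp (a * z - a\<^sup>2 / 2))"
    using lborel_integrable_real_affine_iff [of 1 ?G a]
    by (simp add: integrable_density G aff)
  show "(\<integral>z. F (z + a) \<partial>gauss) = (\<integral>z. F z * exp (a * z - a\<^sup>2 / 2) \<partial>gauss)"
    using lborel_integral_real_affine [of 1 ?G a]
    by (simp add: integral_density G aff)
qed

text \<open>The density in \<open>gauss_shift\<close> for \<open>F = 1\<close> has total mass one;
  integrability and the Laplace transform follow without computing an integral.\<close>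

lemma integrable_gauss_exp: "integrable gauss (\<lambda>z. exp (a * z))"
  and integral_gauss_exp: "(\<integral>z. exp (a * z) \<partial>gauss) = exp (a\<^sup>2 / 2)"
proof -
  interpret prob_space gauss by (rule prob_space_gauss)
  have eq: "exp (a * z) = exp (a\<^sup>2 / 2) * (1 * exp (a * z - a\<^sup>2 / 2))" for z
    by (simp add: exp_add [symmetric])
  have i: "integrable gauss (\<lambda>z. 1 * exp (a * z - a\<^sup>2 / 2))"
    by (subst integrable_gauss_shift [of "\<lambda>_. 1", symmetric]) simp_all
  then show "integrable gauss (\<lambda>z. exp (a * z))"
    unfolding eq by (rule integrable_mult_right)
  have "(\<integral>z. exp (a * z) \<partial>gauss) = exp (a\<^sup>2 / 2) * (\<integral>z. 1 * exp (a * z - a\<^sup>2 / 2) \<partial>gauss)"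
    unfolding eq by (rule Bochner_Integration.integral_mult_right) (use i in simp)
  also have "(\<integral>z. 1 * exp (a * z - a\<^sup>2 / 2) \<partial>gauss) = 1"
    by (subst integral_gauss_shift [of "\<lambda>_. 1", symmetric]) (use prob_space in simp_all)
  finally show "(\<integral>z. exp (a * z) \<partial>gauss) = exp (a\<^sup>2 / 2)" by simp
qed

lemma exp_abs_le: "exp (c * \<bar>z\<bar>) \<le> exp (c * z) + exp (- c * z :: real)"
  by (cases "z \<ge> 0") (auto simp: abs_if)

lemma integrable_gauss_exp_abs: "integrable gauss (\<lambda>z. exp (c * \<bar>z\<bar>))"
proof (rule Bochner_Integration.integrable_bound)
  show "integrable gauss (\<lambda>z. exp (c * z) + exp (- c * z))"
    by (intro Bochner_Integration.integrable_add integrable_gauss_exp)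
  show "AE z in gauss. norm (exp (c * \<bar>z\<bar>)) \<le> norm (exp (c * z) + exp (- c * z))"
    by (intro AE_I2) (use exp_abs_le [of c] in \<open>simp add: add_nonneg_nonneg\<close>)
qed simp

lemma integral_gauss_exp_abs: "(\<integral>z. exp (c * \<bar>z\<bar>) \<partial>gauss) \<le> 2 * exp (c\<^sup>2 / 2)"
proof -
  have "(\<integral>z. exp (c * \<bar>z\<bar>) \<partial>gauss) \<le> (\<integral>z. exp (c * z) + exp (- c * z) \<partial>gauss)"
    by (intro integral_mono exp_abs_le integrable_gauss_exp_abs Bochner_Integration.integrable_add
        integrable_gauss_exp)
  also have "\<dots> = exp (c\<^sup>2 / 2) + exp ((- c)\<^sup>2 / 2)"
    by (subst Bochner_Integration.integral_add) (intro integrable_gauss_exp | simp only: integral_gauss_exp)+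
  finally show ?thesis by simp
qed

subsection \<open>Functions of exponential growth\<close>

text \<open>A class closed under sums, products, affine substitutions and Gaussian averaging, all of
  whose members are Gaussian integrable. Integrability thus becomes a matter of closure
  rules.\<close>

definition growth :: "(real \<Rightarrow> real) \<Rightarrow> bool" where
  "growth f \<longleftrightarrow> f \<in> borel_measurable borel \<and> (\<exists>C c. \<forall>x. \<bar>f x\<bar> \<le> C * exp (c * \<bar>x\<bar>))"

lemma growth_measurable: "growth f \<Longrightarrow> f \<in> borel_measurable borel"
  by (simp add: growth_def)

lemma growthI: "f \<in> borel_measurable borel \<Longrightarrow> (\<And>x. \<bar>f x\<bar> \<le> C * exp (c * \<bar>x\<bar>)) \<Longrightarrow> growth f"
  by (auto simp: growth_def)

lemma growthE:
  assumes "growth f"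
  obtains C c where "0 \<le> C" "0 \<le> c" "\<And>x. \<bar>f x\<bar> \<le> C * exp (c * \<bar>x\<bar>)"
proof -
  obtain C c where b: "\<And>x. \<bar>f x\<bar> \<le> C * exp (c * \<bar>x\<bar>)" using assms by (auto simp: growth_def)
  show ?thesis
  proof (rule that [of "\<bar>C\<bar>" "\<bar>c\<bar>"])
    fix x
    have "\<bar>f x\<bar> \<le> C * exp (c * \<bar>x\<bar>)" by (rule b)
    also have "\<dots> \<le> \<bar>C\<bar> * exp (\<bar>c\<bar> * \<bar>x\<bar>)" by (intro mult_mono) (auto intro!: mult_right_mono)
    finally show "\<bar>f x\<bar> \<le> \<bar>C\<bar> * exp (\<bar>c\<bar> * \<bar>x\<bar>)" .
  qed auto
qed

lemma growth_bound:
  assumes "growth g" "f \<in> borel_measurable borel" "\<And>x. \<bar>f x\<bar> \<le> \<bar>g x\<bar>"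
  shows "growth f"
  using assms by (auto simp: growth_def) (meson order_trans)

lemma growth_const: "growth (\<lambda>_. k)"
  by (rule growthI [of _ "\<bar>k\<bar>" 0]) auto

lemma growth_exp_abs: "growth (\<lambda>x. exp (c * \<bar>x\<bar>))"
  by (rule growthI [of _ 1 c]) auto

lemma growth_ident: "growth (\<lambda>x. x)"
proof (rule growthI [of _ 1 1])
  fix x :: real
  show "\<bar>x\<bar> \<le> 1 * exp (1 * \<bar>x\<bar>)" using exp_ge_add_one_self [of "\<bar>x\<bar>"] by (simp del: exp_ge_add_one_self)
qed auto

lemma growth_abs: "growth f \<Longrightarrow> growth (\<lambda>x. \<bar>f x\<bar>)"
  by (auto simp: growth_def)

lemma growth_minus: "growth f \<Longrightarrow> growth (\<lambda>x. - f x)"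
  by (auto simp: growth_def)

lemma growth_add:
  assumes "growth f" "growth g" shows "growth (\<lambda>x. f x + g x)"
proof -
  note [measurable] = growth_measurable [OF assms(1)] growth_measurable [OF assms(2)]
  obtain C c where f: "0 \<le> C" "0 \<le> c" "\<And>x. \<bar>f x\<bar> \<le> C * exp (c * \<bar>x\<bar>)" using growthE [OF assms(1)] by blast
  obtain D d where g: "0 \<le> D" "0 \<le> d" "\<And>x. \<bar>g x\<bar> \<le> D * exp (d * \<bar>x\<bar>)" using growthE [OF assms(2)] by blast
  show ?thesis
  proof (rule growthI)
    fix x
    have "C * exp (c * \<bar>x\<bar>) \<le> C * exp ((c + d) * \<bar>x\<bar>)" "D * exp (d * \<bar>x\<bar>) \<le> D * exp ((c + d) * \<bar>x\<bar>)"
      using f g by (auto intro!: mult_left_mono mult_right_mono)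
    then show "\<bar>f x + g x\<bar> \<le> (C + D) * exp ((c + d) * \<bar>x\<bar>)"
      using f(3) [of x] g(3) [of x] by (simp only: distrib_right) linarith
  qed simp
qed

lemma growth_diff: "growth f \<Longrightarrow> growth g \<Longrightarrow> growth (\<lambda>x. f x - g x)"
  using growth_add [of f "\<lambda>x. - g x"] growth_minus [of g] by simp

lemma growth_mult:
  assumes "growth f" "growth g" shows "growth (\<lambda>x. f x * g x)"
proof -
  note [measurable] = growth_measurable [OF assms(1)] growth_measurable [OF assms(2)]
  obtain C c where f: "0 \<le> C" "0 \<le> c" "\<And>x. \<bar>f x\<bar> \<le> C * exp (c * \<bar>x\<bar>)" using growthE [OF assms(1)] by blast
  obtain D d where g: "0 \<le> D" "0 \<le> d" "\<And>x. \<bar>g x\<bar> \<le> D * exp (d * \<bar>x\<bar>)" using growthE [OF assms(2)] by blast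
  show ?thesis
  proof (rule growthI)
    fix x
    have "\<bar>f x * g x\<bar> \<le> (C * exp (c * \<bar>x\<bar>)) * (D * exp (d * \<bar>x\<bar>))"
      unfolding abs_mult using f g by (intro mult_mono) auto
    then show "\<bar>f x * g x\<bar> \<le> (C * D) * exp ((c + d) * \<bar>x\<bar>)"
      by (simp add: exp_add [symmetric] algebra_simps)
  qed simp
qed

lemma growth_power: "growth f \<Longrightarrow> growth (\<lambda>x. f x ^ n)"
  by (induction n) (auto intro: growth_const growth_mult)

lemma growth_divide: "growth f \<Longrightarrow> growth (\<lambda>x. f x / k)"
  using growth_mult [OF growth_const [of "1 / k"], of f] by simp

lemma growth_affine:
  assumes "growth f" shows "growth (\<lambda>z. f (x + s * z))"
proof -
  note [measurable] = growth_measurable [OF assms]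
  obtain C c where f: "0 \<le> C" "0 \<le> c" "\<And>x. \<bar>f x\<bar> \<le> C * exp (c * \<bar>x\<bar>)" using growthE [OF assms] by blast
  show ?thesis
  proof (rule growthI)
    fix z
    have "\<bar>x + s * z\<bar> \<le> \<bar>x\<bar> + \<bar>s\<bar> * \<bar>z\<bar>" by (metis abs_mult abs_triangle_ineq)
    then have "c * \<bar>x + s * z\<bar> \<le> c * \<bar>x\<bar> + c * \<bar>s\<bar> * \<bar>z\<bar>"
      using mult_left_mono [OF _ f(2)] by (fastforce simp: algebra_simps)
    then have "C * exp (c * \<bar>x + s * z\<bar>) \<le> C * (exp (c * \<bar>x\<bar>) * exp (c * \<bar>s\<bar> * \<bar>z\<bar>))"
      using f(1) by (intro mult_left_mono) (simp_all add: exp_add [symmetric])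
    then show "\<bar>f (x + s * z)\<bar> \<le> (C * exp (c * \<bar>x\<bar>)) * exp ((c * \<bar>s\<bar>) * \<bar>z\<bar>)"
      using f(3) [of "x + s * z"] by (simp add: mult_ac)
  qed simp
qed

lemma growth_shift: "growth f \<Longrightarrow> growth (\<lambda>z. f (z + a))"
  using growth_affine [of f a 1] by (simp add: add.commute)

lemma growth_exp: "growth (\<lambda>x. exp (c * x))"
  by (rule growthI [of _ 1 "\<bar>c\<bar>"]) (auto simp: abs_mult [symmetric])

lemma growth_exp_affine: "growth (\<lambda>x. exp (c * x - d))"
  using growth_mult [OF growth_const [of "exp (- d)"] growth_exp [of c]]
  by (simp add: exp_add [symmetric])

lemmas growth_intros = growth_const growth_exp_abs growth_ident growth_abs growth_minus growth_add
  growth_diff growth_mult growth_power growth_divide growth_exp growth_exp_affine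

lemma integrable_growth:
  assumes "growth f" shows "integrable gauss f"
proof -
  note [measurable] = growth_measurable [OF assms]
  obtain C c where f: "\<And>x. \<bar>f x\<bar> \<le> C * exp (c * \<bar>x\<bar>)" using assms by (auto simp: growth_def)
  show ?thesis
    by (rule Bochner_Integration.integrable_bound [of _ "\<lambda>z. C * exp (c * \<bar>z\<bar>)"])
       (auto intro!: integrable_mult_right integrable_gauss_exp_abs
             intro: order_trans[OF f abs_ge_self])
qed

lemma integral_gauss_mono:
  "growth f \<Longrightarrow> growth h \<Longrightarrow> (\<And>z. f z \<le> h z) \<Longrightarrow> (\<integral>z. f z \<partial>gauss) \<le> (\<integral>z. h z \<partial>gauss)"
  by (intro integral_mono integrable_growth)

lemma abs_integral_gauss_le:
  assumes "growth f" "growth h" "\<And>z. \<bar>f z\<bar> \<le> h z"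
  shows "\<bar>\<integral>z. f z \<partial>gauss\<bar> \<le> (\<integral>z. h z \<partial>gauss)"
  by (rule order_trans [OF integral_abs_bound])
     (intro integral_gauss_mono assms growth_abs)

lemma integral_gauss_const [simp]: "(\<integral>z. k \<partial>gauss) = (k::real)"
  using prob_space.prob_space [OF prob_space_gauss] by simp

lemma gauss_mean: "(\<integral>z. z \<partial>gauss) = 0"
  using integral_std_normal_distribution_moment_odd [of 1] by simp

lemma gauss_second_moment: "(\<integral>z. z\<^sup>2 \<partial>gauss) = 1"
  using std_normal_distribution_even_moments(1) [of 1] by simp

text \<open>Reduces every centred normal law to a scaled \<open>gauss\<close>, so that all later
  integrals are taken against one measure.\<close>

lemma gauss_distr_normal:
  assumes "prob_space M" "distributed M lborel X (normal_density 0 \<sigma>)" "0 < \<sigma>"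
  shows "distr M borel X = distr gauss borel (\<lambda>z. \<sigma> * z)"
proof -
  interpret G: prob_space gauss by (rule prob_space_gauss)
  have id: "distributed gauss lborel (\<lambda>z. z) std_normal_density"
    by (auto simp: distributed_def distr_id2)
  have "distributed gauss lborel (\<lambda>z. 0 + \<sigma> * z) (normal_density (0 + \<sigma> * 0) (\<bar>\<sigma>\<bar> * 1))"
    by (rule G.normal_density_affine [OF id]) (use assms in auto)
  then have "distr gauss lborel (\<lambda>z. \<sigma> * z) = density lborel (normal_density 0 \<sigma>)"
    using assms by (simp add: distributed_distr_eq_density)
  moreover have "distr M lborel X = density lborel (normal_density 0 \<sigma>)"
    using assms(2) by (rule distributed_distr_eq_density)
  moreover have "distr M lborel X = distr M borel X" "distr gauss lborel (\<lambda>z. \<sigma> * z) = distr gauss borel (\<lambda>z. \<sigma> * z)"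
    by (auto intro!: distr_cong)
  ultimately show ?thesis by simp
qed

lemma gauss_convolution:
  assumes "0 \<le> v" "0 \<le> w"
  shows "distr (gauss \<Otimes>\<^sub>M gauss) borel (\<lambda>x. sqrt v * fst x + sqrt w * snd x) =
    distr gauss borel (\<lambda>z. sqrt (v + w) * z)"
proof -
  interpret G: prob_space gauss by (rule prob_space_gauss)
  interpret P: pair_prob_space gauss gauss ..
  let ?P = "gauss \<Otimes>\<^sub>M gauss"
  have fst: "distr ?P gauss fst = gauss" by (rule G.distr_pair_fst)
  have "distr ?P gauss snd = distr (distr ?P ?P (\<lambda>(x, y). (y, x))) gauss snd"
    by (subst P.distr_pair_swap) simp
  also have "\<dots> = distr ?P gauss fst"
    by (subst distr_distr) (auto intro!: distr_cong)
  finally have snd: "distr ?P gauss snd = gauss" using fst by simp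
  have proj: "distr ?P borel (\<lambda>x. c * h x) = distr gauss borel (\<lambda>z. c * z)"
    if "distr ?P gauss h = gauss" "h \<in> measurable ?P gauss" for h and c :: real
    using distr_distr [of "\<lambda>z. c * z" gauss borel h ?P] that by (simp add: o_def)
  have "P.indep_var gauss fst gauss snd"
    unfolding P.indep_var_distribution_eq fst snd
    using distr_id [of ?P] by (simp add: id_def)
  then have ind: "P.indep_var borel ((\<lambda>z. sqrt v * z) \<circ> fst) borel ((\<lambda>z. sqrt w * z) \<circ> snd)"
    by (rule P.indep_var_compose) auto
  \<comment> \<open>A vanishing variance gives a point mass without density; these two cases follow
    from the marginals of the product.\<close>
  consider "v = 0" | "w = 0" | "0 < v" "0 < w" using assms by fastforce
  then show ?thesis
  proof cases
    case 1
    then show ?thesis using proj [OF snd] by simp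
  next
    case 2
    then show ?thesis using proj [OF fst] by simp
  next
    case 3
    have id: "distributed gauss lborel (\<lambda>z. z) std_normal_density"
      by (auto simp: distributed_def distr_id2)
    have n: "distributed ?P lborel (\<lambda>x. c * h x) (normal_density 0 c)"
      if "c > 0" "distr ?P gauss h = gauss" "h \<in> measurable ?P gauss" for c :: real and h
    proof -
      have "distributed gauss lborel (\<lambda>z. 0 + c * z) (normal_density (0 + c * 0) (\<bar>c\<bar> * 1))"
        by (rule G.normal_density_affine [OF id]) (use that in auto)
      then have "distr gauss lborel (\<lambda>z. c * z) = density lborel (normal_density 0 c)"
        using that by (simp add: distributed_distr_eq_density)
      moreover have "distr ?P lborel (\<lambda>x. c * h x) = distr gauss lborel (\<lambda>z. c * z)"
        using distr_distr [of "\<lambda>z. c * z" gauss lborel h ?P] that by (simp add: o_def)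
      ultimately show ?thesis using that(3) by (simp add: distributed_def)
    qed
    have "distributed ?P lborel (\<lambda>x. sqrt v * fst x + sqrt w * snd x)
       (normal_density (0 + 0) (sqrt ((sqrt v)\<^sup>2 + (sqrt w)\<^sup>2)))"
      by (rule P.add_indep_normal) (use 3 ind n fst snd in \<open>auto simp: o_def\<close>)
    then show ?thesis
      using gauss_distr_normal [of ?P _ "sqrt (v + w)"] 3 P.prob_space_axioms by simp
  qed
qed

section \<open>Expansions of the exponential and of the shifted Gaussian kernel\<close>

lemma exp_bound_1: "\<bar>exp y - 1\<bar> \<le> \<bar>y\<bar> * exp \<bar>y\<bar>" for y :: real
proof -
  obtain t where t: "\<bar>t\<bar> \<le> \<bar>y\<bar>" "exp y = (\<Sum>m<1. y ^ m / fact m) + exp t / fact 1 * y ^ 1"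
    using Maclaurin_exp_le [of y 1] by blast
  have "\<bar>exp y - 1\<bar> = exp t * \<bar>y\<bar>" using t(2) by (simp add: abs_mult)
  also have "\<dots> \<le> exp \<bar>y\<bar> * \<bar>y\<bar>" using t(1) by (intro mult_right_mono) auto
  finally show ?thesis by (simp add: mult.commute)
qed

lemma exp_bound_2: "\<bar>exp y - 1 - y\<bar> \<le> y\<^sup>2 * exp \<bar>y\<bar>" for y :: real
proof -
  obtain t where t: "\<bar>t\<bar> \<le> \<bar>y\<bar>" "exp y = (\<Sum>m<2. y ^ m / fact m) + exp t / fact 2 * y ^ 2"
    using Maclaurin_exp_le [of y 2] by blast
  have "\<bar>exp y - 1 - y\<bar> = exp t / 2 * y\<^sup>2" using t(2) by (simp add: abs_mult numeral_2_eq_2)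
  also have "\<dots> \<le> exp \<bar>y\<bar> * y\<^sup>2" using t(1) by (intro mult_right_mono) (auto intro!: mult_mono [of "exp t" _ 1 2, simplified])
  finally show ?thesis by (simp add: mult.commute)
qed

text \<open>Taylor expansion in a of the kernels that arise when the state is displaced. The linear
  coefficients z and z^2 - 1 are the Hermite polynomials of \<open>heat1\<close> and
  \<open>heat2\<close>; the remainders are a^2 times a function of exponential growth.\<close>

lemma girsanov_kernel_bounds:
  fixes a z :: real
  assumes a: "\<bar>a\<bar> \<le> 1"
  shows "\<bar>exp (a * z - a\<^sup>2 / 2) - 1 - a * z\<bar> \<le> a\<^sup>2 * ((\<bar>z\<bar> + 1)\<^sup>2 * (exp 1 * exp (1 * \<bar>z\<bar>)) + 1)"
    and "\<bar>(z - a) * exp (a * z - a\<^sup>2 / 2) - z - a * (z\<^sup>2 - 1)\<bar>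
       \<le> a\<^sup>2 * ((\<bar>z\<bar> + 1) ^ 3 * (exp 1 * exp (1 * \<bar>z\<bar>)) + 2 * (\<bar>z\<bar> + 1))"
proof -
  define y where "y = a * z - a\<^sup>2 / 2"
  have a2: "a\<^sup>2 \<le> \<bar>a\<bar>" using mult_left_mono [OF a, of "\<bar>a\<bar>"] by (simp add: power2_eq_square)
  have "\<bar>y\<bar> \<le> \<bar>a * z\<bar> + a\<^sup>2 / 2" 
    using zero_le_power2 [of a] unfolding y_def by linarith
  also have "\<dots> \<le> \<bar>a\<bar> * (\<bar>z\<bar> + 1)" using a2 by (simp add: abs_mult algebra_simps)
  finally have y1: "\<bar>y\<bar> \<le> \<bar>a\<bar> * (\<bar>z\<bar> + 1)" .
  also have "\<dots> \<le> 1 * (\<bar>z\<bar> + 1)" using a by (intro mult_right_mono) auto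
  finally have y2: "\<bar>y\<bar> \<le> 1 + \<bar>z\<bar>" by simp
  have "y\<^sup>2 \<le> a\<^sup>2 * (\<bar>z\<bar> + 1)\<^sup>2"
    using power_mono [OF y1, of 2] by (simp add: power_mult_distrib)
  then have "y\<^sup>2 * exp \<bar>y\<bar> \<le> a\<^sup>2 * (\<bar>z\<bar> + 1)\<^sup>2 * exp (1 + \<bar>z\<bar>)"
    using y2 by (intro mult_mono) auto
  then have b: "\<bar>exp y - 1 - y\<bar> \<le> a\<^sup>2 * ((\<bar>z\<bar> + 1)\<^sup>2 * (exp 1 * exp (1 * \<bar>z\<bar>)))"
    using exp_bound_2 [of y] by (simp add: exp_add mult_ac)
  have "exp y - 1 - a * z = (exp y - 1 - y) + (- (a\<^sup>2 / 2))" by (simp add: y_def)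
  also have "\<bar>\<dots>\<bar> \<le> \<bar>exp y - 1 - y\<bar> + a\<^sup>2"
    by (rule order_trans [OF abs_triangle_ineq]) simp
  finally show "\<bar>exp (a * z - a\<^sup>2 / 2) - 1 - a * z\<bar> \<le> a\<^sup>2 * ((\<bar>z\<bar> + 1)\<^sup>2 * (exp 1 * exp (1 * \<bar>z\<bar>)) + 1)"
    using b unfolding y_def by (simp add: distrib_left)
  have eq: "(z - a) * exp y - z - a * (z\<^sup>2 - 1) = (z - a) * (exp y - 1 - y) + a\<^sup>2 * (a / 2 - 3 / 2 * z)"
    unfolding y_def by (simp add: power2_eq_square field_simps)
  have "\<bar>(z - a) * (exp y - 1 - y)\<bar> \<le> (\<bar>z\<bar> + 1) * (a\<^sup>2 * ((\<bar>z\<bar> + 1)\<^sup>2 * (exp 1 * exp (1 * \<bar>z\<bar>))))"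
    unfolding abs_mult using a b by (intro mult_mono) auto
  also have "\<dots> = a\<^sup>2 * ((\<bar>z\<bar> + 1) ^ 3 * (exp 1 * exp (1 * \<bar>z\<bar>)))"
    by (simp add: power2_eq_square power3_eq_cube mult_ac)
  finally have 1: "\<bar>(z - a) * (exp y - 1 - y)\<bar> \<le> a\<^sup>2 * ((\<bar>z\<bar> + 1) ^ 3 * (exp 1 * exp (1 * \<bar>z\<bar>)))" .
  have "\<bar>a / 2 - 3 / 2 * z\<bar> \<le> 2 * (\<bar>z\<bar> + 1)"
    using a abs_triangle_ineq4 [of "a / 2" "3 / 2 * z"] by (simp add: abs_mult)
  then have 2: "\<bar>a\<^sup>2 * (a / 2 - 3 / 2 * z)\<bar> \<le> a\<^sup>2 * (2 * (\<bar>z\<bar> + 1))"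
    unfolding abs_mult by (intro mult_mono) auto
  show "\<bar>(z - a) * exp (a * z - a\<^sup>2 / 2) - z - a * (z\<^sup>2 - 1)\<bar>
       \<le> a\<^sup>2 * ((\<bar>z\<bar> + 1) ^ 3 * (exp 1 * exp (1 * \<bar>z\<bar>)) + 2 * (\<bar>z\<bar> + 1))"
    using abs_triangle_ineq [of "(z - a) * (exp y - 1 - y)" "a\<^sup>2 * (a / 2 - 3 / 2 * z)"] 1 2
    unfolding y_def [symmetric] eq by (simp add: distrib_left)
qed

text \<open>Derivatives are obtained from explicit quadratic remainders because such a bound, unlike
  mere differentiability, survives a further integration.\<close>

lemma has_real_derivative_quadratic:
  fixes F :: "real \<Rightarrow> real"
  assumes "0 < \<delta>" and b: "\<And>e :: real. \<bar>e\<bar> \<le> \<delta> \<Longrightarrow> \<bar>F (x + e) - F x - e * D\<bar> \<le> C * e\<^sup>2"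
  shows "(F has_real_derivative D) (at x)"
proof -
  have "((\<lambda>e. (F (x + e) - F x) / e - D) \<longlongrightarrow> 0) (at 0)"
  proof (rule Lim_null_comparison)
    show "((\<lambda>e. \<bar>C\<bar> * \<bar>e\<bar>) \<longlongrightarrow> 0) (at (0::real))" by (auto intro!: tendsto_eq_intros)
    have "\<forall>\<^sub>F e in at (0::real). e \<in> ball 0 \<delta> \<and> e \<noteq> 0"
      unfolding eventually_at using assms(1) by (auto simp: dist_real_def)
    then show "\<forall>\<^sub>F e in at 0. norm ((F (x + e) - F x) / e - D) \<le> \<bar>C\<bar> * \<bar>e\<bar>"
    proof (rule eventually_mono)
      fix e :: real assume e: "e \<in> ball 0 \<delta> \<and> e \<noteq> 0"
      have "(F (x + e) - F x) / e - D = (F (x + e) - F x - e * D) / e"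
        using e by (simp add: field_simps)
      also have "\<bar>\<dots>\<bar> \<le> \<bar>C\<bar> * e\<^sup>2 / \<bar>e\<bar>"
        unfolding abs_divide using b [of e] e
        by (intro divide_right_mono) (auto intro: order_trans mult_right_mono)
      also have "\<dots> = \<bar>C\<bar> * \<bar>e\<bar>" using e by (simp add: power2_eq_square field_simps)
      finally show "norm ((F (x + e) - F x) / e - D) \<le> \<bar>C\<bar> * \<bar>e\<bar>" by simp
    qed
  qed
  then show ?thesis unfolding DERIV_def by (rule LIM_zero_cancel)
qed

subsection \<open>The heat semigroup\<close>

text \<open>The derivatives \<open>heat1\<close> and \<open>heat2\<close> fall on the Gaussian kernel, so they need no regularity
  of \<open>f\<close>.\<close>

definition heat :: "real \<Rightarrow> (real \<Rightarrow> real) \<Rightarrow> real \<Rightarrow> real" where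
  "heat v f x = (\<integral>z. f (x + sqrt v * z) \<partial>gauss)"

definition heat1 :: "real \<Rightarrow> (real \<Rightarrow> real) \<Rightarrow> real \<Rightarrow> real" where
  "heat1 v f x = (\<integral>z. f (x + sqrt v * z) * z \<partial>gauss) / sqrt v"

definition heat2 :: "real \<Rightarrow> (real \<Rightarrow> real) \<Rightarrow> real \<Rightarrow> real" where
  "heat2 v f x = (\<integral>z. f (x + sqrt v * z) * (z\<^sup>2 - 1) \<partial>gauss) / v"

text \<open>The growth in x splits off as the factor exp (c |x|), and what is left is integrable.
  Closure under averaging is what permits iterating the flow.\<close>

lemma growth_gauss_integral:
  assumes f: "growth f" and p: "growth p"
  shows "growth (\<lambda>x. \<integral>z. f (x + s * z) * p z \<partial>gauss)"
proof -
  note [measurable] = growth_measurable [OF f] growth_measurable [OF p]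
  interpret prob_space gauss by (rule prob_space_gauss)
  obtain C c where b: "0 \<le> C" "0 \<le> c" "\<And>x. \<bar>f x\<bar> \<le> C * exp (c * \<bar>x\<bar>)" using growthE [OF f] by blast
  let ?h = "\<lambda>z. exp ((c * \<bar>s\<bar>) * \<bar>z\<bar>) * \<bar>p z\<bar>"
  have h: "growth ?h" using p by (intro growth_intros)
  show ?thesis
  proof (rule growthI)
    fix x
    have "\<bar>f (x + s * z) * p z\<bar> \<le> C * exp (c * \<bar>x\<bar>) * ?h z" for z
    proof -
      have "\<bar>x + s * z\<bar> \<le> \<bar>x\<bar> + \<bar>s\<bar> * \<bar>z\<bar>" by (metis abs_mult abs_triangle_ineq)
      then have "c * \<bar>x + s * z\<bar> \<le> c * \<bar>x\<bar> + c * \<bar>s\<bar> * \<bar>z\<bar>"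
        using mult_left_mono [OF _ b(2)] by (fastforce simp: algebra_simps)
      then have "C * exp (c * \<bar>x + s * z\<bar>) \<le> C * (exp (c * \<bar>x\<bar>) * exp (c * \<bar>s\<bar> * \<bar>z\<bar>))"
        using b(1) by (intro mult_left_mono) (simp_all add: exp_add [symmetric])
      then have "\<bar>f (x + s * z)\<bar> \<le> C * exp (c * \<bar>x\<bar>) * exp ((c * \<bar>s\<bar>) * \<bar>z\<bar>)"
        using b(3) [of "x + s * z"] by (simp add: mult_ac)
      then have "\<bar>f (x + s * z)\<bar> * \<bar>p z\<bar> \<le> (C * exp (c * \<bar>x\<bar>) * exp ((c * \<bar>s\<bar>) * \<bar>z\<bar>)) * \<bar>p z\<bar>"
        by (rule mult_right_mono) simp
      then show ?thesis by (simp add: abs_mult mult_ac)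
    qed
    then have "\<bar>\<integral>z. f (x + s * z) * p z \<partial>gauss\<bar> \<le> (\<integral>z. C * exp (c * \<bar>x\<bar>) * ?h z \<partial>gauss)"
      by (intro abs_integral_gauss_le growth_intros growth_affine f p h)
    also have "\<dots> = (C * (\<integral>z. ?h z \<partial>gauss)) * exp (c * \<bar>x\<bar>)"
      by simp
    finally show "\<bar>\<integral>z. f (x + s * z) * p z \<partial>gauss\<bar> \<le> (C * (\<integral>z. ?h z \<partial>gauss)) * exp (c * \<bar>x\<bar>)" .
  qed measurable
qed

lemma growth_heat: "growth f \<Longrightarrow> growth (heat v f)"
  using growth_gauss_integral [OF _ growth_const [of 1], of f] by (simp add: heat_def [abs_def])

lemma growth_heat1: "growth f \<Longrightarrow> growth (heat1 v f)"
  unfolding heat1_def [abs_def] by (intro growth_divide growth_gauss_integral growth_ident)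

lemma heat_0 [simp]: "heat 0 f = f"
  using prob_space.prob_space [OF prob_space_gauss] by (simp add: heat_def fun_eq_iff)

text \<open>After the shift f is evaluated at points that do not involve the displacement e, so only
  the kernel has to be expanded in e.\<close>

lemma heat_girsanov:
  assumes f: "growth f" and p [measurable]: "p \<in> borel_measurable borel" and v: "0 < v"
  shows "(\<integral>z. f (x + e + sqrt v * z) * p z \<partial>gauss) =
    (\<integral>z. f (x + sqrt v * z) * (p (z - e / sqrt v) * exp (e / sqrt v * z - (e / sqrt v)\<^sup>2 / 2)) \<partial>gauss)"
proof -
  note [measurable] = growth_measurable [OF f]
  let ?a = "e / sqrt v"
  have "(\<integral>z. f (x + e + sqrt v * z) * p z \<partial>gauss) =
      (\<integral>z. f (x + sqrt v * (z + ?a)) * p ((z + ?a) - ?a) \<partial>gauss)"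
    using v by (intro Bochner_Integration.integral_cong) (auto simp: algebra_simps)
  also have "\<dots> = (\<integral>z. f (x + sqrt v * z) * p (z - ?a) * exp (?a * z - ?a\<^sup>2 / 2) \<partial>gauss)"
    by (rule integral_gauss_shift) measurable
  finally show ?thesis by (simp add: mult.assoc)
qed

text \<open>The bound is uniform in \<open>x\<close> up to a function of exponential growth, which allows a further
  integration.\<close>

lemma heat_quadratic:
  assumes f: "growth f" and v: "0 < v"
  shows "\<exists>R. growth R \<and> (\<forall>x e. \<bar>e\<bar> \<le> sqrt v \<longrightarrow>
     \<bar>heat v f (x + e) - heat v f x - e * heat1 v f x\<bar> \<le> R x * e\<^sup>2 \<and>
     \<bar>heat1 v f (x + e) - heat1 v f x - e * heat2 v f x\<bar> \<le> R x * e\<^sup>2)"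
proof -
  define q1 where "q1 z = (\<bar>z\<bar> + 1)\<^sup>2 * (exp 1 * exp (1 * \<bar>z\<bar>)) + 1" for z :: real
  define q2 where "q2 z = (\<bar>z\<bar> + 1) ^ 3 * (exp 1 * exp (1 * \<bar>z\<bar>)) + 2 * (\<bar>z\<bar> + 1)" for z :: real
  have q1: "growth q1" and q2: "growth q2"
    unfolding q1_def [abs_def] q2_def [abs_def] by (intro growth_intros)+
  note fi = growth_affine [OF f] q1 q2
  have q0: "0 \<le> q1 z" "0 \<le> q2 z" for z by (auto simp: q1_def q2_def)
  define R1 where "R1 x = (\<integral>z. \<bar>f (x + sqrt v * z)\<bar> * q1 z \<partial>gauss)" for x
  define R2 where "R2 x = (\<integral>z. \<bar>f (x + sqrt v * z)\<bar> * q2 z \<partial>gauss)" for x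
  have R: "growth R1" "growth R2"
    unfolding R1_def [abs_def] R2_def [abs_def]
    by (intro growth_gauss_integral [of "\<lambda>y. \<bar>f y\<bar>"] growth_abs f q1 q2)+
  have R0: "0 \<le> R1 x" "0 \<le> R2 x" for x
    by (auto simp: R1_def R2_def q0 intro!: Bochner_Integration.integral_nonneg)
  show ?thesis
  proof (intro exI [of _ "\<lambda>x. R1 x / v + R2 x / (v * sqrt v)"] conjI allI impI)
    show "growth (\<lambda>x. R1 x / v + R2 x / (v * sqrt v))"
      by (intro growth_intros R)
    fix x e :: real assume e: "\<bar>e\<bar> \<le> sqrt v"
    \<comment> \<open>The displacement in units of the standard deviation; |e| \<le> sqrt v is
      exactly the range |a| \<le> 1 of \<open>girsanov_kernel_bounds\<close>.\<close>
    define a where "a = e / sqrt v"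
    have a: "\<bar>a\<bar> \<le> 1" using e v by (simp add: a_def abs_divide)
    have a2: "a\<^sup>2 = e\<^sup>2 / v" using v by (simp add: a_def power_divide)
    have av: "a * c / sqrt v = e * c / v" for c
      using v by (simp add: a_def)
    let ?f = "\<lambda>z. f (x + sqrt v * z)"
    have "heat v f (x + e) - heat v f x - e * heat1 v f x =
      (\<integral>z. ?f z * exp (a * z - a\<^sup>2 / 2) \<partial>gauss) - (\<integral>z. ?f z \<partial>gauss) - a * (\<integral>z. ?f z * z \<partial>gauss)"
      using heat_girsanov [OF f, of "\<lambda>_. 1" v x e] v by (simp add: heat_def heat1_def a_def)
    also have "\<dots> = (\<integral>z. ?f z * (exp (a * z - a\<^sup>2 / 2) - 1 - a * z) \<partial>gauss)"
    proof -
      have "integrable gauss (\<lambda>z. ?f z * exp (a * z - a\<^sup>2 / 2))" "integrable gauss ?f" "integrable gauss (\<lambda>z. a * (?f z * z))"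
        by (intro integrable_growth growth_intros fi)+
      moreover have "?f z * (exp (a * z - a\<^sup>2 / 2) - 1 - a * z) =
          ?f z * exp (a * z - a\<^sup>2 / 2) - ?f z - a * (?f z * z)" for z
        by (simp add: algebra_simps)
      ultimately show ?thesis by simp
    qed
    finally have eq: "heat v f (x + e) - heat v f x - e * heat1 v f x =
      (\<integral>z. ?f z * (exp (a * z - a\<^sup>2 / 2) - 1 - a * z) \<partial>gauss)" .
    have "\<bar>heat v f (x + e) - heat v f x - e * heat1 v f x\<bar> \<le> (\<integral>z. a\<^sup>2 * (\<bar>?f z\<bar> * q1 z) \<partial>gauss)"
      unfolding eq
    proof (intro abs_integral_gauss_le growth_intros fi)
      fix z
      show "\<bar>?f z * (exp (a * z - a\<^sup>2 / 2) - 1 - a * z)\<bar> \<le> a\<^sup>2 * (\<bar>?f z\<bar> * q1 z)"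
        using mult_left_mono [OF girsanov_kernel_bounds(1) [OF a, of z], of "\<bar>?f z\<bar>"]
        by (simp add: abs_mult q1_def mult_ac)
    qed
    also have "\<dots> = R1 x / v * e\<^sup>2" by (simp add: R1_def a2)
    also have "\<dots> \<le> (R1 x / v + R2 x / (v * sqrt v)) * e\<^sup>2"
      using R0 v by (intro mult_right_mono) auto
    finally show "\<bar>heat v f (x + e) - heat v f x - e * heat1 v f x\<bar> \<le> (R1 x / v + R2 x / (v * sqrt v)) * e\<^sup>2" .
    have "heat1 v f (x + e) - heat1 v f x - e * heat2 v f x =
      ((\<integral>z. ?f z * ((z - a) * exp (a * z - a\<^sup>2 / 2)) \<partial>gauss) - (\<integral>z. ?f z * z \<partial>gauss)
        - a * (\<integral>z. ?f z * (z\<^sup>2 - 1) \<partial>gauss)) / sqrt v"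
      using heat_girsanov [OF f, of "\<lambda>z. z" v x e] v av
      by (simp add: heat1_def heat2_def a_def [symmetric] diff_divide_distrib)
    also have "(\<integral>z. ?f z * ((z - a) * exp (a * z - a\<^sup>2 / 2)) \<partial>gauss) - (\<integral>z. ?f z * z \<partial>gauss)
        - a * (\<integral>z. ?f z * (z\<^sup>2 - 1) \<partial>gauss) =
       (\<integral>z. ?f z * ((z - a) * exp (a * z - a\<^sup>2 / 2) - z - a * (z\<^sup>2 - 1)) \<partial>gauss)"
    proof -
      have "integrable gauss (\<lambda>z. ?f z * ((z - a) * exp (a * z - a\<^sup>2 / 2)))" "integrable gauss (\<lambda>z. ?f z * z)"
        "integrable gauss (\<lambda>z. a * (?f z * (z\<^sup>2 - 1)))"
        by (intro integrable_growth growth_intros fi)+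
      moreover have "?f z * ((z - a) * exp (a * z - a\<^sup>2 / 2) - z - a * (z\<^sup>2 - 1)) =
          ?f z * ((z - a) * exp (a * z - a\<^sup>2 / 2)) - ?f z * z - a * (?f z * (z\<^sup>2 - 1))" for z
        by (simp add: algebra_simps)
      ultimately show ?thesis by (simp only: Bochner_Integration.integral_diff Bochner_Integration.integrable_diff Bochner_Integration.integral_mult_right_zero)
    qed
    finally have eq: "\<bar>heat1 v f (x + e) - heat1 v f x - e * heat2 v f x\<bar> =
       \<bar>\<integral>z. ?f z * ((z - a) * exp (a * z - a\<^sup>2 / 2) - z - a * (z\<^sup>2 - 1)) \<partial>gauss\<bar> / sqrt v"
      using v by (simp add: abs_divide)
    have "\<bar>\<integral>z. ?f z * ((z - a) * exp (a * z - a\<^sup>2 / 2) - z - a * (z\<^sup>2 - 1)) \<partial>gauss\<bar>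
        \<le> (\<integral>z. a\<^sup>2 * (\<bar>?f z\<bar> * q2 z) \<partial>gauss)"
    proof (intro abs_integral_gauss_le growth_intros fi)
      fix z
      show "\<bar>?f z * ((z - a) * exp (a * z - a\<^sup>2 / 2) - z - a * (z\<^sup>2 - 1))\<bar> \<le> a\<^sup>2 * (\<bar>?f z\<bar> * q2 z)"
        using mult_left_mono [OF girsanov_kernel_bounds(2) [OF a, of z], of "\<bar>?f z\<bar>"]
        by (simp add: abs_mult q2_def mult_ac)
    qed
    also have "\<dots> = R2 x / v * e\<^sup>2" by (simp add: R2_def a2)
    finally have "\<bar>heat1 v f (x + e) - heat1 v f x - e * heat2 v f x\<bar> \<le> R2 x / v * e\<^sup>2 / sqrt v"
      unfolding eq using v by (intro divide_right_mono) auto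
    also have "\<dots> = R2 x / (v * sqrt v) * e\<^sup>2" by simp
    also have "\<dots> \<le> (R1 x / v + R2 x / (v * sqrt v)) * e\<^sup>2"
      using R0 v by (intro mult_right_mono) auto
    finally show "\<bar>heat1 v f (x + e) - heat1 v f x - e * heat2 v f x\<bar> \<le> (R1 x / v + R2 x / (v * sqrt v)) * e\<^sup>2" .
  qed
qed

lemma measure_gauss_UNIV [simp]: "measure gauss UNIV = 1"
  using prob_space.prob_space [OF prob_space_gauss] by simp

lemma heat_has_derivative:
  assumes "growth f" "0 < v"
  shows "(heat v f has_real_derivative heat1 v f x) (at x)"
    and "(heat1 v f has_real_derivative heat2 v f x) (at x)"
proof -
  obtain R where R: "\<forall>x e. \<bar>e\<bar> \<le> sqrt v \<longrightarrow>
     \<bar>heat v f (x + e) - heat v f x - e * heat1 v f x\<bar> \<le> R x * e\<^sup>2 \<and>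
     \<bar>heat1 v f (x + e) - heat1 v f x - e * heat2 v f x\<bar> \<le> R x * e\<^sup>2"
    using heat_quadratic [OF assms] by blast
  show "(heat v f has_real_derivative heat1 v f x) (at x)"
    using assms(2) R by (intro has_real_derivative_quadratic [of "sqrt v" _ _ _ "R x"]) (simp, blast)
  show "(heat1 v f has_real_derivative heat2 v f x) (at x)"
    using assms(2) R by (intro has_real_derivative_quadratic [of "sqrt v" _ _ _ "R x"]) (simp, blast)
qed

text \<open>Semigroup property: Fubini on the product of two Gaussian laws, then
  \<open>gauss_convolution\<close>.\<close>

lemma heat_heat:
  assumes f: "growth f" and v: "0 \<le> v" "0 \<le> w"
  shows "heat v (heat w f) x = heat (v + w) f x"
proof -
  note [measurable] = growth_measurable [OF f]
  interpret G: prob_space gauss by (rule prob_space_gauss)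
  interpret P: pair_prob_space gauss gauss ..
  let ?P = "gauss \<Otimes>\<^sub>M gauss"
  let ?h = "\<lambda>p. sqrt v * fst p + sqrt w * snd p :: real"
  have D: "distr ?P borel ?h = distr gauss borel (\<lambda>z. sqrt (v + w) * z)"
    by (rule gauss_convolution) fact+
  have "integrable (distr gauss borel (\<lambda>z. sqrt (v + w) * z)) (\<lambda>y. f (x + y))"
    using integrable_growth [OF growth_affine [OF f]] by (subst integrable_distr_eq) auto
  then have int: "integrable ?P (\<lambda>p. f (x + ?h p))"
    unfolding D [symmetric] by (subst (asm) integrable_distr_eq) auto
  have "heat (v + w) f x = (\<integral>y. f (x + y) \<partial>distr gauss borel (\<lambda>z. sqrt (v + w) * z))"
    unfolding heat_def by (subst integral_distr) auto
  also have "\<dots> = (\<integral>p. f (x + ?h p) \<partial>?P)"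
    unfolding D [symmetric] by (subst integral_distr) auto
  also have "\<dots> = (\<integral>z. (\<integral>y. f (x + ?h (z, y)) \<partial>gauss) \<partial>gauss)"
    using P.integral_fst' [OF int] by simp
  also have "\<dots> = heat v (heat w f) x"
    by (simp add: heat_def add.assoc)
  finally show ?thesis by simp
qed

text \<open>The quadratic remainder at time w has a coefficient R of exponential growth, so it may
  be averaged over the first step. This differentiates under the outer integral, and uniqueness of
  the derivative gives the identity.\<close>

lemma heat_heat1:
  assumes f: "growth f" and v: "0 \<le> v" "0 < w"
  shows "heat v (heat1 w f) x = heat1 (v + w) f x"
proof -
  obtain R where gR: "growth R" and R: "\<forall>x e. \<bar>e\<bar> \<le> sqrt w \<longrightarrow> \<bar>heat w f (x + e) - heat w f x - e * heat1 w f x\<bar> \<le> R x * e\<^sup>2"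
    using heat_quadratic [OF f v(2)] by blast
  note gr = growth_affine [OF growth_heat [OF f]] growth_affine [OF growth_heat1 [OF f]] growth_affine [OF gR]
  have "(heat v (heat w f) has_real_derivative heat v (heat1 w f) x) (at x)"
  proof (rule has_real_derivative_quadratic)
    fix e assume e: "\<bar>e\<bar> \<le> sqrt w"
    have eq: "heat v (heat w f) (x + e) - heat v (heat w f) x - e * heat v (heat1 w f) x =
      (\<integral>z. heat w f ((x + e) + sqrt v * z) - heat w f (x + sqrt v * z) - e * heat1 w f (x + sqrt v * z) \<partial>gauss)"
      unfolding heat_def [of v]
      using integrable_growth [OF gr(1)] integrable_growth [OF gr(2)] by simp
    have "\<bar>heat v (heat w f) (x + e) - heat v (heat w f) x - e * heat v (heat1 w f) x\<bar> \<le>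
        (\<integral>z. R (x + sqrt v * z) * e\<^sup>2 \<partial>gauss)"
      unfolding eq
    proof (intro abs_integral_gauss_le growth_intros gr)
      fix z
      have "x + e + sqrt v * z = (x + sqrt v * z) + e" by simp
      then show "\<bar>heat w f (x + e + sqrt v * z) - heat w f (x + sqrt v * z) - e * heat1 w f (x + sqrt v * z)\<bar>
          \<le> R (x + sqrt v * z) * e\<^sup>2"
        using R e by (simp only:)
    qed
    also have "\<dots> = heat v R x * e\<^sup>2" by (simp add: heat_def)
    finally show "\<bar>heat v (heat w f) (x + e) - heat v (heat w f) x - e * heat v (heat1 w f) x\<bar> \<le> heat v R x * e\<^sup>2" .
  qed (use v in simp)
  moreover have "heat v (heat w f) = heat (v + w) f"
    using heat_heat [OF f] v by (auto simp: fun_eq_iff)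
  ultimately show ?thesis
    using heat_has_derivative(1) [OF f, of "v + w" x] v by (auto intro: DERIV_unique)
qed

text \<open>Dominated convergence, with a majorant built from bounds on the convergent sequences.
  Centre and scale move together because time and state both vary along a path; the limiting scale
  may be 0, which covers maturity.\<close>

lemma gauss_integral_tendsto:
  assumes f: "growth f" "continuous_on UNIV f" and p: "growth p"
    and X: "X \<longlonglongrightarrow> x" and S: "S \<longlonglongrightarrow> s"
  shows "(\<lambda>k. \<integral>z. f (X k + S k * z) * p z \<partial>gauss) \<longlonglongrightarrow> (\<integral>z. f (x + s * z) * p z \<partial>gauss)"
proof -
  note [measurable] = growth_measurable [OF f(1)] growth_measurable [OF p]
  obtain C c where b: "0 \<le> C" "0 \<le> c" "\<And>x. \<bar>f x\<bar> \<le> C * exp (c * \<bar>x\<bar>)" using growthE [OF f(1)] by blast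
  obtain bX where bX: "\<forall>k. \<bar>X k\<bar> \<le> bX"
    using convergent_imp_Bseq [OF convergentI [OF X]] by (auto simp: Bseq_def)
  obtain bS where bS: "\<forall>k. \<bar>S k\<bar> \<le> bS"
    using convergent_imp_Bseq [OF convergentI [OF S]] by (auto simp: Bseq_def)
  let ?h = "\<lambda>z. (C * exp (c * bX)) * (exp ((c * bS) * \<bar>z\<bar>) * \<bar>p z\<bar>)"
  show ?thesis
  proof (rule integral_dominated_convergence [where w = ?h])
    show "integrable gauss ?h" by (intro integrable_growth growth_intros p)
    show "AE z in gauss. (\<lambda>k. f (X k + S k * z) * p z) \<longlonglongrightarrow> f (x + s * z) * p z"
    proof (intro AE_I2 tendsto_mult_right)
      fix z
      have "isCont f (x + s * z)" using f(2) by (simp add: continuous_on_eq_continuous_at)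
      moreover have "(\<lambda>k. X k + S k * z) \<longlonglongrightarrow> x + s * z" by (intro tendsto_intros X S)
      ultimately show "(\<lambda>k. f (X k + S k * z)) \<longlonglongrightarrow> f (x + s * z)" by (rule isCont_tendsto_compose)
    qed
    show "AE z in gauss. norm (f (X k + S k * z) * p z) \<le> ?h z" for k
    proof (intro AE_I2)
      fix z
      have "\<bar>X k + S k * z\<bar> \<le> \<bar>X k\<bar> + \<bar>S k\<bar> * \<bar>z\<bar>" by (metis abs_mult abs_triangle_ineq)
      also have "\<dots> \<le> bX + bS * \<bar>z\<bar>" using bX bS by (intro add_mono mult_right_mono) auto
      finally have "c * \<bar>X k + S k * z\<bar> \<le> c * bX + c * bS * \<bar>z\<bar>"
        using mult_left_mono [OF _ b(2)] by (fastforce simp: algebra_simps)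
      then have "C * exp (c * \<bar>X k + S k * z\<bar>) \<le> C * (exp (c * bX) * exp (c * bS * \<bar>z\<bar>))"
        using b(1) by (intro mult_left_mono) (simp_all add: exp_add [symmetric])
      then have "\<bar>f (X k + S k * z)\<bar> \<le> C * exp (c * bX) * exp ((c * bS) * \<bar>z\<bar>)"
        using b(3) [of "X k + S k * z"] by (simp add: mult_ac)
      then have "\<bar>f (X k + S k * z)\<bar> * \<bar>p z\<bar> \<le> (C * exp (c * bX) * exp ((c * bS) * \<bar>z\<bar>)) * \<bar>p z\<bar>"
        by (rule mult_right_mono) simp
      then show "norm (f (X k + S k * z) * p z) \<le> ?h z" by (simp add: abs_mult mult_ac)
    qed
  qed measurable
qed

lemma heat_tendsto:
  assumes "growth f" "continuous_on UNIV f" "V \<longlonglongrightarrow> v" "X \<longlonglongrightarrow> x"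
  shows "(\<lambda>k. heat (V k) f (X k)) \<longlonglongrightarrow> heat v f x"
  using gauss_integral_tendsto [OF assms(1,2) growth_const [of 1] assms(4) tendsto_real_sqrt [OF assms(3)]]
  by (simp add: heat_def)

lemma heat1_tendsto:
  assumes "growth f" "continuous_on UNIV f" "V \<longlonglongrightarrow> v" "X \<longlonglongrightarrow> x" "0 < v"
  shows "(\<lambda>k. heat1 (V k) f (X k)) \<longlonglongrightarrow> heat1 v f x"
  unfolding heat1_def using assms(5)
  by (intro tendsto_divide gauss_integral_tendsto growth_ident tendsto_real_sqrt assms) auto

text \<open>Mean value inequality applied twice on the ball of radius |d|. The bound on w2 may grow
  like exp |y - x| because the estimates of the flow at different states agree only up to this
  factor, see \<open>KK_exp_le\<close>.\<close>

lemma second_order_remainder: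
  fixes w w1 w2 :: "real \<Rightarrow> real"
  assumes w: "\<And>y. (w has_real_derivative w1 y) (at y)" "\<And>y. (w1 has_real_derivative w2 y) (at y)"
    and B: "\<And>y. \<bar>w2 y\<bar> \<le> B * exp \<bar>y - x\<bar>"
  shows "\<bar>w1 (x + d) - w1 x\<bar> \<le> B * \<bar>d\<bar> * exp \<bar>d\<bar>"
    and "\<bar>w (x + d) - w x - w1 x * d\<bar> \<le> B * d\<^sup>2 * exp \<bar>d\<bar>"
proof -
  have B0: "0 \<le> B" using B [of x] abs_ge_zero [of "w2 x"] by simp
  let ?S = "cball x \<bar>d\<bar>"
  have 1: "\<bar>w1 y - w1 x\<bar> \<le> (B * exp \<bar>d\<bar>) * \<bar>y - x\<bar>" if "y \<in> ?S" for y
  proof -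
    have "norm (w1 y - w1 x) \<le> (B * exp \<bar>d\<bar>) * norm (y - x)"
    proof (rule field_differentiable_bound [where S = ?S])
      fix z assume "z \<in> ?S"
      then have "B * exp \<bar>z - x\<bar> \<le> B * exp \<bar>d\<bar>"
        using B0 by (intro mult_left_mono) (auto simp: dist_real_def)
      then show "norm (w2 z) \<le> B * exp \<bar>d\<bar>" using B [of z] by simp
    qed (use that w(2) in \<open>auto intro: DERIV_subset\<close>)
    then show ?thesis by simp
  qed
  show "\<bar>w1 (x + d) - w1 x\<bar> \<le> B * \<bar>d\<bar> * exp \<bar>d\<bar>"
    using 1 [of "x + d"] by (simp add: dist_real_def mult_ac)
  have "norm ((w (x + d) - w1 x * (x + d)) - (w x - w1 x * x)) \<le> (B * exp \<bar>d\<bar> * \<bar>d\<bar>) * norm ((x + d) - x)"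
  proof (rule field_differentiable_bound [where S = ?S and f' = "\<lambda>y. w1 y - w1 x"])
    fix z assume z: "z \<in> ?S"
    show "((\<lambda>y. w y - w1 x * y) has_real_derivative w1 z - w1 x) (at z within ?S)"
      by (auto intro!: derivative_eq_intros DERIV_subset [OF w(1)])
    have "(B * exp \<bar>d\<bar>) * \<bar>z - x\<bar> \<le> (B * exp \<bar>d\<bar>) * \<bar>d\<bar>"
      using z B0 by (intro mult_left_mono) (auto simp: dist_real_def)
    then show "norm (w1 z - w1 x) \<le> B * exp \<bar>d\<bar> * \<bar>d\<bar>" using 1 [OF z] by simp
  qed (auto simp: dist_real_def)
  then show "\<bar>w (x + d) - w x - w1 x * d\<bar> \<le> B * d\<^sup>2 * exp \<bar>d\<bar>"
    by (simp add: algebra_simps power2_eq_square abs_mult_self_eq)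
qed

text \<open>The pathwise one-step error of delta hedging is of second order: the Delta of the position is
  frozen, while the price moves like \<open>exp (\<surd>h z - h / 2)\<close>.\<close>

lemma delta_hedge_remainder:
  assumes T: "0 < T"
  obtains C c where "0 \<le> C" "0 \<le> c" "\<And>w w1 w2 B h x z.
    growth w \<Longrightarrow> (\<And>y. (w has_real_derivative w1 y) (at y)) \<Longrightarrow> (\<And>y. (w1 has_real_derivative w2 y) (at y)) \<Longrightarrow>
    (\<And>y. \<bar>w2 y\<bar> \<le> B * exp \<bar>y - x\<bar>) \<Longrightarrow> 0 < h \<Longrightarrow> h \<le> T \<Longrightarrow>
    \<bar>w (x + sqrt h * z) - heat h w x - heat1 h w x * (exp (sqrt h * z - h / 2) - 1)\<bar>
      \<le> C * h * (B + \<bar>heat1 h w x\<bar>) * exp (c * \<bar>z\<bar>)"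
proof -
  interpret prob_space gauss by (rule prob_space_gauss)
  define e where "e z = exp (sqrt T * \<bar>z\<bar>)" for z
  define I1 where "I1 = (\<integral>z. z\<^sup>2 * e z \<partial>gauss)"
  define I2 where "I2 = (\<integral>z. \<bar>z\<bar> * (z\<^sup>2 * e z) \<partial>gauss)"
  \<comment> \<open>The summands account, up to the factor h, for the Taylor remainder of w at x +
    sqrt h z, its mean, its correlation with z, and the second-order part of the price
    increment.\<close>
  define Q where "Q z = z\<^sup>2 * e z + I1 + I2 * \<bar>z\<bar> + ((\<bar>z\<bar> + sqrt T)\<^sup>2 * (e z * exp T) + 1)" for z
  have ge: "growth e" unfolding e_def [abs_def] by (intro growth_intros)
  have e0: "0 \<le> e z" for z by (simp add: e_def)
  have I0: "0 \<le> I1" "0 \<le> I2" unfolding I1_def I2_def by (auto simp: e0)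
  have "growth Q" unfolding Q_def [abs_def] by (intro growth_intros ge)
  then obtain C c where C: "0 \<le> C" "0 \<le> c" "\<And>z. \<bar>Q z\<bar> \<le> C * exp (c * \<bar>z\<bar>)" using growthE by blast
  show ?thesis
  proof (rule that [OF C(1,2)])
    fix w w1 w2 :: "real \<Rightarrow> real" and B h x z
    assume gw: "growth w" and w: "\<And>y. (w has_real_derivative w1 y) (at y)" "\<And>y. (w1 has_real_derivative w2 y) (at y)"
      and B: "\<And>y. \<bar>w2 y\<bar> \<le> B * exp \<bar>y - x\<bar>" and h: "0 < h" "h \<le> T"
    have B0: "0 \<le> B" using B [of x] abs_ge_zero [of "w2 x"] by simp
    let ?s = "sqrt h"
    have s: "0 < ?s" "?s \<le> sqrt T" "?s\<^sup>2 = h" using h by auto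
    define r where "r z = w (x + ?s * z) - w x - w1 x * (?s * z)" for z
    have sz: "\<bar>?s * z\<bar> \<le> sqrt T * \<bar>z\<bar>" for z
      using s by (simp add: abs_mult mult_right_mono)
    have r: "\<bar>r z\<bar> \<le> B * h * (z\<^sup>2 * e z)" for z
    proof -
      have "\<bar>r z\<bar> \<le> B * (?s * z)\<^sup>2 * exp \<bar>?s * z\<bar>"
        unfolding r_def by (rule second_order_remainder(2) [OF w B])
      also have "\<dots> \<le> B * (?s * z)\<^sup>2 * e z"
        unfolding e_def using B0 sz by (intro mult_left_mono) auto
      finally show ?thesis using s(3) by (simp add: power_mult_distrib mult_ac)
    qed
    have gr: "growth r"
      unfolding r_def [abs_def] by (intro growth_intros growth_affine [OF gw])
    note int = integrable_growth [OF growth_affine [OF gw]] integrable_growth [OF gr]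
    \<comment> \<open>Testing the remainder against 1, and below against z, removes or isolates the
      linear term, since z has mean 0 and variance 1. This compares \<open>heat h w x\<close> with
      \<open>w x\<close> and \<open>heat1 h w x\<close> with \<open>w1 x\<close>.\<close>
    have "(\<integral>z. r z \<partial>gauss) = heat h w x - w x"
      unfolding r_def heat_def
      using int(1) integrable_growth [OF growth_ident] by (simp add: gauss_mean)
    moreover have "\<bar>\<integral>z. r z \<partial>gauss\<bar> \<le> (\<integral>z. B * h * (z\<^sup>2 * e z) \<partial>gauss)"
      by (intro abs_integral_gauss_le r gr growth_intros ge)
    ultimately have b: "\<bar>heat h w x - w x\<bar> \<le> B * h * I1" by (simp add: I1_def)
    have "(\<integral>z. r z * z \<partial>gauss) = ?s * (heat1 h w x - w1 x)"
    proof -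
      have rz: "r z * z = w (x + ?s * z) * z - w x * z - (w1 x * ?s) * z\<^sup>2" for z
        by (simp add: r_def algebra_simps power2_eq_square)
      have "integrable gauss (\<lambda>z. w (x + ?s * z) * z)" "integrable gauss (\<lambda>z::real. z)" "integrable gauss (\<lambda>z::real. z\<^sup>2)"
        by (intro integrable_growth growth_intros growth_affine [OF gw])+
      then have "(\<integral>z. r z * z \<partial>gauss) = (\<integral>z. w (x + ?s * z) * z \<partial>gauss) - w1 x * ?s"
        unfolding rz by (simp add: gauss_mean gauss_second_moment)
      then show ?thesis
        using s(1) by (simp add: heat1_def right_diff_distrib)
    qed
    moreover have "\<bar>\<integral>z. r z * z \<partial>gauss\<bar> \<le> (\<integral>z. B * h * (\<bar>z\<bar> * (z\<^sup>2 * e z)) \<partial>gauss)"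
    proof (intro abs_integral_gauss_le growth_intros gr ge)
      fix z show "\<bar>r z * z\<bar> \<le> B * h * (\<bar>z\<bar> * (z\<^sup>2 * e z))"
        using mult_right_mono [OF r [of z], of "\<bar>z\<bar>"] by (simp add: abs_mult mult_ac)
    qed
    ultimately have "?s * \<bar>heat1 h w x - w1 x\<bar> \<le> B * h * I2"
      using s(1) by (simp add: I2_def abs_mult)
    then have "(?s * \<bar>heat1 h w x - w1 x\<bar>) * \<bar>z\<bar> \<le> B * h * I2 * \<bar>z\<bar>"
      by (rule mult_right_mono) simp
    then have c: "\<bar>(heat1 h w x - w1 x) * (?s * z)\<bar> \<le> B * h * (I2 * \<bar>z\<bar>)"
      using s(1) by (simp add: abs_mult mult_ac)
    let ?y = "?s * z - h / 2"
    have y: "\<bar>?y\<bar> \<le> ?s * (\<bar>z\<bar> + sqrt T)"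
    proof -
      have "h \<le> ?s * sqrt T" using s by (metis mult_left_mono less_imp_le power2_eq_square)
      then show ?thesis
        using abs_triangle_ineq4 [of "?s * z" "h / 2"] h by (simp add: abs_mult distrib_left)
    qed
    have y': "\<bar>?y\<bar> \<le> sqrt T * \<bar>z\<bar> + T"
      using abs_triangle_ineq4 [of "?s * z" "h / 2"] sz [of z] h by linarith
    have "?y\<^sup>2 * exp \<bar>?y\<bar> \<le> (?s * (\<bar>z\<bar> + sqrt T))\<^sup>2 * exp (sqrt T * \<bar>z\<bar> + T)"
      using y y' power_mono [OF y, of 2] by (intro mult_mono) auto
    then have "\<bar>exp ?y - 1 - ?y\<bar> \<le> h * ((\<bar>z\<bar> + sqrt T)\<^sup>2 * (e z * exp T))"
      using exp_bound_2 [of ?y] s(3) by (simp add: power_mult_distrib exp_add e_def mult_ac)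
    moreover have "exp ?y - 1 - ?s * z = (exp ?y - 1 - ?y) - h / 2" by simp
    ultimately have "\<bar>exp ?y - 1 - ?s * z\<bar> \<le> h * ((\<bar>z\<bar> + sqrt T)\<^sup>2 * (e z * exp T) + 1)"
      using h abs_triangle_ineq4 [of "exp ?y - 1 - ?y" "h / 2"] by (simp add: distrib_left)
    then have d: "\<bar>heat1 h w x * (exp ?y - 1 - ?s * z)\<bar> \<le>
        \<bar>heat1 h w x\<bar> * (h * ((\<bar>z\<bar> + sqrt T)\<^sup>2 * (e z * exp T) + 1))"
      unfolding abs_mult by (rule mult_left_mono) simp
    have split: "w (x + ?s * z) - heat h w x - heat1 h w x * (exp ?y - 1) =
        r z - (heat h w x - w x) - (heat1 h w x - w1 x) * (?s * z) - heat1 h w x * (exp ?y - 1 - ?s * z)"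
      by (simp add: r_def algebra_simps)
    have "\<bar>w (x + ?s * z) - heat h w x - heat1 h w x * (exp ?y - 1)\<bar> \<le>
        B * h * (z\<^sup>2 * e z) + B * h * I1 + B * h * (I2 * \<bar>z\<bar>) +
        \<bar>heat1 h w x\<bar> * (h * ((\<bar>z\<bar> + sqrt T)\<^sup>2 * (e z * exp T) + 1))"
      unfolding split using r [of z] b c d by linarith
    also have "\<dots> \<le> h * (B + \<bar>heat1 h w x\<bar>) * Q z"
    proof -
      let ?D = "\<bar>heat1 h w x\<bar>" and ?q = "(\<bar>z\<bar> + sqrt T)\<^sup>2 * (e z * exp T) + 1"
      have "0 \<le> h * B * ?q" "0 \<le> h * ?D * (z\<^sup>2 * e z + I1 + I2 * \<bar>z\<bar>)"
        using h B0 I0 e0 by (auto intro!: mult_nonneg_nonneg add_nonneg_nonneg)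
      then show ?thesis unfolding Q_def by (simp add: distrib_left distrib_right mult_ac)
    qed
    also have "\<dots> \<le> h * (B + \<bar>heat1 h w x\<bar>) * (C * exp (c * \<bar>z\<bar>))"
      using C(3) [of z] h B0 by (intro mult_left_mono) auto
    finally show "\<bar>w (x + ?s * z) - heat h w x - heat1 h w x * (exp ?y - 1)\<bar>
      \<le> C * h * (B + \<bar>heat1 h w x\<bar>) * exp (c * \<bar>z\<bar>)" by (simp add: mult_ac)
  qed
qed

subsection \<open>The K-functional\<close>

lemma Cb0_abs_le_sup_norm: "f \<in> Cb0 \<Longrightarrow> \<bar>f x\<bar> \<le> sup_norm f"
  unfolding sup_norm_def
  by (rule cSUP_upper) (force simp: Cb0_def bounded_iff bdd_above_def)+

lemma sup_norm_nonneg: "f \<in> Cb0 \<Longrightarrow> 0 \<le> sup_norm f"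
  using Cb0_abs_le_sup_norm [of f 0] by linarith

text \<open>For a fixed pair of points the Lipschitz inequality is closed in L, so it survives the
  infimum over all constants.\<close>

lemma Lip0_lip_norm:
  assumes "f \<in> Lip0"
  shows "(lip_norm f)-lipschitz_on UNIV f"
proof (rule lipschitz_onI)
  obtain L where L: "L-lipschitz_on UNIV f" using assms by (auto simp: Lip0_def)
  then have ne: "{L. L-lipschitz_on UNIV f} \<noteq> {}" by auto
  show "0 \<le> lip_norm f"
    unfolding lip_norm_def by (rule cInf_greatest [OF ne]) (auto dest: lipschitz_on_nonneg)
  fix x y :: real
  show "dist (f x) (f y) \<le> lip_norm f * dist x y"
  proof (cases "x = y")
    case False
    have "dist (f x) (f y) / dist x y \<le> lip_norm f"
      unfolding lip_norm_def
    proof (rule cInf_greatest [OF ne])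
      fix L assume "L \<in> {L. L-lipschitz_on UNIV f}"
      then have "dist (f x) (f y) \<le> L * dist x y" by (auto dest: lipschitz_onD)
      then show "dist (f x) (f y) / dist x y \<le> L" using False by (simp add: pos_divide_le_eq)
    qed
    then show ?thesis using False by (simp add: pos_divide_le_eq)
  qed simp
qed

definition splits :: "(real \<Rightarrow> real) \<Rightarrow> (real \<Rightarrow> real) \<Rightarrow> (real \<Rightarrow> real) \<Rightarrow> bool" where
  "splits f f0 f1 \<longleftrightarrow> f0 \<in> Cb0 \<and> f1 \<in> Lip0 \<and> f = (\<lambda>x. f0 x + f1 x)"

lemma splits_nonneg:
  "splits f f0 f1 \<Longrightarrow> 0 \<le> sup_norm f0" "splits f f0 f1 \<Longrightarrow> 0 \<le> lip_norm f1"
  using sup_norm_nonneg lipschitz_on_nonneg [OF Lip0_lip_norm] by (auto simp: splits_def)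

lemma K_functional_le:
  assumes "splits f f0 f1" "0 \<le> v"
  shows "K_functional v f \<le> sup_norm f0 + v * lip_norm f1"
  unfolding K_functional_def
proof (rule cInf_lower)
  show "sup_norm f0 + v * lip_norm f1 \<in>
      {sup_norm f0 + v * lip_norm f1 |f0 f1. f0 \<in> Cb0 \<and> f1 \<in> Lip0 \<and> f = (\<lambda>x. f0 x + f1 x)}"
    using assms by (auto simp: splits_def)
  show "bdd_below {sup_norm f0 + v * lip_norm f1 |f0 f1. f0 \<in> Cb0 \<and> f1 \<in> Lip0 \<and> f = (\<lambda>x. f0 x + f1 x)}"
    using assms(2) by (intro bdd_belowI [of _ 0])
      (auto simp: splits_nonneg [unfolded splits_def])
qed

text \<open>An estimate valid for each splitting passes to the infimum; the given splitting keeps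
  the infimum from being over the empty set. The summand r carries the contribution of g1, which
  takes no part in the optimisation.\<close>

lemma K_functional_ge:
  assumes "splits f h0 h1" "0 \<le> v" "0 \<le> C"
    and le: "\<And>f0 f1. splits f f0 f1 \<Longrightarrow> q \<le> C * (sup_norm f0 + v * lip_norm f1 + r)"
  shows "q \<le> C * (K_functional v f + r)"
proof (cases "C = 0")
  case True then show ?thesis using le [OF assms(1)] by simp
next
  case False
  then have C: "0 < C" using assms(3) by simp
  have "q / C - r \<le> K_functional v f"
    unfolding K_functional_def
  proof (rule cInf_greatest)
    show "{sup_norm f0 + v * lip_norm f1 |f0 f1. f0 \<in> Cb0 \<and> f1 \<in> Lip0 \<and> f = (\<lambda>x. f0 x + f1 x)} \<noteq> {}"
      using assms(1) by (auto simp: splits_def)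
    fix k assume "k \<in> {sup_norm f0 + v * lip_norm f1 |f0 f1. f0 \<in> Cb0 \<and> f1 \<in> Lip0 \<and> f = (\<lambda>x. f0 x + f1 x)}"
    then obtain f0 f1 where "splits f f0 f1" "k = sup_norm f0 + v * lip_norm f1"
      by (auto simp: splits_def)
    then have "q \<le> C * (k + r)" using le by blast
    then show "q / C - r \<le> k" using C by (simp add: pos_divide_le_eq algebra_simps)
  qed
  then show ?thesis using C by (simp add: pos_divide_le_eq algebra_simps)
qed

lemma K_functional_nonneg:
  assumes "splits f h0 h1" "0 \<le> v"
  shows "0 \<le> K_functional v f"
  using K_functional_ge [OF assms, of 1 0 0] splits_nonneg assms(2) by fastforce

lemma K_functional_mono:
  assumes "splits f h0 h1" "0 \<le> v" "v \<le> w"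
  shows "K_functional v f \<le> K_functional w f"
proof -
  have "K_functional v f \<le> 1 * (K_functional w f + 0)"
  proof (rule K_functional_ge [OF assms(1)])
    fix f0 f1 assume s: "splits f f0 f1"
    have "v * lip_norm f1 \<le> w * lip_norm f1"
      using assms splits_nonneg [OF s] by (intro mult_right_mono)
    then show "K_functional v f \<le> 1 * (sup_norm f0 + w * lip_norm f1 + 0)"
      using K_functional_le [OF s assms(2)] by simp
  qed (use assms in auto)
  then show ?thesis by simp
qed

lemma K_functional_scale:
  assumes "splits f h0 h1" "0 \<le> v" "1 \<le> k"
  shows "K_functional (k * v) f \<le> k * K_functional v f"
proof -
  have "K_functional (k * v) f \<le> k * (K_functional v f + 0)"
  proof (rule K_functional_ge [OF assms(1)])
    fix f0 f1 assume s: "splits f f0 f1"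
    have "1 * sup_norm f0 \<le> k * sup_norm f0"
      using assms splits_nonneg [OF s] by (intro mult_right_mono)
    then show "K_functional (k * v) f \<le> k * (sup_norm f0 + v * lip_norm f1 + 0)"
      using K_functional_le [OF s, of "k * v"] assms by (simp add: algebra_simps)
  qed (use assms in auto)
  then show ?thesis by simp
qed

lemma Hol2_splits: "f \<in> Hol2 \<theta> \<Longrightarrow> \<exists>f0 f1. splits f f0 f1"
  by (auto simp: Hol2_def splits_def)

subsection \<open>Payoffs split into a bounded and a Lipschitz part\<close>

lemma growth_lipschitz_exp:
  assumes "L-lipschitz_on UNIV g1"
  shows "growth (\<lambda>x. g1 (exp (x - b)))"
proof (rule growth_bound)
  show "growth (\<lambda>x. \<bar>g1 0\<bar> + L * exp (1 * x - b))" by (intro growth_intros)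
  have "g1 \<in> borel_measurable borel"
    using lipschitz_on_continuous_on [OF assms] by (rule borel_measurable_continuous_onI)
  then show "(\<lambda>x. g1 (exp (x - b))) \<in> borel_measurable borel" by measurable
  fix x
  have "\<bar>g1 (exp (x - b)) - g1 0\<bar> \<le> L * exp (x - b)"
    using lipschitz_onD [OF assms, of "exp (x - b)" 0] by (simp add: dist_real_def)
  then have "\<bar>g1 (exp (x - b))\<bar> \<le> \<bar>g1 0\<bar> + L * exp (x - b)" by linarith
  then show "\<bar>g1 (exp (x - b))\<bar> \<le> \<bar>\<bar>g1 0\<bar> + L * exp (1 * x - b)\<bar>" by simp
qed

lemma lipschitz_exp_diff:
  assumes g1: "L-lipschitz_on UNIV (g1 :: real \<Rightarrow> real)" and b: "0 \<le> b"
  shows "\<bar>g1 (exp (x + d - b)) - g1 (exp (x - b))\<bar> \<le> L * exp x * (\<bar>d\<bar> * exp \<bar>d\<bar>)"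
proof -
  have L: "0 \<le> L" using g1 by (rule lipschitz_on_nonneg)
  have "exp (x + d - b) - exp (x - b) = exp (x - b) * (exp d - 1)"
    by (simp add: right_diff_distrib exp_add [symmetric] algebra_simps)
  then have "\<bar>exp (x + d - b) - exp (x - b)\<bar> = exp (x - b) * \<bar>exp d - 1\<bar>" by (simp add: abs_mult)
  also have "\<dots> \<le> exp x * (\<bar>d\<bar> * exp \<bar>d\<bar>)"
    using b exp_bound_1 [of d] by (intro mult_mono) auto
  finally have "L * \<bar>exp (x + d - b) - exp (x - b)\<bar> \<le> L * (exp x * (\<bar>d\<bar> * exp \<bar>d\<bar>))"
    using L by (rule mult_left_mono)
  then show ?thesis
    using lipschitz_onD [OF g1, of "exp (x + d - b)" "exp (x - b)"] by (simp add: dist_real_def mult_ac)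
qed

text \<open>At distance sqrt v z from x the payoff differs from the constant
  \<open>g1 (exp (x - T / 2))\<close> by at most N times a function of z. Subtracting that constant
  changes neither derivative. The constants C and c are fixed before g0, g1, \<beta> and L, so that
  the splitting can be optimised afterwards.\<close>

lemma heat_payoff_bounds:
  assumes T: "0 < T"
  obtains C c where "0 \<le> C" "0 \<le> c" "\<And>g0 g1 \<beta> L v x z.
    g0 \<in> borel_measurable borel \<Longrightarrow> (\<And>y. \<bar>g0 y\<bar> \<le> \<beta>) \<Longrightarrow> L-lipschitz_on UNIV g1 \<Longrightarrow> 0 < v \<Longrightarrow> v \<le> T \<Longrightarrow>
    (let f = (\<lambda>y. g0 (exp (y - T / 2)) + g1 (exp (y - T / 2))); N = \<beta> + sqrt v * exp x * L in
      \<bar>heat1 v f x\<bar> \<le> C * N / sqrt v \<and> \<bar>heat2 v f x\<bar> \<le> C * N / v \<and>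
      \<bar>f (x + sqrt v * z) - heat v f x\<bar> \<le> C * N * exp (c * \<bar>z\<bar>))"
proof -
  define q where "q z = 1 + \<bar>z\<bar> * exp (sqrt T * \<bar>z\<bar>)" for z
  have gq: "growth q" unfolding q_def [abs_def] by (intro growth_intros)
  have q0: "0 \<le> q z" for z by (simp add: q_def)
  define I0 where "I0 = (\<integral>z. q z \<partial>gauss)"
  define I1 where "I1 = (\<integral>z. q z * \<bar>z\<bar> \<partial>gauss)"
  define I2 where "I2 = (\<integral>z. q z * \<bar>z\<^sup>2 - 1\<bar> \<partial>gauss)"
  have I: "0 \<le> I0" "0 \<le> I1" "0 \<le> I2" unfolding I0_def I1_def I2_def by (auto simp: q0)
  have "growth (\<lambda>z. q z + I0)" by (intro growth_intros gq)
  then obtain C c where C: "0 \<le> C" "0 \<le> c" "\<And>z. \<bar>q z + I0\<bar> \<le> C * exp (c * \<bar>z\<bar>)" using growthE by blast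
  show ?thesis
  proof (rule that [of "C + I1 + I2" c])
    fix g0 g1 :: "real \<Rightarrow> real" and \<beta> L v x z
    assume g0 [measurable]: "g0 \<in> borel_measurable borel" and \<beta>: "\<And>y. \<bar>g0 y\<bar> \<le> \<beta>"
      and g1: "L-lipschitz_on UNIV g1" and v: "0 < v" "v \<le> T"
    define f1 where "f1 y = g1 (exp (y - T / 2))" for y
    define f where "f y = g0 (exp (y - T / 2)) + g1 (exp (y - T / 2))" for y
    define N where "N = \<beta> + sqrt v * exp x * L"
    have \<beta>0: "0 \<le> \<beta>" using \<beta> [of 0] by linarith
    have L0: "0 \<le> L" using g1 by (rule lipschitz_on_nonneg)
    have N0: "0 \<le> N" using \<beta>0 L0 v by (simp add: N_def)
    have "growth (\<lambda>y. g0 (exp (y - T / 2)))"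
      by (rule growthI [of _ \<beta> 0]) (use \<beta> in auto)
    then have gf: "growth f"
      unfolding f_def [abs_def] by (intro growth_add growth_lipschitz_exp [OF g1])
    have key: "\<bar>f (x + sqrt v * z) - f1 x\<bar> \<le> N * q z" for z
    proof -
      let ?d = "sqrt v * z"
      have d: "\<bar>?d\<bar> = sqrt v * \<bar>z\<bar>" "sqrt v * \<bar>z\<bar> \<le> sqrt T * \<bar>z\<bar>"
        using v by (simp_all add: abs_mult mult_right_mono)
      have "\<bar>f (x + ?d) - f1 x\<bar> \<le> \<beta> + L * exp x * (\<bar>?d\<bar> * exp \<bar>?d\<bar>)"
        unfolding f_def f1_def
        using \<beta> [of "exp (x + ?d - T / 2)"] lipschitz_exp_diff [OF g1, of "T / 2" x ?d] T by linarith
      also have "L * exp x * (\<bar>?d\<bar> * exp \<bar>?d\<bar>) \<le> L * exp x * ((sqrt v * \<bar>z\<bar>) * exp (sqrt T * \<bar>z\<bar>))"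
        using d L0 by (intro mult_left_mono mult_mono) auto
      also have "\<beta> + L * exp x * ((sqrt v * \<bar>z\<bar>) * exp (sqrt T * \<bar>z\<bar>)) \<le> N * q z"
      proof -
        have "0 \<le> \<beta> * (\<bar>z\<bar> * exp (sqrt T * \<bar>z\<bar>))" "0 \<le> sqrt v * exp x * L"
          using \<beta>0 L0 v by auto
        then show ?thesis by (simp add: N_def q_def algebra_simps)
      qed
      finally show ?thesis by simp
    qed
    note gfa = growth_affine [OF gf]
    note int = integrable_growth [OF gfa]
    have le: "\<bar>\<integral>z. (f (x + sqrt v * z) - f1 x) * p z \<partial>gauss\<bar> \<le> N * (\<integral>z. q z * \<bar>p z\<bar> \<partial>gauss)"
      if gp: "growth p" for p
    proof -
      have "\<bar>\<integral>z. (f (x + sqrt v * z) - f1 x) * p z \<partial>gauss\<bar> \<le> (\<integral>z. N * (q z * \<bar>p z\<bar>) \<partial>gauss)"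
      proof (intro abs_integral_gauss_le growth_intros gfa gp gq)
        fix z show "\<bar>(f (x + sqrt v * z) - f1 x) * p z\<bar> \<le> N * (q z * \<bar>p z\<bar>)"
          using mult_right_mono [OF key [of z], of "\<bar>p z\<bar>"] by (simp add: abs_mult mult_ac)
      qed
      then show ?thesis by simp
    qed
    \<comment> \<open>For p = z and p = z^2 - 1 the last integral is 0: both kernels are blind to
      constants.\<close>
    have center: "(\<integral>z. (f (x + sqrt v * z) - f1 x) * p z \<partial>gauss) =
        (\<integral>z. f (x + sqrt v * z) * p z \<partial>gauss) - f1 x * (\<integral>z. p z \<partial>gauss)" if gp: "growth p" for p
      using integrable_growth [OF growth_mult [OF gfa gp]] integrable_growth [OF gp]
      by (simp add: left_diff_distrib)
    have 0: "\<bar>heat v f x - f1 x\<bar> \<le> N * I0"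
      using le [OF growth_const [of 1]] center [OF growth_const [of 1]] by (simp add: heat_def I0_def)
    have "\<bar>\<integral>z. f (x + sqrt v * z) * z \<partial>gauss\<bar> \<le> N * I1"
      using le [OF growth_ident] center [OF growth_ident] by (simp add: I1_def gauss_mean)
    then have 1: "\<bar>heat1 v f x\<bar> \<le> N * I1 / sqrt v"
      using v by (simp add: heat1_def abs_divide divide_right_mono)
    have g2: "growth (\<lambda>z. z\<^sup>2 - 1)" by (intro growth_intros)
    have "(\<integral>z. z\<^sup>2 - 1 \<partial>gauss) = 0"
      using integrable_growth [OF growth_power [OF growth_ident], of 2] integrable_growth [OF growth_const]
      by (simp add: gauss_second_moment)
    then have "\<bar>\<integral>z. f (x + sqrt v * z) * (z\<^sup>2 - 1) \<partial>gauss\<bar> \<le> N * I2"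
      using le [OF g2] center [OF g2] by (simp add: I2_def)
    then have 2: "\<bar>heat2 v f x\<bar> \<le> N * I2 / v"
      using v by (simp add: heat2_def abs_divide divide_right_mono)
    have "\<bar>f (x + sqrt v * z) - heat v f x\<bar> \<le> N * (q z + I0)"
      using key [of z] 0 unfolding distrib_left by linarith
    also have "\<dots> \<le> N * (C * exp (c * \<bar>z\<bar>))" using C(3) [of z] N0 by (intro mult_left_mono) auto
    also have "\<dots> \<le> (C + I1 + I2) * N * exp (c * \<bar>z\<bar>)"
      using I N0 by (simp add: algebra_simps)
    finally have 3: "\<bar>f (x + sqrt v * z) - heat v f x\<bar> \<le> (C + I1 + I2) * N * exp (c * \<bar>z\<bar>)" .
    have "N * I1 / sqrt v \<le> (C + I1 + I2) * N / sqrt v" "N * I2 / v \<le> (C + I1 + I2) * N / v"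
      using I N0 C(1) v by (auto intro!: divide_right_mono simp: algebra_simps)
    then show "let f = (\<lambda>y. g0 (exp (y - T / 2)) + g1 (exp (y - T / 2))); N = \<beta> + sqrt v * exp x * L in
      \<bar>heat1 v f x\<bar> \<le> (C + I1 + I2) * N / sqrt v \<and> \<bar>heat2 v f x\<bar> \<le> (C + I1 + I2) * N / v \<and>
      \<bar>f (x + sqrt v * z) - heat v f x\<bar> \<le> (C + I1 + I2) * N * exp (c * \<bar>z\<bar>)"
      unfolding Let_def f_def [abs_def, symmetric] N_def [symmetric]
      using 1 2 3 by linarith
  qed (use C I in auto)
qed

text \<open>Both sides are the derivative at x of the function \<open>heat (v + w) f\<close>. In
  contrast to \<open>heat_heat1\<close> the derivative is taken last.\<close>

lemma heat1_heat:
  assumes f: "growth f" and v: "0 < v" "0 \<le> w"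
  shows "heat1 v (heat w f) x = heat1 (v + w) f x"
proof -
  have "heat v (heat w f) = heat (v + w) f"
    using heat_heat [OF f] v by (auto simp: fun_eq_iff)
  then show ?thesis
    using heat_has_derivative(1) [OF growth_heat [OF f] v(1), of w x]
      heat_has_derivative(1) [OF f, of "v + w" x] v by (auto intro: DERIV_unique)
qed

text \<open>Replaces the intermediate point of the mean value theorem by an end point, whatever the
  sign of the exponent.\<close>

lemma powr_comparable:
  fixes a \<xi> r :: real
  assumes "0 < a" "a / k \<le> \<xi>" "\<xi> \<le> a" "1 \<le> k"
  shows "\<xi> powr r \<le> k powr \<bar>r\<bar> * a powr r" "a powr r \<le> k powr \<bar>r\<bar> * \<xi> powr r"
proof -
  have \<xi>: "0 < \<xi>" using assms(2) divide_pos_pos [OF assms(1), of k] assms(4) by linarith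
  have q: "1 \<le> a / \<xi>" "a / \<xi> \<le> k" using assms \<xi> by (simp_all add: field_simps)
  have le: "(a / \<xi>) powr s \<le> k powr \<bar>s\<bar>" for s
  proof (cases "0 \<le> s")
    case True then show ?thesis using q by (simp add: powr_mono2)
  next
    case False
    then have "(a / \<xi>) powr s \<le> (a / \<xi>) powr 0" using q by (intro powr_mono) auto
    also have "\<dots> \<le> k powr \<bar>s\<bar>" using q assms(4) by (simp add: ge_one_powr_ge_zero)
    finally show ?thesis .
  qed
  show "a powr r \<le> k powr \<bar>r\<bar> * \<xi> powr r"
    using le [of r] \<xi> assms(1) by (simp add: powr_divide pos_divide_le_eq)
  show "\<xi> powr r \<le> k powr \<bar>r\<bar> * a powr r"
    using le [of "- r"] \<xi> assms(1) by (simp add: powr_divide powr_minus field_simps)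
qed

lemma powr_increment:
  fixes b a p k :: real
  assumes "0 < b" "b < a" "a \<le> k * b" "1 \<le> k"
  shows "\<exists>\<xi>. a / k \<le> \<xi> \<and> \<xi> \<le> a \<and> a powr p - b powr p = p * \<xi> powr (p - 1) * (a - b)"
proof -
  have "\<exists>\<xi>>b. \<xi> < a \<and> a powr p - b powr p = (a - b) * (p * \<xi> powr (p - 1))"
    using assms(1,2) by (intro MVT2) (auto intro!: has_real_derivative_powr)
  then obtain \<xi> where "b < \<xi>" "\<xi> < a" "a powr p - b powr p = (a - b) * (p * \<xi> powr (p - 1))" by blast
  moreover have "a / k \<le> b" using assms(3,4) by (simp add: pos_divide_le_eq mult.commute)
  ultimately show ?thesis by (intro exI [of _ \<xi>]) auto
qed

text \<open>The integrals are compared by monotonicity with a step function only, which works for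
  integrands of unknown measurability such as those built from a K-functional.\<close>

lemma lower_sum_le_nn_integral:
  fixes l u c :: "nat \<Rightarrow> real"
  assumes lu: "\<And>i. i < N \<Longrightarrow> l i \<le> u i" and disj: "disjoint_family_on (\<lambda>i. {l i<..u i}) {..<N}"
    and c: "\<And>i. i < N \<Longrightarrow> 0 \<le> c i" "\<And>i v. i < N \<Longrightarrow> v \<in> {l i<..u i} \<Longrightarrow> ennreal (c i) \<le> f v"
  shows "ennreal (\<Sum>i<N. (u i - l i) * c i) \<le> (\<integral>\<^sup>+v. f v \<partial>lborel)"
proof -
  have step: "(\<Sum>i<N. ennreal (c i) * indicator {l i<..u i} v) \<le> f v" for v
  proof (cases "\<exists>j<N. v \<in> {l j<..u j}")
    case True
    then obtain j where j: "j < N" "v \<in> {l j<..u j}" by blast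
    have "(\<Sum>i<N. ennreal (c i) * indicator {l i<..u i} v) = ennreal (c j)"
      by (rule sum_indicator_disjoint_family [OF disj]) (use j in auto)
    then show ?thesis using c(2) [OF j] by simp
  next
    case False
    then have "(\<Sum>i<N. ennreal (c i) * indicator {l i<..u i} v) = 0" by (intro sum.neutral) auto
    then show ?thesis by simp
  qed
  have "ennreal (\<Sum>i<N. (u i - l i) * c i) = (\<Sum>i<N. ennreal (c i) * emeasure lborel {l i<..u i})"
    using lu c(1) by (subst sum_ennreal [symmetric])
      (auto intro!: sum.cong mult_nonneg_nonneg simp: ennreal_mult' [symmetric] mult.commute)
  also have "\<dots> = (\<integral>\<^sup>+v. (\<Sum>i<N. ennreal (c i) * indicator {l i<..u i} v) \<partial>lborel)"
    by (subst nn_integral_sum) (auto simp: nn_integral_cmult_indicator)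
  also have "\<dots> \<le> (\<integral>\<^sup>+v. f v \<partial>lborel)"
    by (intro nn_integral_mono step)
  finally show ?thesis .
qed

text \<open>K increases and the power of v decreases, so on each cell the integrand is at least the
  value formed with K at the left and the power at the right end. The bound J is the integral
  itself, hence independent of the partition; this independence allows nodes scaled by the random
  state.\<close>

lemma Hol2_lower_sum:
  assumes f: "f \<in> Hol2 \<theta>" and \<theta>: "0 < \<theta>"
  shows "\<exists>J\<ge>0. \<forall>r N. (\<forall>i<N. 0 < r (Suc i) \<and> r (Suc i) \<le> r i) \<longrightarrow>
     (\<Sum>i<N. (r i - r (Suc i)) * ((r i) powr (- 2 * \<theta> - 1) * (K_functional (r (Suc i)) f)\<^sup>2)) \<le> J"
proof -
  let ?F = "\<lambda>v. ennreal ((v powr (-\<theta>) * K_functional v f)\<^sup>2 / v) * indicator {0<..} v"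
  define J where "J = enn2real (\<integral>\<^sup>+v. ?F v \<partial>lborel)"
  have fin: "(\<integral>\<^sup>+v. ?F v \<partial>lborel) = ennreal J"
    using f by (simp add: Hol2_def J_def)
  obtain h0 h1 where sp: "splits f h0 h1" using Hol2_splits [OF f] by blast
  show ?thesis
  proof (intro exI [of _ J] conjI allI impI)
    show "0 \<le> J" by (simp add: J_def)
    fix r :: "nat \<Rightarrow> real" and N assume r: "\<forall>i<N. 0 < r (Suc i) \<and> r (Suc i) \<le> r i"
    define c where "c i = (r i) powr (- 2 * \<theta> - 1) * (K_functional (r (Suc i)) f)\<^sup>2" for i
    have anti: "r j \<le> r i" if "i \<le> j" "j \<le> N" for i j
      using that
    proof (induction rule: dec_induct)
      case (step k)
      then have "r (Suc k) \<le> r k" "r k \<le> r i" using r by auto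
      then show ?case by linarith
    qed simp
    have "ennreal (\<Sum>i<N. (r i - r (Suc i)) * c i) \<le> (\<integral>\<^sup>+v. ?F v \<partial>lborel)"
    proof (rule lower_sum_le_nn_integral)
      show "disjoint_family_on (\<lambda>i. {r (Suc i)<..r i}) {..<N}"
        unfolding disjoint_family_on_def
      proof (intro ballI impI)
        fix i j assume ij: "i \<in> {..<N}" "j \<in> {..<N}" "i \<noteq> j"
        then consider "Suc i \<le> j" | "Suc j \<le> i" by linarith
        then show "{r (Suc i)<..r i} \<inter> {r (Suc j)<..r j} = {}"
          by cases (use anti [of "Suc i" j] anti [of "Suc j" i] ij in auto)
      qed
      fix j v assume j: "j < N" "v \<in> {r (Suc j)<..r j}"
      then have v: "0 < r (Suc j)" "r (Suc j) < v" "v \<le> r j" using r by auto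
      have "c j \<le> v powr (- 2 * \<theta> - 1) * (K_functional v f)\<^sup>2"
        unfolding c_def using v \<theta> K_functional_nonneg [OF sp] K_functional_mono [OF sp]
        by (intro mult_mono powr_mono2' power_mono) auto
      also have "\<dots> = (v powr (-\<theta>) * K_functional v f)\<^sup>2 / v"
      proof -
        have "v powr (- 2 * \<theta> - 1) = v powr (- \<theta>) * v powr (- \<theta>) * v powr (- 1)"
          by (simp only: powr_add [symmetric]) simp
        then show ?thesis using v by (simp add: powr_minus power2_eq_square field_simps)
      qed
      finally show "ennreal (c j) \<le> ?F v" using v by (simp add: ennreal_leI)
    qed (use r in \<open>auto simp: c_def\<close>)
    then have "(\<Sum>i<N. (r i - r (Suc i)) * c i) \<le> J"
      unfolding fin by (subst (asm) ennreal_le_iff) (simp add: J_def)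
    then show "(\<Sum>i<N. (r i - r (Suc i)) * ((r i) powr (- 2 * \<theta> - 1) * (K_functional (r (Suc i)) f)\<^sup>2)) \<le> J"
      unfolding c_def .
  qed
qed

section \<open>Derivative bounds and one-step errors for the payoff of the theorem\<close>

locale hedging_payoff =
  fixes T \<theta> L :: real and g\<theta> g1 :: "real \<Rightarrow> real"
  assumes T: "0 < T" and \<theta>: "0 < \<theta>" "\<theta> < 1"
    and g\<theta>: "g\<theta> \<in> Hol2 \<theta>" and g1: "L-lipschitz_on UNIV g1"
begin

definition pay :: "real \<Rightarrow> real" where
  "pay x = g\<theta> (exp (x - T / 2)) + g1 (exp (x - T / 2))"

text \<open>Stands for the K-functional of the whole payoff, with g1 in the Lipschitz part. Since g1
  may fail to vanish at 0, the sum cannot be handed to \<open>K_functional\<close> itself.\<close>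

definition KK :: "real \<Rightarrow> real" where
  "KK v = K_functional v g\<theta> + v * L"

definition h0 where "h0 = (SOME f0. \<exists>f1. splits g\<theta> f0 f1)"
definition h1 where "h1 = (SOME f1. splits g\<theta> h0 f1)"

lemma g\<theta>_splits: "splits g\<theta> h0 h1"
proof -
  have "\<exists>f1. splits g\<theta> h0 f1" unfolding h0_def by (rule someI_ex [OF Hol2_splits [OF g\<theta>]])
  then show ?thesis unfolding h1_def by (rule someI_ex)
qed

lemma L_nonneg: "0 \<le> L"
  using g1 by (rule lipschitz_on_nonneg)

lemma growth_pay: "growth pay" and continuous_pay: "continuous_on UNIV pay"
proof -
  obtain k0 k1 where h: "k0 \<in> Cb0" "k1 \<in> Lip0" "\<And>x. g\<theta> x = k0 x + k1 x"
    using g\<theta>_splits unfolding splits_def by metis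
  have pay: "pay = (\<lambda>x. k0 (exp (x - T / 2)) + k1 (exp (x - T / 2)) + g1 (exp (x - T / 2)))"
    by (simp add: fun_eq_iff pay_def h(3))
  have c: "continuous_on UNIV k0" "continuous_on UNIV k1" "continuous_on UNIV g1"
    using h(1) lipschitz_on_continuous_on [OF Lip0_lip_norm [OF h(2)]] lipschitz_on_continuous_on [OF g1]
    by (auto simp: Cb0_def)
  have "growth (\<lambda>x. k0 (exp (x - T / 2)))"
    using Cb0_abs_le_sup_norm [OF h(1)] borel_measurable_continuous_onI [OF c(1)]
    by (intro growthI [of _ "sup_norm k0" 0]) auto
  from growth_add [OF growth_add [OF this growth_lipschitz_exp [OF Lip0_lip_norm [OF h(2)]]]
      growth_lipschitz_exp [OF g1]]
  show "growth pay" unfolding pay .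
  have e: "continuous_on UNIV (\<lambda>x. h (exp (x - T / 2)))" if "continuous_on UNIV h" for h :: "real \<Rightarrow> real"
    by (rule continuous_on_compose2 [OF that]) (auto intro!: continuous_intros)
  from continuous_on_add [OF continuous_on_add [OF e [OF c(1)] e [OF c(2)]] e [OF c(3)]]
  show "continuous_on UNIV pay" unfolding pay .
qed

lemma KK_nonneg: "0 \<le> v \<Longrightarrow> 0 \<le> KK v"
  using K_functional_nonneg [OF g\<theta>_splits] L_nonneg by (simp add: KK_def)

lemma KK_mono: "0 \<le> v \<Longrightarrow> v \<le> w \<Longrightarrow> KK v \<le> KK w"
  unfolding KK_def using L_nonneg by (intro add_mono mult_right_mono K_functional_mono [OF g\<theta>_splits])

lemma KK_scale: "0 \<le> v \<Longrightarrow> 1 \<le> k \<Longrightarrow> KK (k * v) \<le> k * KK v"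
  using K_functional_scale [OF g\<theta>_splits, of v k] by (simp add: KK_def distrib_left)

text \<open>The argument changes by a factor of at most exp |y - x|, and \<open>KK\<close> grows at
  most linearly. This carries coefficients from the state at one time to the state at an earlier
  one.\<close>

lemma KK_exp_le:
  assumes "0 \<le> v"
  shows "KK (v * exp y) \<le> exp \<bar>y - x\<bar> * KK (v * exp x)"
proof -
  have "v * exp y = v * (exp (y - x) * exp x)" by (simp add: exp_add [symmetric])
  also have "\<dots> \<le> exp \<bar>y - x\<bar> * (v * exp x)" using assms by (simp add: mult_mono mult_ac)
  finally have "KK (v * exp y) \<le> KK (exp \<bar>y - x\<bar> * (v * exp x))" using assms by (intro KK_mono) auto
  also have "\<dots> \<le> exp \<bar>y - x\<bar> * KK (v * exp x)" using assms by (intro KK_scale) auto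
  finally show ?thesis .
qed

lemma pay_bounds:
  "\<exists>C c. 0 \<le> C \<and> 0 \<le> c \<and> (\<forall>v x z. 0 < v \<longrightarrow> v \<le> T \<longrightarrow>
     \<bar>heat1 v pay x\<bar> \<le> C / sqrt v * KK (sqrt v * exp x) \<and>
     \<bar>heat2 v pay x\<bar> \<le> C / v * KK (sqrt v * exp x) \<and>
     \<bar>pay (x + sqrt v * z) - heat v pay x\<bar> \<le> C * exp (c * \<bar>z\<bar>) * KK (sqrt v * exp x))"
proof (rule heat_payoff_bounds [OF T])
  fix C c assume Cc: "0 \<le> C" "0 \<le> c" and b: "\<And>g0 g1 \<beta> L v x z.
    g0 \<in> borel_measurable borel \<Longrightarrow> (\<And>y. \<bar>g0 y\<bar> \<le> \<beta>) \<Longrightarrow> L-lipschitz_on UNIV g1 \<Longrightarrow> 0 < v \<Longrightarrow> v \<le> T \<Longrightarrow>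
    (let f = (\<lambda>y. g0 (exp (y - T / 2)) + g1 (exp (y - T / 2))); N = \<beta> + sqrt v * exp x * L in
      \<bar>heat1 v f x\<bar> \<le> C * N / sqrt v \<and> \<bar>heat2 v f x\<bar> \<le> C * N / v \<and>
      \<bar>f (x + sqrt v * z) - heat v f x\<bar> \<le> C * N * exp (c * \<bar>z\<bar>))"
  have s: "\<bar>heat1 v pay x\<bar> \<le> C / sqrt v * (sup_norm h0 + (sqrt v * exp x) * lip_norm h1 + (sqrt v * exp x) * L) \<and>
     \<bar>heat2 v pay x\<bar> \<le> C / v * (sup_norm h0 + (sqrt v * exp x) * lip_norm h1 + (sqrt v * exp x) * L) \<and>
     \<bar>pay (x + sqrt v * z) - heat v pay x\<bar> \<le>
        C * exp (c * \<bar>z\<bar>) * (sup_norm h0 + (sqrt v * exp x) * lip_norm h1 + (sqrt v * exp x) * L)"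
    if h: "splits g\<theta> h0 h1" and v: "0 < v" "v \<le> T" for h0 h1 v x z
  proof -
    have 1: "h0 \<in> borel_measurable borel"
      using h by (auto simp: splits_def Cb0_def intro: borel_measurable_continuous_onI)
    have 2: "\<And>y. \<bar>h0 y\<bar> \<le> sup_norm h0"
      using h Cb0_abs_le_sup_norm by (auto simp: splits_def)
    \<comment> \<open>The function g1 joins the Lipschitz half of the splitting, so its constant L
      is simply added.\<close>
    have 3: "(lip_norm h1 + L)-lipschitz_on UNIV (\<lambda>y. h1 y + g1 y)"
      using h by (intro lipschitz_on_add g1 Lip0_lip_norm) (auto simp: splits_def)
    have f: "(\<lambda>y. h0 (exp (y - T / 2)) + (h1 (exp (y - T / 2)) + g1 (exp (y - T / 2)))) = pay"
      using h by (auto simp: pay_def splits_def fun_eq_iff)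
    have N: "sup_norm h0 + sqrt v * exp x * (lip_norm h1 + L) =
        sup_norm h0 + (sqrt v * exp x) * lip_norm h1 + (sqrt v * exp x) * L"
      by (simp add: distrib_left)
    show ?thesis
      using b [OF 1 2 3 v, of x z, unfolded Let_def f N] by (simp add: mult_ac)
  qed
  show ?thesis
  proof (rule exI [of _ C], rule exI [of _ c], intro conjI allI impI Cc)
    fix v x z :: real assume v: "0 < v" "v \<le> T"
    note K = K_functional_ge [OF g\<theta>_splits, of "sqrt v * exp x" _ _ "(sqrt v * exp x) * L"]
    show "\<bar>heat1 v pay x\<bar> \<le> C / sqrt v * KK (sqrt v * exp x)"
      unfolding KK_def by (rule K) (use v Cc s in auto)
    show "\<bar>heat2 v pay x\<bar> \<le> C / v * KK (sqrt v * exp x)"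
      unfolding KK_def by (rule K) (use v Cc s in auto)
    show "\<bar>pay (x + sqrt v * z) - heat v pay x\<bar> \<le> C * exp (c * \<bar>z\<bar>) * KK (sqrt v * exp x)"
      unfolding KK_def by (rule K) (use v Cc s in auto)
  qed
qed

text \<open>Before maturity: the step length times the bound \<open>KK / (T - t)\<close> for the
  second derivative. That bound explodes on the interval ending at T, where the oscillation of the
  payoff around its mean takes its place.\<close>

definition coef :: "real \<Rightarrow> real \<Rightarrow> real \<Rightarrow> real" where
  "coef s t y = (if t < T then (t - s) / (T - t) * KK (sqrt (T - t) * exp y) else KK (sqrt (T - s) * exp y))"

lemma coef_nonneg: "s \<le> t \<Longrightarrow> t \<le> T \<Longrightarrow> 0 \<le> coef s t y"
  by (auto simp: coef_def intro!: mult_nonneg_nonneg divide_nonneg_pos KK_nonneg)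

lemma coef_exp_le: "s \<le> t \<Longrightarrow> t \<le> T \<Longrightarrow> coef s t y \<le> exp \<bar>y - x\<bar> * coef s t x"
  using KK_exp_le [of "sqrt (T - t)" y x] KK_exp_le [of "sqrt (T - s)" y x]
  by (auto simp: coef_def mult.left_commute intro!: divide_right_mono mult_left_mono)

lemma divide_sqrt_eq: "0 < v \<Longrightarrow> k / sqrt v = sqrt v * (k / v)"
proof -
  assume "0 < v"
  then have "v = sqrt v * sqrt v" "sqrt v \<noteq> 0" by simp_all
  then show ?thesis by (metis times_divide_times_eq divide_divide_eq_left mult.commute nonzero_mult_div_cancel_left times_divide_eq_right)
qed

text \<open>By \<open>KK_scale\<close> the quotient \<open>KK u / u\<close> decreases. This bounds
  the Delta at the start of a step through the quantity at its end, in which \<open>coef\<close> is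
  expressed.\<close>

lemma heat_quotient_le:
  assumes "0 < v" "v \<le> w"
  shows "KK (sqrt w * exp y) / sqrt w \<le> KK (sqrt v * exp y) / sqrt v"
proof -
  have "sqrt w * exp y = (sqrt w / sqrt v) * (sqrt v * exp y)" using assms by simp
  moreover have "1 \<le> sqrt w / sqrt v" using assms by simp
  ultimately have "KK (sqrt w * exp y) \<le> (sqrt w / sqrt v) * KK (sqrt v * exp y)"
    using KK_scale [of "sqrt v * exp y" "sqrt w / sqrt v"] assms by simp
  then show ?thesis using assms by (simp add: field_simps)
qed

text \<open>For t < T the flow at time t is smooth and \<open>delta_hedge_remainder\<close> applies.
  At t = T the payoff is compared with its mean, and the hedge is harmless because a Delta of size
  KK / sqrt h meets a price increment of order sqrt h.\<close>

lemma one_step_error: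
  "\<exists>C c. 0 \<le> C \<and> 0 \<le> c \<and> (\<forall>s t y z. 0 \<le> s \<longrightarrow> s < t \<longrightarrow> t \<le> T \<longrightarrow>
     \<bar>heat (T - t) pay (y + sqrt (t - s) * z) - heat (T - s) pay y
       - heat1 (T - s) pay y * (exp (sqrt (t - s) * z - (t - s) / 2) - 1)\<bar> \<le> C * coef s t y * exp (c * \<bar>z\<bar>))"
proof (rule delta_hedge_remainder [OF T])
  fix C1 c1 assume C1: "0 \<le> C1" "0 \<le> c1" and rem: "\<And>w w1 w2 B h x z.
    growth w \<Longrightarrow> (\<And>y. (w has_real_derivative w1 y) (at y)) \<Longrightarrow> (\<And>y. (w1 has_real_derivative w2 y) (at y)) \<Longrightarrow>
    (\<And>y. \<bar>w2 y\<bar> \<le> B * exp \<bar>y - x\<bar>) \<Longrightarrow> 0 < h \<Longrightarrow> h \<le> T \<Longrightarrow>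
    \<bar>w (x + sqrt h * z) - heat h w x - heat1 h w x * (exp (sqrt h * z - h / 2) - 1)\<bar>
      \<le> C1 * h * (B + \<bar>heat1 h w x\<bar>) * exp (c1 * \<bar>z\<bar>)"
  obtain C c where C: "0 \<le> C" "0 \<le> c" and b: "\<And>v x z. 0 < v \<Longrightarrow> v \<le> T \<Longrightarrow>
     \<bar>heat1 v pay x\<bar> \<le> C / sqrt v * KK (sqrt v * exp x) \<and>
     \<bar>heat2 v pay x\<bar> \<le> C / v * KK (sqrt v * exp x) \<and>
     \<bar>pay (x + sqrt v * z) - heat v pay x\<bar> \<le> C * exp (c * \<bar>z\<bar>) * KK (sqrt v * exp x)"
    using pay_bounds by blast
  \<comment> \<open>Majorant for the terminal step: oscillation of the payoff plus Delta times the
    price increment, after sqrt h has cancelled.\<close>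
  define Q where "Q z = exp (c * \<bar>z\<bar>) + (\<bar>z\<bar> + sqrt T) * (exp (sqrt T * \<bar>z\<bar>) * exp T)" for z
  have "growth Q" unfolding Q_def [abs_def] by (intro growth_intros)
  then obtain C2 c2 where C2: "0 \<le> C2" "0 \<le> c2" "\<And>z. \<bar>Q z\<bar> \<le> C2 * exp (c2 * \<bar>z\<bar>)" using growthE by blast
  define D where "D = C1 * (C + C * sqrt T) + C * C2"
  have D: "0 \<le> C1 * (C + C * sqrt T)" "0 \<le> C * C2" using C C1 C2 T by auto
  show ?thesis
  proof (rule exI [of _ D], rule exI [of _ "c1 + c2"], intro conjI allI impI)
    fix s t y z assume st: "0 \<le> s" "s < t" "t \<le> T"
    let ?h = "t - s"
    let ?e = "heat (T - t) pay (y + sqrt ?h * z) - heat (T - s) pay y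
       - heat1 (T - s) pay y * (exp (sqrt ?h * z - ?h / 2) - 1)"
    have e: "exp (c1 * \<bar>z\<bar>) \<le> exp ((c1 + c2) * \<bar>z\<bar>)" "exp (c2 * \<bar>z\<bar>) \<le> exp ((c1 + c2) * \<bar>z\<bar>)"
      using C1 C2 by (auto intro!: mult_right_mono)
    have c0: "0 \<le> coef s t y" using st by (intro coef_nonneg) auto
    show "\<bar>?e\<bar> \<le> D * coef s t y * exp ((c1 + c2) * \<bar>z\<bar>)"
    proof (cases "t < T")
      case True
      let ?v = "T - t" and ?w = "T - s"
      let ?k = "KK (sqrt ?v * exp y) / ?v"
      have v: "0 < ?v" "?v \<le> T" "0 < ?w" "?w \<le> T" "?v \<le> ?w" using True st by auto
      have k0: "0 \<le> ?k" using v by (intro divide_nonneg_pos KK_nonneg) auto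
      have hw: "heat ?h (heat ?v pay) y = heat ?w pay y" "heat1 ?h (heat ?v pay) y = heat1 ?w pay y"
        using st v heat_heat [OF growth_pay, of ?h ?v y] heat1_heat [OF growth_pay, of ?h ?v y] by auto
      have 1: "\<bar>?e\<bar> \<le> C1 * ?h * (C * ?k + \<bar>heat1 ?h (heat ?v pay) y\<bar>) * exp (c1 * \<bar>z\<bar>)"
        unfolding hw [symmetric]
      proof (rule rem [OF growth_heat [OF growth_pay]])
        show "(heat ?v pay has_real_derivative heat1 ?v pay x) (at x)"
          "(heat1 ?v pay has_real_derivative heat2 ?v pay x) (at x)" for x
          using heat_has_derivative [OF growth_pay] v by auto
        fix x
        have "\<bar>heat2 ?v pay x\<bar> \<le> C / ?v * KK (sqrt ?v * exp x)" using b v by blast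
        also have "\<dots> \<le> C / ?v * (exp \<bar>x - y\<bar> * KK (sqrt ?v * exp y))"
          using v C by (intro mult_left_mono KK_exp_le) auto
        finally show "\<bar>heat2 ?v pay x\<bar> \<le> (C * ?k) * exp \<bar>x - y\<bar>" by (simp add: mult_ac)
      qed (use st in auto)
      have 2: "\<bar>heat1 ?h (heat ?v pay) y\<bar> \<le> C * sqrt T * ?k"
      proof -
        have "\<bar>heat1 ?w pay y\<bar> \<le> C * (KK (sqrt ?w * exp y) / sqrt ?w)" using b v by simp
        also have "\<dots> \<le> C * (KK (sqrt ?v * exp y) / sqrt ?v)"
          using v C by (intro mult_left_mono heat_quotient_le) auto
        also have "KK (sqrt ?v * exp y) / sqrt ?v = sqrt ?v * ?k"
          using v by (intro divide_sqrt_eq) auto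
        also have "C * (sqrt ?v * ?k) \<le> C * (sqrt T * ?k)"
          using v C k0 by (intro mult_left_mono mult_right_mono) auto
        finally show ?thesis unfolding hw by (simp add: mult_ac)
      qed
      have "\<bar>?e\<bar> \<le> C1 * ?h * (C * ?k + C * sqrt T * ?k) * exp (c1 * \<bar>z\<bar>)"
        by (rule order_trans [OF 1]) (use 2 C1 st in \<open>intro mult_right_mono mult_left_mono; simp\<close>)
      also have "C1 * ?h * (C * ?k + C * sqrt T * ?k) * exp (c1 * \<bar>z\<bar>) =
          (C1 * (C + C * sqrt T)) * coef s t y * exp (c1 * \<bar>z\<bar>)"
        using True by (simp add: coef_def distrib_left distrib_right add_divide_distrib mult_ac)
      also have "\<dots> \<le> D * coef s t y * exp ((c1 + c2) * \<bar>z\<bar>)"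
        unfolding D_def using D c0 e by (intro mult_mono mult_nonneg_nonneg) auto
      finally show ?thesis .
    next
      case False
      then have t: "t = T" using st by simp
      have h: "0 < ?h" "?h \<le> T" using st by auto
      let ?N = "KK (sqrt ?h * exp y)" and ?d = "sqrt ?h * z - ?h / 2"
      have N0: "0 \<le> ?N" using h by (intro KK_nonneg) auto
      have 1: "\<bar>pay (y + sqrt ?h * z) - heat ?h pay y\<bar> \<le> C * exp (c * \<bar>z\<bar>) * ?N"
        "\<bar>heat1 ?h pay y\<bar> \<le> C / sqrt ?h * ?N" using b h by auto
      have sz: "\<bar>sqrt ?h * z\<bar> \<le> sqrt T * \<bar>z\<bar>" using h by (simp add: abs_mult mult_right_mono)
      have hh: "?h \<le> sqrt ?h * sqrt T"
        using h mult_left_mono [of "sqrt ?h" "sqrt T" "sqrt ?h"] by simp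
      have d1: "\<bar>?d\<bar> \<le> sqrt ?h * (\<bar>z\<bar> + sqrt T)"
      proof -
        have "\<bar>?d\<bar> \<le> \<bar>sqrt ?h * z\<bar> + \<bar>?h / 2\<bar>" by (rule abs_triangle_ineq4)
        also have "\<dots> \<le> sqrt ?h * \<bar>z\<bar> + sqrt ?h * sqrt T"
          using h hh by (intro add_mono) (simp_all add: abs_mult)
        finally show ?thesis by (simp add: distrib_left)
      qed
      have d2: "\<bar>?d\<bar> \<le> sqrt T * \<bar>z\<bar> + T"
      proof -
        have "\<bar>?d\<bar> \<le> \<bar>sqrt ?h * z\<bar> + \<bar>?h / 2\<bar>" by (rule abs_triangle_ineq4)
        also have "\<dots> \<le> sqrt T * \<bar>z\<bar> + T"
          using h sz by (intro add_mono) auto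
        finally show ?thesis .
      qed
      have "\<bar>exp ?d - 1\<bar> \<le> \<bar>?d\<bar> * exp \<bar>?d\<bar>" by (rule exp_bound_1)
      also have "\<dots> \<le> (sqrt ?h * (\<bar>z\<bar> + sqrt T)) * exp (sqrt T * \<bar>z\<bar> + T)"
        using d1 d2 by (intro mult_mono) auto
      finally have "\<bar>heat1 ?h pay y\<bar> * \<bar>exp ?d - 1\<bar> \<le>
          (C / sqrt ?h * ?N) * ((sqrt ?h * (\<bar>z\<bar> + sqrt T)) * exp (sqrt T * \<bar>z\<bar> + T))"
        using 1 C N0 h by (intro mult_mono) auto
      also have "\<dots> = C * ?N * ((\<bar>z\<bar> + sqrt T) * (exp (sqrt T * \<bar>z\<bar>) * exp T))"
        using h by (simp add: exp_add)
      finally have 2: "\<bar>heat1 ?h pay y * (exp ?d - 1)\<bar> \<le> C * ?N * ((\<bar>z\<bar> + sqrt T) * (exp (sqrt T * \<bar>z\<bar>) * exp T))"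
        by (simp add: abs_mult)
      have "\<bar>?e\<bar> \<le> C * exp (c * \<bar>z\<bar>) * ?N + C * ?N * ((\<bar>z\<bar> + sqrt T) * (exp (sqrt T * \<bar>z\<bar>) * exp T))"
        using 1(1) 2 t by simp
      also have "\<dots> = C * ?N * Q z" by (simp add: Q_def algebra_simps)
      also have "\<dots> \<le> C * ?N * (C2 * exp (c2 * \<bar>z\<bar>))"
        using C2(3) [of z] C N0 by (intro mult_left_mono) auto
      also have "\<dots> = (C * C2) * coef s t y * exp (c2 * \<bar>z\<bar>)"
        using t by (simp add: coef_def mult_ac)
      also have "\<dots> \<le> D * coef s t y * exp ((c1 + c2) * \<bar>z\<bar>)"
        unfolding D_def using D c0 e by (intro mult_mono mult_nonneg_nonneg) auto
      finally show ?thesis .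
    qed
  qed (use D C1 C2 in \<open>auto simp: D_def\<close>)
qed

end

subsection \<open>The time-net\<close>

lemma theta_net_remaining: "T - theta_net T \<theta> n i = T * (1 - real i / real n) powr (1 / \<theta>)"
  by (simp add: theta_net_def)

text \<open>Since i + 2 \<le> n, a full cell remains after the step, so the remaining fraction is at
  most halved. In the last step it drops to 0 and no such ratio exists.\<close>

lemma net_ratio: "Suc i < n \<Longrightarrow> 1 - real i / real n \<le> 2 * (1 - real (Suc i) / real n)"
proof -
  assume "Suc i < n"
  then have "(real i + 2) / real n \<le> 1" by (simp add: of_nat_less_iff [symmetric] del: of_nat_less_iff)
  then show ?thesis by (simp add: add_divide_distrib)
qed

context hedging_payoff
begin

text \<open>The square root of the time left to maturity (\<open>sqrt_remaining\<close>), the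
  variable in which the net meets the K-functional.\<close>

definition net_root :: "nat \<Rightarrow> nat \<Rightarrow> real" where
  "net_root n i = sqrt T * (1 - real i / real n) powr (1 / (2 * \<theta>))"

lemma sqrt_remaining:
  assumes "i \<le> n" "0 < n"
  shows "sqrt (T - theta_net T \<theta> n i) = net_root n i"
proof -
  have a: "0 \<le> 1 - real i / real n" using assms by simp
  have "sqrt ((1 - real i / real n) powr (1 / \<theta>)) = ((1 - real i / real n) powr (1 / \<theta>)) powr (1 / 2)"
    by (simp add: powr_half_sqrt)
  also have "\<dots> = (1 - real i / real n) powr (1 / (2 * \<theta>))"
    by (simp add: powr_powr mult.commute)
  finally show ?thesis by (simp add: theta_net_remaining net_root_def real_sqrt_mult)
qed

lemma root_pos: "i < n \<Longrightarrow> 0 < net_root n i"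
  using T by (simp add: net_root_def)

lemma remaining_eq:
  assumes "i \<le> n" "0 < n" shows "T - theta_net T \<theta> n i = (net_root n i)\<^sup>2"
proof -
  have "0 \<le> T - theta_net T \<theta> n i" using T by (simp add: theta_net_remaining)
  then show ?thesis using sqrt_remaining [OF assms] by (metis real_sqrt_pow2)
qed

lemma root_anti:
  assumes "i < j" "j \<le> n" shows "net_root n j < net_root n i"
proof -
  have "0 < n" using assms by linarith
  then have "real i / real n < real j / real n" "real j / real n \<le> 1"
    using assms by (simp_all add: divide_strict_right_mono)
  then show ?thesis using T \<theta> unfolding net_root_def by (intro mult_strict_left_mono powr_less_mono2) auto
qed

lemma theta_net_mono: "i < j \<Longrightarrow> j \<le> n \<Longrightarrow> theta_net T \<theta> n i < theta_net T \<theta> n j"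
  using root_anti [of i j n] remaining_eq [of i n] remaining_eq [of j n] root_pos [of i n]
    power_strict_mono [of "net_root n j" "net_root n i" 2] T
  by (simp add: net_root_def)

lemma theta_net_0 [simp]: "theta_net T \<theta> n 0 = 0"
  by (simp add: theta_net_def)

lemma theta_net_n [simp]: "0 < n \<Longrightarrow> theta_net T \<theta> n n = T"
  using \<theta> by (simp add: theta_net_def)

text \<open>The mean value theorem gives an increment of order \<open>a powr (q - 1) / n\<close>.
  The identity \<open>q * (1 - 2 * \<theta>) = q - 1\<close> for
  \<open>q = 1 / (2 * \<theta>)\<close> turns this power of a into the power 1 - 2 \<theta> of the
  root; it is what singles out the exponent of the net.\<close>

lemma root_step:
  "\<exists>D\<ge>0. \<forall>n i. Suc i < n \<longrightarrow> net_root n i - net_root n (Suc i) \<le> D / real n * net_root n i powr (1 - 2 * \<theta>)"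
proof -
  define q where "q = 1 / (2 * \<theta>)"
  have q: "0 < q" "q * (1 - 2 * \<theta>) = q - 1" using \<theta> by (simp_all add: q_def field_simps)
  define D where "D = sqrt T * q * 2 powr \<bar>q - 1\<bar> / sqrt T powr (1 - 2 * \<theta>)"
  show ?thesis
  proof (intro exI [of _ D] conjI allI impI)
    show "0 \<le> D" using T q by (simp add: D_def)
    fix n i :: nat assume i: "Suc i < n"
    define a where "a = 1 - real i / real n"
    define b where "b = 1 - real (Suc i) / real n"
    have ab: "0 < b" "b < a" "a \<le> 2 * b" "a - b = 1 / real n"
    proof -
      have n: "0 < real n" "real i + 1 < real n" "real i + 2 \<le> real n" using i by linarith+
      show "0 < b" "b < a" "a - b = 1 / real n" using n by (simp_all add: a_def b_def field_simps)
      show "a \<le> 2 * b" using net_ratio [OF i] by (simp only: a_def b_def)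
    qed
    obtain \<xi> where \<xi>: "a / 2 \<le> \<xi>" "\<xi> \<le> a" "a powr q - b powr q = q * \<xi> powr (q - 1) * (a - b)"
      using powr_increment [OF ab(1-3), of q] by auto
    have V: "net_root n i = sqrt T * a powr q" "net_root n (Suc i) = sqrt T * b powr q"
      by (simp_all add: net_root_def a_def b_def q_def)
    have a0: "0 < a" using ab by linarith
    have ap: "net_root n i powr (1 - 2 * \<theta>) = sqrt T powr (1 - 2 * \<theta>) * a powr (q - 1)"
      unfolding V using T a0 by (simp add: powr_mult powr_powr q(2))
    have "net_root n i - net_root n (Suc i) = sqrt T * (q * \<xi> powr (q - 1) * (1 / real n))"
      unfolding V right_diff_distrib [symmetric] \<xi>(3) ab(4) ..
    also have "\<dots> \<le> sqrt T * (q * (2 powr \<bar>q - 1\<bar> * a powr (q - 1)) * (1 / real n))"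
      using powr_comparable(1) [OF a0 \<xi>(1,2), of "q - 1"] q T
      by (intro mult_left_mono mult_right_mono) auto
    also have "\<dots> = D / real n * net_root n i powr (1 - 2 * \<theta>)"
      unfolding ap D_def using T by simp
    finally show "net_root n i - net_root n (Suc i) \<le> D / real n * net_root n i powr (1 - 2 * \<theta>)" .
  qed
qed

lemma root_ratio: "Suc i < n \<Longrightarrow> net_root n i \<le> 2 powr (1 / (2 * \<theta>)) * net_root n (Suc i)"
proof -
  assume i: "Suc i < n"
  then have "1 - real i / real n \<le> 2 * (1 - real (Suc i) / real n)" "0 \<le> 1 - real i / real n"
    using net_ratio by simp_all
  then have "(1 - real i / real n) powr (1 / (2 * \<theta>)) \<le> (2 * (1 - real (Suc i) / real n)) powr (1 / (2 * \<theta>))"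
    using \<theta> by (intro powr_mono2) auto
  also have "\<dots> = 2 powr (1 / (2 * \<theta>)) * (1 - real (Suc i) / real n) powr (1 / (2 * \<theta>))"
    by (rule powr_mult) 
  finally show ?thesis unfolding net_root_def using mult_left_mono [of _ _ "sqrt T"] T by fastforce
qed

lemma KK_sq_le: "(KK v)\<^sup>2 \<le> 2 * (K_functional v g\<theta>)\<^sup>2 + 2 * (v * L)\<^sup>2"
  using sum_squares_bound [of "K_functional v g\<theta>" "v * L"] by (simp add: KK_def power2_sum)

lemma coef_sq_le:
  "\<exists>D\<ge>0. \<forall>n i x. Suc i < n \<longrightarrow> (coef (theta_net T \<theta> n i) (theta_net T \<theta> n (Suc i)) x)\<^sup>2 \<le>
     D / real n * ((net_root n i - net_root n (Suc i)) * net_root n i powr (- 2 * \<theta> - 1)) * (KK (net_root n (Suc i) * exp x))\<^sup>2"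
proof -
  obtain D1 where D1: "0 \<le> D1" "\<And>n i. Suc i < n \<Longrightarrow> net_root n i - net_root n (Suc i) \<le> D1 / real n * net_root n i powr (1 - 2 * \<theta>)"
    using root_step by blast
  \<comment> \<open>The ratio bound for consecutive roots. The relative step is at most 2 k^2 times
    \<open>(?V - ?v) / ?V\<close>, and its square gives the factor 4 k^4.\<close>
  define k where "k = 2 powr (1 / (2 * \<theta>))"
  show ?thesis
  proof (intro exI [of _ "4 * k ^ 4 * D1"] conjI allI impI)
    show "0 \<le> 4 * k ^ 4 * D1" using D1 by simp
    fix n i :: nat and x assume i: "Suc i < n"
    let ?V = "net_root n i" and ?v = "net_root n (Suc i)"
    let ?K = "KK (?v * exp x)"
    have V: "0 < ?v" "?v < ?V" "?V \<le> k * ?v"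
      using root_pos [OF i] root_anti [of i "Suc i" n] root_ratio [OF i] i by (auto simp: k_def)
    have n0: "0 < n" "i \<le> n" "Suc i \<le> n" "i < n" using i by auto
    have t: "T - theta_net T \<theta> n (Suc i) = ?v\<^sup>2" "T - theta_net T \<theta> n i = ?V\<^sup>2"
      using remaining_eq n0 by auto
    then have "theta_net T \<theta> n (Suc i) < T" using V(1) zero_less_power [of ?v 2] by linarith
    moreover have "theta_net T \<theta> n (Suc i) - theta_net T \<theta> n i = ?V\<^sup>2 - ?v\<^sup>2" using t by linarith
    ultimately have c: "coef (theta_net T \<theta> n i) (theta_net T \<theta> n (Suc i)) x = (?V\<^sup>2 - ?v\<^sup>2) / ?v\<^sup>2 * ?K"
      using V(1) by (simp add: coef_def t)
    have "(?V\<^sup>2 - ?v\<^sup>2) / ?v\<^sup>2 \<le> 2 * k\<^sup>2 * (?V - ?v) / ?V"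
    proof -
      have "?V\<^sup>2 - ?v\<^sup>2 = (?V - ?v) * (?V + ?v)" by (simp add: power2_eq_square algebra_simps)
      also have "\<dots> \<le> (?V - ?v) * (2 * ?V)" using V by (intro mult_left_mono) auto
      finally have 1: "?V\<^sup>2 - ?v\<^sup>2 \<le> (?V - ?v) * (2 * ?V)" .
      have "?V * ?V \<le> (k * ?v) * (k * ?v)" using V by (intro mult_mono) auto
      then have 2: "?V * ?V \<le> k\<^sup>2 * ?v\<^sup>2" by (simp add: power2_eq_square mult_ac)
      have "(?V\<^sup>2 - ?v\<^sup>2) * ?V \<le> ((?V - ?v) * (2 * ?V)) * ?V"
        using V by (intro mult_right_mono [OF 1]) auto
      also have "\<dots> = (?V - ?v) * 2 * (?V * ?V)" by (simp only: mult_ac)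
      also have "\<dots> \<le> (?V - ?v) * 2 * (k\<^sup>2 * ?v\<^sup>2)"
        using 2 V by (intro mult_left_mono) auto
      finally show ?thesis using V by (simp add: field_simps)
    qed
    moreover have "0 \<le> (?V\<^sup>2 - ?v\<^sup>2) / ?v\<^sup>2" using V power_mono [of ?v ?V 2] by simp
    ultimately have "((?V\<^sup>2 - ?v\<^sup>2) / ?v\<^sup>2)\<^sup>2 \<le> (2 * k\<^sup>2 * (?V - ?v) / ?V)\<^sup>2" by (intro power_mono) auto
    also have "\<dots> = 4 * k ^ 4 * ((?V - ?v) * (?V - ?v) / ?V\<^sup>2)"
      by (simp add: power2_eq_square power4_eq_xxxx)
    also have "\<dots> \<le> 4 * k ^ 4 * ((?V - ?v) * (D1 / real n * ?V powr (1 - 2 * \<theta>)) / ?V\<^sup>2)"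
      using D1(2) [OF i] V by (intro mult_left_mono divide_right_mono) auto
    also have "\<dots> = (4 * k ^ 4 * D1) / real n * ((?V - ?v) * (?V powr (1 - 2 * \<theta>) / ?V\<^sup>2))" by simp
    also have "?V powr (1 - 2 * \<theta>) / ?V\<^sup>2 = ?V powr (- 2 * \<theta> - 1)"
    proof -
      have "?V powr (1 - 2 * \<theta>) / ?V powr 2 = ?V powr (1 - 2 * \<theta> - 2)"
        by (rule powr_diff [symmetric])
      also have "1 - 2 * \<theta> - 2 = - 2 * \<theta> - 1" by simp
      finally show ?thesis using V by simp
    qed
    finally show "(coef (theta_net T \<theta> n i) (theta_net T \<theta> n (Suc i)) x)\<^sup>2 \<le>
       (4 * k ^ 4 * D1) / real n * ((?V - ?v) * ?V powr (- 2 * \<theta> - 1)) * ?K\<^sup>2"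
      unfolding c power_mult_distrib by (intro mult_right_mono) auto
  qed
qed

text \<open>A lower sum with the single cell from u to 2 u. It is the embedding of the interpolation
  space with second index 2 into the one with second index infinity.\<close>

lemma K_functional_sq_le:
  "\<exists>J\<ge>0. \<forall>u>0. (K_functional u g\<theta>)\<^sup>2 \<le> J * u powr (2 * \<theta>)"
proof -
  obtain J where J: "0 \<le> J" "\<And>r N. (\<forall>i<N. 0 < r (Suc i) \<and> r (Suc i) \<le> r i) \<Longrightarrow>
     (\<Sum>i<N. (r i - r (Suc i)) * ((r i) powr (- 2 * \<theta> - 1) * (K_functional (r (Suc i)) g\<theta>)\<^sup>2)) \<le> J"
    using Hol2_lower_sum [OF g\<theta> \<theta>(1)] by blast
  show ?thesis
  proof (intro exI [of _ "J * 2 powr (2 * \<theta> + 1)"] conjI allI impI)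
    fix u :: real assume u: "0 < u"
    let ?k = "(K_functional u g\<theta>)\<^sup>2"
    have "(\<Sum>i<1. (2 * u / 2 ^ i - 2 * u / 2 ^ Suc i) *
        ((2 * u / 2 ^ i) powr (- 2 * \<theta> - 1) * (K_functional (2 * u / 2 ^ Suc i) g\<theta>)\<^sup>2)) \<le> J"
      by (rule J(2)) (use u in auto)
    then have 1: "u * ((2 * u) powr (- 2 * \<theta> - 1) * ?k) \<le> J" by simp
    have "(2 * u) powr (- 2 * \<theta> - 1) = 1 / (2 powr (2 * \<theta> + 1) * (u powr (2 * \<theta>) * u))"
    proof -
      have "- 2 * \<theta> - 1 = - (2 * \<theta> + 1)" by simp
      then have "(2 * u) powr (- 2 * \<theta> - 1) = 1 / (2 * u) powr (2 * \<theta> + 1)"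
        by (simp only: powr_minus_divide)
      also have "(2 * u) powr (2 * \<theta> + 1) = 2 powr (2 * \<theta> + 1) * u powr (2 * \<theta> + 1)"
        by (rule powr_mult)
      also have "u powr (2 * \<theta> + 1) = u powr (2 * \<theta>) * u"
        using u by (simp only: powr_add powr_one)
      finally show ?thesis .
    qed
    then have "?k / (2 powr (2 * \<theta> + 1) * u powr (2 * \<theta>)) \<le> J" using 1 u by simp
    moreover have "0 < 2 powr (2 * \<theta> + 1) * u powr (2 * \<theta>)" using u by (intro mult_pos_pos) auto
    ultimately have "?k \<le> J * (2 powr (2 * \<theta> + 1) * u powr (2 * \<theta>))" by (simp only: pos_divide_le_eq)
    then show "?k \<le> J * 2 powr (2 * \<theta> + 1) * u powr (2 * \<theta>)" by (simp only: mult.assoc)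
  qed (use J in simp)
qed

text \<open>The time left before the last step is T / n powr (1 / \<theta>). Its power \<theta> is
  of order 1 / n, just enough for the interpolation part; for the Lipschitz part the time itself is
  at most T / n because \<theta> < 1.\<close>

lemma coef_last_sq_le:
  "\<exists>D\<ge>0. \<forall>n x. 0 < n \<longrightarrow> (coef (theta_net T \<theta> n (n - 1)) (theta_net T \<theta> n n) x)\<^sup>2 \<le>
     D / real n * (max (exp x) (exp (\<theta> * x)))\<^sup>2"
proof -
  obtain J where J: "0 \<le> J" "\<And>u. 0 < u \<Longrightarrow> (K_functional u g\<theta>)\<^sup>2 \<le> J * u powr (2 * \<theta>)"
    using K_functional_sq_le by blast
  define D where "D = 2 * (J * T powr \<theta>) + 2 * (T * L\<^sup>2)"
  show ?thesis
  proof (intro exI [of _ D] conjI allI impI)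
    show "0 \<le> D" using J T by (simp add: D_def)
    fix n :: nat and x assume n: "0 < n"
    let ?w = "max (exp x) (exp (\<theta> * x))"
    let ?V = "net_root n (n - 1)"
    have V0: "0 < ?V" using n by (intro root_pos) auto
    have a: "1 - real (n - 1) / real n = 1 / real n" using n by (simp add: field_simps of_nat_diff)
    have c: "coef (theta_net T \<theta> n (n - 1)) (theta_net T \<theta> n n) x = KK (?V * exp x)"
      using n sqrt_remaining [of "n - 1" n] by (simp add: coef_def)
    let ?u = "?V * exp x"
    have V\<theta>: "?V powr (2 * \<theta>) = T powr \<theta> / real n"
    proof -
      have "?V powr (2 * \<theta>) = sqrt T powr (2 * \<theta>) * ((1 / real n) powr (1 / (2 * \<theta>))) powr (2 * \<theta>)"
        unfolding net_root_def a by (rule powr_mult)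
      also have "sqrt T powr (2 * \<theta>) = T powr \<theta>"
        using T by (simp add: powr_half_sqrt [symmetric] powr_powr)
      also have "((1 / real n) powr (1 / (2 * \<theta>))) powr (2 * \<theta>) = 1 / real n"
        using \<theta> n by (simp add: powr_powr)
      finally show ?thesis by simp
    qed
    have "?u powr (2 * \<theta>) = T powr \<theta> / real n * (exp (\<theta> * x))\<^sup>2"
    proof -
      have "(exp x) powr (2 * \<theta>) = (exp (\<theta> * x))\<^sup>2"
        by (simp add: exp_powr_real exp_double [symmetric] mult_ac)
      then show ?thesis unfolding powr_mult V\<theta> by simp
    qed
    also have "\<dots> \<le> T powr \<theta> / real n * ?w\<^sup>2"
      by (intro mult_left_mono power_mono) auto
    finally have "J * ?u powr (2 * \<theta>) \<le> J * (T powr \<theta> / real n * ?w\<^sup>2)"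
      using J by (intro mult_left_mono) auto
    then have 3: "(K_functional ?u g\<theta>)\<^sup>2 \<le> (J * T powr \<theta>) / real n * ?w\<^sup>2"
      using J(2) [of ?u] V0 by simp
    have "?V\<^sup>2 \<le> T / real n"
    proof -
      have "?V\<^sup>2 = T * (1 / real n) powr (1 / \<theta>)"
        using remaining_eq [of "n - 1" n] n unfolding theta_net_remaining a by simp
      also have "\<dots> \<le> T * (1 / real n) powr 1"
        using T n \<theta> by (intro mult_left_mono powr_mono') auto
      finally show ?thesis using n by simp
    qed
    then have "(?V\<^sup>2 * L\<^sup>2) * (exp x)\<^sup>2 \<le> (T / real n * L\<^sup>2) * ?w\<^sup>2"
      using T L_nonneg by (intro mult_mono power_mono) auto
    then have 4: "(?u * L)\<^sup>2 \<le> (T * L\<^sup>2) / real n * ?w\<^sup>2"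
      by (simp add: power_mult_distrib mult_ac)
    have "(KK ?u)\<^sup>2 \<le> 2 * ((J * T powr \<theta>) / real n * ?w\<^sup>2) + 2 * ((T * L\<^sup>2) / real n * ?w\<^sup>2)"
      using KK_sq_le [of ?u] 3 4 by linarith
    also have "\<dots> = D / real n * ?w\<^sup>2" by (simp add: D_def add_divide_distrib distrib_right)
    finally show "(coef (theta_net T \<theta> n (n - 1)) (theta_net T \<theta> n n) x)\<^sup>2 \<le> D / real n * ?w\<^sup>2"
      unfolding c .
  qed
qed

text \<open>The state is absorbed by the nodes: the lower sum is taken over
  \<open>net_root n i * exp x\<close>, and homogeneity gives back exp (2 \<theta> x). The Lipschitz
  part is compared with a telescoping sum, and the last interval is added separately.\<close>

lemma coef_net_sum:
  "\<exists>D\<ge>0. \<forall>n x. 0 < n \<longrightarrow> (\<Sum>i<n. (coef (theta_net T \<theta> n i) (theta_net T \<theta> n (Suc i)) x)\<^sup>2) \<le>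
     D / real n * (max (exp x) (exp (\<theta> * x)))\<^sup>2"
proof -
  obtain J where J: "0 \<le> J" "\<And>r N. (\<forall>i<N. 0 < r (Suc i) \<and> r (Suc i) \<le> r i) \<Longrightarrow>
     (\<Sum>i<N. (r i - r (Suc i)) * ((r i) powr (- 2 * \<theta> - 1) * (K_functional (r (Suc i)) g\<theta>)\<^sup>2)) \<le> J"
    using Hol2_lower_sum [OF g\<theta> \<theta>(1)] by blast
  obtain D1 where D1: "0 \<le> D1" "\<And>n i x. Suc i < n \<Longrightarrow> (coef (theta_net T \<theta> n i) (theta_net T \<theta> n (Suc i)) x)\<^sup>2 \<le>
     D1 / real n * ((net_root n i - net_root n (Suc i)) * net_root n i powr (- 2 * \<theta> - 1)) * (KK (net_root n (Suc i) * exp x))\<^sup>2"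
    using coef_sq_le by blast
  obtain D2 where D2: "0 \<le> D2" "\<And>n x. 0 < n \<Longrightarrow> (coef (theta_net T \<theta> n (n - 1)) (theta_net T \<theta> n n) x)\<^sup>2 \<le>
     D2 / real n * (max (exp x) (exp (\<theta> * x)))\<^sup>2"
    using coef_last_sq_le by blast
  define k where "k = 2 powr (1 / (2 * \<theta>))"
  \<comment> \<open>For the Lipschitz part the sum imitates the integral of
    \<open>r powr (1 - 2 * \<theta>)\<close>, whose primitive is \<open>r powr p / p\<close>. It
    converges at 0 because \<theta> < 1.\<close>
  define p where "p = 2 - 2 * \<theta>"
  have p: "0 < p" using \<theta> by (simp add: p_def)
  have k1: "1 \<le> k" using \<theta> by (simp add: k_def ge_one_powr_ge_zero)
  define D3 where "D3 = k powr \<bar>p - 1\<bar> / p * sqrt T powr p"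
  define D where "D = D1 * (2 * J + 2 * (L\<^sup>2 * D3)) + D2"
  show ?thesis
  proof (intro exI [of _ D] conjI allI impI)
    show "0 \<le> D" using J D1 D2 p by (simp add: D_def D3_def)
    fix n :: nat and x assume n: "0 < n"
    then obtain m where m: "n = Suc m" by (cases n) auto
    let ?w = "max (exp x) (exp (\<theta> * x))"
    let ?V = "net_root n"
    let ?c = "\<lambda>i. (coef (theta_net T \<theta> n i) (theta_net T \<theta> n (Suc i)) x)\<^sup>2"
    have V: "0 < ?V (Suc i)" "?V (Suc i) < ?V i" if "i < m" for i
      using that root_pos [of "Suc i" n] root_anti [of i "Suc i" n] by (auto simp: m)
    define A where "A i = (?V i - ?V (Suc i)) * ?V i powr (- 2 * \<theta> - 1)" for i
    have A0: "0 \<le> A i" if "i < m" for i using V [OF that] by (simp add: A_def)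
    have S1: "(\<Sum>i<m. A i * (K_functional (?V (Suc i) * exp x) g\<theta>)\<^sup>2) \<le> ?w\<^sup>2 * J"
    proof -
      have "(\<Sum>i<m. (?V i * exp x - ?V (Suc i) * exp x) *
          ((?V i * exp x) powr (- 2 * \<theta> - 1) * (K_functional (?V (Suc i) * exp x) g\<theta>)\<^sup>2)) \<le> J"
        by (rule J(2)) (use V in \<open>auto intro: less_imp_le\<close>)
      also have "(\<Sum>i<m. (?V i * exp x - ?V (Suc i) * exp x) *
          ((?V i * exp x) powr (- 2 * \<theta> - 1) * (K_functional (?V (Suc i) * exp x) g\<theta>)\<^sup>2)) =
         (\<Sum>i<m. exp (- 2 * \<theta> * x) * (A i * (K_functional (?V (Suc i) * exp x) g\<theta>)\<^sup>2))"
      proof (intro sum.cong refl)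
        fix i
        have "exp x * (exp x) powr (- 2 * \<theta> - 1) = exp (- 2 * \<theta> * x)"
          by (simp add: exp_powr_real exp_add [symmetric] algebra_simps)
        moreover have "(?V i * exp x - ?V (Suc i) * exp x) *
          ((?V i * exp x) powr (- 2 * \<theta> - 1) * (K_functional (?V (Suc i) * exp x) g\<theta>)\<^sup>2) =
          (exp x * (exp x) powr (- 2 * \<theta> - 1)) * (A i * (K_functional (?V (Suc i) * exp x) g\<theta>)\<^sup>2)"
          unfolding powr_mult A_def left_diff_distrib [symmetric] by (simp only: mult_ac)
        ultimately show "(?V i * exp x - ?V (Suc i) * exp x) *
          ((?V i * exp x) powr (- 2 * \<theta> - 1) * (K_functional (?V (Suc i) * exp x) g\<theta>)\<^sup>2) =
          exp (- 2 * \<theta> * x) * (A i * (K_functional (?V (Suc i) * exp x) g\<theta>)\<^sup>2)"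
          by simp
      qed
      finally have "exp (- 2 * \<theta> * x) * (\<Sum>i<m. A i * (K_functional (?V (Suc i) * exp x) g\<theta>)\<^sup>2) \<le> J"
        by (simp only: sum_distrib_left)
      then have "(exp (\<theta> * x))\<^sup>2 * (exp (- 2 * \<theta> * x) * (\<Sum>i<m. A i * (K_functional (?V (Suc i) * exp x) g\<theta>)\<^sup>2)) \<le> (exp (\<theta> * x))\<^sup>2 * J"
        by (intro mult_left_mono) auto
      moreover have "(exp (\<theta> * x))\<^sup>2 * (exp (- 2 * \<theta> * x) * y) = y" for y
      proof -
        have "(exp (\<theta> * x))\<^sup>2 * exp (- 2 * \<theta> * x) = 1"
          by (simp add: power2_eq_square exp_add [symmetric])
        then show ?thesis by (simp only: mult.assoc [symmetric] mult_1_left)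
      qed
      moreover have "(exp (\<theta> * x))\<^sup>2 * J \<le> ?w\<^sup>2 * J"
        using J by (intro mult_right_mono power_mono) auto
      ultimately show ?thesis by (simp only:)
    qed
    have S2: "(\<Sum>i<m. A i * (?V (Suc i) * exp x * L)\<^sup>2) \<le> ?w\<^sup>2 * (L\<^sup>2 * D3)"
    proof -
      have le: "A i * (?V (Suc i))\<^sup>2 \<le> k powr \<bar>p - 1\<bar> / p * (?V i powr p - ?V (Suc i) powr p)" if i: "i < m" for i
      proof -
        have r: "?V i \<le> k * ?V (Suc i)" using root_ratio [of i n] i by (simp add: m k_def)
        obtain \<xi> where \<xi>: "?V i / k \<le> \<xi>" "\<xi> \<le> ?V i" "?V i powr p - ?V (Suc i) powr p = p * \<xi> powr (p - 1) * (?V i - ?V (Suc i))"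
          using powr_increment [OF V [OF i] r k1, of p] by auto
        have V0: "0 < ?V i" using V [OF i] by linarith
        have "A i * (?V (Suc i))\<^sup>2 \<le> A i * (?V i)\<^sup>2"
          using V [OF i] A0 [OF i] by (intro mult_left_mono power_mono) auto
        also have "\<dots> = (?V i - ?V (Suc i)) * (?V i powr (- 2 * \<theta> - 1) * ?V i powr 2)"
          using V0 by (simp add: A_def)
        also have "?V i powr (- 2 * \<theta> - 1) * ?V i powr 2 = ?V i powr (p - 1)"
          by (simp add: powr_add [symmetric] p_def)
        also have "(?V i - ?V (Suc i)) * ?V i powr (p - 1) \<le> (?V i - ?V (Suc i)) * (k powr \<bar>p - 1\<bar> * \<xi> powr (p - 1))"
          using powr_comparable(2) [OF V0 \<xi>(1,2) k1, of "p - 1"] V [OF i] by (intro mult_left_mono) auto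
        also have "\<dots> = k powr \<bar>p - 1\<bar> / p * (?V i powr p - ?V (Suc i) powr p)"
          unfolding \<xi>(3) using p by simp
        finally show ?thesis .
      qed
      have "(\<Sum>i<m. A i * (?V (Suc i))\<^sup>2) \<le> (\<Sum>i<m. k powr \<bar>p - 1\<bar> / p * (?V i powr p - ?V (Suc i) powr p))"
        using le by (intro sum_mono) auto
      also have "\<dots> = k powr \<bar>p - 1\<bar> / p * (?V 0 powr p - ?V m powr p)"
        by (simp only: sum_lessThan_telescope' [of "\<lambda>i. ?V i powr p" m, symmetric] sum_distrib_left)
      also have "\<dots> \<le> k powr \<bar>p - 1\<bar> / p * (?V 0 powr p)"
        using p by (intro mult_left_mono) auto
      also have "\<dots> = D3" by (simp add: D3_def net_root_def)
      finally have "(\<Sum>i<m. A i * (?V (Suc i))\<^sup>2) \<le> D3" .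
      then have "((exp x)\<^sup>2 * L\<^sup>2) * (\<Sum>i<m. A i * (?V (Suc i))\<^sup>2) \<le> (?w\<^sup>2 * L\<^sup>2) * D3"
        using A0 by (intro mult_mono power_mono mult_right_mono sum_nonneg mult_nonneg_nonneg) auto
      then show ?thesis by (simp add: sum_distrib_left power_mult_distrib mult_ac)
    qed
    have "(\<Sum>i<m. ?c i) \<le> (\<Sum>i<m. D1 / real n * (A i * (2 * (K_functional (?V (Suc i) * exp x) g\<theta>)\<^sup>2 + 2 * (?V (Suc i) * exp x * L)\<^sup>2)))"
    proof (intro sum_mono)
      fix i assume "i \<in> {..<m}"
      then have i: "i < m" by simp
      have "?c i \<le> D1 / real n * A i * (KK (?V (Suc i) * exp x))\<^sup>2"
        using D1(2) [of i n x] i unfolding A_def by (simp add: m)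
      also have "\<dots> \<le> D1 / real n * A i * (2 * (K_functional (?V (Suc i) * exp x) g\<theta>)\<^sup>2 + 2 * (?V (Suc i) * exp x * L)\<^sup>2)"
        using D1(1) A0 [OF i] by (intro mult_left_mono KK_sq_le) auto
      finally show "?c i \<le> D1 / real n * (A i * (2 * (K_functional (?V (Suc i) * exp x) g\<theta>)\<^sup>2 + 2 * (?V (Suc i) * exp x * L)\<^sup>2))"
        by (simp add: mult.assoc)
    qed
    also have "\<dots> = D1 / real n * (2 * (\<Sum>i<m. A i * (K_functional (?V (Suc i) * exp x) g\<theta>)\<^sup>2) + 2 * (\<Sum>i<m. A i * (?V (Suc i) * exp x * L)\<^sup>2))"
      unfolding sum_distrib_left sum.distrib [symmetric]
      by (intro sum.cong refl) (simp only: distrib_left mult.left_commute)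
    also have "\<dots> \<le> D1 / real n * (2 * (?w\<^sup>2 * J) + 2 * (?w\<^sup>2 * (L\<^sup>2 * D3)))"
      using S1 S2 D1(1) by (intro mult_left_mono add_mono) auto
    finally have "(\<Sum>i<m. ?c i) \<le> D1 / real n * (2 * (?w\<^sup>2 * J) + 2 * (?w\<^sup>2 * (L\<^sup>2 * D3)))" .
    moreover have "?c m \<le> D2 / real n * ?w\<^sup>2"
      using D2(2) [OF n, of x] by (simp add: m)
    ultimately have "(\<Sum>i<n. ?c i) \<le> D1 / real n * (2 * (?w\<^sup>2 * J) + 2 * (?w\<^sup>2 * (L\<^sup>2 * D3))) + D2 / real n * ?w\<^sup>2"
      by (simp add: m)
    also have "\<dots> = D / real n * ?w\<^sup>2"
      by (simp add: D_def add_divide_distrib distrib_left distrib_right mult_ac)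
    finally show "(\<Sum>i<n. ?c i) \<le> D / real n * ?w\<^sup>2" .
  qed
qed

end

subsection \<open>The augmented Brownian filtration\<close>

text \<open>The approximating points come from below, by rounding down. Used wherever continuity of
  paths reduces all times to countably many.\<close>

lemma dyadic_approx:
  assumes "0 \<le> r" "r \<le> s"
  shows "\<exists>j. (\<forall>k. j k \<le> 2 ^ k) \<and> (\<lambda>k. s * real (j k) / 2 ^ k) \<longlonglongrightarrow> r"
proof (cases "s = 0")
  case True
  then show ?thesis using assms by (intro exI [of _ "\<lambda>_. 0"]) auto
next
  case False
  then have s: "0 < s" using assms by simp
  define j where "j k = nat \<lfloor>r / s * 2 ^ k\<rfloor>" for k
  have rj: "real (j k) \<le> r / s * 2 ^ k" "r / s * 2 ^ k < real (j k) + 1" for k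
    using assms s by (simp_all add: j_def of_nat_nat)
  have 1: "j k \<le> 2 ^ k" for k
  proof -
    have "r / s * 2 ^ k \<le> real (2 ^ k)" using assms s by (simp add: field_simps)
    then have "real (j k) \<le> real (2 ^ k)" using rj(1) [of k] by (rule order_trans [rotated])
    then show ?thesis by (simp only: of_nat_le_iff)
  qed
  have "(\<lambda>k. s * real (j k) / 2 ^ k) \<longlonglongrightarrow> r"
  proof (rule tendsto_sandwich)
    show "(\<lambda>k. r - s * (1 / 2) ^ k) \<longlonglongrightarrow> r"
      by (auto intro!: tendsto_eq_intros LIMSEQ_power_zero)
    show "\<forall>\<^sub>F k in sequentially. r - s * (1 / 2) ^ k \<le> s * real (j k) / 2 ^ k"
    proof (intro always_eventually allI)
      fix k
      have "r < (s + s * real (j k)) / 2 ^ k"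
        using rj(2) [of k] s by (simp add: field_simps)
      then show "r - s * (1 / 2) ^ k \<le> s * real (j k) / 2 ^ k"
        by (simp add: add_divide_distrib power_one_over)
    qed
    show "\<forall>\<^sub>F k in sequentially. s * real (j k) / 2 ^ k \<le> r"
      using rj(1) s by (intro always_eventually allI) (auto simp: field_simps)
  qed auto
  then show ?thesis using 1 by blast
qed

lemma dyadic_mem:
  fixes a b :: real
  assumes "a \<le> b" "j \<le> 2 ^ k"
  shows "a + (b - a) * real j / 2 ^ k \<in> {a..b}"
proof -
  have "real j \<le> 2 ^ k" using assms(2) by (metis of_nat_le_iff of_nat_numeral of_nat_power)
  then have "(b - a) * real j \<le> (b - a) * 2 ^ k" using assms(1) by (intro mult_left_mono) auto
  then have "(b - a) * real j / 2 ^ k \<le> b - a" by (simp add: pos_divide_le_eq)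
  then show ?thesis using assms(1) by auto
qed

locale brownian = prob_space M for M :: "'a measure" +
  fixes W :: "real \<Rightarrow> 'a \<Rightarrow> real" and T :: real
  assumes T0: "0 < T" and complete: "complete_measure M" and bm: "std_brownian_motion M T W"
begin

abbreviation F :: "real \<Rightarrow> 'a measure" where "F \<equiv> augmented_filtration M W"

lemma W_measurable: "0 \<le> t \<Longrightarrow> t \<le> T \<Longrightarrow> W t \<in> borel_measurable M"
  using bm by (auto simp: std_brownian_motion_def)

lemma W_0: "\<omega> \<in> space M \<Longrightarrow> W 0 \<omega> = 0"
  using bm by (auto simp: std_brownian_motion_def)

lemma W_continuous: "\<omega> \<in> space M \<Longrightarrow> continuous_on {0..T} (\<lambda>t. W t \<omega>)"
  using bm by (auto simp: std_brownian_motion_def)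

lemma W_increment_normal: "0 \<le> s \<Longrightarrow> s < t \<Longrightarrow> t \<le> T \<Longrightarrow>
    distributed M lborel (\<lambda>\<omega>. W t \<omega> - W s \<omega>) (normal_density 0 (sqrt (t - s)))"
  using bm by (auto simp: std_brownian_motion_def)

lemma W_indep_increments: "0 \<le> r 0 \<Longrightarrow> (\<And>i. i < m \<Longrightarrow> r i \<le> r (Suc i)) \<Longrightarrow> r m \<le> T \<Longrightarrow>
    indep_vars (\<lambda>_. borel) (\<lambda>i \<omega>. W (r (Suc i)) \<omega> - W (r i) \<omega>) {..<m :: nat}"
  using bm by (auto simp: std_brownian_motion_def)

lemma filtration_generators:
  "{W s -` B \<inter> space M |s B. 0 \<le> s \<and> s \<le> t \<and> B \<in> sets borel} \<union> null_sets M \<subseteq> Pow (space M)"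
  using sets.sets_into_space by (auto simp: null_sets_def)

lemma space_F [simp]: "space (F t) = space M"
  unfolding augmented_filtration_def using filtration_generators by (rule space_measure_of)

lemma sets_F: "sets (F t) = sigma_sets (space M)
    ({W s -` B \<inter> space M |s B. 0 \<le> s \<and> s \<le> t \<and> B \<in> sets borel} \<union> null_sets M)"
  unfolding augmented_filtration_def using filtration_generators by (rule sets_measure_of)

lemma W_F_measurable: "0 \<le> s \<Longrightarrow> s \<le> t \<Longrightarrow> W s \<in> borel_measurable (F t)"
  by (rule measurableI) (auto simp: sets_F intro!: sigma_sets.Basic)

lemma F_mono: "s \<le> t \<Longrightarrow> sets (F s) \<subseteq> sets (F t)"
  unfolding sets_F by (rule sigma_sets_mono') fastforce

lemma F_subset: "t \<le> T \<Longrightarrow> sets (F t) \<subseteq> sets M"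
proof -
  assume t: "t \<le> T"
  have "{W s -` B \<inter> space M |s B. 0 \<le> s \<and> s \<le> t \<and> B \<in> sets borel} \<union> null_sets M \<subseteq> sets M"
    using W_measurable t by (auto simp: null_sets_def intro!: measurable_sets)
  then show ?thesis unfolding sets_F by (rule sets.sigma_sets_subset)
qed

lemma F_measurable_mono: "s \<le> t \<Longrightarrow> X \<in> borel_measurable (F s) \<Longrightarrow> X \<in> borel_measurable (F t)"
  using F_mono [of s t] by (auto simp: measurable_def)

lemma F_measurable: "t \<le> T \<Longrightarrow> X \<in> borel_measurable (F t) \<Longrightarrow> X \<in> borel_measurable M"
  using F_subset [of t] by (auto simp: measurable_def)

text \<open>Since the paths are continuous, the dyadic times in \<open>[0, s]\<close> generate the \<open>\<sigma>\<close>-algebra of the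
  past, and they do so through an increasing sequence of \<open>\<sigma>\<close>-algebras.\<close>

definition dyadic_past :: "real \<Rightarrow> nat \<Rightarrow> 'a set set" where
  "dyadic_past s k = sigma_sets (space M) {W (s * real j / 2 ^ k) -` B \<inter> space M |j B. j \<le> 2 ^ k \<and> B \<in> sets borel}"

lemma dyadic_past_mono: "k \<le> l \<Longrightarrow> dyadic_past s k \<subseteq> dyadic_past s l"
proof (rule lift_Suc_mono_le)
  fix k
  have "\<exists>i. s * real j / 2 ^ k = s * real i / 2 ^ Suc k \<and> i \<le> 2 ^ Suc k" if "j \<le> 2 ^ k" for j
    using that by (intro exI [of _ "2 * j"]) auto
  then show "dyadic_past s k \<subseteq> dyadic_past s (Suc k)"
    unfolding dyadic_past_def by (intro sigma_sets_mono') (safe, metis)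
qed

text \<open>At grid times W is a partial sum of increments, as it starts in 0. The past is therefore
  generated by the first N increments, and these are independent of the remaining one.\<close>

lemma dyadic_past_indep:
  assumes s: "0 \<le> s" "s < t" "t \<le> T" and a: "a \<in> dyadic_past s k" and B: "B \<in> sets borel"
  shows "a \<in> sets M"
    and "prob (a \<inter> ((\<lambda>\<omega>. W t \<omega> - W s \<omega>) -` B \<inter> space M)) = prob a * prob ((\<lambda>\<omega>. W t \<omega> - W s \<omega>) -` B \<inter> space M)"
proof -
  define N where "N = (2::nat) ^ k"
  \<comment> \<open>The dyadic grid of [0, s] with t appended as node N + 1, which makes W t - W s
    the increment of index N.\<close>
  define r where "r i = (if i \<le> N then s * real i / 2 ^ k else t)" for i
  define D where "D i \<omega> = W (r (Suc i)) \<omega> - W (r i) \<omega>" for i \<omega>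
  have N0: "0 < N" "real N = 2 ^ k" by (auto simp: N_def)
  have rN: "r N = s" "r (Suc N) = t" "r 0 = 0" using N0 by (auto simp: r_def)
  have r_mono: "r i \<le> r (Suc i)" if "i < Suc N" for i
  proof (cases "i = N")
    case False
    then show ?thesis using that s by (auto simp: r_def intro!: divide_right_mono mult_left_mono)
  qed (use rN s in auto)
  have ind: "indep_vars (\<lambda>_. borel) D {..<Suc N}"
    unfolding D_def [abs_def] by (rule W_indep_increments) (use rN r_mono s in auto)
  let ?P = "PiM {..<N} (\<lambda>_. borel :: real measure)"
  let ?D = "\<lambda>\<omega>. restrict (\<lambda>i. D i \<omega>) {..<N}"
  have iv: "indep_var ?P ?D (PiM {N} (\<lambda>_. borel)) (\<lambda>\<omega>. restrict (\<lambda>i. D i \<omega>) {N})"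
    by (rule indep_var_restrict [OF ind]) auto
  have D_meas: "?D \<in> measurable M ?P"
    using iv by (rule indep_var_rv1)
  \<comment> \<open>The events of the past are to be written as preimages under the vector of the
    first N increments; this \<sigma>-algebra consists of such preimages.\<close>
  let ?V = "vimage_algebra (space M) ?D ?P"
  have sp: "?D \<in> space M \<rightarrow> space ?P" using measurable_space [OF D_meas] by auto
  have DV: "D i \<in> borel_measurable ?V" if "i < N" for i
  proof -
    have "(\<lambda>\<omega>. (?D \<omega>) i) \<in> borel_measurable ?V"
      using that by (intro measurable_compose [OF measurable_vimage_algebra1 [OF sp]] measurable_component_singleton) auto
    then show ?thesis using that by simp
  qed
  have WV: "W (r j) \<in> borel_measurable ?V" if "j \<le> N" for j
  proof -
    have "(\<Sum>i<j. D i \<omega>) = W (r j) \<omega>" if "\<omega> \<in> space M" for \<omega>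
      unfolding D_def sum_lessThan_telescope [of "\<lambda>i. W (r i) \<omega>"] using W_0 that rN by simp
    moreover have "(\<lambda>\<omega>. \<Sum>i<j. D i \<omega>) \<in> borel_measurable ?V"
      using that DV by (intro borel_measurable_sum) auto
    ultimately show ?thesis
      using measurable_cong [of ?V "\<lambda>\<omega>. \<Sum>i<j. D i \<omega>" "W (r j)" borel] by simp
  qed
  have "{W (s * real j / 2 ^ k) -` B \<inter> space M |j B. j \<le> 2 ^ k \<and> B \<in> sets borel} \<subseteq> sets ?V"
  proof safe
    fix j :: nat and B :: "real set" assume "j \<le> 2 ^ k" "B \<in> sets borel"
    then show "W (s * real j / 2 ^ k) -` B \<inter> space M \<in> sets ?V"
      using measurable_sets [OF WV [of j], of B] by (auto simp: r_def N_def)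
  qed
  from sets.sigma_sets_subset [OF this] have "dyadic_past s k \<subseteq> sets ?V"
    unfolding dyadic_past_def by simp
  then have "a \<in> sets ?V" using a by auto
  then obtain A where A: "A \<in> sets ?P" "a = ?D -` A \<inter> space M"
    using sp by (auto simp: sets_vimage_algebra2)
  show "a \<in> sets M" unfolding A(2) using D_meas A(1) by (rule measurable_sets)
  let ?E = "\<lambda>\<omega>. restrict (\<lambda>i. D i \<omega>) {N}" and ?B = "{f \<in> space (PiM {N} (\<lambda>_. borel)). f N \<in> B}"
  have "?B \<in> sets (PiM {N} (\<lambda>_. borel))" using B by measurable
  moreover have "?E -` ?B \<inter> space M = (\<lambda>\<omega>. W t \<omega> - W s \<omega>) -` B \<inter> space M"
    by (auto simp: space_PiM D_def rN)
  moreover have "(\<lambda>\<omega>. (?D \<omega>, ?E \<omega>)) -` (A \<times> ?B) \<inter> space M = a \<inter> (?E -` ?B \<inter> space M)"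
    using A(2) by auto
  ultimately
  show "prob (a \<inter> ((\<lambda>\<omega>. W t \<omega> - W s \<omega>) -` B \<inter> space M)) = prob a * prob ((\<lambda>\<omega>. W t \<omega> - W s \<omega>) -` B \<inter> space M)"
    using indep_varD [OF iv A(1), of ?B] A(2) by simp
qed

text \<open>The dyadic pasts increase and null sets are independent of everything, so together they
  form an intersection-stable family independent of the increment. By continuity of the paths its
  generated \<sigma>-algebra contains the whole of F s.\<close>

lemma F_indep_increment:
  assumes s: "0 \<le> s" "s < t" "t \<le> T"
    and a': "a' \<in> sets (F s)" and B': "B' \<in> sets borel"
  shows "prob (a' \<inter> ((\<lambda>\<omega>. W t \<omega> - W s \<omega>) -` B' \<inter> space M)) = prob a' * prob ((\<lambda>\<omega>. W t \<omega> - W s \<omega>) -` B' \<inter> space M)"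
proof -
  let ?D = "\<lambda>\<omega>. W t \<omega> - W s \<omega>"
  let ?B = "{?D -` B \<inter> space M |B. B \<in> sets borel}"
  have D: "?D \<in> borel_measurable M" using s by (intro borel_measurable_diff W_measurable) auto
  define A where "A = (\<Union>k. dyadic_past s k) \<union> null_sets M"
  have ev: "A \<subseteq> events"
    using dyadic_past_indep(1) [OF s] by (auto simp: A_def null_sets_def)
  have A: "Int_stable A"
  proof (rule Int_stableI)
    fix a b assume a: "a \<in> A" and b: "b \<in> A"
    show "a \<inter> b \<in> A"
    proof (cases "a \<in> null_sets M \<or> b \<in> null_sets M")
      case True
      then have "a \<inter> b \<in> null_sets M" using a b ev by (auto intro: null_set_Int1 null_set_Int2)
      then show ?thesis by (simp add: A_def)
    next
      case False
      then obtain k l where "a \<in> dyadic_past s k" "b \<in> dyadic_past s l" using a b by (auto simp: A_def)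
      then have ab: "a \<in> dyadic_past s (max k l)" "b \<in> dyadic_past s (max k l)"
        using dyadic_past_mono [of k "max k l"] dyadic_past_mono [of l "max k l"] by auto
      interpret S: sigma_algebra "space M" "dyadic_past s (max k l)"
        unfolding dyadic_past_def by (rule sigma_algebra_sigma_sets) auto
      have "a \<inter> b \<in> dyadic_past s (max k l)" using ab by (rule S.Int)
      then show ?thesis by (auto simp: A_def)
    qed
  qed
  have B: "Int_stable ?B"
  proof (rule Int_stableI)
    fix a b assume "a \<in> ?B" "b \<in> ?B"
    then obtain B1 B2 where "B1 \<in> sets borel" "B2 \<in> sets borel" "a = ?D -` B1 \<inter> space M" "b = ?D -` B2 \<inter> space M"
      by blast
    then have "B1 \<inter> B2 \<in> sets borel" "a \<inter> b = ?D -` (B1 \<inter> B2) \<inter> space M" by auto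
    then show "a \<inter> b \<in> ?B" by blast
  qed
  have "indep_set A ?B"
  proof (rule indep_setI [OF ev])
    show "?B \<subseteq> events" using D by (auto intro: measurable_sets)
    fix a b assume a: "a \<in> A" and "b \<in> ?B"
    then obtain B where b: "b = ?D -` B \<inter> space M" "B \<in> sets borel" by auto
    show "prob (a \<inter> b) = prob a * prob b"
    proof (cases "a \<in> null_sets M")
      case True
      have "b \<in> events" using b D by (auto intro: measurable_sets)
      then have "a \<inter> b \<in> null_sets M" using True by (auto intro: null_set_Int2)
      then show ?thesis using True by (auto simp: measure_def null_sets_def)
    next
      case False
      then obtain k where "a \<in> dyadic_past s k" using a by (auto simp: A_def)
      then show ?thesis using dyadic_past_indep(2) [OF s _ b(2)] b(1) by simp
    qed
  qed
  then have ind: "indep_set (sigma_sets (space M) A) (sigma_sets (space M) ?B)"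
    using A B by (rule indep_set_sigma_sets)
  let ?S = "sigma (space M) A"
  have Apow: "A \<subseteq> Pow (space M)" using ev sets.sets_into_space by auto
  have spS [simp]: "space ?S = space M" using Apow by (rule space_measure_of)
  have setsS: "sets ?S = sigma_sets (space M) A" using Apow by (rule sets_measure_of)
  have grid: "W (s * real j / 2 ^ k) \<in> borel_measurable ?S" if "j \<le> 2 ^ k" for j k
  proof (rule measurableI)
    fix B :: "real set" assume "B \<in> sets borel"
    then have "W (s * real j / 2 ^ k) -` B \<inter> space M \<in> dyadic_past s k"
      unfolding dyadic_past_def using that by (intro sigma_sets.Basic) auto
    then have "W (s * real j / 2 ^ k) -` B \<inter> space M \<in> A" by (auto simp: A_def)
    then show "W (s * real j / 2 ^ k) -` B \<inter> space ?S \<in> sets ?S"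
      by (simp add: setsS sigma_sets.Basic)
  qed simp
  have W_S: "W r \<in> borel_measurable ?S" if r: "0 \<le> r" "r \<le> s" for r
  proof -
    obtain j where j: "\<And>k. j k \<le> 2 ^ k" "(\<lambda>k. s * real (j k) / 2 ^ k) \<longlonglongrightarrow> r"
      using dyadic_approx [OF r] by blast
    show ?thesis
    proof (rule borel_measurable_LIMSEQ_real)
      fix \<omega> assume "\<omega> \<in> space ?S"
      then have "\<omega> \<in> space M" by simp
      then have c: "continuous_on {0..T} (\<lambda>t. W t \<omega>)" by (rule W_continuous)
      have in_T: "s * real (j k) / 2 ^ k \<in> {0..T}" for k
      proof -
        have "real (j k) \<le> 2 ^ k" using j(1) [of k] by (metis of_nat_le_iff of_nat_numeral of_nat_power)
        then have "s * real (j k) / 2 ^ k \<le> s"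
          using s by (simp add: pos_divide_le_eq mult_left_mono)
        then show ?thesis using s by auto
      qed
      show "(\<lambda>k. W (s * real (j k) / 2 ^ k) \<omega>) \<longlonglongrightarrow> W r \<omega>"
        by (rule continuous_on_tendsto_compose [OF c j(2)]) (use r s in_T in auto)
    next
      show "W (s * real (j k) / 2 ^ k) \<in> borel_measurable ?S" for k
        using j(1) by (rule grid)
    qed
  qed
  have sub: "sets (F s) \<subseteq> sigma_sets (space M) A"
    unfolding sets_F
  proof (rule sigma_sets_mono, rule subsetI)
    fix c assume "c \<in> {W r -` B \<inter> space M |r B. 0 \<le> r \<and> r \<le> s \<and> B \<in> sets borel} \<union> null_sets M"
    then consider "c \<in> null_sets M" | r B where "0 \<le> r" "r \<le> s" "B \<in> sets borel" "c = W r -` B \<inter> space M"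
      by blast
    then show "c \<in> sigma_sets (space M) A"
    proof cases
      case 1 then show ?thesis by (intro sigma_sets.Basic) (simp add: A_def)
    next
      case 2 then show ?thesis using measurable_sets [OF W_S [of r], of B] by (simp add: setsS)
    qed
  qed
  show ?thesis
  proof (rule indep_setD [OF ind])
    show "a' \<in> sigma_sets (space M) A" using a' sub by auto
    show "?D -` B' \<inter> space M \<in> sigma_sets (space M) ?B" using B' by (intro sigma_sets.Basic) auto
  qed
qed

lemma measurable_F_id: "t \<le> T \<Longrightarrow> (\<lambda>\<omega>. \<omega>) \<in> measurable M (F t)"
  using F_subset [of t] by (auto simp: measurable_def Int_absorb2 dest: sets.sets_into_space)

lemma measurable_F_pair: "0 \<le> s \<Longrightarrow> s < t \<Longrightarrow> t \<le> T \<Longrightarrow>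
    (\<lambda>\<omega>. (\<omega>, W t \<omega> - W s \<omega>)) \<in> measurable M (F s \<Otimes>\<^sub>M borel)"
  by (intro measurable_Pair measurable_F_id borel_measurable_diff W_measurable) simp_all

text \<open>Independence written as a product law. The first coordinate is the sample point itself,
  seen through F s, so that arbitrary weights known at time s can be integrated jointly with the
  increment.\<close>

lemma distr_increment:
  assumes s: "0 \<le> s" "s < t" "t \<le> T"
  shows "distr M (F s \<Otimes>\<^sub>M borel) (\<lambda>\<omega>. (\<omega>, W t \<omega> - W s \<omega>)) =
    distr M (F s) (\<lambda>\<omega>. \<omega>) \<Otimes>\<^sub>M distr gauss borel (\<lambda>z. sqrt (t - s) * z)"
proof (rule pair_measure_eqI [symmetric])
  let ?D = "\<lambda>\<omega>. W t \<omega> - W s \<omega>"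
  interpret G: prob_space gauss by (rule prob_space_gauss)
  interpret N: prob_space "distr gauss borel (\<lambda>z. sqrt (t - s) * z)" by (rule G.prob_space_distr) simp
  have id [measurable]: "(\<lambda>\<omega>. \<omega>) \<in> measurable M (F s)" using s by (intro measurable_F_id) auto
  interpret R: prob_space "distr M (F s) (\<lambda>\<omega>. \<omega>)" by (rule prob_space_distr) simp
  show "sigma_finite_measure (distr M (F s) (\<lambda>\<omega>. \<omega>))" ..
  show "sigma_finite_measure (distr gauss borel (\<lambda>z. sqrt (t - s) * z))" ..
  have D: "?D \<in> borel_measurable M" using s by (intro borel_measurable_diff W_measurable) auto
  have distr: "distr gauss borel (\<lambda>z. sqrt (t - s) * z) = distr M borel ?D"
    by (rule gauss_distr_normal [OF prob_space_axioms W_increment_normal [OF s], symmetric]) (use s in simp)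
  show "sets (distr M (F s) (\<lambda>\<omega>. \<omega>) \<Otimes>\<^sub>M distr gauss borel (\<lambda>z. sqrt (t - s) * z)) =
      sets (distr M (F s \<Otimes>\<^sub>M borel) (\<lambda>\<omega>. (\<omega>, ?D \<omega>)))"
    unfolding sets_distr by (rule sets_pair_measure_cong) simp_all
  fix A B assume "A \<in> sets (distr M (F s) (\<lambda>\<omega>. \<omega>))" "B \<in> sets (distr gauss borel (\<lambda>z. sqrt (t - s) * z))"
  then have A: "A \<in> sets (F s)" and B: "B \<in> sets borel" by auto
  have AM: "A \<in> sets M" "A \<subseteq> space M" using A F_subset [of s] s sets.sets_into_space [OF A] by auto
  have "emeasure (distr M (F s) (\<lambda>\<omega>. \<omega>)) A = emeasure M A"
    using AM by (subst emeasure_distr [OF id A]) (simp add: vimage_def Int_absorb2)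
  moreover have "emeasure (distr gauss borel (\<lambda>z. sqrt (t - s) * z)) B = emeasure M (?D -` B \<inter> space M)"
    unfolding distr by (rule emeasure_distr [OF D B])
  moreover have "emeasure (distr M (F s \<Otimes>\<^sub>M borel) (\<lambda>\<omega>. (\<omega>, ?D \<omega>))) (A \<times> B) = emeasure M (A \<inter> (?D -` B \<inter> space M))"
    using A B measurable_F_pair [OF s] by (subst emeasure_distr) (auto intro!: arg_cong [where f = "emeasure M"])
  ultimately show "emeasure (distr M (F s) (\<lambda>\<omega>. \<omega>)) A * emeasure (distr gauss borel (\<lambda>z. sqrt (t - s) * z)) B =
      emeasure (distr M (F s \<Otimes>\<^sub>M borel) (\<lambda>\<omega>. (\<omega>, ?D \<omega>))) (A \<times> B)"
    using F_indep_increment [OF s A B] by (simp add: emeasure_eq_measure ennreal_mult')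
qed

text \<open>The freezing lemma: the past is held fixed and the increment replaced by an independent
  Gaussian variable. It does the work of conditional expectations given F s.\<close>

lemma integral_increment:
  fixes h :: "'a \<times> real \<Rightarrow> real"
  assumes s: "0 \<le> s" "s < t" "t \<le> T" and h [measurable]: "h \<in> borel_measurable (F s \<Otimes>\<^sub>M borel)"
    and int: "integrable M (\<lambda>\<omega>. h (\<omega>, W t \<omega> - W s \<omega>))"
  shows "(\<integral>\<omega>. h (\<omega>, W t \<omega> - W s \<omega>) \<partial>M) = (\<integral>\<omega>. (\<integral>z. h (\<omega>, sqrt (t - s) * z) \<partial>gauss) \<partial>M)"
proof -
  let ?N = "distr gauss borel (\<lambda>z. sqrt (t - s) * z)" and ?R = "distr M (F s) (\<lambda>\<omega>. \<omega>)"
  interpret G: prob_space gauss by (rule prob_space_gauss)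
  interpret N: prob_space ?N by (rule G.prob_space_distr) simp
  have id [measurable]: "(\<lambda>\<omega>. \<omega>) \<in> measurable M (F s)" using s by (intro measurable_F_id) auto
  interpret R: prob_space ?R by (rule prob_space_distr) simp
  interpret P: pair_sigma_finite ?R ?N ..
  have "integrable (?R \<Otimes>\<^sub>M ?N) h"
    unfolding distr_increment [OF s, symmetric]
    by (subst integrable_distr_eq) (use measurable_F_pair [OF s] int in auto)
  note int' = this
  have "(\<integral>\<omega>. h (\<omega>, W t \<omega> - W s \<omega>) \<partial>M) = (\<integral>p. h p \<partial>(?R \<Otimes>\<^sub>M ?N))"
    unfolding distr_increment [OF s, symmetric]
    by (rule integral_distr [symmetric]) (use measurable_F_pair [OF s] in auto)
  also have "\<dots> = (\<integral>\<omega>. (\<integral>z. h (\<omega>, z) \<partial>?N) \<partial>?R)"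
    by (rule P.integral_fst' [OF int', symmetric])
  also have "\<dots> = (\<integral>\<omega>. (\<integral>z. h (\<omega>, z) \<partial>?N) \<partial>M)"
    by (rule integral_distr) measurable
  also have "\<dots> = (\<integral>\<omega>. (\<integral>z. h (\<omega>, sqrt (t - s) * z) \<partial>gauss) \<partial>M)"
    using measurable_compose [OF measurable_Pair1' h] by (intro Bochner_Integration.integral_cong integral_distr) simp_all
  finally show ?thesis .
qed

end

subsection \<open>Random variables with all moments and martingale increments\<close>

context brownian
begin

text \<open>Variables with all moments form an algebra, so integrability of products and powers
  never requires matching exponents.\<close>

definition nice :: "('a \<Rightarrow> real) \<Rightarrow> bool" where
  "nice X \<longleftrightarrow> X \<in> borel_measurable M \<and> (\<forall>q::nat. integrable M (\<lambda>\<omega>. \<bar>X \<omega>\<bar> ^ q))"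

lemma nice_measurable: "nice X \<Longrightarrow> X \<in> borel_measurable M"
  by (simp add: nice_def)

lemma nice_integrable: "nice X \<Longrightarrow> integrable M X"
  using integrable_abs_cancel [of M X] by (auto simp: nice_def dest: spec [of _ 1])

lemma nice_bound:
  assumes "nice Y" "X \<in> borel_measurable M" "\<And>\<omega>. \<omega> \<in> space M \<Longrightarrow> \<bar>X \<omega>\<bar> \<le> \<bar>Y \<omega>\<bar>"
  shows "nice X"
  unfolding nice_def
proof (intro conjI allI)
  fix q :: nat
  show "integrable M (\<lambda>\<omega>. \<bar>X \<omega>\<bar> ^ q)"
  proof (rule Bochner_Integration.integrable_bound)
    show "integrable M (\<lambda>\<omega>. \<bar>Y \<omega>\<bar> ^ q)" using assms(1) by (simp add: nice_def)
    show "AE \<omega> in M. norm (\<bar>X \<omega>\<bar> ^ q) \<le> norm (\<bar>Y \<omega>\<bar> ^ q)"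
      using assms(3) by (intro AE_I2) (auto intro: power_mono)
  qed (use assms(2) in measurable)
qed fact

lemma nice_const [intro]: "nice (\<lambda>_. c)"
  by (simp add: nice_def)

lemma nice_mult [intro]:
  assumes "nice X" "nice Y" shows "nice (\<lambda>\<omega>. X \<omega> * Y \<omega>)"
  unfolding nice_def
proof (intro conjI allI)
  note [measurable] = assms [THEN nice_measurable]
  show "(\<lambda>\<omega>. X \<omega> * Y \<omega>) \<in> borel_measurable M" by measurable
  fix q :: nat
  show "integrable M (\<lambda>\<omega>. \<bar>X \<omega> * Y \<omega>\<bar> ^ q)"
  proof (rule Bochner_Integration.integrable_bound)
    show "integrable M (\<lambda>\<omega>. \<bar>X \<omega>\<bar> ^ (2 * q) + \<bar>Y \<omega>\<bar> ^ (2 * q))"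
      using assms by (auto simp: nice_def)
    show "AE \<omega> in M. norm (\<bar>X \<omega> * Y \<omega>\<bar> ^ q) \<le> norm (\<bar>X \<omega>\<bar> ^ (2 * q) + \<bar>Y \<omega>\<bar> ^ (2 * q))"
    proof (intro AE_I2)
      fix \<omega>
      define a where "a = \<bar>X \<omega>\<bar> ^ q"
      define b where "b = \<bar>Y \<omega>\<bar> ^ q"
      have ab: "0 \<le> a" "0 \<le> b" by (auto simp: a_def b_def)
      have "2 * (a * b) \<le> a * a + b * b" "0 \<le> a * b"
        using ab sum_squares_bound [of a b] by (simp_all add: power2_eq_square mult.assoc)
      then have "a * b \<le> a * a + b * b" by linarith
      moreover have "\<bar>X \<omega>\<bar> ^ (2 * q) = a * a" "\<bar>Y \<omega>\<bar> ^ (2 * q) = b * b" "\<bar>X \<omega> * Y \<omega>\<bar> ^ q = a * b"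
        by (simp_all add: a_def b_def mult_2 power_add abs_mult power_mult_distrib)
      ultimately show "norm (\<bar>X \<omega> * Y \<omega>\<bar> ^ q) \<le> norm (\<bar>X \<omega>\<bar> ^ (2 * q) + \<bar>Y \<omega>\<bar> ^ (2 * q))"
        using ab by simp
    qed
  qed measurable
qed

lemma nice_add [intro]:
  assumes "nice X" "nice Y" shows "nice (\<lambda>\<omega>. X \<omega> + Y \<omega>)"
  unfolding nice_def
proof (intro conjI allI)
  note [measurable] = assms [THEN nice_measurable]
  show "(\<lambda>\<omega>. X \<omega> + Y \<omega>) \<in> borel_measurable M" by measurable
  fix q :: nat
  show "integrable M (\<lambda>\<omega>. \<bar>X \<omega> + Y \<omega>\<bar> ^ q)"
  proof (rule Bochner_Integration.integrable_bound)
    show "integrable M (\<lambda>\<omega>. 2 ^ q * (\<bar>X \<omega>\<bar> ^ q + \<bar>Y \<omega>\<bar> ^ q))"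
      using assms by (auto simp: nice_def)
    show "AE \<omega> in M. norm (\<bar>X \<omega> + Y \<omega>\<bar> ^ q) \<le> norm (2 ^ q * (\<bar>X \<omega>\<bar> ^ q + \<bar>Y \<omega>\<bar> ^ q))"
    proof (intro AE_I2)
      fix \<omega>
      let ?m = "max \<bar>X \<omega>\<bar> \<bar>Y \<omega>\<bar>"
      have "\<bar>X \<omega> + Y \<omega>\<bar> \<le> 2 * ?m" by linarith
      then have "\<bar>X \<omega> + Y \<omega>\<bar> ^ q \<le> (2 * ?m) ^ q" by (intro power_mono) auto
      also have "\<dots> = 2 ^ q * ?m ^ q" by (rule power_mult_distrib)
      also have "?m ^ q \<le> \<bar>X \<omega>\<bar> ^ q + \<bar>Y \<omega>\<bar> ^ q" by (auto simp: max_def)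
      finally show "norm (\<bar>X \<omega> + Y \<omega>\<bar> ^ q) \<le> norm (2 ^ q * (\<bar>X \<omega>\<bar> ^ q + \<bar>Y \<omega>\<bar> ^ q))"
        by simp
    qed
  qed measurable
qed

lemma nice_minus [intro]: "nice X \<Longrightarrow> nice (\<lambda>\<omega>. - X \<omega>)"
  using nice_mult [OF nice_const [of "-1"], of X] by simp

lemma nice_diff [intro]: "nice X \<Longrightarrow> nice Y \<Longrightarrow> nice (\<lambda>\<omega>. X \<omega> - Y \<omega>)"
  using nice_add [of X "\<lambda>\<omega>. - Y \<omega>"] nice_minus [of Y] by simp

lemma nice_power [intro]: "nice X \<Longrightarrow> nice (\<lambda>\<omega>. X \<omega> ^ n)"
  by (induction n) auto

lemma nice_sum [intro]: "(\<And>i. i \<in> I \<Longrightarrow> nice (X i)) \<Longrightarrow> nice (\<lambda>\<omega>. \<Sum>i\<in>I. X i \<omega>)"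
  by (induction I rule: infinite_finite_induct) auto

lemma nice_indicator: "A \<in> sets M \<Longrightarrow> nice (indicator A)"
  by (rule nice_bound [of "\<lambda>_. 1"]) (auto simp: indicator_def)

section \<open>Functions of the Brownian motion at fixed times and martingale increments\<close>

lemma distr_W:
  assumes "0 < t" "t \<le> T"
  shows "distr M borel (W t) = distr gauss borel (\<lambda>z. sqrt t * z)"
proof -
  have "distributed M lborel (\<lambda>\<omega>. W t \<omega> - W 0 \<omega>) (normal_density 0 (sqrt (t - 0)))"
    by (rule W_increment_normal) (use assms in auto)
  then have "distr M borel (\<lambda>\<omega>. W t \<omega> - W 0 \<omega>) = distr gauss borel (\<lambda>z. sqrt (t - 0) * z)"
    by (rule gauss_distr_normal [OF prob_space_axioms]) (use assms in simp)
  moreover have "distr M borel (\<lambda>\<omega>. W t \<omega> - W 0 \<omega>) = distr M borel (W t)"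
    by (rule distr_cong) (auto simp: W_0)
  ultimately show ?thesis by simp
qed

lemma integral_W:
  assumes f: "growth f" and t: "0 \<le> t" "t \<le> T"
  shows "integrable M (\<lambda>\<omega>. f (W t \<omega>))" and "(\<integral>\<omega>. f (W t \<omega>) \<partial>M) = heat t f 0"
proof -
  note [measurable] = growth_measurable [OF f] W_measurable [OF t]
  have "integrable M (\<lambda>\<omega>. f (W t \<omega>)) \<and> (\<integral>\<omega>. f (W t \<omega>) \<partial>M) = heat t f 0"
  proof (cases "t = 0")
    case True
    then have "\<omega> \<in> space M \<Longrightarrow> f (W t \<omega>) = f 0" for \<omega> by (simp add: W_0)
    then show ?thesis
      using True by (simp cong: Bochner_Integration.integrable_cong Bochner_Integration.integral_cong add: prob_space)
  next
    case False
    then have D: "distr M borel (W t) = distr gauss borel (\<lambda>z. sqrt t * z)" using distr_W t by simp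
    have "integrable gauss (\<lambda>z. f (0 + sqrt t * z))" by (rule integrable_growth [OF growth_affine [OF f]])
    then have "integrable (distr gauss borel (\<lambda>z. sqrt t * z)) f" by (subst integrable_distr_eq) auto
    then have 1: "integrable M (\<lambda>\<omega>. f (W t \<omega>))" unfolding D [symmetric] by (subst (asm) integrable_distr_eq) auto
    have "(\<integral>\<omega>. f (W t \<omega>) \<partial>M) = (\<integral>x. f x \<partial>distr M borel (W t))" by (subst integral_distr) auto
    also have "\<dots> = heat t f 0" unfolding D by (subst integral_distr) (auto simp: heat_def)
    finally show ?thesis using 1 by simp
  qed
  then show "integrable M (\<lambda>\<omega>. f (W t \<omega>))" and "(\<integral>\<omega>. f (W t \<omega>) \<partial>M) = heat t f 0" by auto
qed

lemma nice_W:
  assumes f: "growth f" and t: "0 \<le> t" "t \<le> T"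
  shows "nice (\<lambda>\<omega>. f (W t \<omega>))"
  unfolding nice_def
proof (intro conjI allI)
  show "(\<lambda>\<omega>. f (W t \<omega>)) \<in> borel_measurable M"
    using growth_measurable [OF f] W_measurable [OF t] by measurable
  show "integrable M (\<lambda>\<omega>. \<bar>f (W t \<omega>)\<bar> ^ q)" for q
    by (rule integral_W(1) [OF _ t]) (intro growth_intros f)
qed

lemma measurable_F_W: "growth f \<Longrightarrow> 0 \<le> s \<Longrightarrow> s \<le> t \<Longrightarrow> (\<lambda>\<omega>. f (W s \<omega>)) \<in> borel_measurable (F t)"
  using growth_measurable W_F_measurable by (rule measurable_compose [rotated])

text \<open>Conditional mean zero given F s, expressed by testing with weights. In this form it is
  stable under multiplication by known factors, and orthogonality is available directly.\<close>

definition mds :: "real \<Rightarrow> ('a \<Rightarrow> real) \<Rightarrow> bool" where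
  "mds s D \<longleftrightarrow> nice D \<and> (\<forall>\<zeta>. nice \<zeta> \<longrightarrow> \<zeta> \<in> borel_measurable (F s) \<longrightarrow> (\<integral>\<omega>. \<zeta> \<omega> * D \<omega> \<partial>M) = 0)"

lemma mds_nice: "mds s D \<Longrightarrow> nice D"
  by (simp add: mds_def)

lemma mds_orthogonal: "mds s D \<Longrightarrow> nice \<zeta> \<Longrightarrow> \<zeta> \<in> borel_measurable (F s) \<Longrightarrow> (\<integral>\<omega>. \<zeta> \<omega> * D \<omega> \<partial>M) = 0"
  by (simp add: mds_def)

lemma mds_mono: "mds t D \<Longrightarrow> s \<le> t \<Longrightarrow> mds s D"
  by (auto simp: mds_def dest: F_measurable_mono)

lemma mds_zero: "mds s (\<lambda>_. 0)"
  by (auto simp: mds_def)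

lemma mds_mult:
  assumes "mds s D" "nice \<eta>" "\<eta> \<in> borel_measurable (F s)"
  shows "mds s (\<lambda>\<omega>. \<eta> \<omega> * D \<omega>)"
  unfolding mds_def
proof (intro conjI allI impI)
  show "nice (\<lambda>\<omega>. \<eta> \<omega> * D \<omega>)" using assms by (auto dest: mds_nice)
  fix \<zeta> assume "nice \<zeta>" "\<zeta> \<in> borel_measurable (F s)"
  then have "(\<integral>\<omega>. (\<zeta> \<omega> * \<eta> \<omega>) * D \<omega> \<partial>M) = 0"
    using assms by (intro mds_orthogonal) auto
  then show "(\<integral>\<omega>. \<zeta> \<omega> * (\<eta> \<omega> * D \<omega>) \<partial>M) = 0" by (simp add: mult.assoc)
qed

lemma mds_add:
  assumes "mds s D" "mds s E" shows "mds s (\<lambda>\<omega>. D \<omega> + E \<omega>)"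
  unfolding mds_def
proof (intro conjI allI impI)
  show "nice (\<lambda>\<omega>. D \<omega> + E \<omega>)" using assms by (auto dest: mds_nice)
  fix \<zeta> assume z: "nice \<zeta>" "\<zeta> \<in> borel_measurable (F s)"
  have "integrable M (\<lambda>\<omega>. \<zeta> \<omega> * D \<omega>)" "integrable M (\<lambda>\<omega>. \<zeta> \<omega> * E \<omega>)"
    using assms z by (auto intro!: nice_integrable dest: mds_nice)
  then show "(\<integral>\<omega>. \<zeta> \<omega> * (D \<omega> + E \<omega>) \<partial>M) = 0"
    using assms z by (simp add: distrib_left mds_orthogonal)
qed

lemma mds_diff: "mds s D \<Longrightarrow> mds s E \<Longrightarrow> mds s (\<lambda>\<omega>. D \<omega> - E \<omega>)"
  using mds_add [of s D "\<lambda>\<omega>. (-1) * E \<omega>"] mds_mult [of s E "\<lambda>_. -1"] by auto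

lemma mds_sum: "(\<And>i. i \<in> I \<Longrightarrow> mds s (D i)) \<Longrightarrow> mds s (\<lambda>\<omega>. \<Sum>i\<in>I. D i \<omega>)"
  by (induction I rule: infinite_finite_induct) (auto intro: mds_add mds_zero)

text \<open>The Markov property: once the past is frozen, the inner Gaussian integral of w is the
  very heat flow that is subtracted.\<close>

lemma mds_W:
  assumes w: "growth w" and s: "0 \<le> s" "s \<le> t" "t \<le> T"
  shows "mds s (\<lambda>\<omega>. w (W t \<omega>) - heat (t - s) w (W s \<omega>))"
proof (cases "s = t")
  case True
  then show ?thesis by (simp add: mds_zero)
next
  case False
  then have st: "s < t" using s by simp
  have n: "nice (\<lambda>\<omega>. w (W t \<omega>) - heat (t - s) w (W s \<omega>))"
    using s by (intro nice_diff nice_W growth_heat w) auto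
  note [measurable] = growth_measurable [OF w] growth_measurable [OF growth_heat [OF w]] W_F_measurable [of s s, OF s(1) order_refl]
  show ?thesis
    unfolding mds_def
  proof (intro conjI allI impI)
    fix \<zeta> assume z: "nice \<zeta>" and [measurable]: "\<zeta> \<in> borel_measurable (F s)"
    let ?h = "\<lambda>p. \<zeta> (fst p) * (w (W s (fst p) + snd p) - heat (t - s) w (W s (fst p)))"
    have eq: "\<zeta> \<omega> * (w (W t \<omega>) - heat (t - s) w (W s \<omega>)) = ?h (\<omega>, W t \<omega> - W s \<omega>)" for \<omega> by simp
    have hm: "?h \<in> borel_measurable (F s \<Otimes>\<^sub>M borel)" by measurable
    have int: "integrable M (\<lambda>\<omega>. ?h (\<omega>, W t \<omega> - W s \<omega>))"
      unfolding eq [symmetric] using z n by (intro nice_integrable nice_mult)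
    have zero: "(\<integral>z. ?h (\<omega>, sqrt (t - s) * z) \<partial>gauss) = 0" for \<omega>
      using integrable_growth [OF growth_affine [OF w]] prob_space.finite_measure [OF prob_space_gauss]
      by (simp add: heat_def finite_measure.integrable_const)
    show "(\<integral>\<omega>. \<zeta> \<omega> * (w (W t \<omega>) - heat (t - s) w (W s \<omega>)) \<partial>M) = 0"
      unfolding eq integral_increment [OF s(1) st s(3) hm int] unfolding zero by simp
  qed fact
qed

lemma mds_square:
  assumes "nice D" "D \<in> borel_measurable (F s)" "mds s E"
  shows "(\<integral>\<omega>. (D \<omega> + E \<omega>)\<^sup>2 \<partial>M) = (\<integral>\<omega>. (D \<omega>)\<^sup>2 \<partial>M) + (\<integral>\<omega>. (E \<omega>)\<^sup>2 \<partial>M)"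
proof -
  have E: "nice E" using assms(3) by (rule mds_nice)
  have i: "integrable M (\<lambda>\<omega>. (D \<omega>)\<^sup>2)" "integrable M (\<lambda>\<omega>. (E \<omega>)\<^sup>2)" "integrable M (\<lambda>\<omega>. D \<omega> * E \<omega>)"
    using assms(1) E by (auto intro!: nice_integrable)
  have "(D \<omega> + E \<omega>)\<^sup>2 = (D \<omega>)\<^sup>2 + 2 * (D \<omega> * E \<omega>) + (E \<omega>)\<^sup>2" for \<omega> by (simp add: power2_sum)
  then show ?thesis using i mds_orthogonal [OF assms(3,1,2)] by simp
qed

section \<open>Geometric Brownian motion and exponential moments of increments\<close>

lemma geom_bm_eq: "geom_bm W t = (\<lambda>\<omega>. exp (1 * W t \<omega> - t / 2))"
  by (simp add: geom_bm_def fun_eq_iff)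

lemma geom_bm_pos: "0 < geom_bm W t \<omega>"
  by (simp add: geom_bm_def)

lemma nice_Y: "0 \<le> t \<Longrightarrow> t \<le> T \<Longrightarrow> nice (geom_bm W t)"
  unfolding geom_bm_eq by (rule nice_W [OF growth_exp_affine])

lemma measurable_Y: "0 \<le> s \<Longrightarrow> s \<le> t \<Longrightarrow> geom_bm W s \<in> borel_measurable (F t)"
  unfolding geom_bm_eq by (rule measurable_F_W [OF growth_exp_affine])

lemma heat_exp: "0 \<le> v \<Longrightarrow> heat v (\<lambda>x. exp (1 * x - d)) x = exp (x - d + v / 2)"
proof -
  assume v: "0 \<le> v"
  have "exp (1 * (x + sqrt v * z) - d) = exp (x - d) * exp (sqrt v * z)" for z
    by (simp add: exp_add [symmetric])
  then have "heat v (\<lambda>x. exp (1 * x - d)) x = exp (x - d) * exp ((sqrt v)\<^sup>2 / 2)"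
    by (simp add: heat_def integral_gauss_exp)
  then show ?thesis using v by (simp add: exp_add [symmetric])
qed

lemma mds_Y:
  assumes "0 \<le> s" "s \<le> t" "t \<le> T"
  shows "mds s (\<lambda>\<omega>. geom_bm W t \<omega> - geom_bm W s \<omega>)"
proof -
  have "mds s (\<lambda>\<omega>. exp (1 * W t \<omega> - t / 2) - heat (t - s) (\<lambda>x. exp (1 * x - t / 2)) (W s \<omega>))"
    by (rule mds_W [OF growth_exp_affine assms])
  moreover have "heat (t - s) (\<lambda>x. exp (1 * x - t / 2)) x = exp (1 * x - s / 2)" for x
    using assms by (subst heat_exp) (auto simp: field_simps)
  ultimately show ?thesis unfolding geom_bm_eq by simp
qed

text \<open>Freezing reduces it to the Laplace transform at c sqrt (t - s); the absolute value costs
  the factor 2. The weight Z makes it a conditional estimate given F s.\<close>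

lemma exp_abs_moment:
  assumes "0 \<le> s" "s \<le> t" "t \<le> T" and Z: "nice Z" "Z \<in> borel_measurable (F s)" "\<And>\<omega>. \<omega> \<in> space M \<Longrightarrow> 0 \<le> Z \<omega>"
    and c: "0 \<le> c"
  shows "(\<integral>\<omega>. Z \<omega> * exp (c * \<bar>W t \<omega> - W s \<omega>\<bar>) \<partial>M) \<le> 2 * exp (c\<^sup>2 * (t - s) / 2) * (\<integral>\<omega>. Z \<omega> \<partial>M)"
    and "nice (\<lambda>\<omega>. Z \<omega> * exp (c * \<bar>W t \<omega> - W s \<omega>\<bar>))"
proof -
  have n: "nice (\<lambda>\<omega>. exp (c * \<bar>W t \<omega>\<bar>) * exp (c * \<bar>W s \<omega>\<bar>))"
    using assms by (intro nice_mult nice_W [of "\<lambda>x. exp (c * \<bar>x\<bar>)"] growth_exp_abs) auto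
  have "nice (\<lambda>\<omega>. exp (c * \<bar>W t \<omega> - W s \<omega>\<bar>))"
  proof (rule nice_bound [OF n])
    show "(\<lambda>\<omega>. exp (c * \<bar>W t \<omega> - W s \<omega>\<bar>)) \<in> borel_measurable M"
    proof -
      have [measurable]: "W t \<in> borel_measurable M" "W s \<in> borel_measurable M"
        using assms by (auto intro: W_measurable)
      show ?thesis by measurable
    qed
    fix \<omega>
    have "c * \<bar>W t \<omega> - W s \<omega>\<bar> \<le> c * (\<bar>W t \<omega>\<bar> + \<bar>W s \<omega>\<bar>)"
      using c by (intro mult_left_mono) auto
    then show "\<bar>exp (c * \<bar>W t \<omega> - W s \<omega>\<bar>)\<bar> \<le> \<bar>exp (c * \<bar>W t \<omega>\<bar>) * exp (c * \<bar>W s \<omega>\<bar>)\<bar>"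
      by (simp add: exp_add [symmetric] distrib_left)
  qed
  with Z(1) show n: "nice (\<lambda>\<omega>. Z \<omega> * exp (c * \<bar>W t \<omega> - W s \<omega>\<bar>))" by (rule nice_mult)
  show "(\<integral>\<omega>. Z \<omega> * exp (c * \<bar>W t \<omega> - W s \<omega>\<bar>) \<partial>M) \<le> 2 * exp (c\<^sup>2 * (t - s) / 2) * (\<integral>\<omega>. Z \<omega> \<partial>M)"
  proof (cases "s = t")
    case True
    have Z0: "0 \<le> (\<integral>\<omega>. Z \<omega> \<partial>M)" using Z(3) by (intro Bochner_Integration.integral_nonneg_AE AE_I2)
    then show ?thesis using True by simp
  next
    case False
    then have st: "s < t" using assms by simp
    note [measurable] = Z(2)
    let ?h = "\<lambda>p. Z (fst p) * exp (c * \<bar>snd p\<bar>)"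
    have "(\<integral>\<omega>. ?h (\<omega>, W t \<omega> - W s \<omega>) \<partial>M) = (\<integral>\<omega>. (\<integral>z. ?h (\<omega>, sqrt (t - s) * z) \<partial>gauss) \<partial>M)"
    proof (rule integral_increment [OF assms(1) st assms(3)])
      show "?h \<in> borel_measurable (F s \<Otimes>\<^sub>M borel)" by measurable
      show "integrable M (\<lambda>\<omega>. ?h (\<omega>, W t \<omega> - W s \<omega>))" using nice_integrable [OF n] by simp
    qed
    also have "\<dots> = (\<integral>\<omega>. Z \<omega> * (\<integral>z. exp ((c * sqrt (t - s)) * \<bar>z\<bar>) \<partial>gauss) \<partial>M)"
      using st by (simp add: abs_mult mult.assoc)
    also have "\<dots> \<le> (\<integral>\<omega>. Z \<omega> * (2 * exp (c\<^sup>2 * (t - s) / 2)) \<partial>M)"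
    proof (intro integral_mono mult_left_mono Z(3))
      have "(\<integral>z. exp ((c * sqrt (t - s)) * \<bar>z\<bar>) \<partial>gauss) \<le> 2 * exp ((c * sqrt (t - s))\<^sup>2 / 2)"
        by (rule integral_gauss_exp_abs)
      also have "(c * sqrt (t - s))\<^sup>2 = c\<^sup>2 * (t - s)"
        using st by (simp add: power_mult_distrib)
      finally show "(\<integral>z. exp ((c * sqrt (t - s)) * \<bar>z\<bar>) \<partial>gauss) \<le> 2 * exp (c\<^sup>2 * (t - s) / 2)" by simp
    qed (use nice_integrable [OF Z(1)] in auto)
    finally show ?thesis by (simp add: mult_ac)
  qed
qed

lemma exp_abs_W_moment:
  assumes t: "0 \<le> t" "t \<le> T" and c: "0 \<le> c"
  shows "nice (\<lambda>\<omega>. exp (c * \<bar>W t \<omega>\<bar>))" and "(\<integral>\<omega>. exp (c * \<bar>W t \<omega>\<bar>) \<partial>M) \<le> 2 * exp (c\<^sup>2 * T / 2)"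
proof -
  show "nice (\<lambda>\<omega>. exp (c * \<bar>W t \<omega>\<bar>))"
    using t by (intro nice_W [of "\<lambda>x. exp (c * \<bar>x\<bar>)"] growth_exp_abs)
  have "(\<integral>\<omega>. 1 * exp (c * \<bar>W t \<omega> - W 0 \<omega>\<bar>) \<partial>M) \<le> 2 * exp (c\<^sup>2 * (t - 0) / 2) * (\<integral>\<omega>. 1 \<partial>M)"
    by (rule exp_abs_moment(1)) (use t c in auto)
  also have "(\<integral>\<omega>. 1 * exp (c * \<bar>W t \<omega> - W 0 \<omega>\<bar>) \<partial>M) = (\<integral>\<omega>. exp (c * \<bar>W t \<omega>\<bar>) \<partial>M)"
    by (rule Bochner_Integration.integral_cong) (auto simp: W_0)
  finally have "(\<integral>\<omega>. exp (c * \<bar>W t \<omega>\<bar>) \<partial>M) \<le> 2 * exp (c\<^sup>2 * t / 2)" by (simp add: prob_space)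
  also have "\<dots> \<le> 2 * exp (c\<^sup>2 * T / 2)" using t by (simp add: mult_left_mono)
  finally show "(\<integral>\<omega>. exp (c * \<bar>W t \<omega>\<bar>) \<partial>M) \<le> 2 * exp (c\<^sup>2 * T / 2)" .
qed

end

section \<open>Value process, Delta process and hedge along the Brownian path\<close>

locale hedging = brownian M W T + hedging_payoff T \<theta> L g\<theta> g1
  for M :: "'a measure" and W T \<theta> L g\<theta> g1
begin

definition X :: "real \<Rightarrow> 'a \<Rightarrow> real" where
  "X t \<omega> = heat (T - t) pay (W t \<omega>) - heat T pay 0"

text \<open>The Delta with respect to the logarithmic state. By the chain rule the hedge is V / Y
  (\<open>hedge_eq\<close>), and V is a martingale before maturity (\<open>mds_V\<close>).\<close>

definition V :: "real \<Rightarrow> 'a \<Rightarrow> real" where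
  "V t \<omega> = heat1 (T - t) pay (W t \<omega>)"

abbreviation Y :: "real \<Rightarrow> 'a \<Rightarrow> real" where "Y \<equiv> geom_bm W"

lemma nice_X: "0 \<le> t \<Longrightarrow> t \<le> T \<Longrightarrow> nice (X t)"
  unfolding X_def [abs_def] by (intro nice_diff nice_const nice_W growth_heat growth_pay)

lemma measurable_X: "0 \<le> s \<Longrightarrow> s \<le> t \<Longrightarrow> X s \<in> borel_measurable (F t)"
  unfolding X_def [abs_def] by (intro borel_measurable_diff borel_measurable_const measurable_F_W growth_heat growth_pay)

lemma mds_X:
  assumes "0 \<le> s" "s \<le> t" "t \<le> T"
  shows "mds s (\<lambda>\<omega>. X t \<omega> - X s \<omega>)"
proof -
  have "heat (t - s) (heat (T - t) pay) x = heat (T - s) pay x" for x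
    using heat_heat [OF growth_pay, of "t - s" "T - t" x] assms by simp
  then show ?thesis
    using mds_W [OF growth_heat [OF growth_pay] assms, of "T - t"] by (simp add: X_def)
qed

lemma nice_V: "0 \<le> t \<Longrightarrow> t \<le> T \<Longrightarrow> nice (V t)"
  unfolding V_def [abs_def] by (intro nice_W growth_heat1 growth_pay)

lemma measurable_V: "0 \<le> s \<Longrightarrow> s \<le> t \<Longrightarrow> V s \<in> borel_measurable (F t)"
  unfolding V_def [abs_def] by (intro measurable_F_W growth_heat1 growth_pay)

lemma mds_V:
  assumes "0 \<le> s" "s \<le> t" "t < T"
  shows "mds s (\<lambda>\<omega>. V t \<omega> - V s \<omega>)"
proof -
  have "heat (t - s) (heat1 (T - t) pay) x = heat1 (T - s) pay x" for x
    using heat_heat1 [OF growth_pay, of "t - s" "T - t" x] assms by simp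
  then show ?thesis
    using mds_W [OF growth_heat1 [OF growth_pay], of s t "T - t"] assms by (simp add: V_def)
qed

text \<open>The state that belongs to the price y at time t is ln y + t / 2, which is W t for y = Y
  t; the drifts then add up to the T / 2 subtracted in \<open>pay\<close>.\<close>

lemma value_fun_eq:
  assumes t: "0 \<le> t" "t \<le> T" and y: "0 < y"
  shows "value_fun M W T (\<lambda>x. g\<theta> x + g1 x) t y = heat (T - t) pay (ln y + t / 2)"
proof -
  let ?c = "ln y + t / 2"
  have "y * exp (w - (T - t) / 2) = exp (w + ?c - T / 2)" for w
  proof -
    have "y * exp (w - (T - t) / 2) = exp (ln y) * exp (w - (T - t) / 2)" using y by simp
    also have "\<dots> = exp (w + ?c - T / 2)" unfolding exp_add [symmetric] by (simp add: field_simps)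
    finally show ?thesis .
  qed
  then have "value_fun M W T (\<lambda>x. g\<theta> x + g1 x) t y = (\<integral>\<omega>. pay (W (T - t) \<omega> + ?c) \<partial>M)"
    by (simp add: value_fun_def geom_bm_def pay_def)
  also have "\<dots> = heat (T - t) (\<lambda>x. pay (x + ?c)) 0"
    by (rule integral_W(2)) (use t in \<open>auto intro!: growth_shift growth_pay\<close>)
  also have "\<dots> = heat (T - t) pay ?c" by (simp add: heat_def add.commute)
  finally show ?thesis .
qed

lemma hedge_eq:
  assumes t: "0 \<le> t" "t < T"
  shows "hedge M W T (\<lambda>x. g\<theta> x + g1 x) t \<omega> = V t \<omega> / Y t \<omega>"
proof -
  let ?y = "Y t \<omega>"
  have y: "0 < ?y" by (rule geom_bm_pos)
  have "(heat (T - t) pay has_real_derivative heat1 (T - t) pay (ln ?y + t / 2)) (at (ln ?y + t / 2))"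
    by (rule heat_has_derivative(1) [OF growth_pay]) (use t in simp)
  moreover have "((\<lambda>y. ln y + t / 2) has_real_derivative 1 / ?y) (at ?y)"
    using y by (auto intro!: derivative_eq_intros)
  ultimately have "((\<lambda>y. heat (T - t) pay (ln y + t / 2)) has_real_derivative
      heat1 (T - t) pay (ln ?y + t / 2) * (1 / ?y)) (at ?y)"
    by (rule DERIV_chain2)
  \<comment> \<open>The two functions of y agree for y > 0 only, but this is an open set around the
    point of differentiation.\<close>
  then have "(value_fun M W T (\<lambda>x. g\<theta> x + g1 x) t has_real_derivative
      heat1 (T - t) pay (ln ?y + t / 2) * (1 / ?y)) (at ?y)"
  proof (rule has_field_derivative_transform_within_open [where S = "{0<..}"])
    fix y :: real assume "y \<in> {0<..}"
    then show "heat (T - t) pay (ln y + t / 2) = value_fun M W T (\<lambda>x. g\<theta> x + g1 x) t y"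
      using t by (subst value_fun_eq) auto
  qed (use y in auto)
  moreover have "ln ?y + t / 2 = W t \<omega>" by (simp add: geom_bm_def)
  ultimately show ?thesis
    unfolding hedge_def by (auto simp: V_def dest: DERIV_imp_deriv)
qed

lemma step_error_bound:
  "\<exists>C c. 0 \<le> C \<and> 0 \<le> c \<and> (\<forall>s t \<omega>. 0 \<le> s \<longrightarrow> s < t \<longrightarrow> t \<le> T \<longrightarrow>
     \<bar>X t \<omega> - X s \<omega> - V s \<omega> / Y s \<omega> * (Y t \<omega> - Y s \<omega>)\<bar>
       \<le> C * coef s t (W s \<omega>) * exp (c / sqrt (t - s) * \<bar>W t \<omega> - W s \<omega>\<bar>))"
proof -
  obtain C c where C: "0 \<le> C" "0 \<le> c" and b: "\<And>s t y z. 0 \<le> s \<Longrightarrow> s < t \<Longrightarrow> t \<le> T \<Longrightarrow>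
     \<bar>heat (T - t) pay (y + sqrt (t - s) * z) - heat (T - s) pay y
       - heat1 (T - s) pay y * (exp (sqrt (t - s) * z - (t - s) / 2) - 1)\<bar> \<le> C * coef s t y * exp (c * \<bar>z\<bar>)"
    using one_step_error by blast
  show ?thesis
  proof (rule exI [of _ C], rule exI [of _ c], intro conjI allI impI C)
    fix s t \<omega> assume st: "0 \<le> s" "s < t" "t \<le> T"
    define z where "z = (W t \<omega> - W s \<omega>) / sqrt (t - s)"
    have z: "sqrt (t - s) * z = W t \<omega> - W s \<omega>" "\<bar>z\<bar> = \<bar>W t \<omega> - W s \<omega>\<bar> / sqrt (t - s)"
      using st by (simp_all add: z_def abs_divide)
    have "Y t \<omega> = Y s \<omega> * exp (sqrt (t - s) * z - (t - s) / 2)"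
      unfolding z(1) geom_bm_def exp_add [symmetric] by (simp add: field_simps)
    then have "V s \<omega> / Y s \<omega> * (Y t \<omega> - Y s \<omega>) = V s \<omega> * (exp (sqrt (t - s) * z - (t - s) / 2) - 1)"
      using geom_bm_pos [of s \<omega>] by (simp add: field_simps)
    then show "\<bar>X t \<omega> - X s \<omega> - V s \<omega> / Y s \<omega> * (Y t \<omega> - Y s \<omega>)\<bar>
       \<le> C * coef s t (W s \<omega>) * exp (c / sqrt (t - s) * \<bar>W t \<omega> - W s \<omega>\<bar>)"
      using b [OF st, of "W s \<omega>" z] z by (simp add: X_def V_def)
  qed
qed

subsection \<open>The one-sided Ito isometry\<close>

text \<open>Up to \<beta> < T the coefficient of a step is linear in its length. The constant K
  explodes as \<beta> tends to T, which is harmless: in \<open>ito_interval\<close> it multiplies a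
  quantity that vanishes with the mesh.\<close>

lemma step_error_L2:
  assumes \<beta>: "0 \<le> \<beta>" "\<beta> < T"
  shows "\<exists>K\<ge>0. \<forall>s t. 0 \<le> s \<longrightarrow> s < t \<longrightarrow> t \<le> \<beta> \<longrightarrow>
     nice (\<lambda>\<omega>. X t \<omega> - X s \<omega> - V s \<omega> / Y s \<omega> * (Y t \<omega> - Y s \<omega>)) \<and>
     (\<integral>\<omega>. (X t \<omega> - X s \<omega> - V s \<omega> / Y s \<omega> * (Y t \<omega> - Y s \<omega>))\<^sup>2 \<partial>M) \<le> K * (t - s)\<^sup>2"
proof -
  obtain C c where C: "0 \<le> C" "0 \<le> c" and b: "\<And>s t \<omega>. 0 \<le> s \<Longrightarrow> s < t \<Longrightarrow> t \<le> T \<Longrightarrow>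
     \<bar>X t \<omega> - X s \<omega> - V s \<omega> / Y s \<omega> * (Y t \<omega> - Y s \<omega>)\<bar>
       \<le> C * coef s t (W s \<omega>) * exp (c / sqrt (t - s) * \<bar>W t \<omega> - W s \<omega>\<bar>)"
    using step_error_bound by blast
  define A where "A = C * KK (sqrt T) / (T - \<beta>)"
  have KT: "0 \<le> KK (sqrt T)" using T0 by (intro KK_nonneg) auto
  have A: "0 \<le> A" using C KT \<beta> by (simp add: A_def)
  define K where "K = A\<^sup>2 * (2 * exp ((2 * c)\<^sup>2 / 2) * (2 * exp (2\<^sup>2 * T / 2)))"
  show ?thesis
  proof (intro exI [of _ K] conjI allI impI)
    show "0 \<le> K" by (simp add: K_def)
    fix s t assume st: "0 \<le> s" "s < t" "t \<le> \<beta>"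
    then have tT: "t \<le> T" "t < T" using \<beta> by auto
    let ?R = "\<lambda>\<omega>. X t \<omega> - X s \<omega> - V s \<omega> / Y s \<omega> * (Y t \<omega> - Y s \<omega>)"
    let ?Z = "\<lambda>\<omega>. exp (2 * \<bar>W s \<omega>\<bar>)"
    let ?E = "\<lambda>\<omega>. exp (2 * (c / sqrt (t - s)) * \<bar>W t \<omega> - W s \<omega>\<bar>)"
    have coef: "coef s t y \<le> (t - s) * (KK (sqrt T) / (T - \<beta>)) * exp \<bar>y\<bar>" for y
    proof -
      have "KK (sqrt (T - t) * exp y) \<le> KK (sqrt T * exp y)"
        using st tT by (intro KK_mono mult_right_mono) auto
      also have "\<dots> \<le> exp \<bar>y\<bar> * KK (sqrt T)"
        using KK_exp_le [of "sqrt T" y 0] T0 by simp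
      finally have "(t - s) / (T - t) * KK (sqrt (T - t) * exp y) \<le> (t - s) / (T - \<beta>) * (exp \<bar>y\<bar> * KK (sqrt T))"
        using st tT \<beta> KT by (intro mult_mono frac_le KK_nonneg) auto
      then show ?thesis using tT by (simp add: coef_def mult_ac)
    qed
    have R: "\<bar>?R \<omega>\<bar> \<le> A * (t - s) * exp (1 * \<bar>W s \<omega>\<bar>) * exp (c / sqrt (t - s) * \<bar>W t \<omega> - W s \<omega>\<bar>)" for \<omega>
    proof -
      have "\<bar>?R \<omega>\<bar> \<le> C * coef s t (W s \<omega>) * exp (c / sqrt (t - s) * \<bar>W t \<omega> - W s \<omega>\<bar>)"
        using b st tT by simp
      also have "\<dots> \<le> C * ((t - s) * (KK (sqrt T) / (T - \<beta>)) * exp \<bar>W s \<omega>\<bar>) * exp (c / sqrt (t - s) * \<bar>W t \<omega> - W s \<omega>\<bar>)"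
        using C coef by (intro mult_right_mono mult_left_mono) auto
      finally show ?thesis by (simp add: A_def mult_ac)
    qed
    have nz: "nice ?Z" "?Z \<in> borel_measurable (F s)"
      using st tT by (auto intro!: nice_W [of "\<lambda>x. exp (2 * \<bar>x\<bar>)"] measurable_F_W [of "\<lambda>x. exp (2 * \<bar>x\<bar>)"] growth_exp_abs)
    have nice_bd: "nice (\<lambda>\<omega>. (A * (t - s) * exp (1 * \<bar>W s \<omega>\<bar>)) * exp (c / sqrt (t - s) * \<bar>W t \<omega> - W s \<omega>\<bar>))"
    proof (rule exp_abs_moment(2))
      show "nice (\<lambda>\<omega>. A * (t - s) * exp (1 * \<bar>W s \<omega>\<bar>))"
        using st tT by (intro nice_mult nice_const nice_W [of "\<lambda>x. exp (1 * \<bar>x\<bar>)"] growth_exp_abs) auto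
      show "(\<lambda>\<omega>. A * (t - s) * exp (1 * \<bar>W s \<omega>\<bar>)) \<in> borel_measurable (F s)"
        using st by (intro borel_measurable_times borel_measurable_const measurable_F_W [of "\<lambda>x. exp (1 * \<bar>x\<bar>)"] growth_exp_abs) auto
    qed (use st tT A C in auto)
    have R_meas: "?R \<in> borel_measurable M"
      using nice_X [of t] nice_X [of s] nice_V [of s] nice_Y [of t] nice_Y [of s] st tT
      by (auto dest!: nice_measurable)
    show "nice ?R"
    proof (rule nice_bound [OF nice_bd R_meas])
      fix \<omega>
      show "\<bar>?R \<omega>\<bar> \<le> \<bar>A * (t - s) * exp (1 * \<bar>W s \<omega>\<bar>) * exp (c / sqrt (t - s) * \<bar>W t \<omega> - W s \<omega>\<bar>)\<bar>"
        using R [of \<omega>] by linarith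
    qed
    then have nR: "integrable M (\<lambda>\<omega>. (?R \<omega>)\<^sup>2)" by (intro nice_integrable nice_power)
    have E: "nice (\<lambda>\<omega>. ?Z \<omega> * ?E \<omega>)"
      by (rule exp_abs_moment(2)) (use st tT C nz in auto)
    have "(\<integral>\<omega>. (?R \<omega>)\<^sup>2 \<partial>M) \<le> (\<integral>\<omega>. (A * (t - s))\<^sup>2 * (?Z \<omega> * ?E \<omega>) \<partial>M)"
    proof (rule integral_mono [OF nR])
      show "integrable M (\<lambda>\<omega>. (A * (t - s))\<^sup>2 * (?Z \<omega> * ?E \<omega>))" using nice_integrable [OF E] by simp
      fix \<omega>
      have "(?R \<omega>)\<^sup>2 \<le> (A * (t - s) * exp (1 * \<bar>W s \<omega>\<bar>) * exp (c / sqrt (t - s) * \<bar>W t \<omega> - W s \<omega>\<bar>))\<^sup>2"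
        using R [of \<omega>] by (metis abs_ge_zero power2_abs power_mono)
      also have "\<dots> = (A * (t - s))\<^sup>2 * (?Z \<omega> * ?E \<omega>)"
        by (simp add: power_mult_distrib exp_double [symmetric] mult_ac)
      finally show "(?R \<omega>)\<^sup>2 \<le> (A * (t - s))\<^sup>2 * (?Z \<omega> * ?E \<omega>)" .
    qed
    also have "\<dots> = (A * (t - s))\<^sup>2 * (\<integral>\<omega>. ?Z \<omega> * ?E \<omega> \<partial>M)" by simp
    also have "(\<integral>\<omega>. ?Z \<omega> * ?E \<omega> \<partial>M) \<le> 2 * exp ((2 * c)\<^sup>2 / 2) * (2 * exp (2\<^sup>2 * T / 2))"
    proof -
      have "(\<integral>\<omega>. ?Z \<omega> * ?E \<omega> \<partial>M) \<le> 2 * exp ((2 * (c / sqrt (t - s)))\<^sup>2 * (t - s) / 2) * (\<integral>\<omega>. ?Z \<omega> \<partial>M)"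
        by (rule exp_abs_moment(1)) (use st tT C nz in auto)
      also have "(2 * (c / sqrt (t - s)))\<^sup>2 * (t - s) = (2 * c)\<^sup>2"
        using st by (simp add: power_mult_distrib power_divide)
      also have "(\<integral>\<omega>. ?Z \<omega> \<partial>M) \<le> 2 * exp (2\<^sup>2 * T / 2)"
        using exp_abs_W_moment(2) [of s 2] st tT by simp
      finally show ?thesis by (simp add: mult_left_mono)
    qed
    finally have "(\<integral>\<omega>. (?R \<omega>)\<^sup>2 \<partial>M) \<le> (A * (t - s))\<^sup>2 * (2 * exp ((2 * c)\<^sup>2 / 2) * (2 * exp (2\<^sup>2 * T / 2)))"
      by (simp add: mult_left_mono)
    then show "(\<integral>\<omega>. (?R \<omega>)\<^sup>2 \<partial>M) \<le> K * (t - s)\<^sup>2"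
      by (simp add: K_def power_mult_distrib mult_ac)
  qed
qed

lemma (in -) gauss_variance_exp:
  assumes h: "0 \<le> h"
  shows "(\<integral>z. (exp (sqrt h * z - h / 2) - 1)\<^sup>2 \<partial>gauss) = exp h - 1"
proof -
  have eq: "(exp (sqrt h * z - h / 2) - 1)\<^sup>2 = exp (- h) * exp ((2 * sqrt h) * z) - 2 * exp (- h / 2) * exp (sqrt h * z) + 1" for z
  proof -
    have "exp (sqrt h * z - h / 2) = exp (- h / 2) * exp (sqrt h * z)"
      by (simp add: exp_add [symmetric])
    moreover have "exp (- h) = (exp (- h / 2))\<^sup>2" "exp ((2 * sqrt h) * z) = (exp (sqrt h * z))\<^sup>2"
      by (simp_all add: exp_double [symmetric] mult.assoc)
    ultimately show ?thesis by (simp add: power2_diff power_mult_distrib)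
  qed
  have i: "(\<integral>z. exp ((2 * sqrt h) * z) \<partial>gauss) = exp (2 * h)" "(\<integral>z. exp (sqrt h * z) \<partial>gauss) = exp (h / 2)"
    using h by (simp_all only: integral_gauss_exp) (simp_all add: power_mult_distrib)
  have "(\<integral>z. (exp (sqrt h * z - h / 2) - 1)\<^sup>2 \<partial>gauss) = exp (- h) * exp (2 * h) - 2 * exp (- h / 2) * exp (h / 2) + 1"
    unfolding eq
    using integrable_gauss_exp [of "2 * sqrt h"] integrable_gauss_exp [of "sqrt h"] integrable_growth [OF growth_const [of 1]]
    by (simp add: i)
  also have "\<dots> = exp h - 1" by (simp add: mult.assoc exp_add [symmetric])
  finally show ?thesis .
qed

text \<open>Freezing gives an exact product with the lognormal variance exp h - 1, which is at most
  h exp T. This is the source of exp T in the later isometry.\<close>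

lemma Y_square_increment:
  assumes st: "0 \<le> s" "s < t" "t \<le> T" and U: "nice U" "U \<in> borel_measurable (F s)"
  shows "(\<integral>\<omega>. (U \<omega> / Y s \<omega> * (Y t \<omega> - Y s \<omega>))\<^sup>2 \<partial>M) \<le> (t - s) * exp T * (\<integral>\<omega>. (U \<omega>)\<^sup>2 \<partial>M)"
    and "nice (\<lambda>\<omega>. U \<omega> / Y s \<omega> * (Y t \<omega> - Y s \<omega>))"
proof -
  let ?h = "t - s"
  note [measurable] = U(2)
  let ?f = "\<lambda>p. (U (fst p))\<^sup>2 * (exp (snd p - ?h / 2) - 1)\<^sup>2"
  have eq: "U \<omega> / Y s \<omega> * (Y t \<omega> - Y s \<omega>) = U \<omega> * (exp (W t \<omega> - W s \<omega> - ?h / 2) - 1)" for \<omega>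
  proof -
    have "Y t \<omega> = Y s \<omega> * exp (W t \<omega> - W s \<omega> - ?h / 2)"
      unfolding geom_bm_def exp_add [symmetric] by (simp add: field_simps)
    then show ?thesis using geom_bm_pos [of s \<omega>] by (simp add: field_simps)
  qed
  have e: "exp (W t \<omega> - W s \<omega> - ?h / 2) = exp (1 * W t \<omega> - ?h / 2) * exp ((-1) * W s \<omega>)" for \<omega>
    unfolding exp_add [symmetric] by simp
  have ne: "nice (\<lambda>\<omega>. exp (W t \<omega> - W s \<omega> - ?h / 2))"
    unfolding e using st by (intro nice_mult nice_W [of "\<lambda>x. exp (1 * x - ?h / 2)"] nice_W [of "\<lambda>x. exp ((-1) * x)"] growth_exp growth_exp_affine) auto
  show n: "nice (\<lambda>\<omega>. U \<omega> / Y s \<omega> * (Y t \<omega> - Y s \<omega>))"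
    unfolding eq using ne U(1) by (intro nice_mult nice_diff nice_const)
  have "(\<integral>\<omega>. (U \<omega> / Y s \<omega> * (Y t \<omega> - Y s \<omega>))\<^sup>2 \<partial>M) = (\<integral>\<omega>. ?f (\<omega>, W t \<omega> - W s \<omega>) \<partial>M)"
    unfolding eq by (simp add: power_mult_distrib)
  also have "\<dots> = (\<integral>\<omega>. (\<integral>z. ?f (\<omega>, sqrt (t - s) * z) \<partial>gauss) \<partial>M)"
  proof (rule integral_increment [OF st])
    show "?f \<in> borel_measurable (F s \<Otimes>\<^sub>M borel)" by measurable
    show "integrable M (\<lambda>\<omega>. ?f (\<omega>, W t \<omega> - W s \<omega>))"
      using nice_integrable [OF nice_mult [OF nice_power [OF U(1)] nice_power [OF nice_diff [OF ne nice_const]]]]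
      by simp
  qed
  also have "\<dots> = (\<integral>\<omega>. (U \<omega>)\<^sup>2 * (\<integral>z. (exp (sqrt ?h * z - ?h / 2) - 1)\<^sup>2 \<partial>gauss) \<partial>M)" by simp
  also have "(\<integral>z. (exp (sqrt ?h * z - ?h / 2) - 1)\<^sup>2 \<partial>gauss) = exp ?h - 1"
    by (rule gauss_variance_exp) (use st in simp)
  also have "(\<integral>\<omega>. (U \<omega>)\<^sup>2 * (exp ?h - 1) \<partial>M) = (exp ?h - 1) * (\<integral>\<omega>. (U \<omega>)\<^sup>2 \<partial>M)" by simp
  also have "\<dots> \<le> (?h * exp T) * (\<integral>\<omega>. (U \<omega>)\<^sup>2 \<partial>M)"
  proof (intro mult_right_mono)
    have "exp ?h - 1 \<le> ?h * exp ?h" using exp_bound_1 [of ?h] st by simp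
    also have "\<dots> \<le> ?h * exp T" using st by (intro mult_left_mono) auto
    finally show "exp ?h - 1 \<le> ?h * exp T" .
  qed simp
  finally show "(\<integral>\<omega>. (U \<omega> / Y s \<omega> * (Y t \<omega> - Y s \<omega>))\<^sup>2 \<partial>M) \<le> (t - s) * exp T * (\<integral>\<omega>. (U \<omega>)\<^sup>2 \<partial>M)" .
qed

lemma nice_Y_inverse: "0 \<le> t \<Longrightarrow> t \<le> T \<Longrightarrow> nice (\<lambda>\<omega>. 1 / Y t \<omega>)"
proof -
  assume t: "0 \<le> t" "t \<le> T"
  have eq: "1 / Y t \<omega> = exp ((-1) * W t \<omega> - (- t / 2))" for \<omega>
    by (simp add: geom_bm_def exp_minus [symmetric] inverse_eq_divide [symmetric])
  show ?thesis unfolding eq by (rule nice_W [OF growth_exp_affine t])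
qed

text \<open>Only one inequality of the isometry is needed, and its proof uses no stochastic calculus: the
  interval is subdivided, the one-step errors are of second order in the mesh, and the second moment
  of the martingale \<open>\<eta> * Y - V\<close> increases in time.\<close>

lemma ito_interval:
  assumes ab: "0 \<le> \<alpha>" "\<alpha> \<le> \<beta>" "\<beta> < T"
    and \<eta>: "nice \<eta>" "\<eta> \<in> borel_measurable (F \<alpha>)" and D0: "nice D0" "D0 \<in> borel_measurable (F \<alpha>)"
  shows "ennreal (\<integral>\<omega>. (D0 \<omega> + (\<eta> \<omega> * (Y \<beta> \<omega> - Y \<alpha> \<omega>) - (X \<beta> \<omega> - X \<alpha> \<omega>)))\<^sup>2 \<partial>M) \<le>
    ennreal (\<integral>\<omega>. (D0 \<omega>)\<^sup>2 \<partial>M) +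
    ennreal (2 * exp T) * (\<integral>\<^sup>+u. ennreal (\<integral>\<omega>. (\<eta> \<omega> * Y u \<omega> - V u \<omega>)\<^sup>2 \<partial>M) * indicator {\<alpha><..\<beta>} u \<partial>lborel)"
proof -
  define m where "m u = (\<integral>\<omega>. (\<eta> \<omega> * Y u \<omega> - V u \<omega>)\<^sup>2 \<partial>M)" for u
  define D where "D r \<omega> = D0 \<omega> + (\<eta> \<omega> * (Y r \<omega> - Y \<alpha> \<omega>) - (X r \<omega> - X \<alpha> \<omega>))" for r \<omega>
  define e where "e r = (\<integral>\<omega>. (D r \<omega>)\<^sup>2 \<partial>M)" for r
  define J where "J = (\<integral>\<^sup>+u. ennreal (m u) * indicator {\<alpha><..\<beta>} u \<partial>lborel)"
  obtain K where K: "0 \<le> K" "\<And>s t. 0 \<le> s \<Longrightarrow> s < t \<Longrightarrow> t \<le> \<beta> \<Longrightarrow>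
     nice (\<lambda>\<omega>. X t \<omega> - X s \<omega> - V s \<omega> / Y s \<omega> * (Y t \<omega> - Y s \<omega>)) \<and>
     (\<integral>\<omega>. (X t \<omega> - X s \<omega> - V s \<omega> / Y s \<omega> * (Y t \<omega> - Y s \<omega>))\<^sup>2 \<partial>M) \<le> K * (t - s)\<^sup>2"
    using step_error_L2 [of \<beta>] ab by auto
  have \<eta>F: "\<eta> \<in> borel_measurable (F r)" "D0 \<in> borel_measurable (F r)" if "\<alpha> \<le> r" for r
    using that \<eta> D0 by (auto intro: F_measurable_mono)
  have U: "nice (\<lambda>\<omega>. \<eta> \<omega> * Y r \<omega> - V r \<omega>)" "(\<lambda>\<omega>. \<eta> \<omega> * Y r \<omega> - V r \<omega>) \<in> borel_measurable (F r)"
    if "\<alpha> \<le> r" "r \<le> \<beta>" for r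
  proof -
    have r: "0 \<le> r" "r \<le> T" using that ab by auto
    show "nice (\<lambda>\<omega>. \<eta> \<omega> * Y r \<omega> - V r \<omega>)" using \<eta>(1) nice_Y [OF r] nice_V [OF r] by (intro nice_diff nice_mult)
    show "(\<lambda>\<omega>. \<eta> \<omega> * Y r \<omega> - V r \<omega>) \<in> borel_measurable (F r)"
      using \<eta>F(1) [OF that(1)] measurable_Y [OF r(1) order_refl] measurable_V [OF r(1) order_refl]
      by (intro borel_measurable_diff borel_measurable_times)
  qed
  have DF: "nice (D r)" "D r \<in> borel_measurable (F r)" if "\<alpha> \<le> r" "r \<le> \<beta>" for r
  proof -
    have r: "0 \<le> r" "r \<le> T" "\<alpha> \<le> T" using that ab by auto
    show "nice (D r)" unfolding D_def [abs_def]
      using \<eta>(1) D0(1) nice_Y [OF r(1,2)] nice_X [OF r(1,2)] nice_Y [OF ab(1) r(3)] nice_X [OF ab(1) r(3)]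
      by (intro nice_add nice_diff nice_mult)
    show "D r \<in> borel_measurable (F r)" unfolding D_def [abs_def]
      using \<eta>F [OF that(1)] measurable_Y [OF r(1) order_refl] measurable_X [OF r(1) order_refl]
        measurable_Y [OF ab(1) that(1)] measurable_X [OF ab(1) that(1)]
      by (intro borel_measurable_diff borel_measurable_add borel_measurable_times)
  qed
  have mono: "m r \<le> m t" if "\<alpha> \<le> r" "r \<le> t" "t \<le> \<beta>" for r t
  proof -
    have rt: "0 \<le> r" "r \<le> t" "t < T" "t \<le> T" using that ab by auto
    have E: "mds r (\<lambda>\<omega>. \<eta> \<omega> * (Y t \<omega> - Y r \<omega>) - (V t \<omega> - V r \<omega>))"
      using rt \<eta>F(1) [OF that(1)] \<eta>(1) by (intro mds_diff mds_mult mds_Y mds_V)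
    have "m t = (\<integral>\<omega>. ((\<eta> \<omega> * Y r \<omega> - V r \<omega>) + (\<eta> \<omega> * (Y t \<omega> - Y r \<omega>) - (V t \<omega> - V r \<omega>)))\<^sup>2 \<partial>M)"
      unfolding m_def by (simp add: algebra_simps)
    also have "\<dots> = m r + (\<integral>\<omega>. (\<eta> \<omega> * (Y t \<omega> - Y r \<omega>) - (V t \<omega> - V r \<omega>))\<^sup>2 \<partial>M)"
      unfolding m_def using U [of r] that by (intro mds_square [OF _ _ E]) auto
    finally show ?thesis by simp
  qed
  have step: "e t - e r \<le> 2 * exp T * ((t - r) * m r) + 2 * K * (t - r)\<^sup>2" if rt: "\<alpha> \<le> r" "r < t" "t \<le> \<beta>" for r t
  proof -
    have rt': "0 \<le> r" "r \<le> t" "t \<le> T" "r \<le> \<beta>" using rt ab by auto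
    let ?G = "\<lambda>\<omega>. \<eta> \<omega> * (Y t \<omega> - Y r \<omega>) - (X t \<omega> - X r \<omega>)"
    let ?U = "\<lambda>\<omega>. (\<eta> \<omega> * Y r \<omega> - V r \<omega>) / Y r \<omega> * (Y t \<omega> - Y r \<omega>)"
    let ?R = "\<lambda>\<omega>. X t \<omega> - X r \<omega> - V r \<omega> / Y r \<omega> * (Y t \<omega> - Y r \<omega>)"
    have G: "mds r ?G"
      using rt' \<eta>F(1) [OF rt(1)] \<eta>(1) by (intro mds_diff mds_mult mds_Y mds_X)
    have "e t = (\<integral>\<omega>. (D r \<omega> + ?G \<omega>)\<^sup>2 \<partial>M)"
      unfolding e_def D_def by (simp add: algebra_simps)
    also have "\<dots> = e r + (\<integral>\<omega>. (?G \<omega>)\<^sup>2 \<partial>M)"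
      unfolding e_def using DF [of r] rt by (intro mds_square [OF _ _ G]) auto
    finally have 1: "e t - e r = (\<integral>\<omega>. (?G \<omega>)\<^sup>2 \<partial>M)" by simp
    have nR: "nice ?R" and R2: "(\<integral>\<omega>. (?R \<omega>)\<^sup>2 \<partial>M) \<le> K * (t - r)\<^sup>2" using K(2) [OF rt'(1) rt(2,3)] by auto
    have U2: "(\<integral>\<omega>. (?U \<omega>)\<^sup>2 \<partial>M) \<le> (t - r) * exp T * m r" and nU: "nice ?U"
      unfolding m_def
      by (rule Y_square_increment [OF rt'(1) rt(2) rt'(3) U(1) [OF rt(1) rt'(4)] U(2) [OF rt(1) rt'(4)]])+
    have "(\<integral>\<omega>. (?G \<omega>)\<^sup>2 \<partial>M) \<le> (\<integral>\<omega>. 2 * (?U \<omega>)\<^sup>2 + 2 * (?R \<omega>)\<^sup>2 \<partial>M)"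
    proof (rule integral_mono)
      show "integrable M (\<lambda>\<omega>. (?G \<omega>)\<^sup>2)" using mds_nice [OF G] by (intro nice_integrable nice_power)
      show "integrable M (\<lambda>\<omega>. 2 * (?U \<omega>)\<^sup>2 + 2 * (?R \<omega>)\<^sup>2)"
        by (intro nice_integrable nice_add nice_mult [OF nice_const] nice_power [OF nU] nice_power [OF nR])
      fix \<omega>
      have eq: "?G \<omega> = ?U \<omega> - ?R \<omega>"
        using geom_bm_pos [of r \<omega>] by (simp add: field_simps)
      have sq: "(a - b)\<^sup>2 \<le> 2 * a\<^sup>2 + 2 * b\<^sup>2" for a b :: real
        using zero_le_power2 [of "a + b"] by (simp add: power2_diff power2_sum)
      show "(?G \<omega>)\<^sup>2 \<le> 2 * (?U \<omega>)\<^sup>2 + 2 * (?R \<omega>)\<^sup>2" unfolding eq by (rule sq)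
    qed
    also have "\<dots> = 2 * (\<integral>\<omega>. (?U \<omega>)\<^sup>2 \<partial>M) + 2 * (\<integral>\<omega>. (?R \<omega>)\<^sup>2 \<partial>M)"
      using nice_integrable [OF nice_power [OF nU]] nice_integrable [OF nice_power [OF nR]] by simp
    also have "\<dots> \<le> 2 * ((t - r) * exp T * m r) + 2 * (K * (t - r)\<^sup>2)" using U2 R2 by linarith
    finally show ?thesis unfolding 1 by (simp add: mult_ac)
  qed
  have "ennreal (e \<beta>) \<le> ennreal (e \<alpha>) + ennreal (2 * exp T) * J"
  proof (cases "\<alpha> = \<beta>")
    case False
    then have lt: "\<alpha> < \<beta>" using ab by simp
    have "ennreal (e \<beta>) \<le> (ennreal (e \<alpha>) + ennreal (2 * exp T) * J) + ennreal \<epsilon>" if \<epsilon>: "0 < \<epsilon>" for \<epsilon>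
    proof -
      \<comment> \<open>N is chosen so large that the remainders of all N steps together stay below
        \<epsilon>.\<close>
      obtain N0 :: nat where N0: "2 * K * (\<beta> - \<alpha>)\<^sup>2 / \<epsilon> < real N0" using reals_Archimedean2 by blast
      define N where "N = Suc N0"
      have N: "0 < N" "2 * K * (\<beta> - \<alpha>)\<^sup>2 / real N \<le> \<epsilon>"
        using N0 \<epsilon> by (auto simp: N_def field_simps)
      define r where "r i = \<alpha> + (\<beta> - \<alpha>) * real i / real N" for i
      have r0: "r 0 = \<alpha>" "r N = \<beta>" using N by (auto simp: r_def)
      have diff: "r (Suc i) - r i = (\<beta> - \<alpha>) / real N" for i
        by (simp add: r_def diff_divide_distrib [symmetric] algebra_simps)
      have "0 < (\<beta> - \<alpha>) / real N" using lt N by simp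
      then have inc: "r i < r (Suc i)" for i using diff [of i] by linarith
      have r_mono: "r i \<le> r j" if "i \<le> j" for i j
        by (rule lift_Suc_mono_le [of r, OF less_imp_le [OF inc] that])
      have rab: "\<alpha> \<le> r i" "r i \<le> \<beta>" if "i \<le> N" for i
        using r_mono [of 0 i] r_mono [of i N] r0 that by auto
      have "e \<beta> - e \<alpha> = (\<Sum>i<N. e (r (Suc i)) - e (r i))"
        unfolding sum_lessThan_telescope [of "\<lambda>i. e (r i)"] r0 ..
      also have "\<dots> \<le> (\<Sum>i<N. 2 * exp T * ((r (Suc i) - r i) * m (r i)) + 2 * K * ((\<beta> - \<alpha>) / real N)\<^sup>2)"
      proof (intro sum_mono)
        fix i assume "i \<in> {..<N}"
        then show "e (r (Suc i)) - e (r i) \<le> 2 * exp T * ((r (Suc i) - r i) * m (r i)) + 2 * K * ((\<beta> - \<alpha>) / real N)\<^sup>2"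
          using step [of "r i" "r (Suc i)"] rab [of i] rab [of "Suc i"] inc [of i] by (simp add: diff)
      qed
      also have "\<dots> = 2 * exp T * (\<Sum>i<N. (r (Suc i) - r i) * m (r i)) + real N * (2 * K * ((\<beta> - \<alpha>) / real N)\<^sup>2)"
        by (simp add: sum.distrib sum_distrib_left)
      also have "real N * (2 * K * ((\<beta> - \<alpha>) / real N)\<^sup>2) = 2 * K * (\<beta> - \<alpha>)\<^sup>2 / real N"
        using N by (simp add: power2_eq_square field_simps)
      finally have "e \<beta> - e \<alpha> \<le> 2 * exp T * (\<Sum>i<N. (r (Suc i) - r i) * m (r i)) + \<epsilon>" using N by linarith
      then have 1: "e \<beta> \<le> e \<alpha> + 2 * exp T * (\<Sum>i<N. (r (Suc i) - r i) * m (r i)) + \<epsilon>" by linarith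
      have m0: "0 \<le> m u" for u by (simp add: m_def)
      \<comment> \<open>As m increases in time, the sum formed with left end points is a lower sum
        of the integral J.\<close>
      have S: "ennreal (\<Sum>i<N. (r (Suc i) - r i) * m (r i)) \<le> J"
        unfolding J_def
      proof (rule lower_sum_le_nn_integral)
        show "disjoint_family_on (\<lambda>i. {r i<..r (Suc i)}) {..<N}"
          unfolding disjoint_family_on_def
        proof (intro ballI impI)
          fix i j :: nat assume "i \<noteq> j"
          then consider "Suc i \<le> j" | "Suc j \<le> i" by linarith
          then show "{r i<..r (Suc i)} \<inter> {r j<..r (Suc j)} = {}"
            by cases (use r_mono [of "Suc i" j] r_mono [of "Suc j" i] in auto)
        qed
        fix i v assume i: "i < N" "v \<in> {r i<..r (Suc i)}"
        then have "\<alpha> < v" "v \<le> \<beta>" "\<alpha> \<le> r i" "r i \<le> v" using rab [of i] rab [of "Suc i"] by auto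
        then show "ennreal (m (r i)) \<le> ennreal (m v) * indicator {\<alpha><..\<beta>} v"
          using mono [of "r i" v] by (simp add: ennreal_leI)
      next
        show "r i \<le> r (Suc i)" "0 \<le> m (r i)" for i using inc [of i] m0 by (auto intro: less_imp_le)
      qed
      have e0: "0 \<le> e \<alpha>" "0 \<le> (\<Sum>i<N. (r (Suc i) - r i) * m (r i))"
        using less_imp_le [OF inc] m0 by (auto simp: e_def intro!: sum_nonneg mult_nonneg_nonneg)
      have "ennreal (e \<beta>) \<le> ennreal (e \<alpha> + 2 * exp T * (\<Sum>i<N. (r (Suc i) - r i) * m (r i)) + \<epsilon>)"
        using 1 by (rule ennreal_leI)
      also have "\<dots> = ennreal (e \<alpha>) + ennreal (2 * exp T) * ennreal (\<Sum>i<N. (r (Suc i) - r i) * m (r i)) + ennreal \<epsilon>"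
        using e0 \<epsilon> by (simp add: ennreal_mult)
      also have "\<dots> \<le> ennreal (e \<alpha>) + ennreal (2 * exp T) * J + ennreal \<epsilon>"
        using S by (intro add_mono mult_left_mono) auto
      finally show ?thesis .
    qed
    then show ?thesis by (rule ennreal_le_epsilon)
  qed simp
  moreover have "e \<alpha> = (\<integral>\<omega>. (D0 \<omega>)\<^sup>2 \<partial>M)" by (simp add: e_def D_def)
  ultimately show ?thesis unfolding J_def m_def e_def D_def by simp
qed

end

text \<open>Locates the time relative to the nodes, as an induction over cells needs it. Nodes may
  coincide; since the cells exclude their left end points, at most one of them contains a given
  time.\<close>

lemma simple_integral_cases:
  assumes s: "\<forall>i<m. s i \<le> (s (Suc i) :: real)"
  shows "t \<le> s 0 \<Longrightarrow> simple_integral S m s \<xi> t \<omega> = 0"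
    and "j < m \<Longrightarrow> s j \<le> t \<Longrightarrow> t \<le> s (Suc j) \<Longrightarrow>
      simple_integral S m s \<xi> t \<omega> = simple_integral S m s \<xi> (s j) \<omega> + \<xi> j \<omega> * (S t \<omega> - S (s j) \<omega>)"
    and "s m \<le> t \<Longrightarrow> simple_integral S m s \<xi> t \<omega> = simple_integral S m s \<xi> (s m) \<omega>"
    and "u \<le> s 0 \<Longrightarrow> simple_process m s \<xi> u \<omega> = 0"
    and "j < m \<Longrightarrow> s j < u \<Longrightarrow> u \<le> s (Suc j) \<Longrightarrow> simple_process m s \<xi> u \<omega> = \<xi> j \<omega>"
    and "s m < u \<Longrightarrow> simple_process m s \<xi> u \<omega> = 0"
proof -
  have mono: "s i \<le> s k" if "i \<le> k" "k \<le> m" for i k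
    using that
  proof (induction rule: dec_induct)
    case (step k) then show ?case using s by (auto intro: order_trans)
  qed simp
  show "simple_integral S m s \<xi> t \<omega> = 0" if "t \<le> s 0"
    unfolding simple_integral_def
  proof (intro sum.neutral ballI)
    fix i assume "i \<in> {..<m}"
    then have "t \<le> s i" "t \<le> s (Suc i)" using mono [of 0 i] mono [of 0 "Suc i"] that by auto
    then show "\<xi> i \<omega> * (S (min (s (Suc i)) t) \<omega> - S (min (s i) t) \<omega>) = 0" by (simp add: min_absorb2)
  qed
  show "simple_process m s \<xi> u \<omega> = 0" if "u \<le> s 0"
    unfolding simple_process_def
  proof (intro sum.neutral ballI)
    fix i assume "i \<in> {..<m}"
    then have "u \<le> s i" using mono [of 0 i] that by auto
    then show "\<xi> i \<omega> * indicator {s i<..s (Suc i)} u = 0" by simp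
  qed
  show "simple_process m s \<xi> u \<omega> = 0" if "s m < u"
    unfolding simple_process_def
  proof (intro sum.neutral ballI)
    fix i assume "i \<in> {..<m}"
    then have "s (Suc i) < u" using mono [of "Suc i" m] that by auto
    then show "\<xi> i \<omega> * indicator {s i<..s (Suc i)} u = 0" by simp
  qed
  show "simple_integral S m s \<xi> t \<omega> = simple_integral S m s \<xi> (s m) \<omega>" if "s m \<le> t"
    unfolding simple_integral_def
  proof (intro sum.cong refl)
    fix i assume "i \<in> {..<m}"
    then have "s i \<le> s m" "s (Suc i) \<le> s m" using mono by auto
    then show "\<xi> i \<omega> * (S (min (s (Suc i)) t) \<omega> - S (min (s i) t) \<omega>) =
        \<xi> i \<omega> * (S (min (s (Suc i)) (s m)) \<omega> - S (min (s i) (s m)) \<omega>)"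
      using that by (simp add: min_absorb1)
  qed
  show "simple_process m s \<xi> u \<omega> = \<xi> j \<omega>" if j: "j < m" "s j < u" "u \<le> s (Suc j)"
  proof -
    have "(\<Sum>i<m. \<xi> i \<omega> * indicator {s i<..s (Suc i)} u) = (\<Sum>i<m. if i = j then \<xi> j \<omega> else 0)"
    proof (intro sum.cong refl)
      fix i assume i: "i \<in> {..<m}"
      consider "i = j" | "Suc i \<le> j" | "Suc j \<le> i" by linarith
      then show "\<xi> i \<omega> * indicator {s i<..s (Suc i)} u = (if i = j then \<xi> j \<omega> else 0)"
      proof cases
        case 2 then have "s (Suc i) \<le> s j" using mono j by auto
        then show ?thesis using 2 j by auto
      next
        case 3 then have "s (Suc j) \<le> s i" using mono i by auto
        then show ?thesis using 3 j by auto
      qed (use j in auto)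
    qed
    then show ?thesis using j by (simp add: simple_process_def)
  qed
  show "simple_integral S m s \<xi> t \<omega> = simple_integral S m s \<xi> (s j) \<omega> + \<xi> j \<omega> * (S t \<omega> - S (s j) \<omega>)"
    if j: "j < m" "s j \<le> t" "t \<le> s (Suc j)"
  proof -
    have "simple_integral S m s \<xi> t \<omega> =
      (\<Sum>i<m. \<xi> i \<omega> * (S (min (s (Suc i)) (s j)) \<omega> - S (min (s i) (s j)) \<omega>) +
        (if i = j then \<xi> j \<omega> * (S t \<omega> - S (s j) \<omega>) else 0))"
      unfolding simple_integral_def
    proof (intro sum.cong refl)
      fix i assume i: "i \<in> {..<m}"
      consider "i = j" | "Suc i \<le> j" | "Suc j \<le> i" by linarith
      then show "\<xi> i \<omega> * (S (min (s (Suc i)) t) \<omega> - S (min (s i) t) \<omega>) =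
          \<xi> i \<omega> * (S (min (s (Suc i)) (s j)) \<omega> - S (min (s i) (s j)) \<omega>) +
            (if i = j then \<xi> j \<omega> * (S t \<omega> - S (s j) \<omega>) else 0)"
      proof cases
        case 1 then show ?thesis using j by (simp add: min_def)
      next
        case 2 then have "s (Suc i) \<le> s j" "s i \<le> s j" using mono j by auto
        then show ?thesis using 2 j by (simp add: min_absorb1)
      next
        case 3 then have "s (Suc j) \<le> s i" "s (Suc j) \<le> s (Suc i)" using mono i by auto
        then show ?thesis using 3 j by (simp add: min_absorb2)
      qed
    qed
    then show ?thesis using j by (simp add: sum.distrib simple_integral_def)
  qed
qed

section \<open>Path regularity, joint measurability and the isometry for simple integrands\<close>

context hedging
begin

lemma X_continuous: "\<omega> \<in> space M \<Longrightarrow> continuous_on {0..T} (\<lambda>t. X t \<omega>)"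
  unfolding continuous_on_sequentially comp_def X_def
  by (intro allI ballI impI tendsto_diff tendsto_const heat_tendsto growth_pay continuous_pay)
     (auto intro!: tendsto_intros continuous_on_tendsto_compose [OF W_continuous])

lemma Y_continuous: "\<omega> \<in> space M \<Longrightarrow> continuous_on {0..T} (\<lambda>t. Y t \<omega>)"
  unfolding geom_bm_def by (intro continuous_intros W_continuous) auto

lemma V_continuous: "\<omega> \<in> space M \<Longrightarrow> continuous_on {0..<T} (\<lambda>t. V t \<omega>)"
proof -
  assume \<omega>: "\<omega> \<in> space M"
  have W: "continuous_on {0..<T} (\<lambda>t. W t \<omega>)"
    by (rule continuous_on_subset [OF W_continuous [OF \<omega>]]) auto
  show ?thesis
    unfolding continuous_on_sequentially comp_def V_def
    by (intro allI ballI impI heat1_tendsto growth_pay continuous_pay)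
       (auto intro!: tendsto_intros continuous_on_tendsto_compose [OF W])
qed

text \<open>Freezing the time at the nearest dyadic point to the left gives functions that depend on
  time through a countable index only; these are jointly measurable and converge by continuity of
  the paths.\<close>

lemma joint_measurable:
  fixes Z :: "real \<Rightarrow> 'a \<Rightarrow> real"
  assumes Z: "\<And>t. 0 \<le> t \<Longrightarrow> t < T \<Longrightarrow> Z t \<in> borel_measurable M"
    and c: "\<And>\<omega>. \<omega> \<in> space M \<Longrightarrow> continuous_on {0..<T} (\<lambda>t. Z t \<omega>)"
  shows "(\<lambda>(u, \<omega>). indicator {0..<T} u * Z u \<omega>) \<in> borel_measurable (borel \<Otimes>\<^sub>M M)"
proof (rule borel_measurable_LIMSEQ_real)
  \<comment> \<open>The default 0 is taken outside [0, T), where nothing is assumed about Z.\<close>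
  define D where "D k i \<omega> = (if 0 \<le> real_of_int i / 2 ^ k \<and> real_of_int i / 2 ^ k < T then Z (real_of_int i / 2 ^ k) \<omega> else 0)"
    for k :: nat and i :: int and \<omega>
  have D [measurable]: "D k i \<in> borel_measurable M" for k i
  proof (cases "0 \<le> real_of_int i / 2 ^ k \<and> real_of_int i / 2 ^ k < T")
    case True
    then have "D k i = Z (real_of_int i / 2 ^ k)" by (simp add: D_def fun_eq_iff)
    then show ?thesis using Z True by simp
  next
    case False
    then have "D k i = (\<lambda>_. 0)" by (auto simp: D_def fun_eq_iff)
    then show ?thesis by simp
  qed
  show "(\<lambda>p. indicator {0..<T} (fst p) * D k \<lfloor>fst p * 2 ^ k\<rfloor> (snd p)) \<in> borel_measurable (borel \<Otimes>\<^sub>M M)" for k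
  proof (intro borel_measurable_times)
    show "(\<lambda>p. D k \<lfloor>(fst p :: real) * 2 ^ k\<rfloor> (snd p)) \<in> borel_measurable (borel \<Otimes>\<^sub>M M)"
      by (rule measurable_compose_countable [where f = "\<lambda>i p. D k i (snd p)"]) measurable
  qed measurable
  fix p :: "real \<times> 'a" assume "p \<in> space (borel \<Otimes>\<^sub>M M)"
  then obtain u \<omega> where p: "p = (u, \<omega>)" "\<omega> \<in> space M" by (auto simp: space_pair_measure)
  show "(\<lambda>k. indicator {0..<T} (fst p) * D k \<lfloor>fst p * 2 ^ k\<rfloor> (snd p)) \<longlonglongrightarrow> (case p of (u, \<omega>) \<Rightarrow> indicator {0..<T} u * Z u \<omega>)"
  proof (cases "u \<in> {0..<T}")
    case True
    let ?u = "\<lambda>k. real_of_int \<lfloor>u * 2 ^ k\<rfloor> / 2 ^ k"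
    have u: "0 \<le> ?u k" "?u k \<le> u" "u - (1 / 2) ^ k \<le> ?u k" for k
    proof -
      have "real_of_int \<lfloor>u * 2 ^ k\<rfloor> \<le> u * 2 ^ k" "u * 2 ^ k < real_of_int \<lfloor>u * 2 ^ k\<rfloor> + 1" "0 \<le> \<lfloor>u * 2 ^ k\<rfloor>"
        using True by auto
      then have "u < (real_of_int \<lfloor>u * 2 ^ k\<rfloor> + 1) / 2 ^ k" "0 \<le> ?u k" "?u k \<le> u"
        by (simp_all add: pos_less_divide_eq pos_divide_le_eq)
      then show "0 \<le> ?u k" "?u k \<le> u" "u - (1 / 2) ^ k \<le> ?u k"
        by (simp_all add: add_divide_distrib power_one_over)
    qed
    have lim: "?u \<longlonglongrightarrow> u"
    proof (rule tendsto_sandwich [of "\<lambda>k. u - (1 / 2) ^ k" ?u _ "\<lambda>_. u"])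
      show "(\<lambda>k. u - (1 / 2) ^ k) \<longlonglongrightarrow> u" by (auto intro!: tendsto_eq_intros LIMSEQ_power_zero)
    qed (use u in \<open>auto intro!: always_eventually\<close>)
    have uT: "?u k \<in> {0..<T}" for k using u(1,2) [of k] True by auto
    have "(\<lambda>k. Z (?u k) \<omega>) \<longlonglongrightarrow> Z u \<omega>"
      by (rule continuous_on_tendsto_compose [OF c [OF p(2)] lim True]) (use uT in auto)
    moreover have "D k \<lfloor>u * 2 ^ k\<rfloor> \<omega> = Z (?u k) \<omega>" for k using uT [of k] by (simp add: D_def)
    ultimately show ?thesis using True by (simp add: p)
  qed (simp add: p)
qed

lemma V_joint: "(\<lambda>(u, \<omega>). indicator {0..<T} u * V u \<omega>) \<in> borel_measurable (borel \<Otimes>\<^sub>M M)"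
  by (rule joint_measurable) (auto intro!: nice_measurable nice_V V_continuous)

lemma Y_joint: "(\<lambda>(u, \<omega>). indicator {0..<T} u * Y u \<omega>) \<in> borel_measurable (borel \<Otimes>\<^sub>M M)"
  by (rule joint_measurable)
     (auto intro!: nice_measurable nice_Y continuous_on_subset [OF Y_continuous])

lemma simple_integrand_times:
  assumes "simple_integrand F T m s \<xi>" "i \<le> m"
  shows "0 \<le> s i" "s i \<le> T"
proof -
  have mono: "s j \<le> s k" if "j \<le> k" "k \<le> m" for j k
    using that
  proof (induction rule: dec_induct)
    case (step k) then show ?case using assms(1) by (auto simp: simple_integrand_def intro: order_trans)
  qed simp
  show "0 \<le> s i" "s i \<le> T"
    using assms mono [of 0 i] mono [of i m] by (auto simp: simple_integrand_def)
qed

lemma simple_integrand_nice: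
  assumes "simple_integrand F T m s \<xi>" "i < m"
  shows "nice (\<xi> i)" "\<xi> i \<in> borel_measurable (F (s i))" "0 \<le> s i" "s i \<le> T"
proof -
  show s: "0 \<le> s i" "s i \<le> T" using simple_integrand_times [OF assms(1), of i] assms(2) by auto
  show m: "\<xi> i \<in> borel_measurable (F (s i))" using assms by (auto simp: simple_integrand_def)
  have "\<exists>C. \<forall>\<omega>\<in>space M. \<bar>\<xi> i \<omega>\<bar> \<le> C" using assms by (simp add: simple_integrand_def)
  then obtain C where C: "\<forall>\<omega>\<in>space M. \<bar>\<xi> i \<omega>\<bar> \<le> C" by blast
  show "nice (\<xi> i)"
  proof (rule nice_bound [OF nice_const [of C]])
    show "\<xi> i \<in> borel_measurable M" using m s by (auto intro: F_measurable)
  qed (use C in force)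
qed

lemma simple_integral_nice:
  assumes s: "simple_integrand F T m s \<xi>" and t: "0 \<le> t" "t \<le> T"
  shows "nice (simple_integral Y m s \<xi> t)" "simple_integral Y m s \<xi> t \<in> borel_measurable (F t)"
proof -
  have "nice (\<lambda>\<omega>. \<xi> i \<omega> * (Y (min (s (Suc i)) t) \<omega> - Y (min (s i) t) \<omega>)) \<and>
    (\<lambda>\<omega>. \<xi> i \<omega> * (Y (min (s (Suc i)) t) \<omega> - Y (min (s i) t) \<omega>)) \<in> borel_measurable (F t)" if i: "i < m" for i
  proof (cases "s i \<le> t")
    case True
    have s0: "0 \<le> s i" "s i \<le> s (Suc i)" using simple_integrand_nice [OF s i] s i by (auto simp: simple_integrand_def)
    then have "0 \<le> min (s (Suc i)) t" "0 \<le> min (s i) t" using t by auto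
    then show ?thesis
      using simple_integrand_nice [OF s i] t True
      by (intro conjI nice_mult nice_diff nice_Y borel_measurable_times borel_measurable_diff measurable_Y)
         (auto intro: F_measurable_mono)
  next
    case False
    then have "t \<le> s i" "t \<le> s (Suc i)" using s i by (auto simp: simple_integrand_def intro: order_trans)
    then show ?thesis by (auto simp: min_absorb2)
  qed
  then show "nice (simple_integral Y m s \<xi> t)" "simple_integral Y m s \<xi> t \<in> borel_measurable (F t)"
    unfolding simple_integral_def [abs_def] by (auto intro!: nice_sum borel_measurable_sum)
qed

text \<open>The integrand of the approximation error in \<open>is_ito_integral\<close>: for the
  hedge V / Y the factor Y^2 of the bracket cancels the denominator, see
  \<open>hedge_gap\<close>.\<close>

definition gap :: "nat \<Rightarrow> (nat \<Rightarrow> real) \<Rightarrow> (nat \<Rightarrow> 'a \<Rightarrow> real) \<Rightarrow> real \<Rightarrow> 'a \<Rightarrow> real" where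
  "gap m s \<xi> u \<omega> = indicator {0..<T} u * (simple_process m s \<xi> u \<omega> * Y u \<omega> - V u \<omega>)\<^sup>2"

lemma simple_process_joint:
  assumes "\<And>i. i < m \<Longrightarrow> \<xi> i \<in> borel_measurable M"
  shows "(\<lambda>(u, \<omega>). simple_process m s \<xi> u \<omega>) \<in> borel_measurable (borel \<Otimes>\<^sub>M M)"
proof -
  have "(\<lambda>p. \<Sum>i<m. \<xi> i (snd p) * indicator {s i<..s (Suc i)} (fst p)) \<in> borel_measurable (borel \<Otimes>\<^sub>M M)"
  proof (intro borel_measurable_sum)
    fix i assume "i \<in> {..<m}"
    then have [measurable]: "\<xi> i \<in> borel_measurable M" using assms by simp
    show "(\<lambda>p. \<xi> i (snd p) * indicator {s i<..s (Suc i)} (fst p)) \<in> borel_measurable (borel \<Otimes>\<^sub>M M)" by measurable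
  qed
  then show ?thesis by (simp add: simple_process_def case_prod_beta')
qed

lemma gap_joint:
  assumes "simple_integrand F T m s \<xi>"
  shows "(\<lambda>(u, \<omega>). gap m s \<xi> u \<omega>) \<in> borel_measurable (borel \<Otimes>\<^sub>M M)"
proof -
  note [measurable] = V_joint Y_joint
  have [measurable]: "(\<lambda>(u, \<omega>). simple_process m s \<xi> u \<omega>) \<in> borel_measurable (borel \<Otimes>\<^sub>M M)"
    using simple_integrand_nice [OF assms] by (intro simple_process_joint) (auto dest: nice_measurable)
  have "(\<lambda>p. ((case p of (u, \<omega>) \<Rightarrow> simple_process m s \<xi> u \<omega>) * (case p of (u, \<omega>) \<Rightarrow> indicator {0..<T} u * Y u \<omega>) -
      (case p of (u, \<omega>) \<Rightarrow> indicator {0..<T} u * V u \<omega>))\<^sup>2) \<in> borel_measurable (borel \<Otimes>\<^sub>M M)"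
    by measurable
  also have "(\<lambda>p. ((case p of (u, \<omega>) \<Rightarrow> simple_process m s \<xi> u \<omega>) * (case p of (u, \<omega>) \<Rightarrow> indicator {0..<T} u * Y u \<omega>) -
      (case p of (u, \<omega>) \<Rightarrow> indicator {0..<T} u * V u \<omega>))\<^sup>2) = (\<lambda>(u, \<omega>). gap m s \<xi> u \<omega>)"
    by (auto simp: gap_def fun_eq_iff indicator_def)
  finally show ?thesis .
qed

text \<open>Induction over the cells: on each of them the integrand is one factor known at the left
  end, and \<open>ito_interval\<close> applies with \<open>D0\<close> the error accumulated so far.
  The integrals over adjacent cells add up.\<close>

lemma simple_isometry_lt:
  assumes si: "simple_integrand F T m s \<xi>" and t: "0 \<le> t" "t < T"
  shows "ennreal (\<integral>\<omega>. (simple_integral Y m s \<xi> t \<omega> - X t \<omega>)\<^sup>2 \<partial>M) \<le>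
    ennreal (2 * exp T) * (\<integral>\<^sup>+u. (\<integral>\<^sup>+\<omega>. ennreal (gap m s \<xi> u \<omega>) \<partial>M) * indicator {0<..t} u \<partial>lborel)"
proof -
  define f where "f u = (\<integral>\<^sup>+\<omega>. ennreal (gap m s \<xi> u \<omega>) \<partial>M)" for u
  have [measurable]: "f \<in> borel_measurable borel"
    unfolding f_def [abs_def] using gap_joint [OF si] by (intro borel_measurable_nn_integral) (simp add: case_prod_beta')
  define e where "e r = (\<integral>\<omega>. (simple_integral Y m s \<xi> r \<omega> - X r \<omega>)\<^sup>2 \<partial>M)" for r
  define I where "I a b = (\<integral>\<^sup>+u. f u * indicator {a<..b} u \<partial>lborel)" for a b
  have I_add: "I a b + I b c = I a c" if "a \<le> b" "b \<le> c" for a b c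
  proof -
    have "f u * indicator {a<..b} u + f u * indicator {b<..c} u = f u * indicator {a<..c} u" for u
      using that by (auto simp: indicator_def)
    then show ?thesis unfolding I_def by (subst nn_integral_add [symmetric]) simp_all
  qed
  have mono: "\<forall>i<m. s i \<le> s (Suc i)" and s0: "0 \<le> s 0" using si by (auto simp: simple_integrand_def)
  note cases = simple_integral_cases [OF mono]
  have interval: "ennreal (e b) \<le> ennreal (e a) + ennreal (2 * exp T) * I a b"
    if ab: "0 \<le> a" "a \<le> b" "b < T" and \<eta>: "nice \<eta>" "\<eta> \<in> borel_measurable (F a)"
      and inc: "\<And>\<omega>. simple_integral Y m s \<xi> b \<omega> = simple_integral Y m s \<xi> a \<omega> + \<eta> \<omega> * (Y b \<omega> - Y a \<omega>)"
      and pr: "\<And>u \<omega>. a < u \<Longrightarrow> u \<le> b \<Longrightarrow> simple_process m s \<xi> u \<omega> = \<eta> \<omega>" for a b \<eta>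
  proof -
    have D: "nice (\<lambda>\<omega>. simple_integral Y m s \<xi> a \<omega> - X a \<omega>)"
      "(\<lambda>\<omega>. simple_integral Y m s \<xi> a \<omega> - X a \<omega>) \<in> borel_measurable (F a)"
      using simple_integral_nice [OF si, of a] nice_X [of a] measurable_X [of a a] ab by auto
    have eb: "e b = (\<integral>\<omega>. ((simple_integral Y m s \<xi> a \<omega> - X a \<omega>) + (\<eta> \<omega> * (Y b \<omega> - Y a \<omega>) - (X b \<omega> - X a \<omega>)))\<^sup>2 \<partial>M)"
      unfolding e_def inc by (simp add: algebra_simps)
    have "ennreal (e b) \<le> ennreal (e a) +
        ennreal (2 * exp T) * (\<integral>\<^sup>+u. ennreal (\<integral>\<omega>. (\<eta> \<omega> * Y u \<omega> - V u \<omega>)\<^sup>2 \<partial>M) * indicator {a<..b} u \<partial>lborel)"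
      unfolding eb unfolding e_def by (rule ito_interval [OF ab \<eta> D])
    also have "(\<integral>\<^sup>+u. ennreal (\<integral>\<omega>. (\<eta> \<omega> * Y u \<omega> - V u \<omega>)\<^sup>2 \<partial>M) * indicator {a<..b} u \<partial>lborel) = I a b"
      unfolding I_def
    proof (intro nn_integral_cong)
      fix u
      show "ennreal (\<integral>\<omega>. (\<eta> \<omega> * Y u \<omega> - V u \<omega>)\<^sup>2 \<partial>M) * indicator {a<..b} u = f u * indicator {a<..b} u"
      proof (cases "u \<in> {a<..b}")
        case True
        then have u: "a < u" "u \<le> b" "0 \<le> u" "u \<le> T" "u < T" using ab by auto
        have "integrable M (\<lambda>\<omega>. (\<eta> \<omega> * Y u \<omega> - V u \<omega>)\<^sup>2)"
          using \<eta>(1) nice_Y [OF u(3,4)] nice_V [OF u(3,4)] by (intro nice_integrable nice_power nice_diff nice_mult)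
        then have "(\<integral>\<^sup>+\<omega>. ennreal ((\<eta> \<omega> * Y u \<omega> - V u \<omega>)\<^sup>2) \<partial>M) = ennreal (\<integral>\<omega>. (\<eta> \<omega> * Y u \<omega> - V u \<omega>)\<^sup>2 \<partial>M)"
          by (rule nn_integral_eq_integral) simp
        then show ?thesis using u pr by (simp add: f_def gap_def)
      qed simp
    qed
    finally show ?thesis .
  qed
  have P: "ennreal (e t) \<le> ennreal (2 * exp T) * I 0 t" if "j \<le> m" "0 \<le> t" "t \<le> s j" "t < T" for j t
    using that
  proof (induction j arbitrary: t)
    case 0
    have X0: "X 0 \<omega> = 0" if "\<omega> \<in> space M" for \<omega> using that by (simp add: X_def W_0)
    have "e 0 = (\<integral>\<omega>. 0 \<partial>M)"
      unfolding e_def using cases(1) [of 0 Y \<xi>] s0 X0 by (intro Bochner_Integration.integral_cong) auto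
    moreover have "ennreal (e t) \<le> ennreal (e 0) + ennreal (2 * exp T) * I 0 t"
    \<comment> \<open>The time before the first node counts as a cell with integrand 0, because X
      moves there as well. The time after the last node is treated alike.\<close>
    proof (rule interval [of 0 t "\<lambda>_. 0"])
      show "simple_integral Y m s \<xi> t \<omega> = simple_integral Y m s \<xi> 0 \<omega> + 0 * (Y t \<omega> - Y 0 \<omega>)" for \<omega>
        using cases(1) [OF 0(3), of Y \<xi> \<omega>] cases(1) [OF s0, of Y \<xi> \<omega>] by simp
      fix u \<omega> assume "0 < u" "u \<le> t"
      then have "u \<le> s 0" using 0 by simp
      then show "simple_process m s \<xi> u \<omega> = 0" by (rule cases(4))
    qed (use 0 in auto)
    ultimately show ?case by simp
  next
    case (Suc j)
    show ?case
    proof (cases "t \<le> s j")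
      case True
      then show ?thesis using Suc by simp
    next
      case False
      then have j: "j < m" "s j \<le> t" "t \<le> s (Suc j)" "s j < T" using Suc by auto
      note n = simple_integrand_nice [OF si j(1)]
      have IH: "ennreal (e (s j)) \<le> ennreal (2 * exp T) * I 0 (s j)"
        using j n by (intro Suc.IH) auto
      have "ennreal (e t) \<le> ennreal (e (s j)) + ennreal (2 * exp T) * I (s j) t"
      proof (rule interval [OF n(3) j(2) Suc.prems(4) n(1,2)])
        show "simple_integral Y m s \<xi> t \<omega> = simple_integral Y m s \<xi> (s j) \<omega> + \<xi> j \<omega> * (Y t \<omega> - Y (s j) \<omega>)" for \<omega>
          using j(1-3) by (rule cases(2))
        fix u \<omega> assume u: "s j < u" "u \<le> t"
        show "simple_process m s \<xi> u \<omega> = \<xi> j \<omega>"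
          using j(1) u(1) by (rule cases(5)) (use u j in simp)
      qed
      also have "\<dots> \<le> ennreal (2 * exp T) * (I 0 (s j) + I (s j) t)"
        using IH by (simp add: distrib_left add_right_mono)
      also have "I 0 (s j) + I (s j) t = I 0 t" using n j by (intro I_add) auto
      finally show ?thesis .
    qed
  qed
  have "ennreal (e t) \<le> ennreal (2 * exp T) * I 0 t"
  proof (cases "t \<le> s m")
    case True then show ?thesis using P [of m t] t by simp
  next
    case False
    then have sm: "0 \<le> s m" "s m \<le> t" "s m < T"
      using simple_integrand_times [OF si, of m] t by auto
    have "ennreal (e t) \<le> ennreal (e (s m)) + ennreal (2 * exp T) * I (s m) t"
      by (rule interval [of "s m" t "\<lambda>_. 0"]) (use cases(3) [OF sm(2)] cases(6) sm t in auto)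
    also have "\<dots> \<le> ennreal (2 * exp T) * (I 0 (s m) + I (s m) t)"
      using P [of m "s m"] sm by (simp add: distrib_left add_right_mono)
    also have "I 0 (s m) + I (s m) t = I 0 t" using sm by (intro I_add) auto
    finally show ?thesis .
  qed
  then show ?thesis by (simp add: e_def I_def f_def)
qed

text \<open>The bound for t < T is uniform in t; Fatou's lemma along times increasing to T and
  continuity of the paths extend it to maturity.\<close>

lemma simple_isometry:
  assumes si: "simple_integrand F T m s \<xi>" and t: "0 \<le> t" "t \<le> T"
  shows "(\<integral>\<^sup>+\<omega>. ennreal ((simple_integral Y m s \<xi> t \<omega> - X t \<omega>)\<^sup>2) \<partial>M) \<le>
    ennreal (2 * exp T) * (\<integral>\<^sup>+u. (\<integral>\<^sup>+\<omega>. ennreal (gap m s \<xi> u \<omega>) \<partial>M) \<partial>lborel)"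
proof -
  let ?D = "\<lambda>t \<omega>. ennreal ((simple_integral Y m s \<xi> t \<omega> - X t \<omega>)\<^sup>2)"
  let ?B = "ennreal (2 * exp T) * (\<integral>\<^sup>+u. (\<integral>\<^sup>+\<omega>. ennreal (gap m s \<xi> u \<omega>) \<partial>M) \<partial>lborel)"
  have lt: "(\<integral>\<^sup>+\<omega>. ?D r \<omega> \<partial>M) \<le> ?B" if r: "0 \<le> r" "r < T" for r
  proof -
    have "integrable M (\<lambda>\<omega>. (simple_integral Y m s \<xi> r \<omega> - X r \<omega>)\<^sup>2)"
      using simple_integral_nice [OF si, of r] nice_X [of r] r by (intro nice_integrable nice_power nice_diff) auto
    then have "(\<integral>\<^sup>+\<omega>. ?D r \<omega> \<partial>M) = ennreal (\<integral>\<omega>. (simple_integral Y m s \<xi> r \<omega> - X r \<omega>)\<^sup>2 \<partial>M)"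
      by (rule nn_integral_eq_integral) simp
    also have "\<dots> \<le> ennreal (2 * exp T) * (\<integral>\<^sup>+u. (\<integral>\<^sup>+\<omega>. ennreal (gap m s \<xi> u \<omega>) \<partial>M) * indicator {0<..r} u \<partial>lborel)"
      by (rule simple_isometry_lt [OF si r])
    also have "\<dots> \<le> ?B"
      by (intro mult_left_mono nn_integral_mono) (auto simp: indicator_def)
    finally show ?thesis .
  qed
  show ?thesis
  proof (cases "t < T")
    case False
    then have tT: "t = T" using t by simp
    define r where "r k = T - T * inverse (real (Suc k))" for k :: nat
    have r: "0 \<le> r k" "r k < T" for k using T0 by (auto simp: r_def field_simps)
    have rT: "r \<longlonglongrightarrow> T"
    proof -
      have "(\<lambda>k. T - T * inverse (real (Suc k))) \<longlonglongrightarrow> T - T * 0"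
        by (intro tendsto_diff tendsto_mult tendsto_const LIMSEQ_inverse_real_of_nat)
      then show ?thesis by (simp add: r_def [abs_def])
    qed
    have "(\<integral>\<^sup>+\<omega>. ?D T \<omega> \<partial>M) = (\<integral>\<^sup>+\<omega>. liminf (\<lambda>k. ?D (r k) \<omega>) \<partial>M)"
    proof (intro nn_integral_cong)
      fix \<omega> assume \<omega>: "\<omega> \<in> space M"
      note s = simple_integrand_times [OF si]
      have YT: "(\<lambda>k. Y (min (s i) (r k)) \<omega>) \<longlonglongrightarrow> Y (min (s i) T) \<omega>" if "i \<le> m" for i
      proof (rule continuous_on_tendsto_compose [OF Y_continuous [OF \<omega>]])
        show "(\<lambda>k. min (s i) (r k)) \<longlonglongrightarrow> min (s i) T" by (intro tendsto_min tendsto_const rT)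
        have "min (s i) (r k) \<in> {0..T}" for k using s [OF that] r [of k] by auto
        then show "\<forall>\<^sub>F k in sequentially. min (s i) (r k) \<in> {0..T}" by simp
      qed (use s [OF that] T0 in auto)
      have "(\<lambda>k. X (r k) \<omega>) \<longlonglongrightarrow> X T \<omega>"
        by (rule continuous_on_tendsto_compose [OF X_continuous [OF \<omega>] rT])
           (use r(1) less_imp_le [OF r(2)] T0 in auto)
      then have "(\<lambda>k. (simple_integral Y m s \<xi> (r k) \<omega> - X (r k) \<omega>)\<^sup>2) \<longlonglongrightarrow> (simple_integral Y m s \<xi> T \<omega> - X T \<omega>)\<^sup>2"
        unfolding simple_integral_def by (intro tendsto_intros YT) auto
      then have "(\<lambda>k. ?D (r k) \<omega>) \<longlonglongrightarrow> ?D T \<omega>" by (rule tendsto_ennrealI)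
      then show "?D T \<omega> = liminf (\<lambda>k. ?D (r k) \<omega>)"
        by (rule lim_imp_Liminf [OF sequentially_bot, symmetric])
    qed
    also have "\<dots> \<le> liminf (\<lambda>k. \<integral>\<^sup>+\<omega>. ?D (r k) \<omega> \<partial>M)"
    proof (rule nn_integral_liminf)
      fix k
      have "simple_integral Y m s \<xi> (r k) \<in> borel_measurable M" "X (r k) \<in> borel_measurable M"
        using simple_integral_nice [OF si, of "r k"] nice_X [of "r k"] r [of k] by (auto dest: nice_measurable)
      then show "?D (r k) \<in> borel_measurable M" by measurable
    qed
    also have "\<dots> \<le> ?B"
      by (rule Liminf_le) (use lt r in \<open>auto intro!: always_eventually\<close>)
    finally show ?thesis by (simp add: tT)
  qed (use lt t in simp)
qed

subsection \<open>Existence and uniqueness of the Ito integral of the hedge\<close>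

lemma nn_integral_Y_square: "0 \<le> u \<Longrightarrow> u \<le> T \<Longrightarrow> (\<integral>\<^sup>+\<omega>. ennreal ((Y u \<omega>)\<^sup>2) \<partial>M) \<le> ennreal (2 * exp (2\<^sup>2 * T / 2))"
proof -
  assume u: "0 \<le> u" "u \<le> T"
  have "(\<integral>\<^sup>+\<omega>. ennreal ((Y u \<omega>)\<^sup>2) \<partial>M) \<le> (\<integral>\<^sup>+\<omega>. ennreal (exp (2 * \<bar>W u \<omega>\<bar>)) \<partial>M)"
  proof (intro nn_integral_mono ennreal_leI)
    fix \<omega> show "(Y u \<omega>)\<^sup>2 \<le> exp (2 * \<bar>W u \<omega>\<bar>)"
      using u by (simp add: geom_bm_def exp_double [symmetric])
  qed
  also have "\<dots> = ennreal (\<integral>\<omega>. exp (2 * \<bar>W u \<omega>\<bar>) \<partial>M)"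
    by (rule nn_integral_eq_integral) (use exp_abs_W_moment(1) [OF u, of 2] in \<open>auto intro: nice_integrable\<close>)
  also have "\<dots> \<le> ennreal (2 * exp (2\<^sup>2 * T / 2))"
    using exp_abs_W_moment(2) [OF u, of 2] by (intro ennreal_leI) simp
  finally show ?thesis .
qed

lemma KK_powr_bound: "\<exists>D\<ge>0. \<forall>v. 0 < v \<longrightarrow> v \<le> T \<longrightarrow> (KK (sqrt v))\<^sup>2 \<le> D * v powr \<theta>"
proof -
  obtain J where J: "0 \<le> J" "\<And>u. 0 < u \<Longrightarrow> (K_functional u g\<theta>)\<^sup>2 \<le> J * u powr (2 * \<theta>)"
    using K_functional_sq_le by blast
  show ?thesis
  proof (intro exI [of _ "2 * J + 2 * (T powr (1 - \<theta>) * L\<^sup>2)"] conjI allI impI)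
    fix v assume v: "0 < v" "v \<le> T"
    have "sqrt v powr (2 * \<theta>) = v powr \<theta>" using v by (simp add: powr_half_sqrt [symmetric] powr_powr)
    then have 1: "(K_functional (sqrt v) g\<theta>)\<^sup>2 \<le> J * v powr \<theta>" using J(2) [of "sqrt v"] v by simp
    have "v = v powr (1 - \<theta>) * v powr \<theta>" using v by (simp add: powr_add [symmetric])
    also have "\<dots> \<le> T powr (1 - \<theta>) * v powr \<theta>"
      using v \<theta> by (intro mult_right_mono powr_mono2) auto
    finally have "v * L\<^sup>2 \<le> (T powr (1 - \<theta>) * v powr \<theta>) * L\<^sup>2" by (intro mult_right_mono) auto
    then have "(sqrt v * L)\<^sup>2 \<le> T powr (1 - \<theta>) * L\<^sup>2 * v powr \<theta>"
      using v by (simp add: power_mult_distrib mult_ac)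
    then show "(KK (sqrt v))\<^sup>2 \<le> (2 * J + 2 * (T powr (1 - \<theta>) * L\<^sup>2)) * v powr \<theta>"
      using 1 KK_sq_le [of "sqrt v"] by (simp add: distrib_right)
  qed (use J in simp)
qed

lemma nn_integral_powr_remaining:
  "(\<integral>\<^sup>+u. ennreal ((T - u) powr (\<theta> - 1)) * indicator {0..<T} u \<partial>lborel) < \<infinity>"
proof -
  let ?f = "\<lambda>x. ennreal (x powr (\<theta> - 1)) * indicator {0..T} x"
  have "((\<lambda>x. x powr (\<theta> - 1)) has_integral (T powr (\<theta> - 1 + 1) / (\<theta> - 1 + 1))) {0..T}"
    by (rule has_integral_powr_from_0) (use \<theta> T0 in auto)
  then have f: "(\<integral>\<^sup>+x. ?f x \<partial>lborel) = ennreal (T powr (\<theta> - 1 + 1) / (\<theta> - 1 + 1))"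
    by (rule nn_integral_has_integral_lebesgue' [rotated]) simp
  have "(\<integral>\<^sup>+x. ?f x \<partial>lborel) = ennreal \<bar>- 1\<bar> * (\<integral>\<^sup>+u. ?f (T + (-1) * u) \<partial>lborel)"
    by (rule nn_integral_real_affine) auto
  moreover have "(\<integral>\<^sup>+u. ennreal ((T - u) powr (\<theta> - 1)) * indicator {0..<T} u \<partial>lborel) \<le> (\<integral>\<^sup>+u. ?f (T + (-1) * u) \<partial>lborel)"
    by (intro nn_integral_mono) (auto simp: indicator_def)
  ultimately have "(\<integral>\<^sup>+u. ennreal ((T - u) powr (\<theta> - 1)) * indicator {0..<T} u \<partial>lborel) \<le> ennreal (T powr (\<theta> - 1 + 1) / (\<theta> - 1 + 1))"
    unfolding f by simp
  then show ?thesis by (rule order.strict_trans1) simp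
qed

text \<open>The bounds on \<open>heat1\<close> and on \<open>KK\<close> make the second moment of V
  at time u of order \<open>(T - u) powr (\<theta> - 1)\<close>, which is integrable up to T because
  \<theta> > 0.\<close>

lemma V_square_integrable:
  "(\<integral>\<^sup>+u. (\<integral>\<^sup>+\<omega>. ennreal (indicator {0..<T} u * (V u \<omega>)\<^sup>2) \<partial>M) \<partial>lborel) < \<infinity>"
proof -
  obtain C where C: "0 \<le> C" "\<And>v x. 0 < v \<Longrightarrow> v \<le> T \<Longrightarrow> \<bar>heat1 v pay x\<bar> \<le> C / sqrt v * KK (sqrt v * exp x)"
    using pay_bounds by blast
  obtain D where D: "0 \<le> D" "\<And>v. 0 < v \<Longrightarrow> v \<le> T \<Longrightarrow> (KK (sqrt v))\<^sup>2 \<le> D * v powr \<theta>"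
    using KK_powr_bound by blast
  define A where "A = C\<^sup>2 * D * (2 * exp (2\<^sup>2 * T / 2))"
  have A: "0 \<le> A" using D by (simp add: A_def)
  have "(\<integral>\<^sup>+\<omega>. ennreal (indicator {0..<T} u * (V u \<omega>)\<^sup>2) \<partial>M) \<le>
      ennreal A * (ennreal ((T - u) powr (\<theta> - 1)) * indicator {0..<T} u)" for u
  proof (cases "u \<in> {0..<T}")
    case True
    let ?v = "T - u"
    have u: "0 \<le> u" "u \<le> T" and v: "0 < ?v" "?v \<le> T" using True by auto
    have b: "(V u \<omega>)\<^sup>2 \<le> C\<^sup>2 * D * ?v powr (\<theta> - 1) * exp (2 * \<bar>W u \<omega>\<bar>)" for \<omega>
    proof -
      have "\<bar>V u \<omega>\<bar> \<le> C / sqrt ?v * KK (sqrt ?v * exp (W u \<omega>))" unfolding V_def by (rule C(2) [OF v])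
      also have "\<dots> \<le> C / sqrt ?v * (exp \<bar>W u \<omega>\<bar> * KK (sqrt ?v))"
        using KK_exp_le [of "sqrt ?v" "W u \<omega>" 0] C v by (intro mult_left_mono) auto
      finally have "(V u \<omega>)\<^sup>2 \<le> (C / sqrt ?v * (exp \<bar>W u \<omega>\<bar> * KK (sqrt ?v)))\<^sup>2"
        by (metis abs_ge_zero power2_abs power_mono)
      also have "\<dots> = C\<^sup>2 / ?v * (KK (sqrt ?v))\<^sup>2 * exp (2 * \<bar>W u \<omega>\<bar>)"
        using v by (simp add: power_mult_distrib power_divide exp_double [symmetric])
      also have "\<dots> \<le> C\<^sup>2 / ?v * (D * ?v powr \<theta>) * exp (2 * \<bar>W u \<omega>\<bar>)"
        using D(2) [OF v] v by (intro mult_right_mono mult_left_mono) auto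
      also have "?v powr (\<theta> - 1) = ?v powr \<theta> / ?v" using v by (simp add: powr_diff)
      then have "C\<^sup>2 / ?v * (D * ?v powr \<theta>) = C\<^sup>2 * D * ?v powr (\<theta> - 1)" by simp
      finally show ?thesis .
    qed
    have "(\<integral>\<^sup>+\<omega>. ennreal (indicator {0..<T} u * (V u \<omega>)\<^sup>2) \<partial>M) \<le>
        (\<integral>\<^sup>+\<omega>. ennreal (C\<^sup>2 * D * ?v powr (\<theta> - 1)) * ennreal (exp (2 * \<bar>W u \<omega>\<bar>)) \<partial>M)"
      using b D True by (intro nn_integral_mono) (simp add: ennreal_mult' [symmetric] ennreal_leI)
    also have "\<dots> = ennreal (C\<^sup>2 * D * ?v powr (\<theta> - 1)) * (\<integral>\<^sup>+\<omega>. ennreal (exp (2 * \<bar>W u \<omega>\<bar>)) \<partial>M)"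
      using W_measurable [OF u] by (intro nn_integral_cmult) measurable
    also have "(\<integral>\<^sup>+\<omega>. ennreal (exp (2 * \<bar>W u \<omega>\<bar>)) \<partial>M) = ennreal (\<integral>\<omega>. exp (2 * \<bar>W u \<omega>\<bar>) \<partial>M)"
      by (rule nn_integral_eq_integral) (use exp_abs_W_moment(1) [OF u, of 2] in \<open>auto intro: nice_integrable\<close>)
    also have "ennreal (C\<^sup>2 * D * ?v powr (\<theta> - 1)) * ennreal (\<integral>\<omega>. exp (2 * \<bar>W u \<omega>\<bar>) \<partial>M) \<le>
        ennreal (C\<^sup>2 * D * ?v powr (\<theta> - 1)) * ennreal (2 * exp (2\<^sup>2 * T / 2))"
      using exp_abs_W_moment(2) [OF u, of 2] by (intro mult_left_mono ennreal_leI) simp_all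
    also have "\<dots> = ennreal A * ennreal (?v powr (\<theta> - 1))"
      using D by (simp add: A_def ennreal_mult' [symmetric] mult_ac)
    finally show ?thesis using True by simp
  qed simp
  then have "(\<integral>\<^sup>+u. (\<integral>\<^sup>+\<omega>. ennreal (indicator {0..<T} u * (V u \<omega>)\<^sup>2) \<partial>M) \<partial>lborel) \<le>
      (\<integral>\<^sup>+u. ennreal A * (ennreal ((T - u) powr (\<theta> - 1)) * indicator {0..<T} u) \<partial>lborel)"
    by (intro nn_integral_mono)
  also have "\<dots> = ennreal A * (\<integral>\<^sup>+u. ennreal ((T - u) powr (\<theta> - 1)) * indicator {0..<T} u \<partial>lborel)"
    by (rule nn_integral_cmult) auto
  also have "\<dots> < \<infinity>" using nn_integral_powr_remaining by (simp add: ennreal_mult_less_top)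
  finally show ?thesis .
qed

section \<open>Approximation of the hedge by simple integrands\<close>

definition H :: "real \<Rightarrow> 'a \<Rightarrow> real" where
  "H u \<omega> = V u \<omega> / Y u \<omega>"

text \<open>Truncation supplies the boundedness that \<open>simple_integrand\<close> demands of each
  coefficient.\<close>

definition clip :: "nat \<Rightarrow> real \<Rightarrow> real" where
  "clip N x = max (- real N) (min (real N) x)"

lemma clip_abs_le: "\<bar>clip N x\<bar> \<le> real N"
  by (auto simp: clip_def)

lemma clip_diff_le: "\<bar>clip N x - x\<bar> \<le> \<bar>x\<bar>"
  by (auto simp: clip_def max_def min_def)

lemma clip_eq: "\<bar>x\<bar> \<le> real N \<Longrightarrow> clip N x = x"
  by (auto simp: clip_def)

lemma clip_measurable [measurable]: "clip N \<in> borel_measurable borel"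
  unfolding clip_def [abs_def] by measurable

lemma H_joint: "(\<lambda>(u, \<omega>). indicator {0..<T} u * H u \<omega>) \<in> borel_measurable (borel \<Otimes>\<^sub>M M)"
proof (rule joint_measurable)
  show "H t \<in> borel_measurable M" if "0 \<le> t" "t < T" for t
    unfolding H_def [abs_def] using nice_V [of t] nice_Y [of t] that by (auto dest!: nice_measurable)
  show "continuous_on {0..<T} (\<lambda>t. H t \<omega>)" if "\<omega> \<in> space M" for \<omega>
    unfolding H_def using that geom_bm_pos [of _ \<omega>]
    by (intro continuous_on_divide V_continuous continuous_on_subset [OF Y_continuous]) (auto simp: less_le)
qed

lemma H_continuous: "\<omega> \<in> space M \<Longrightarrow> continuous_on {0..<T} (\<lambda>t. H t \<omega>)"
  unfolding H_def using geom_bm_pos [of _ \<omega>]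
  by (intro continuous_on_divide V_continuous continuous_on_subset [OF Y_continuous]) (auto simp: less_le)

definition grid :: "nat \<Rightarrow> nat \<Rightarrow> real" where
  "grid K i = T * real i / real (Suc K)"

lemma grid_simple_integrand: "simple_integrand F T (Suc K) (grid K) (\<lambda>i \<omega>. clip N (H (grid K i) \<omega>))"
  unfolding simple_integrand_def
proof (intro conjI allI impI)
  show "0 \<le> grid K 0" "grid K (Suc K) \<le> T" by (simp_all add: grid_def)
  fix i assume i: "i < Suc K"
  show "grid K i \<le> grid K (Suc i)" using T0 by (simp add: grid_def divide_right_mono)
  have s: "0 \<le> grid K i" using T0 by (simp add: grid_def)
  show "(\<lambda>\<omega>. clip N (H (grid K i) \<omega>)) \<in> borel_measurable (F (grid K i))"
    using measurable_V [OF s order_refl] measurable_Y [OF s order_refl] unfolding H_def by measurable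
  show "\<exists>C. \<forall>\<omega>\<in>space (F (grid K i)). \<bar>clip N (H (grid K i) \<omega>)\<bar> \<le> C" using clip_abs_le by blast
qed

abbreviation "grid_process N K \<equiv> simple_process (Suc K) (grid K) (\<lambda>i \<omega>. clip N (H (grid K i) \<omega>))"

lemma grid_process_eq:
  assumes "0 < u" "u < T"
  shows "\<exists>i\<le>K. grid K i < u \<and> u \<le> grid K i + T / real (Suc K) \<and> grid_process N K u \<omega> = clip N (H (grid K i) \<omega>)"
proof -
  define x where "x = u * real (Suc K) / T"
  have "u * real (Suc K) < T * real (Suc K)" using assms by (intro mult_strict_right_mono) auto
  then have x: "0 < x" "x < real (Suc K)"
    using assms T0 by (simp_all add: x_def pos_divide_less_eq mult.commute del: of_nat_Suc)
  \<comment> \<open>Ceiling minus one instead of the floor, because the cells are open on the left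
    and closed on the right.\<close>
  define i where "i = nat (\<lceil>x\<rceil> - 1)"
  have "0 < \<lceil>x\<rceil>" using x by simp
  then have "real i = real_of_int \<lceil>x\<rceil> - 1" by (simp add: i_def)
  then have i: "real i < x" "x \<le> real i + 1" by linarith+
  then have iK: "i < Suc K" using x by linarith
  have g: "grid K i < u" "u \<le> grid K (Suc i)"
    using i T0 by (simp_all add: grid_def x_def field_simps)
  have "grid_process N K u \<omega> = clip N (H (grid K i) \<omega>)"
    by (rule simple_integral_cases(5)) (use grid_simple_integrand [of K N] iK g in \<open>auto simp: simple_integrand_def\<close>)
  moreover have "grid K (Suc i) = grid K i + T / real (Suc K)"
    by (simp add: grid_def distrib_left add_divide_distrib del: of_nat_Suc) (simp add: distrib_left add_divide_distrib)
  ultimately show ?thesis using iK g by (intro exI [of _ i]) auto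
qed

lemma grid_process_tendsto:
  assumes u: "0 < u" "u < T" and \<omega>: "\<omega> \<in> space M"
  shows "(\<lambda>K. grid_process N K u \<omega>) \<longlonglongrightarrow> clip N (H u \<omega>)"
proof -
  have "\<forall>K. \<exists>i. i \<le> K \<and> grid K i < u \<and> u \<le> grid K i + T / real (Suc K) \<and> grid_process N K u \<omega> = clip N (H (grid K i) \<omega>)"
    using grid_process_eq [OF u] by blast
  then obtain i where i: "\<And>K. grid K (i K) < u" "\<And>K. u \<le> grid K (i K) + T / real (Suc K)"
      "\<And>K. grid_process N K u \<omega> = clip N (H (grid K (i K)) \<omega>)" by metis
  have lim: "(\<lambda>K. grid K (i K)) \<longlonglongrightarrow> u"
  proof (rule tendsto_sandwich [of "\<lambda>K. u - T * inverse (real (Suc K))" _ _ "\<lambda>_. u"])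
    have "(\<lambda>K. u - T * inverse (real (Suc K))) \<longlonglongrightarrow> u - T * 0"
      by (intro tendsto_diff tendsto_mult tendsto_const LIMSEQ_inverse_real_of_nat)
    then show "(\<lambda>K. u - T * inverse (real (Suc K))) \<longlonglongrightarrow> u" by simp
    show "\<forall>\<^sub>F K in sequentially. u - T * inverse (real (Suc K)) \<le> grid K (i K)"
      using i(2) by (intro always_eventually allI) (simp add: divide_inverse diff_le_eq del: of_nat_Suc)
    show "\<forall>\<^sub>F K in sequentially. grid K (i K) \<le> u"
      using i(1) by (intro always_eventually allI less_imp_le)
  qed auto
  have "grid K (i K) \<in> {0..<T}" for K using i(1) [of K] u T0 by (auto simp: grid_def)
  then have "(\<lambda>K. H (grid K (i K)) \<omega>) \<longlonglongrightarrow> H u \<omega>"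
    by (intro continuous_on_tendsto_compose [OF H_continuous [OF \<omega>] lim]) (use u in auto)
  then have "(\<lambda>K. clip N (H (grid K (i K)) \<omega>)) \<longlonglongrightarrow> clip N (H u \<omega>)"
    unfolding clip_def by (intro tendsto_max tendsto_min tendsto_const)
  then show ?thesis unfolding i(3) .
qed

lemma nn_integral_iterated:
  assumes "(\<lambda>(u, \<omega>). h u \<omega>) \<in> borel_measurable (borel \<Otimes>\<^sub>M M)"
  shows "(\<integral>\<^sup>+u. (\<integral>\<^sup>+\<omega>. h u \<omega> \<partial>M) \<partial>lborel) = (\<integral>\<^sup>+p. h (fst p) (snd p) \<partial>(lborel \<Otimes>\<^sub>M M))"
    and "(\<integral>\<^sup>+u. (\<integral>\<^sup>+\<omega>. h u \<omega> \<partial>M) \<partial>lborel) = (\<integral>\<^sup>+\<omega>. (\<integral>\<^sup>+u. h u \<omega> \<partial>lborel) \<partial>M)"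
proof -
  interpret P: pair_sigma_finite lborel M ..
  have m: "(\<lambda>p. h (fst p) (snd p)) \<in> borel_measurable (lborel \<Otimes>\<^sub>M M)"
    using assms by (simp add: case_prod_beta' cong: measurable_cong_sets)
  show "(\<integral>\<^sup>+u. (\<integral>\<^sup>+\<omega>. h u \<omega> \<partial>M) \<partial>lborel) = (\<integral>\<^sup>+p. h (fst p) (snd p) \<partial>(lborel \<Otimes>\<^sub>M M))"
    using nn_integral_fst [OF m] by simp
  show "(\<integral>\<^sup>+u. (\<integral>\<^sup>+\<omega>. h u \<omega> \<partial>M) \<partial>lborel) = (\<integral>\<^sup>+\<omega>. (\<integral>\<^sup>+u. h u \<omega> \<partial>lborel) \<partial>M)"
    using P.Fubini' [of h] m by (simp add: case_prod_beta')
qed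

abbreviation P :: "(real \<times> 'a) measure" where "P \<equiv> lborel \<Otimes>\<^sub>M M"

lemma P_measurable:
  "(\<lambda>(u, \<omega>). f u \<omega>) \<in> borel_measurable (borel \<Otimes>\<^sub>M M) \<Longrightarrow> (\<lambda>p. f (fst p) (snd p)) \<in> borel_measurable P"
  by (simp add: case_prod_beta' cong: measurable_cong_sets)

text \<open>Truncation moves H by at most |H|, and |H| Y = |V|, so V^2 dominates. For each fixed
  time and path the truncation is inactive for large N.\<close>

lemma clip_approx:
  "(\<lambda>N. \<integral>\<^sup>+p. ennreal (indicator {0..<T} (fst p) * ((clip N (H (fst p) (snd p)) - H (fst p) (snd p)) * Y (fst p) (snd p))\<^sup>2) \<partial>P) \<longlonglongrightarrow> 0"
proof -
  note [measurable] = P_measurable [OF H_joint] P_measurable [OF Y_joint] P_measurable [OF V_joint]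
  let ?u = "\<lambda>N p. ennreal (indicator {0..<T} (fst p) * ((clip N (H (fst p) (snd p)) - H (fst p) (snd p)) * Y (fst p) (snd p))\<^sup>2)"
  let ?w = "\<lambda>p. ennreal (indicator {0..<T} (fst p) * (V (fst p) (snd p))\<^sup>2)"
  have "(\<lambda>N. \<integral>\<^sup>+p. ?u N p \<partial>P) \<longlonglongrightarrow> (\<integral>\<^sup>+p. 0 \<partial>P)"
  proof (rule nn_integral_dominated_convergence [where w = ?w])
    fix N
    have "(\<lambda>p. ennreal (((clip N (indicator {0..<T} (fst p) * H (fst p) (snd p)) - indicator {0..<T} (fst p) * H (fst p) (snd p)) *
        (indicator {0..<T} (fst p) * Y (fst p) (snd p)))\<^sup>2)) \<in> borel_measurable P"
      by measurable
    also have "(\<lambda>p. ennreal (((clip N (indicator {0..<T} (fst p) * H (fst p) (snd p)) - indicator {0..<T} (fst p) * H (fst p) (snd p)) *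
        (indicator {0..<T} (fst p) * Y (fst p) (snd p)))\<^sup>2)) = ?u N"
      by (auto simp: fun_eq_iff indicator_def)
    finally show "?u N \<in> borel_measurable P" .
    show "AE p in P. ?u N p \<le> ?w p"
    proof (intro AE_I2 ennreal_leI mult_left_mono)
      fix p :: "real \<times> 'a"
      have "\<bar>(clip N (H (fst p) (snd p)) - H (fst p) (snd p)) * Y (fst p) (snd p)\<bar> \<le> \<bar>H (fst p) (snd p)\<bar> * Y (fst p) (snd p)"
        unfolding abs_mult using clip_diff_le geom_bm_pos [of "fst p" "snd p"] by (intro mult_mono) auto
      also have "\<dots> = \<bar>V (fst p) (snd p)\<bar>" using geom_bm_pos [of "fst p" "snd p"] by (simp add: H_def)
      finally show "((clip N (H (fst p) (snd p)) - H (fst p) (snd p)) * Y (fst p) (snd p))\<^sup>2 \<le> (V (fst p) (snd p))\<^sup>2"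
        by (rule abs_le_square_iff [THEN iffD1])
    qed simp
  next
    have "(\<lambda>p. ennreal ((indicator {0..<T} (fst p) * V (fst p) (snd p))\<^sup>2)) \<in> borel_measurable P"
      by measurable
    also have "(\<lambda>p. ennreal ((indicator {0..<T} (fst p) * V (fst p) (snd p))\<^sup>2)) = ?w"
      by (auto simp: fun_eq_iff indicator_def)
    finally show "?w \<in> borel_measurable P" .
    have "(\<lambda>(u, \<omega>). ennreal ((indicator {0..<T} u * V u \<omega>)\<^sup>2)) \<in> borel_measurable (borel \<Otimes>\<^sub>M M)"
      using V_joint by (simp add: case_prod_beta')
    also have "(\<lambda>(u, \<omega>). ennreal ((indicator {0..<T} u * V u \<omega>)\<^sup>2)) = (\<lambda>(u, \<omega>). ennreal (indicator {0..<T} u * (V u \<omega>)\<^sup>2))"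
      by (auto simp: fun_eq_iff indicator_def)
    finally have "(\<integral>\<^sup>+u. (\<integral>\<^sup>+\<omega>. ennreal (indicator {0..<T} u * (V u \<omega>)\<^sup>2) \<partial>M) \<partial>lborel) = (\<integral>\<^sup>+p. ?w p \<partial>P)"
      by (rule nn_integral_iterated)
    then show "(\<integral>\<^sup>+p. ?w p \<partial>P) < \<infinity>" using V_square_integrable by simp
    show "AE p in P. (\<lambda>N. ?u N p) \<longlonglongrightarrow> 0"
    proof (intro AE_I2)
      fix p :: "real \<times> 'a"
      have "\<forall>\<^sub>F N in sequentially. \<bar>H (fst p) (snd p)\<bar> \<le> real N"
        using eventually_ge_at_top [of "nat \<lceil>\<bar>H (fst p) (snd p)\<bar>\<rceil>"] by eventually_elim linarith
      then have "\<forall>\<^sub>F N in sequentially. ?u N p = 0" by eventually_elim (simp add: clip_eq)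
      then show "(\<lambda>N. ?u N p) \<longlonglongrightarrow> 0" by (rule tendsto_eventually)
    qed
  qed auto
  then show ?thesis by simp
qed

lemma grid_joint: "(\<lambda>(u, \<omega>). grid_process N K u \<omega>) \<in> borel_measurable (borel \<Otimes>\<^sub>M M)"
  using simple_integrand_nice [OF grid_simple_integrand] by (intro simple_process_joint) (auto dest: nice_measurable)

text \<open>For a fixed truncation level 4 N^2 Y^2 dominates, and the convergence comes from
  continuity of H along paths. Time 0 is left out: it belongs to no cell, so the simple process
  vanishes there; being a null set it can be removed later.\<close>

lemma grid_approx:
  "(\<lambda>K. \<integral>\<^sup>+p. ennreal (indicator {0<..<T} (fst p) * ((grid_process N K (fst p) (snd p) - clip N (H (fst p) (snd p))) * Y (fst p) (snd p))\<^sup>2) \<partial>P) \<longlonglongrightarrow> 0"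
proof -
  note [measurable] = P_measurable [OF H_joint] P_measurable [OF Y_joint] P_measurable [OF grid_joint]
  let ?u = "\<lambda>K p. ennreal (indicator {0<..<T} (fst p) * ((grid_process N K (fst p) (snd p) - clip N (H (fst p) (snd p))) * Y (fst p) (snd p))\<^sup>2)"
  let ?w = "\<lambda>p. ennreal (4 * (real N)\<^sup>2) * ennreal ((indicator {0..<T} (fst p) * Y (fst p) (snd p))\<^sup>2)"
  have "(\<lambda>K. \<integral>\<^sup>+p. ?u K p \<partial>P) \<longlonglongrightarrow> (\<integral>\<^sup>+p. 0 \<partial>P)"
  proof (rule nn_integral_dominated_convergence [where w = ?w])
    fix K
    have "(\<lambda>p. ennreal (indicator {0<..<T} (fst p) * ((grid_process N K (fst p) (snd p) - clip N (indicator {0..<T} (fst p) * H (fst p) (snd p))) *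
        (indicator {0..<T} (fst p) * Y (fst p) (snd p)))\<^sup>2)) \<in> borel_measurable P"
      by measurable
    also have "(\<lambda>p. ennreal (indicator {0<..<T} (fst p) * ((grid_process N K (fst p) (snd p) - clip N (indicator {0..<T} (fst p) * H (fst p) (snd p))) *
        (indicator {0..<T} (fst p) * Y (fst p) (snd p)))\<^sup>2)) = ?u K"
      by (auto simp: fun_eq_iff indicator_def)
    finally show "?u K \<in> borel_measurable P" .
    show "AE p in P. ?u K p \<le> ?w p"
    proof (intro AE_I2)
      fix p :: "real \<times> 'a"
      obtain u \<omega> where p: "p = (u, \<omega>)" by (cases p)
      show "?u K p \<le> ?w p"
      proof (cases "0 < u \<and> u < T")
        case True
        obtain i where "grid_process N K u \<omega> = clip N (H (grid K i) \<omega>)"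
          using grid_process_eq True by blast
        then have "\<bar>grid_process N K u \<omega> - clip N (H u \<omega>)\<bar> \<le> 2 * real N"
          using clip_abs_le [of N "H (grid K i) \<omega>"] clip_abs_le [of N "H u \<omega>"] by linarith
        then have "(grid_process N K u \<omega> - clip N (H u \<omega>))\<^sup>2 \<le> (2 * real N)\<^sup>2"
          by (metis abs_ge_zero power2_abs power_mono)
        then have "(grid_process N K u \<omega> - clip N (H u \<omega>))\<^sup>2 * (Y u \<omega>)\<^sup>2 \<le> (2 * real N)\<^sup>2 * (Y u \<omega>)\<^sup>2"
          by (rule mult_right_mono) simp
        then show ?thesis using True by (simp add: p power_mult_distrib ennreal_mult' [symmetric] ennreal_leI)
      qed (simp add: p)
    qed
  next
    have "(\<lambda>(u, \<omega>). ennreal ((indicator {0..<T} u * Y u \<omega>)\<^sup>2)) \<in> borel_measurable (borel \<Otimes>\<^sub>M M)"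
      using Y_joint by (simp add: case_prod_beta')
    then have "(\<integral>\<^sup>+p. ennreal ((indicator {0..<T} (fst p) * Y (fst p) (snd p))\<^sup>2) \<partial>P) =
        (\<integral>\<^sup>+u. (\<integral>\<^sup>+\<omega>. ennreal ((indicator {0..<T} u * Y u \<omega>)\<^sup>2) \<partial>M) \<partial>lborel)"
      by (rule nn_integral_iterated [symmetric])
    also have "\<dots> \<le> (\<integral>\<^sup>+u. ennreal (2 * exp (2\<^sup>2 * T / 2)) * indicator {0..<T} u \<partial>lborel)"
    proof (intro nn_integral_mono)
      fix u
      show "(\<integral>\<^sup>+\<omega>. ennreal ((indicator {0..<T} u * Y u \<omega>)\<^sup>2) \<partial>M) \<le> ennreal (2 * exp (2\<^sup>2 * T / 2)) * indicator {0..<T} u"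
      proof (cases "u \<in> {0..<T}")
        case True then show ?thesis using nn_integral_Y_square [of u] by simp
      qed simp
    qed
    also have "\<dots> = ennreal (2 * exp (2\<^sup>2 * T / 2)) * ennreal T" using T0 by (simp add: nn_integral_cmult)
    also have "\<dots> < \<infinity>" by (simp add: ennreal_mult_less_top)
    finally have "(\<integral>\<^sup>+p. ennreal ((indicator {0..<T} (fst p) * Y (fst p) (snd p))\<^sup>2) \<partial>P) < \<infinity>" .
    moreover have "(\<integral>\<^sup>+p. ?w p \<partial>P) =
        ennreal (4 * (real N)\<^sup>2) * (\<integral>\<^sup>+p. ennreal ((indicator {0..<T} (fst p) * Y (fst p) (snd p))\<^sup>2) \<partial>P)"
      by (rule nn_integral_cmult) measurable
    ultimately show "(\<integral>\<^sup>+p. ?w p \<partial>P) < \<infinity>" by (simp add: ennreal_mult_less_top)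
    show "AE p in P. (\<lambda>K. ?u K p) \<longlonglongrightarrow> 0"
    proof (intro AE_I2)
      fix p assume "p \<in> space P"
      then obtain u \<omega> where p: "p = (u, \<omega>)" "\<omega> \<in> space M" by (auto simp: space_pair_measure)
      show "(\<lambda>K. ?u K p) \<longlonglongrightarrow> 0"
      proof (cases "0 < u \<and> u < T")
        case True
        then have "(\<lambda>K. grid_process N K u \<omega>) \<longlonglongrightarrow> clip N (H u \<omega>)" using grid_process_tendsto p by blast
        then have "(\<lambda>K. ((grid_process N K u \<omega> - clip N (H u \<omega>)) * Y u \<omega>)\<^sup>2) \<longlonglongrightarrow> ((clip N (H u \<omega>) - clip N (H u \<omega>)) * Y u \<omega>)\<^sup>2"
          by (intro tendsto_intros)
        then have "(\<lambda>K. ennreal (((grid_process N K u \<omega> - clip N (H u \<omega>)) * Y u \<omega>)\<^sup>2)) \<longlonglongrightarrow> ennreal (((clip N (H u \<omega>) - clip N (H u \<omega>)) * Y u \<omega>)\<^sup>2)"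
          by (rule tendsto_ennrealI)
        then show ?thesis using True by (simp add: p)
      qed (simp add: p)
    qed
  qed (auto intro!: borel_measurable_const)
  then show ?thesis by simp
qed

lemma (in -) ennreal_le_double_sum:
  fixes x a b :: real
  assumes "x \<le> 2 * a + 2 * b" "0 \<le> a" "0 \<le> b"
  shows "ennreal x \<le> 2 * ennreal a + 2 * ennreal b"
proof -
  have "ennreal x \<le> ennreal (2 * a + 2 * b)" using assms(1) by (rule ennreal_leI)
  also have "\<dots> = ennreal (2 * a) + ennreal (2 * b)" using assms by (intro ennreal_plus) auto
  also have "\<dots> = 2 * ennreal a + 2 * ennreal b" by (simp add: ennreal_mult')
  finally show ?thesis .
qed

text \<open>A diagonal choice: the truncation level N comes first, then a grid fine enough for this
  level.\<close>

lemma hedge_approx: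
  "\<exists>K. (\<lambda>N. \<integral>\<^sup>+u. (\<integral>\<^sup>+\<omega>. ennreal (gap (Suc (K N)) (grid (K N)) (\<lambda>i \<omega>. clip N (H (grid (K N) i) \<omega>)) u \<omega>) \<partial>M) \<partial>lborel) \<longlonglongrightarrow> 0"
proof -
  let ?A = "\<lambda>N p. ennreal (indicator {0..<T} (fst p) * ((clip N (H (fst p) (snd p)) - H (fst p) (snd p)) * Y (fst p) (snd p))\<^sup>2)"
  let ?B = "\<lambda>N K p. ennreal (indicator {0<..<T} (fst p) * ((grid_process N K (fst p) (snd p) - clip N (H (fst p) (snd p))) * Y (fst p) (snd p))\<^sup>2)"
  have "\<exists>K. (\<integral>\<^sup>+p. ?B N K p \<partial>P) < ennreal (inverse (real (Suc N)))" for N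
  proof -
    have "\<forall>\<^sub>F K in sequentially. (\<integral>\<^sup>+p. ?B N K p \<partial>P) < ennreal (inverse (real (Suc N)))"
      by (rule order_tendstoD(2) [OF grid_approx]) simp
    then show ?thesis by (rule eventually_happens'[OF sequentially_bot])
  qed
  then have "\<forall>N. \<exists>K. (\<integral>\<^sup>+p. ?B N K p \<partial>P) < ennreal (inverse (real (Suc N)))" ..
  from choice [OF this] obtain K where K: "\<And>N. (\<integral>\<^sup>+p. ?B N (K N) p \<partial>P) < ennreal (inverse (real (Suc N)))" by blast
  let ?g = "\<lambda>N u \<omega>. gap (Suc (K N)) (grid (K N)) (\<lambda>i \<omega>. clip N (H (grid (K N) i) \<omega>)) u \<omega>"
  note [measurable] = P_measurable [OF H_joint] P_measurable [OF Y_joint] P_measurable [OF grid_joint]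
  have bound: "(\<integral>\<^sup>+u. (\<integral>\<^sup>+\<omega>. ennreal (?g N u \<omega>) \<partial>M) \<partial>lborel) \<le> 2 * (\<integral>\<^sup>+p. ?A N p \<partial>P) + 2 * ennreal (inverse (real (Suc N)))" for N
  proof -
    let ?h = "\<lambda>u \<omega>. indicator {0<..<T} u * ?g N u \<omega>"
    have mA: "?A N \<in> borel_measurable P"
    proof -
      have "(\<lambda>p. ennreal (((clip N (indicator {0..<T} (fst p) * H (fst p) (snd p)) - indicator {0..<T} (fst p) * H (fst p) (snd p)) *
        (indicator {0..<T} (fst p) * Y (fst p) (snd p)))\<^sup>2)) \<in> borel_measurable P"
        by measurable
      also have "(\<lambda>p. ennreal (((clip N (indicator {0..<T} (fst p) * H (fst p) (snd p)) - indicator {0..<T} (fst p) * H (fst p) (snd p)) *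
        (indicator {0..<T} (fst p) * Y (fst p) (snd p)))\<^sup>2)) = ?A N"
        by (auto simp: fun_eq_iff indicator_def)
      finally show ?thesis .
    qed
    have mB: "?B N (K N) \<in> borel_measurable P"
    proof -
      have "(\<lambda>p. ennreal (indicator {0<..<T} (fst p) * ((grid_process N (K N) (fst p) (snd p) - clip N (indicator {0..<T} (fst p) * H (fst p) (snd p))) *
        (indicator {0..<T} (fst p) * Y (fst p) (snd p)))\<^sup>2)) \<in> borel_measurable P"
        by measurable
      also have "(\<lambda>p. ennreal (indicator {0<..<T} (fst p) * ((grid_process N (K N) (fst p) (snd p) - clip N (indicator {0..<T} (fst p) * H (fst p) (snd p))) *
        (indicator {0..<T} (fst p) * Y (fst p) (snd p)))\<^sup>2)) = ?B N (K N)"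
        by (auto simp: fun_eq_iff indicator_def)
      finally show ?thesis .
    qed
    have "(\<integral>\<^sup>+u. (\<integral>\<^sup>+\<omega>. ennreal (?g N u \<omega>) \<partial>M) \<partial>lborel) = (\<integral>\<^sup>+u. (\<integral>\<^sup>+\<omega>. ennreal (?h u \<omega>) \<partial>M) \<partial>lborel)"
    proof (rule nn_integral_cong_AE)
      show "AE u in lborel. (\<integral>\<^sup>+\<omega>. ennreal (?g N u \<omega>) \<partial>M) = (\<integral>\<^sup>+\<omega>. ennreal (?h u \<omega>) \<partial>M)"
        using AE_lborel_singleton [of 0] by eventually_elim (auto simp: gap_def indicator_def)
    qed
    also have "\<dots> = (\<integral>\<^sup>+p. ennreal (?h (fst p) (snd p)) \<partial>P)"
    proof (rule nn_integral_iterated(1))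
      show "(\<lambda>(u, \<omega>). ennreal (?h u \<omega>)) \<in> borel_measurable (borel \<Otimes>\<^sub>M M)"
        using gap_joint [OF grid_simple_integrand [of "K N" N]] by (simp add: case_prod_beta')
    qed
    also have "\<dots> \<le> (\<integral>\<^sup>+p. 2 * ?A N p + 2 * ?B N (K N) p \<partial>P)"
    proof (intro nn_integral_mono)
      fix p :: "real \<times> 'a"
      obtain u \<omega> where p: "p = (u, \<omega>)" by (cases p)
      show "ennreal (?h (fst p) (snd p)) \<le> 2 * ?A N p + 2 * ?B N (K N) p"
      proof (cases "0 < u \<and> u < T")
        case True
        let ?a = "(clip N (H u \<omega>) - H u \<omega>) * Y u \<omega>" and ?b = "(grid_process N (K N) u \<omega> - clip N (H u \<omega>)) * Y u \<omega>"
        have "V u \<omega> = H u \<omega> * Y u \<omega>" using geom_bm_pos [of u \<omega>] by (simp add: H_def)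
        then have "grid_process N (K N) u \<omega> * Y u \<omega> - V u \<omega> = ?a + ?b" by (simp add: algebra_simps)
        moreover have "(?a + ?b)\<^sup>2 \<le> 2 * ?a\<^sup>2 + 2 * ?b\<^sup>2"
          using zero_le_power2 [of "?a - ?b"] unfolding power2_sum power2_diff by linarith
        ultimately have "?g N u \<omega> \<le> 2 * ?a\<^sup>2 + 2 * ?b\<^sup>2" using True by (simp add: gap_def)
        then have "ennreal (?g N u \<omega>) \<le> 2 * ennreal (?a\<^sup>2) + 2 * ennreal (?b\<^sup>2)"
          by (rule ennreal_le_double_sum) simp_all
        then show ?thesis using True by (simp add: p)
      qed (simp add: p)
    qed
    also have "\<dots> = 2 * (\<integral>\<^sup>+p. ?A N p \<partial>P) + 2 * (\<integral>\<^sup>+p. ?B N (K N) p \<partial>P)"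
      using mA mB by (subst nn_integral_add) (auto intro!: borel_measurable_times_ennreal simp: nn_integral_cmult)
    also have "\<dots> \<le> 2 * (\<integral>\<^sup>+p. ?A N p \<partial>P) + 2 * ennreal (inverse (real (Suc N)))"
      using K [of N] by (intro add_left_mono mult_left_mono less_imp_le) auto
    finally show ?thesis .
  qed
  have "(\<lambda>N. 2 * (\<integral>\<^sup>+p. ?A N p \<partial>P) + 2 * ennreal (inverse (real (Suc N)))) \<longlonglongrightarrow> 2 * 0 + 2 * ennreal 0"
    by (intro tendsto_add ennreal_tendsto_cmult clip_approx tendsto_ennrealI LIMSEQ_inverse_real_of_nat) simp_all
  then have lim: "(\<lambda>N. 2 * (\<integral>\<^sup>+p. ?A N p \<partial>P) + 2 * ennreal (inverse (real (Suc N)))) \<longlonglongrightarrow> 0" by simp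
  show ?thesis
    by (intro exI [of _ K] tendsto_sandwich [OF _ _ tendsto_const lim])
       (use bound in \<open>auto intro!: always_eventually\<close>)
qed

section \<open>Identification of the integral with the value process\<close>

abbreviation "hedge_process \<equiv> hedge M W T (\<lambda>x. g\<theta> x + g1 x)"

lemma hedge_process_eq: "0 \<le> t \<Longrightarrow> t < T \<Longrightarrow> hedge_process t \<omega> = H t \<omega>"
  unfolding H_def by (rule hedge_eq)

lemma hedge_measurable:
  "(\<lambda>(u, \<omega>). hedge_process u \<omega>) \<in> borel_measurable (restrict_space borel {0..<T} \<Otimes>\<^sub>M M)"
proof -
  have "fst \<in> measurable (restrict_space borel {0..<T} \<Otimes>\<^sub>M M) borel"
    by (rule measurable_compose [OF measurable_fst measurable_restrict_space1 [OF measurable_ident_sets [OF refl]]])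
  then have "(\<lambda>p. (fst p, snd p)) \<in> measurable (restrict_space borel {0..<T} \<Otimes>\<^sub>M M) (borel \<Otimes>\<^sub>M M)"
    by (intro measurable_Pair measurable_snd)
  from measurable_compose [OF this H_joint]
  have "(\<lambda>p. indicator {0..<T} (fst p) * H (fst p) (snd p)) \<in> borel_measurable (restrict_space borel {0..<T} \<Otimes>\<^sub>M M)"
    by simp
  also have "?this \<longleftrightarrow> ?thesis"
    by (rule measurable_cong) (auto simp: space_pair_measure space_restrict_space hedge_process_eq)
  finally show ?thesis .
qed

lemma hedge_gap:
  assumes "simple_integrand F T m s \<xi>"
  shows "(\<integral>\<^sup>+\<omega>. (\<integral>\<^sup>+u\<in>{0..<T}. ennreal ((simple_process m s \<xi> u \<omega> - hedge_process u \<omega>)\<^sup>2 * (Y u \<omega>)\<^sup>2) \<partial>lborel) \<partial>M) =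
    (\<integral>\<^sup>+u. (\<integral>\<^sup>+\<omega>. ennreal (gap m s \<xi> u \<omega>) \<partial>M) \<partial>lborel)"
proof -
  have "ennreal ((simple_process m s \<xi> u \<omega> - hedge_process u \<omega>)\<^sup>2 * (Y u \<omega>)\<^sup>2) * indicator {0..<T} u = ennreal (gap m s \<xi> u \<omega>)" for u \<omega>
  proof (cases "u \<in> {0..<T}")
    case True
    have "(simple_process m s \<xi> u \<omega> - H u \<omega>) * Y u \<omega> = simple_process m s \<xi> u \<omega> * Y u \<omega> - V u \<omega>"
      using geom_bm_pos [of u \<omega>] by (simp add: H_def left_diff_distrib)
    then show ?thesis using True by (simp add: gap_def hedge_process_eq power_mult_distrib [symmetric])
  qed (simp add: gap_def)
  moreover have "(\<lambda>(u, \<omega>). ennreal (gap m s \<xi> u \<omega>)) \<in> borel_measurable (borel \<Otimes>\<^sub>M M)"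
    using gap_joint [OF assms] by (simp add: case_prod_beta')
  ultimately show ?thesis by (simp add: nn_integral_iterated(2))
qed

lemma hedge_ito: "is_ito_integral M F T Y (\<lambda>u \<omega>. (Y u \<omega>)\<^sup>2) hedge_process X"
proof -
  obtain K where K: "(\<lambda>N. \<integral>\<^sup>+u. (\<integral>\<^sup>+\<omega>. ennreal (gap (Suc (K N)) (grid (K N)) (\<lambda>i \<omega>. clip N (H (grid (K N) i) \<omega>)) u \<omega>) \<partial>M) \<partial>lborel) \<longlonglongrightarrow> 0"
    using hedge_approx by blast
  let ?m = "\<lambda>N. Suc (K N)" and ?s = "\<lambda>N. grid (K N)" and ?x = "\<lambda>N i \<omega>. clip N (H (grid (K N) i) \<omega>)"
  have si: "\<forall>k. simple_integrand F T (?m k) (?s k) (?x k)" using grid_simple_integrand by blast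
  have lim: "(\<lambda>k. \<integral>\<^sup>+\<omega>. ennreal ((simple_integral Y (?m k) (?s k) (?x k) t \<omega> - X t \<omega>)\<^sup>2) \<partial>M) \<longlonglongrightarrow> 0"
    if t: "t \<in> {0..T}" for t
  proof (rule tendsto_sandwich [OF _ _ tendsto_const])
    have "(\<lambda>N. ennreal (2 * exp T) * (\<integral>\<^sup>+u. (\<integral>\<^sup>+\<omega>. ennreal (gap (?m N) (?s N) (?x N) u \<omega>) \<partial>M) \<partial>lborel)) \<longlonglongrightarrow> ennreal (2 * exp T) * 0"
      by (rule ennreal_tendsto_cmult [OF _ K]) simp
    then show "(\<lambda>N. ennreal (2 * exp T) * (\<integral>\<^sup>+u. (\<integral>\<^sup>+\<omega>. ennreal (gap (?m N) (?s N) (?x N) u \<omega>) \<partial>M) \<partial>lborel)) \<longlonglongrightarrow> 0"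
      by simp
    show "\<forall>\<^sub>F N in sequentially. (\<integral>\<^sup>+\<omega>. ennreal ((simple_integral Y (?m N) (?s N) (?x N) t \<omega> - X t \<omega>)\<^sup>2) \<partial>M) \<le>
        ennreal (2 * exp T) * (\<integral>\<^sup>+u. (\<integral>\<^sup>+\<omega>. ennreal (gap (?m N) (?s N) (?x N) u \<omega>) \<partial>M) \<partial>lborel)"
      using simple_isometry [OF grid_simple_integrand] t by (intro always_eventually allI) auto
  qed (simp add: always_eventually)
  have gap: "(\<lambda>k. \<integral>\<^sup>+\<omega>. (\<integral>\<^sup>+u\<in>{0..<T}. ennreal ((simple_process (?m k) (?s k) (?x k) u \<omega> - hedge_process u \<omega>)\<^sup>2 * (Y u \<omega>)\<^sup>2) \<partial>lborel) \<partial>M) \<longlonglongrightarrow> 0"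
    unfolding hedge_gap [OF grid_simple_integrand] by (rule K)
  show ?thesis
    unfolding is_ito_integral_def
  proof (intro conjI ballI hedge_measurable)
    show "X t \<in> borel_measurable (F t)" if "t \<in> {0..T}" for t using that measurable_X by simp
    show "continuous_on {0..T} (\<lambda>t. X t \<omega>)" if "\<omega> \<in> space M" for \<omega> using that by (rule X_continuous)
    show "\<exists>m s \<xi>. (\<forall>k. simple_integrand F T (m k) (s k) (\<xi> k)) \<and>
      (\<lambda>k. \<integral>\<^sup>+\<omega>. (\<integral>\<^sup>+u\<in>{0..<T}. ennreal ((simple_process (m k) (s k) (\<xi> k) u \<omega> - hedge_process u \<omega>)\<^sup>2 * (Y u \<omega>)\<^sup>2) \<partial>lborel) \<partial>M) \<longlonglongrightarrow> 0 \<and>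
      (\<forall>t\<in>{0..T}. (\<lambda>k. \<integral>\<^sup>+\<omega>. ennreal ((simple_integral Y (m k) (s k) (\<xi> k) t \<omega> - X t \<omega>)\<^sup>2) \<partial>M) \<longlonglongrightarrow> 0)"
      by (rule exI [of _ ?m], rule exI [of _ ?s], rule exI [of _ ?x]) (use si gap lim in blast)
  qed
qed

text \<open>\<open>simple_isometry\<close> holds for every simple integrand, so whichever sequence
  defines X', its integrals converge to X as well. Both are limits in L^2 of one sequence.\<close>

lemma ito_unique:
  assumes X': "is_ito_integral M F T Y (\<lambda>u \<omega>. (Y u \<omega>)\<^sup>2) hedge_process X'" and t: "0 \<le> t" "t \<le> T"
  shows "AE \<omega> in M. X' t \<omega> = X t \<omega>"
proof -
  obtain m s \<xi> where si: "\<And>k::nat. simple_integrand F T (m k) (s k) (\<xi> k)"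
    and gap: "(\<lambda>k. \<integral>\<^sup>+\<omega>. (\<integral>\<^sup>+u\<in>{0..<T}. ennreal ((simple_process (m k) (s k) (\<xi> k) u \<omega> - hedge_process u \<omega>)\<^sup>2 * (Y u \<omega>)\<^sup>2) \<partial>lborel) \<partial>M) \<longlonglongrightarrow> 0"
    and lim: "\<forall>t\<in>{0..T}. (\<lambda>k. \<integral>\<^sup>+\<omega>. ennreal ((simple_integral Y (m k) (s k) (\<xi> k) t \<omega> - X' t \<omega>)\<^sup>2) \<partial>M) \<longlonglongrightarrow> 0"
    using X' unfolding is_ito_integral_def by blast
  define I where "I k = simple_integral Y (m k) (s k) (\<xi> k) t" for k
  have mI [measurable]: "I k \<in> borel_measurable M" for k
    unfolding I_def using simple_integral_nice(1) [OF si t] by (rule nice_measurable)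
  have mX [measurable]: "X t \<in> borel_measurable M" using nice_X [OF t] by (rule nice_measurable)
  have "X' t \<in> borel_measurable (F t)" using X' t unfolding is_ito_integral_def by auto
  then have mX' [measurable]: "X' t \<in> borel_measurable M" using t by (intro F_measurable [of t])
  let ?J = "\<lambda>k. \<integral>\<^sup>+u. (\<integral>\<^sup>+\<omega>. ennreal (gap (m k) (s k) (\<xi> k) u \<omega>) \<partial>M) \<partial>lborel"
  let ?L = "\<lambda>k. \<integral>\<^sup>+\<omega>. ennreal ((I k \<omega> - X' t \<omega>)\<^sup>2) \<partial>M"
  have J: "?J \<longlonglongrightarrow> 0" using gap unfolding hedge_gap [OF si] .
  have L: "?L \<longlonglongrightarrow> 0" using lim t unfolding I_def by auto
  have bound: "(\<integral>\<^sup>+\<omega>. ennreal ((X' t \<omega> - X t \<omega>)\<^sup>2) \<partial>M) \<le> 2 * ?L k + 2 * (ennreal (2 * exp T) * ?J k)" for k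
  proof -
    have "(\<integral>\<^sup>+\<omega>. ennreal ((X' t \<omega> - X t \<omega>)\<^sup>2) \<partial>M) \<le>
        (\<integral>\<^sup>+\<omega>. 2 * ennreal ((I k \<omega> - X' t \<omega>)\<^sup>2) + 2 * ennreal ((I k \<omega> - X t \<omega>)\<^sup>2) \<partial>M)"
    proof (intro nn_integral_mono ennreal_le_double_sum)
      fix \<omega>
      have "(a - b)\<^sup>2 \<le> 2 * (c - a)\<^sup>2 + 2 * (c - b)\<^sup>2" for a b c :: real
        using zero_le_power2 [of "2 * c - a - b"] by (simp add: power2_eq_square algebra_simps)
      then show "(X' t \<omega> - X t \<omega>)\<^sup>2 \<le> 2 * (I k \<omega> - X' t \<omega>)\<^sup>2 + 2 * (I k \<omega> - X t \<omega>)\<^sup>2" .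
    qed simp_all
    also have "\<dots> = 2 * ?L k + 2 * (\<integral>\<^sup>+\<omega>. ennreal ((I k \<omega> - X t \<omega>)\<^sup>2) \<partial>M)"
      by (subst nn_integral_add) (simp_all add: nn_integral_cmult)
    also have "(\<integral>\<^sup>+\<omega>. ennreal ((I k \<omega> - X t \<omega>)\<^sup>2) \<partial>M) \<le> ennreal (2 * exp T) * ?J k"
      unfolding I_def by (rule simple_isometry [OF si t])
    finally show ?thesis by (simp add: add_left_mono mult_left_mono)
  qed
  have "(\<lambda>k. 2 * ?L k + 2 * (ennreal (2 * exp T) * ?J k)) \<longlonglongrightarrow> 2 * 0 + 2 * (ennreal (2 * exp T) * 0)"
    by (intro tendsto_add ennreal_tendsto_cmult L J) simp_all
  then have "(\<integral>\<^sup>+\<omega>. ennreal ((X' t \<omega> - X t \<omega>)\<^sup>2) \<partial>M) \<le> 2 * 0 + 2 * (ennreal (2 * exp T) * 0)"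
    by (rule LIMSEQ_le_const) (use bound in blast)
  then have "(\<integral>\<^sup>+\<omega>. ennreal ((X' t \<omega> - X t \<omega>)\<^sup>2) \<partial>M) = 0" by simp
  then have "AE \<omega> in M. ennreal ((X' t \<omega> - X t \<omega>)\<^sup>2) = 0"
    by (subst (asm) nn_integral_0_iff_AE) simp_all
  then show ?thesis by eventually_elim simp
qed

definition wealth :: "real \<Rightarrow> 'a \<Rightarrow> real" where
  "wealth = ito_integral M F T Y (\<lambda>u \<omega>. (Y u \<omega>)\<^sup>2) hedge_process"

lemma wealth_ito: "is_ito_integral M F T Y (\<lambda>u \<omega>. (Y u \<omega>)\<^sup>2) hedge_process wealth"
  unfolding wealth_def ito_integral_def by (rule someI [where P = "is_ito_integral M F T Y (\<lambda>u \<omega>. (Y u \<omega>)\<^sup>2) hedge_process", OF hedge_ito])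

lemma wealth_continuous: "\<omega> \<in> space M \<Longrightarrow> continuous_on {0..T} (\<lambda>t. wealth t \<omega>)"
  using wealth_ito unfolding is_ito_integral_def by blast

lemma wealth_measurable: "0 \<le> t \<Longrightarrow> t \<le> T \<Longrightarrow> wealth t \<in> borel_measurable M"
  using wealth_ito unfolding is_ito_integral_def by (intro F_measurable [of t]) auto

text \<open>The countably many exceptional sets of the dyadic times are joined, and continuity of
  both paths does the rest. A single null set for all t is what a statement about the supremum
  requires.\<close>

lemma wealth_eq: "AE \<omega> in M. \<forall>t\<in>{0..T}. wealth t \<omega> = X t \<omega>"
proof -
  have d: "0 \<le> T * real j / 2 ^ k \<and> T * real j / 2 ^ k \<le> T" if "j \<le> 2 ^ k" for j k
  proof -
    have "real j \<le> 2 ^ k" using that by (metis of_nat_le_iff of_nat_numeral of_nat_power)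
    then show ?thesis using T0 by (auto simp: pos_divide_le_eq)
  qed
  have "AE \<omega> in M. \<forall>k j. j \<le> 2 ^ k \<longrightarrow> wealth (T * real j / 2 ^ k) \<omega> = X (T * real j / 2 ^ k) \<omega>"
    unfolding AE_all_countable
  proof (intro allI)
    fix k j :: nat
    show "AE \<omega> in M. j \<le> 2 ^ k \<longrightarrow> wealth (T * real j / 2 ^ k) \<omega> = X (T * real j / 2 ^ k) \<omega>"
    proof (cases "j \<le> 2 ^ k")
      case True
      then show ?thesis using ito_unique [OF wealth_ito] d [OF True] by simp
    qed simp
  qed
  moreover have "AE \<omega> in M. \<omega> \<in> space M" by (rule AE_space)
  ultimately show ?thesis
  proof eventually_elim
    fix \<omega> assume eq: "\<forall>k j. j \<le> 2 ^ k \<longrightarrow> wealth (T * real j / 2 ^ k) \<omega> = X (T * real j / 2 ^ k) \<omega>" and \<omega>: "\<omega> \<in> space M"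
    show "\<forall>t\<in>{0..T}. wealth t \<omega> = X t \<omega>"
    proof
      fix t assume t: "t \<in> {0..T}"
      then obtain j where j: "\<And>k. j k \<le> 2 ^ k" "(\<lambda>k. T * real (j k) / 2 ^ k) \<longlonglongrightarrow> t"
        using dyadic_approx [of t T] by auto
      have mem: "\<forall>\<^sub>F k in sequentially. T * real (j k) / 2 ^ k \<in> {0..T}"
        using d j(1) by (intro always_eventually allI) simp
      have 1: "(\<lambda>k. wealth (T * real (j k) / 2 ^ k) \<omega>) \<longlonglongrightarrow> wealth t \<omega>"
        by (rule continuous_on_tendsto_compose [OF wealth_continuous [OF \<omega>] j(2) t mem])
      have 2: "(\<lambda>k. X (T * real (j k) / 2 ^ k) \<omega>) \<longlonglongrightarrow> X t \<omega>"
        by (rule continuous_on_tendsto_compose [OF X_continuous [OF \<omega>] j(2) t mem])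
      have "wealth (T * real (j k) / 2 ^ k) \<omega> = X (T * real (j k) / 2 ^ k) \<omega>" for k
        using eq j(1) by blast
      then show "wealth t \<omega> = X t \<omega>" using LIMSEQ_unique [OF 1] 2 by simp
    qed
  qed
qed

end

subsection \<open>Even moments of martingales with conditionally bounded increments\<close>

text \<open>In the binomial expansion the terms of order at least 2 in d are bounded through the
  larger of |s| and |d|, and the binomial coefficients sum to 4^m. The linear term is kept exactly
  because it will integrate to 0.\<close>

lemma even_power_add_le:
  fixes s d :: real
  assumes "1 \<le> m"
  shows "(s + d) ^ (2 * m) \<le> s ^ (2 * m) + 2 * real m * s ^ (2 * m - 1) * d + 4 ^ m * (s ^ (2 * (m - 1)) * d\<^sup>2 + d ^ (2 * m))"
proof -
  let ?t = "\<lambda>k. real (2 * m choose k) * d ^ k * s ^ (2 * m - k)"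
  define R where "R = s ^ (2 * (m - 1)) * d\<^sup>2 + d ^ (2 * m)"
  have R: "R = \<bar>s\<bar> ^ (2 * m - 2) * \<bar>d\<bar>\<^sup>2 + \<bar>d\<bar> ^ (2 * m - 2) * \<bar>d\<bar>\<^sup>2"
  proof -
    have "\<bar>d\<bar> ^ (2 * m - 2) * \<bar>d\<bar>\<^sup>2 = \<bar>d\<bar> ^ (2 * m)"
    proof -
      have "2 * m = (2 * m - 2) + 2" using assms by simp
      then show ?thesis by (metis power_add)
    qed
    then show ?thesis using assms by (simp add: R_def power_even_abs diff_mult_distrib2)
  qed
  have R0: "0 \<le> R" unfolding R by simp
  have "?t k \<le> real (2 * m choose k) * R" if k: "2 \<le> k" "k \<le> 2 * m" for k
  proof -
    have "d ^ k * s ^ (2 * m - k) \<le> \<bar>d\<bar> ^ k * \<bar>s\<bar> ^ (2 * m - k)"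
      by (metis abs_ge_self abs_mult power_abs)
    also have "\<dots> = (\<bar>d\<bar> ^ (k - 2) * \<bar>s\<bar> ^ (2 * m - k)) * \<bar>d\<bar>\<^sup>2"
    proof -
      have "\<bar>d\<bar> ^ k = \<bar>d\<bar> ^ (k - 2) * \<bar>d\<bar>\<^sup>2" using k(1) by (metis le_add_diff_inverse2 power_add)
      then show ?thesis by (simp only: mult_ac)
    qed
    also have "\<dots> \<le> (max \<bar>s\<bar> \<bar>d\<bar> ^ (k - 2) * max \<bar>s\<bar> \<bar>d\<bar> ^ (2 * m - k)) * \<bar>d\<bar>\<^sup>2"
      by (intro mult_right_mono mult_mono power_mono) auto
    also have "max \<bar>s\<bar> \<bar>d\<bar> ^ (k - 2) * max \<bar>s\<bar> \<bar>d\<bar> ^ (2 * m - k) = max \<bar>s\<bar> \<bar>d\<bar> ^ (2 * m - 2)"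
    proof -
      have "2 * m - 2 = (k - 2) + (2 * m - k)" using k by simp
      then show ?thesis by (metis power_add)
    qed
    also have "\<dots> \<le> \<bar>s\<bar> ^ (2 * m - 2) + \<bar>d\<bar> ^ (2 * m - 2)"
      by (cases "\<bar>s\<bar> \<le> \<bar>d\<bar>") (simp_all add: max_def)
    finally have "d ^ k * s ^ (2 * m - k) \<le> R"
      unfolding R by (simp add: distrib_right mult_right_mono)
    then show ?thesis by (simp add: mult.assoc mult_left_mono)
  qed
  then have "(\<Sum>k=2..2*m. ?t k) \<le> (\<Sum>k=2..2*m. real (2 * m choose k) * R)"
    by (intro sum_mono) simp
  also have "\<dots> \<le> (\<Sum>k\<le>2*m. real (2 * m choose k) * R)"
    using R0 by (intro sum_mono2) auto
  also have "\<dots> = 4 ^ m * R"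
    by (simp add: sum_distrib_right [symmetric] choose_row_sum flip: of_nat_sum) (simp add: power_mult)
  finally have tail: "(\<Sum>k=2..2*m. ?t k) \<le> 4 ^ m * R" .
  have "(s + d) ^ (2 * m) = (\<Sum>k\<le>2*m. ?t k)"
    using binomial_ring [of d s "2 * m"] by (simp add: add.commute)
  also have "{..2 * m} = {0, 1} \<union> {2..2*m}" using assms by auto
  also have "(\<Sum>k\<in>{0, 1} \<union> {2..2*m}. ?t k) = s ^ (2 * m) + 2 * real m * s ^ (2 * m - 1) * d + (\<Sum>k=2..2*m. ?t k)"
    by (subst sum.union_disjoint) (auto simp: mult_ac)
  finally show ?thesis using tail by (simp add: R_def)
qed

lemma power_mult_le_sum:
  fixes x y :: real
  assumes "0 \<le> x" "0 \<le> y" "1 \<le> m"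
  shows "x ^ (m - 1) * y \<le> x ^ m + y ^ m"
proof -
  have "x ^ (m - 1) * y \<le> max x y ^ (m - 1) * max x y"
    using assms by (intro mult_mono power_mono) auto
  also have "\<dots> = max x y ^ m" using assms(3) by (metis power_minus_mult zero_less_one less_le_trans)
  also have "\<dots> \<le> x ^ m + y ^ m" using assms by (cases "x \<le> y") (simp_all add: max_def)
  finally show ?thesis .
qed

text \<open>Both error terms are made to carry k^2 instead of k^(2 m), using k^2 / K \<le> 1. Over
  many steps the cost then depends on the sum of the k^2 alone, as in Burkholder's inequality, and
  not on the number of steps.\<close>

lemma even_power_step:
  fixes s d k D K :: real
  assumes m: "1 \<le> m" and K: "0 < K" "k\<^sup>2 \<le> K" and d: "\<bar>d\<bar> \<le> k * D"
  shows "(s + d) ^ (2 * m) \<le> (1 + k\<^sup>2 / K) * s ^ (2 * m) + 2 * real m * s ^ (2 * m - 1) * d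
    + 2 * (4 ^ m * K) ^ m / K * (k\<^sup>2 * D ^ (2 * m))"
proof -
  let ?\<kappa> = "k\<^sup>2 / K" and ?A = "(4 ^ m * K) ^ m"
  have \<kappa>: "0 \<le> ?\<kappa>" "?\<kappa> \<le> 1" using K by simp_all
  have d2: "d\<^sup>2 \<le> k\<^sup>2 * D\<^sup>2"
    using d by (metis abs_ge_zero power2_abs power_mono power_mult_distrib)
  have "4 ^ m * (s ^ (2 * (m - 1)) * d\<^sup>2) \<le> 4 ^ m * ((s\<^sup>2) ^ (m - 1) * (k\<^sup>2 * D\<^sup>2))"
    unfolding power_mult using d2 by (intro mult_left_mono) auto
  also have "\<dots> = ?\<kappa> * ((s\<^sup>2) ^ (m - 1) * (4 ^ m * K * D\<^sup>2))" using K by simp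
  also have "\<dots> \<le> ?\<kappa> * ((s\<^sup>2) ^ m + (4 ^ m * K * D\<^sup>2) ^ m)"
    using K m \<kappa> by (intro mult_left_mono power_mult_le_sum) auto
  also have "\<dots> = ?\<kappa> * s ^ (2 * m) + ?A / K * (k\<^sup>2 * D ^ (2 * m))"
    by (simp add: power_mult power_mult_distrib distrib_left)
  finally have 1: "4 ^ m * (s ^ (2 * (m - 1)) * d\<^sup>2) \<le> ?\<kappa> * s ^ (2 * m) + ?A / K * (k\<^sup>2 * D ^ (2 * m))" .
  have "d ^ (2 * m) \<le> (k\<^sup>2 * D\<^sup>2) ^ m" unfolding power_mult using d2 by (intro power_mono) auto
  also have "\<dots> = (k\<^sup>2) ^ m * D ^ (2 * m)" by (simp add: power_mult_distrib power_mult)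
  also have "(k\<^sup>2) ^ m = ?\<kappa> ^ m * K ^ m" using K by (simp add: power_divide)
  also have "?\<kappa> ^ m * K ^ m * D ^ (2 * m) \<le> ?\<kappa> * K ^ m * D ^ (2 * m)"
    using power_decreasing [of 1 m ?\<kappa>] m \<kappa> K by (intro mult_right_mono) auto
  finally have "4 ^ m * d ^ (2 * m) \<le> 4 ^ m * (?\<kappa> * K ^ m * D ^ (2 * m))" by (intro mult_left_mono) auto
  \<comment> \<open>Enlarging 4^m to its m-th power gives both error terms the same
    constant.\<close>
  also have "\<dots> \<le> (4 ^ m) ^ m * (?\<kappa> * K ^ m * D ^ (2 * m))"
    using m \<kappa> K self_le_power [of "4 ^ m :: real" m] by (intro mult_right_mono) auto
  also have "\<dots> = ?A / K * (k\<^sup>2 * D ^ (2 * m))" by (simp add: power_mult_distrib mult_ac)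
  finally have 2: "4 ^ m * d ^ (2 * m) \<le> ?A / K * (k\<^sup>2 * D ^ (2 * m))" .
  have "(1 + ?\<kappa>) * s ^ (2 * m) = s ^ (2 * m) + ?\<kappa> * s ^ (2 * m)"
    "2 * ?A / K * (k\<^sup>2 * D ^ (2 * m)) = ?A / K * (k\<^sup>2 * D ^ (2 * m)) + ?A / K * (k\<^sup>2 * D ^ (2 * m))"
    by (simp_all add: distrib_right)
  then show ?thesis using 1 2 even_power_add_le [OF m, of s d] unfolding distrib_left by linarith
qed

context brownian
begin

text \<open>The linear term is a factor known at time t times a martingale increment and integrates
  to 0. The growth factor 1 + k^2 / K is moved into the weight, which prepares an induction over the
  steps.\<close>

lemma even_moment_step:
  assumes m: "1 \<le> m" and K: "0 < K" and at: "a \<le> t"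
    and Z: "nice Z" "Z \<in> borel_measurable (F a)" "\<And>\<omega>. \<omega> \<in> space M \<Longrightarrow> 0 \<le> Z \<omega>"
    and k: "nice k" "\<And>\<omega>. \<omega> \<in> space M \<Longrightarrow> (k \<omega>)\<^sup>2 \<le> K"
    and S: "nice S" "S \<in> borel_measurable (F t)"
    and d: "mds t d" "\<And>\<omega>. \<omega> \<in> space M \<Longrightarrow> \<bar>d \<omega>\<bar> \<le> k \<omega> * D \<omega>"
    and D: "nice D"
    and B: "(\<integral>\<omega>. Z \<omega> * (k \<omega>)\<^sup>2 * D \<omega> ^ (2 * m) \<partial>M) \<le> B * (\<integral>\<omega>. Z \<omega> * (k \<omega>)\<^sup>2 \<partial>M)"
  shows "(\<integral>\<omega>. Z \<omega> * (S \<omega> + d \<omega>) ^ (2 * m) \<partial>M) \<le>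
    (\<integral>\<omega>. (Z \<omega> * (1 + (k \<omega>)\<^sup>2 / K)) * S \<omega> ^ (2 * m) \<partial>M) + 2 * (4 ^ m * K) ^ m * B * (\<integral>\<omega>. Z \<omega> * ((k \<omega>)\<^sup>2 / K) \<partial>M)"
proof -
  let ?c = "2 * (4 ^ m * K) ^ m / K"
  let ?\<zeta> = "\<lambda>\<omega>. Z \<omega> * (2 * real m * S \<omega> ^ (2 * m - 1))"
  have dn: "nice d" using d(1) by (rule mds_nice)
  have \<zeta>: "(\<integral>\<omega>. ?\<zeta> \<omega> * d \<omega> \<partial>M) = 0"
    using Z(1) S F_measurable_mono [OF at Z(2)]
    by (intro mds_orthogonal [OF d(1)] nice_mult nice_power nice_const borel_measurable_times borel_measurable_power borel_measurable_const)
  have \<kappa>: "nice (\<lambda>\<omega>. (k \<omega>)\<^sup>2 / K)"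
    using nice_mult [OF nice_power [OF k(1), of 2] nice_const [of "1 / K"]] by simp
  have i1: "integrable M (\<lambda>\<omega>. (Z \<omega> * (1 + (k \<omega>)\<^sup>2 / K)) * S \<omega> ^ (2 * m))"
    using Z S k \<kappa> by (intro nice_integrable nice_mult nice_add nice_power nice_const)
  have i2: "integrable M (\<lambda>\<omega>. ?\<zeta> \<omega> * d \<omega>)"
    using Z S dn by (intro nice_integrable nice_mult nice_power nice_const)
  have i3: "integrable M (\<lambda>\<omega>. Z \<omega> * (k \<omega>)\<^sup>2 * D \<omega> ^ (2 * m))"
    using Z k D by (intro nice_integrable nice_mult nice_power)
  have "(\<integral>\<omega>. Z \<omega> * (S \<omega> + d \<omega>) ^ (2 * m) \<partial>M) \<le>
    (\<integral>\<omega>. (Z \<omega> * (1 + (k \<omega>)\<^sup>2 / K)) * S \<omega> ^ (2 * m) + ?\<zeta> \<omega> * d \<omega> + ?c * (Z \<omega> * (k \<omega>)\<^sup>2 * D \<omega> ^ (2 * m)) \<partial>M)"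
  proof (rule integral_mono)
    show "integrable M (\<lambda>\<omega>. Z \<omega> * (S \<omega> + d \<omega>) ^ (2 * m))"
      using Z S dn by (intro nice_integrable nice_mult nice_power nice_add)
    fix \<omega> assume \<omega>: "\<omega> \<in> space M"
    show "Z \<omega> * (S \<omega> + d \<omega>) ^ (2 * m) \<le>
      (Z \<omega> * (1 + (k \<omega>)\<^sup>2 / K)) * S \<omega> ^ (2 * m) + ?\<zeta> \<omega> * d \<omega> + ?c * (Z \<omega> * (k \<omega>)\<^sup>2 * D \<omega> ^ (2 * m))"
      using mult_left_mono [OF even_power_step [OF m K k(2) [OF \<omega>] d(2) [OF \<omega>], of "S \<omega>"] Z(3) [OF \<omega>]]
      by (simp add: algebra_simps)
  qed (use i1 i2 i3 in auto)
  also have "\<dots> = (\<integral>\<omega>. (Z \<omega> * (1 + (k \<omega>)\<^sup>2 / K)) * S \<omega> ^ (2 * m) \<partial>M) + ?c * (\<integral>\<omega>. Z \<omega> * (k \<omega>)\<^sup>2 * D \<omega> ^ (2 * m) \<partial>M)"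
    using i1 i2 i3 \<zeta> by simp
  also have "\<dots> \<le> (\<integral>\<omega>. (Z \<omega> * (1 + (k \<omega>)\<^sup>2 / K)) * S \<omega> ^ (2 * m) \<partial>M) + ?c * (B * (\<integral>\<omega>. Z \<omega> * (k \<omega>)\<^sup>2 \<partial>M))"
    using B K by (intro add_left_mono mult_left_mono) auto
  also have "?c * (B * (\<integral>\<omega>. Z \<omega> * (k \<omega>)\<^sup>2 \<partial>M)) = 2 * (4 ^ m * K) ^ m * B * (\<integral>\<omega>. Z \<omega> * ((k \<omega>)\<^sup>2 / K) \<partial>M)"
    by simp
  finally show ?thesis .
qed

text \<open>Conditionally on the past of \<open>a\<close>, the weights \<open>k i\<close> are constants; the moments of \<open>S j\<close> are
  controlled by the product of the \<open>1 + (k i)\<^sup>2 / K\<close>.\<close>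

lemma even_moment_bound:
  assumes m: "1 \<le> m" and K: "0 < K" and t: "\<And>j. j < N \<Longrightarrow> a \<le> t j"
    and k: "\<And>j. j < N \<Longrightarrow> nice (k j)" "\<And>j. j < N \<Longrightarrow> k j \<in> borel_measurable (F a)"
    and sum: "\<And>\<omega>. \<omega> \<in> space M \<Longrightarrow> (\<Sum>j<N. (k j \<omega>)\<^sup>2) \<le> K"
    and S0: "\<And>\<omega>. \<omega> \<in> space M \<Longrightarrow> S 0 \<omega> = 0"
    and S: "\<And>j. j \<le> N \<Longrightarrow> nice (S j)" "\<And>j. j < N \<Longrightarrow> S j \<in> borel_measurable (F (t j))"
    and d: "\<And>j. j < N \<Longrightarrow> mds (t j) (\<lambda>\<omega>. S (Suc j) \<omega> - S j \<omega>)"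
      "\<And>j \<omega>. j < N \<Longrightarrow> \<omega> \<in> space M \<Longrightarrow> \<bar>S (Suc j) \<omega> - S j \<omega>\<bar> \<le> k j \<omega> * D j \<omega>"
    and D: "\<And>j. j < N \<Longrightarrow> nice (D j)"
    and B: "\<And>j Z. j < N \<Longrightarrow> nice Z \<Longrightarrow> Z \<in> borel_measurable (F a) \<Longrightarrow> (\<And>\<omega>. \<omega> \<in> space M \<Longrightarrow> 0 \<le> Z \<omega>) \<Longrightarrow>
      (\<integral>\<omega>. Z \<omega> * D j \<omega> ^ (2 * m) \<partial>M) \<le> B * (\<integral>\<omega>. Z \<omega> \<partial>M)" and B0: "0 \<le> B"
    and Z: "nice Z" "Z \<in> borel_measurable (F a)" "\<And>\<omega>. \<omega> \<in> space M \<Longrightarrow> 0 \<le> Z \<omega>"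
  shows "(\<integral>\<omega>. Z \<omega> * S N \<omega> ^ (2 * m) \<partial>M) \<le> 4 * (4 ^ m * K) ^ m * B * (\<integral>\<omega>. Z \<omega> \<partial>M)"
proof -
  define \<beta> where "\<beta> = 2 * (4 ^ m * K) ^ m * B"
  have \<beta>: "0 \<le> \<beta>" using K B0 by (simp add: \<beta>_def)
  define p where "p j \<omega> = (\<Prod>i<j. 1 + (k i \<omega>)\<^sup>2 / K)" for j \<omega>
  have \<kappa>: "nice (\<lambda>\<omega>. (k j \<omega>)\<^sup>2 / K)" if "j < N" for j
    using nice_mult [OF nice_power [OF k(1) [OF that], of 2] nice_const [of "1 / K"]] by simp
  have p: "nice (p j)" if "j \<le> N" for j
    using that
  proof (induction j)
    case (Suc j)
    then show ?case using \<kappa> [of j] unfolding p_def by (auto intro!: nice_mult nice_add)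
  qed (auto simp: p_def [abs_def])
  \<comment> \<open>Z is generalised because each step multiplies the weight by a further factor.
    The bounds close up by (1 + \<kappa>) (p - 1) + \<kappa> = (1 + \<kappa>) p - 1, with \<kappa>
    the share k^2 / K of the step.\<close>
  have claim: "(\<integral>\<omega>. Z \<omega> * S j \<omega> ^ (2 * m) \<partial>M) \<le> \<beta> * (\<integral>\<omega>. Z \<omega> * (p j \<omega> - 1) \<partial>M)"
    if "j \<le> N" "nice Z" "Z \<in> borel_measurable (F a)" "\<And>\<omega>. \<omega> \<in> space M \<Longrightarrow> 0 \<le> Z \<omega>" for j Z
    using that
  proof (induction j arbitrary: Z)
    case 0
    have "(\<integral>\<omega>. Z \<omega> * S 0 \<omega> ^ (2 * m) \<partial>M) = (\<integral>\<omega>. 0 \<partial>M)"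
      using S0 m by (intro Bochner_Integration.integral_cong) auto
    then show ?case by (simp add: p_def)
  next
    case (Suc j)
    then have j: "j < N" by simp
    let ?\<kappa> = "\<lambda>\<omega>. (k j \<omega>)\<^sup>2 / K"
    let ?Z = "\<lambda>\<omega>. Z \<omega> * (1 + ?\<kappa> \<omega>)"
    have kK: "(k j \<omega>)\<^sup>2 \<le> K" if "\<omega> \<in> space M" for \<omega>
      using member_le_sum [of j "{..<N}" "\<lambda>j. (k j \<omega>)\<^sup>2"] sum [OF that] j by simp
    have Zk: "(\<integral>\<omega>. Z \<omega> * (k j \<omega>)\<^sup>2 * D j \<omega> ^ (2 * m) \<partial>M) \<le> B * (\<integral>\<omega>. Z \<omega> * (k j \<omega>)\<^sup>2 \<partial>M)"
      using Suc.prems k [OF j] by (intro B [OF j] nice_mult nice_power) auto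
    have "(\<integral>\<omega>. Z \<omega> * S (Suc j) \<omega> ^ (2 * m) \<partial>M) = (\<integral>\<omega>. Z \<omega> * (S j \<omega> + (S (Suc j) \<omega> - S j \<omega>)) ^ (2 * m) \<partial>M)"
      by simp
    also have "\<dots> \<le> (\<integral>\<omega>. ?Z \<omega> * S j \<omega> ^ (2 * m) \<partial>M) + \<beta> * (\<integral>\<omega>. Z \<omega> * ?\<kappa> \<omega> \<partial>M)"
      unfolding \<beta>_def
      by (rule even_moment_step [OF m K t [OF j] Suc.prems(2,3,4) k(1) [OF j] kK S(1) S(2) [OF j] d(1) [OF j] d(2) [OF j] D [OF j] Zk])
         (use j in simp_all)
    also have "(\<integral>\<omega>. ?Z \<omega> * S j \<omega> ^ (2 * m) \<partial>M) \<le> \<beta> * (\<integral>\<omega>. ?Z \<omega> * (p j \<omega> - 1) \<partial>M)"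
    proof (rule Suc.IH)
      show "nice ?Z" using Suc.prems(2) \<kappa> [OF j] by (intro nice_mult nice_add nice_const)
      show "?Z \<in> borel_measurable (F a)" using Suc.prems(3) k(2) [OF j] by measurable
      show "0 \<le> ?Z \<omega>" if "\<omega> \<in> space M" for \<omega> using Suc.prems(4) [OF that] K by simp
    qed (use j in simp)
    also have "\<beta> * (\<integral>\<omega>. ?Z \<omega> * (p j \<omega> - 1) \<partial>M) + \<beta> * (\<integral>\<omega>. Z \<omega> * ?\<kappa> \<omega> \<partial>M) = \<beta> * (\<integral>\<omega>. ?Z \<omega> * (p j \<omega> - 1) + Z \<omega> * ?\<kappa> \<omega> \<partial>M)"
    proof -
      have "integrable M (\<lambda>\<omega>. ?Z \<omega> * (p j \<omega> - 1))" "integrable M (\<lambda>\<omega>. Z \<omega> * ?\<kappa> \<omega>)"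
        using Suc.prems(2) \<kappa> [OF j] p [of j] j by (intro nice_integrable nice_mult nice_add nice_diff nice_const; simp)+
      then show ?thesis by (simp add: distrib_left)
    qed
    also have "(\<lambda>\<omega>. ?Z \<omega> * (p j \<omega> - 1) + Z \<omega> * ?\<kappa> \<omega>) = (\<lambda>\<omega>. Z \<omega> * (p (Suc j) \<omega> - 1))"
      by (simp add: p_def fun_eq_iff algebra_simps)
    finally show ?case by simp
  qed
  have "(\<integral>\<omega>. Z \<omega> * S N \<omega> ^ (2 * m) \<partial>M) \<le> \<beta> * (\<integral>\<omega>. Z \<omega> * (p N \<omega> - 1) \<partial>M)"
    using Z by (intro claim) auto
  also have "\<beta> * (\<integral>\<omega>. Z \<omega> * (p N \<omega> - 1) \<partial>M) \<le> \<beta> * (\<integral>\<omega>. Z \<omega> * 2 \<partial>M)"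
  proof (rule mult_left_mono [OF integral_mono])
    show "integrable M (\<lambda>\<omega>. Z \<omega> * (p N \<omega> - 1))" "integrable M (\<lambda>\<omega>. Z \<omega> * 2)"
      using Z p by (auto intro!: nice_integrable nice_mult nice_diff)
    fix \<omega> assume \<omega>: "\<omega> \<in> space M"
    \<comment> \<open>The shares k^2 / K sum to at most 1, so the product is at most e and p - 1 at
      most 2.\<close>
    have "p N \<omega> \<le> (\<Prod>i<N. exp ((k i \<omega>)\<^sup>2 / K))"
      unfolding p_def using K by (intro prod_mono) (auto intro: add_nonneg_nonneg)
    also have "\<dots> = exp ((\<Sum>i<N. (k i \<omega>)\<^sup>2) / K)"
      by (simp add: exp_sum [symmetric] sum_divide_distrib)
    also have "\<dots> \<le> exp 1" using sum [OF \<omega>] K by simp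
    also have "\<dots> \<le> 3" by (rule exp_le)
    finally show "Z \<omega> * (p N \<omega> - 1) \<le> Z \<omega> * 2" using Z(3) [OF \<omega>] by (intro mult_left_mono) auto
  qed (rule \<beta>)
  finally show ?thesis by (simp add: \<beta>_def mult_ac)
qed

end

context hedging
begin

subsection \<open>Moments of the hedging error\<close>

lemma nice_H: "0 \<le> t \<Longrightarrow> t \<le> T \<Longrightarrow> nice (H t)"
proof -
  assume t: "0 \<le> t" "t \<le> T"
  have "H t = (\<lambda>\<omega>. V t \<omega> * (1 / Y t \<omega>))" by (simp add: H_def fun_eq_iff)
  then show ?thesis using nice_mult [OF nice_V [OF t] nice_Y_inverse [OF t]] by simp
qed

lemma measurable_H: "0 \<le> s \<Longrightarrow> s \<le> t \<Longrightarrow> H s \<in> borel_measurable (F t)"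
  unfolding H_def [abs_def] by (intro borel_measurable_divide measurable_V measurable_Y)

abbreviation net :: "nat \<Rightarrow> nat \<Rightarrow> real" where "net \<equiv> theta_net T \<theta>"

lemma net_le: "i \<le> j \<Longrightarrow> j \<le> n \<Longrightarrow> net n i \<le> net n j"
  using theta_net_mono [of i j n] by (cases "i = j") auto

lemma net_bounds:
  assumes "0 < n" "i \<le> n"
  shows "0 \<le> net n i" "net n i \<le> T" "i < n \<Longrightarrow> net n i < T"
  using net_le [of 0 i n] net_le [of i n n] theta_net_mono [of i n n] assms by auto

text \<open>The hedging error with the explicit value process in place of the chosen version of the
  integral; moments are computed for this process and transferred by
  \<open>herr_eq_err\<close>.\<close>

definition err :: "nat \<Rightarrow> real \<Rightarrow> 'a \<Rightarrow> real" where
  "err n t \<omega> = X t \<omega> - simple_integral Y n (net n) (\<lambda>i. H (net n i)) t \<omega>"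

lemma err_nice:
  assumes n: "0 < n" and t: "0 \<le> t" "t \<le> T"
  shows "nice (err n t)" "err n t \<in> borel_measurable (F t)"
proof -
  have "nice (\<lambda>\<omega>. H (net n i) \<omega> * (Y (min (net n (Suc i)) t) \<omega> - Y (min (net n i) t) \<omega>)) \<and>
    (\<lambda>\<omega>. H (net n i) \<omega> * (Y (min (net n (Suc i)) t) \<omega> - Y (min (net n i) t) \<omega>)) \<in> borel_measurable (F t)" if i: "i < n" for i
  proof (cases "net n i \<le> t")
    case True
    have b: "0 \<le> net n i" "net n i \<le> T" "0 \<le> net n (Suc i)"
      using net_bounds [OF n, of i] net_bounds [OF n, of "Suc i"] i by auto
    then show ?thesis
      using t True
      by (intro conjI nice_mult nice_diff nice_Y borel_measurable_times borel_measurable_diff measurable_Y measurable_H nice_H) auto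
  next
    case False
    then have "t \<le> net n i" "t \<le> net n (Suc i)" using net_le [of i "Suc i" n] i by auto
    then show ?thesis by (auto simp: min_absorb2)
  qed
  then show "nice (err n t)" "err n t \<in> borel_measurable (F t)"
    unfolding err_def [abs_def] simple_integral_def [abs_def]
    using nice_X [OF t] measurable_X [OF t(1) order_refl]
    by (auto intro!: nice_sum nice_diff borel_measurable_sum borel_measurable_diff)
qed

lemma err_continuous: "0 < n \<Longrightarrow> \<omega> \<in> space M \<Longrightarrow> continuous_on {0..T} (\<lambda>t. err n t \<omega>)"
  unfolding err_def simple_integral_def
  using net_bounds [of n]
  by (intro continuous_on_diff continuous_on_sum continuous_on_mult continuous_on_const X_continuous
      continuous_on_compose2 [OF Y_continuous] continuous_on_min continuous_on_id) (auto intro: min.coboundedI2)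

text \<open>Each cell lies before s, after t, around s, or begins between s and t. In the last case
  the increment is orthogonal to the past of the cell's left end, and \<open>mds_mono\<close> brings
  this down to s.\<close>

lemma mds_err:
  assumes n: "0 < n" and s: "0 \<le> s" "s \<le> t" "t \<le> T"
  shows "mds s (\<lambda>\<omega>. err n t \<omega> - err n s \<omega>)"
proof -
  let ?p = "\<lambda>i t \<omega>. H (net n i) \<omega> * (Y (min (net n (Suc i)) t) \<omega> - Y (min (net n i) t) \<omega>)"
  have "mds s (\<lambda>\<omega>. ?p i t \<omega> - ?p i s \<omega>)" if i: "i < n" for i
  proof -
    have b: "0 \<le> net n i" "net n i \<le> net n (Suc i)" "net n (Suc i) \<le> T"
      using net_bounds [OF n, of i] net_bounds [OF n, of "Suc i"] net_le [of i "Suc i" n] i by auto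
    consider "net n (Suc i) \<le> s" | "t \<le> net n i" | "net n i < s" "s < net n (Suc i)" | "s \<le> net n i" "net n i < t"
      by linarith
    then show ?thesis
    proof cases
      case 1
      then show ?thesis using s b by (simp add: min_absorb1 mds_zero)
    next
      case 2
      then show ?thesis using s b by (simp add: min_absorb2 mds_zero)
    next
      case 3
      have "mds s (\<lambda>\<omega>. H (net n i) \<omega> * (Y (min (net n (Suc i)) t) \<omega> - Y s \<omega>))"
        using s b 3 by (intro mds_mult mds_Y nice_H measurable_H) auto
      then show ?thesis using s b 3 by (simp add: min_absorb1 min_absorb2 right_diff_distrib)
    next
      case 4
      have "mds (net n i) (\<lambda>\<omega>. H (net n i) \<omega> * (Y (min (net n (Suc i)) t) \<omega> - Y (net n i) \<omega>))"
        using s b 4 by (intro mds_mult mds_Y nice_H measurable_H) auto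
      from mds_mono [OF this 4(1)] show ?thesis using s b 4 by (simp add: min_absorb1 min_absorb2)
    qed
  qed
  then have "mds s (\<lambda>\<omega>. \<Sum>i<n. ?p i t \<omega> - ?p i s \<omega>)" by (intro mds_sum) simp
  moreover have "err n t \<omega> - err n s \<omega> = (X t \<omega> - X s \<omega>) - (\<Sum>i<n. ?p i t \<omega> - ?p i s \<omega>)" for \<omega>
    unfolding err_def simple_integral_def sum_subtractf by linarith
  ultimately show ?thesis using mds_diff [OF mds_X [OF s]] by simp
qed

lemma err_step:
  assumes n: "0 < n" and j: "j < n"
  shows "err n (net n (Suc j)) \<omega> - err n (net n j) \<omega> =
    X (net n (Suc j)) \<omega> - X (net n j) \<omega> - V (net n j) \<omega> / Y (net n j) \<omega> * (Y (net n (Suc j)) \<omega> - Y (net n j) \<omega>)"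
proof -
  have m: "\<forall>i<n. net n i \<le> net n (Suc i)" using net_le by simp
  have "simple_integral Y n (net n) (\<lambda>i. H (net n i)) (net n (Suc j)) \<omega> =
      simple_integral Y n (net n) (\<lambda>i. H (net n i)) (net n j) \<omega> + H (net n j) \<omega> * (Y (net n (Suc j)) \<omega> - Y (net n j) \<omega>)"
    by (rule simple_integral_cases(2) [OF m j]) (use m j in auto)
  then show ?thesis by (simp add: err_def H_def)
qed

definition weight :: "real \<Rightarrow> 'a \<Rightarrow> real" where
  "weight a \<omega> = max (Y a \<omega>) (Y a \<omega> powr \<theta>)"

lemma weight_pos: "0 < weight a \<omega>"
  using geom_bm_pos [of a \<omega>] by (simp add: weight_def less_max_iff_disj)

lemma weight_inverse:
  assumes a: "0 \<le> a" "a \<le> T"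
  shows "nice (\<lambda>\<omega>. 1 / weight a \<omega>)" "weight a \<in> borel_measurable (F a)"
    "(\<lambda>\<omega>. 1 / weight a \<omega>) \<in> borel_measurable (F a)"
proof -
  have [measurable]: "Y a \<in> borel_measurable (F a)" using a by (intro measurable_Y) auto
  show w: "weight a \<in> borel_measurable (F a)" unfolding weight_def [abs_def] by measurable
  then show i: "(\<lambda>\<omega>. 1 / weight a \<omega>) \<in> borel_measurable (F a)" by measurable
  show "nice (\<lambda>\<omega>. 1 / weight a \<omega>)"
  proof (rule nice_bound [OF nice_Y_inverse [OF a]])
    show "(\<lambda>\<omega>. 1 / weight a \<omega>) \<in> borel_measurable M" using i a(2) by (rule F_measurable [rotated])
    fix \<omega>
    have "Y a \<omega> \<le> weight a \<omega>" by (simp add: weight_def)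
    then show "\<bar>1 / weight a \<omega>\<bar> \<le> \<bar>1 / Y a \<omega>\<bar>"
      using geom_bm_pos [of a \<omega>] weight_pos [of a \<omega>] by (simp add: frac_le)
  qed
qed

text \<open>exp (W a) exceeds Y a by the factor exp (a / 2) only, which is at most exp (T /
  2).\<close>

lemma weight_ge:
  assumes a: "0 \<le> a" "a \<le> T"
  shows "max (exp (W a \<omega>)) (exp (\<theta> * W a \<omega>)) \<le> exp (T / 2) * weight a \<omega>"
proof -
  have 1: "exp (W a \<omega>) \<le> exp (T / 2) * Y a \<omega>"
    using a by (simp add: geom_bm_def exp_add [symmetric])
  have "\<theta> * a \<le> 1 * T" using a \<theta> by (intro mult_mono) auto
  then have 2: "exp (\<theta> * W a \<omega>) \<le> exp (T / 2) * Y a \<omega> powr \<theta>"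
    using a by (simp add: geom_bm_def powr_def exp_add [symmetric] right_diff_distrib)
  have "exp (T / 2) * Y a \<omega> \<le> exp (T / 2) * weight a \<omega>" "exp (T / 2) * Y a \<omega> powr \<theta> \<le> exp (T / 2) * weight a \<omega>"
    by (simp_all add: weight_def)
  with 1 2 show ?thesis by linarith
qed

text \<open>As a function of the state the coefficient increases, hence is Borel. This settles the
  measurability of an expression that involves an infimum over all splittings.\<close>

lemma coef_W:
  assumes st: "0 \<le> s" "s \<le> t" "t \<le> T" and a: "0 \<le> a" "a \<le> T"
  shows "nice (\<lambda>\<omega>. coef s t (W a \<omega>))" "(\<lambda>\<omega>. coef s t (W a \<omega>)) \<in> borel_measurable (F a)"
proof -
  have "mono (coef s t)"
    using st by (auto simp: mono_def coef_def intro!: divide_right_mono mult_left_mono KK_mono)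
  then have "coef s t \<in> borel_measurable borel" by (rule borel_measurable_mono)
  from measurable_compose [OF W_F_measurable this]
  show m: "(\<lambda>\<omega>. coef s t (W a \<omega>)) \<in> borel_measurable (F a)" using a by simp
  show "nice (\<lambda>\<omega>. coef s t (W a \<omega>))"
  proof (rule nice_bound)
    show "nice (\<lambda>\<omega>. exp (1 * \<bar>W a \<omega>\<bar>) * coef s t 0)"
      using exp_abs_W_moment(1) [OF a, of 1] by (intro nice_mult nice_const) simp
    show "(\<lambda>\<omega>. coef s t (W a \<omega>)) \<in> borel_measurable M" using a(2) m by (rule F_measurable)
    show "\<bar>coef s t (W a \<omega>)\<bar> \<le> \<bar>exp (1 * \<bar>W a \<omega>\<bar>) * coef s t 0\<bar>" for \<omega>
      using coef_exp_le [OF st(2,3), of "W a \<omega>" 0] coef_nonneg [OF st(2,3)] by (simp add: abs_mult)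
  qed
qed

text \<open>The weights \<open>exp \<bar>W s - W a\<bar>\<close> come from replacing the state at time \<open>s\<close> by the one at time \<open>a\<close>
  in the bound for a single step.\<close>

lemma increment_moment:
  assumes s: "0 \<le> a" "a \<le> s" "s < t" "t \<le> T" and c: "0 \<le> c"
    and Z: "nice Z" "Z \<in> borel_measurable (F a)" "\<And>\<omega>. \<omega> \<in> space M \<Longrightarrow> 0 \<le> Z \<omega>"
  shows "(\<integral>\<omega>. Z \<omega> * (exp \<bar>W s \<omega> - W a \<omega>\<bar> * exp (c / sqrt (t - s) * \<bar>W t \<omega> - W s \<omega>\<bar>)) ^ (2 * m) \<partial>M) \<le>
     2 * exp (8 * (T + c\<^sup>2) * (real m)\<^sup>2) * (\<integral>\<omega>. Z \<omega> \<partial>M)"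
    and "nice (\<lambda>\<omega>. exp \<bar>W s \<omega> - W a \<omega>\<bar> * exp (c / sqrt (t - s) * \<bar>W t \<omega> - W s \<omega>\<bar>))"
proof -
  \<comment> \<open>Separating the two exponentials by u v \<le> (u^2 + v^2) / 2 doubles the
    exponent 2 m. In \<open>?q\<close> the division by sqrt (t - s) normalises the increment, so the
    final bound does not depend on the mesh.\<close>
  let ?p = "4 * real m" and ?q = "4 * real m * (c / sqrt (t - s))"
  have sT: "s \<le> T" and s0: "0 \<le> s" and st: "s \<le> t" using s by simp_all
  have q: "0 \<le> ?q" using c s by simp
  have Zs: "Z \<in> borel_measurable (F s)" using s(2) Z(2) by (rule F_measurable_mono)
  note P = exp_abs_moment [OF s(1,2) sT Z, of ?p]
  note Q = exp_abs_moment [OF s0 st s(4) Z(1) Zs Z(3) q]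
  have one: "nice (\<lambda>_. 1)" "(\<lambda>_. 1 :: real) \<in> borel_measurable (F r)" for r by auto
  have "nice (\<lambda>\<omega>. 1 * exp (1 * \<bar>W s \<omega> - W a \<omega>\<bar>))"
    by (rule exp_abs_moment(2) [OF s(1,2) sT one]) simp_all
  moreover have "nice (\<lambda>\<omega>. 1 * exp (c / sqrt (t - s) * \<bar>W t \<omega> - W s \<omega>\<bar>))"
    by (rule exp_abs_moment(2) [OF s0 st s(4) one]) (use c s in simp_all)
  ultimately show N: "nice (\<lambda>\<omega>. exp \<bar>W s \<omega> - W a \<omega>\<bar> * exp (c / sqrt (t - s) * \<bar>W t \<omega> - W s \<omega>\<bar>))"
    using nice_mult by simp
  have "(\<integral>\<omega>. Z \<omega> * (exp \<bar>W s \<omega> - W a \<omega>\<bar> * exp (c / sqrt (t - s) * \<bar>W t \<omega> - W s \<omega>\<bar>)) ^ (2 * m) \<partial>M) \<le>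
    (\<integral>\<omega>. (1 / 2) * (Z \<omega> * exp (?p * \<bar>W s \<omega> - W a \<omega>\<bar>)) + (1 / 2) * (Z \<omega> * exp (?q * \<bar>W t \<omega> - W s \<omega>\<bar>)) \<partial>M)"
  proof (rule integral_mono)
    show "integrable M (\<lambda>\<omega>. Z \<omega> * (exp \<bar>W s \<omega> - W a \<omega>\<bar> * exp (c / sqrt (t - s) * \<bar>W t \<omega> - W s \<omega>\<bar>)) ^ (2 * m))"
      by (intro nice_integrable nice_mult [OF Z(1)] nice_power N)
    show "integrable M (\<lambda>\<omega>. (1 / 2) * (Z \<omega> * exp (?p * \<bar>W s \<omega> - W a \<omega>\<bar>)) + (1 / 2) * (Z \<omega> * exp (?q * \<bar>W t \<omega> - W s \<omega>\<bar>)))"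
      using P(2) Q(2) by (intro nice_integrable nice_add nice_mult [OF nice_const]) auto
    fix \<omega> assume "\<omega> \<in> space M"
    then have Z0: "0 \<le> Z \<omega>" by (rule Z)
    let ?u = "exp \<bar>W s \<omega> - W a \<omega>\<bar> ^ (2 * m)" and ?v = "exp (c / sqrt (t - s) * \<bar>W t \<omega> - W s \<omega>\<bar>) ^ (2 * m)"
    have "?u * ?v \<le> (1 / 2) * ?u\<^sup>2 + (1 / 2) * ?v\<^sup>2"
      using zero_le_power2 [of "?u - ?v"] unfolding power2_diff by simp
    moreover have "?u\<^sup>2 = exp (?p * \<bar>W s \<omega> - W a \<omega>\<bar>)" "?v\<^sup>2 = exp (?q * \<bar>W t \<omega> - W s \<omega>\<bar>)"
      by (simp_all add: power_mult [symmetric] exp_of_nat_mult [symmetric])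
    ultimately have "(exp \<bar>W s \<omega> - W a \<omega>\<bar> * exp (c / sqrt (t - s) * \<bar>W t \<omega> - W s \<omega>\<bar>)) ^ (2 * m) \<le>
        (1 / 2) * exp (?p * \<bar>W s \<omega> - W a \<omega>\<bar>) + (1 / 2) * exp (?q * \<bar>W t \<omega> - W s \<omega>\<bar>)"
      by (simp only: power_mult_distrib)
    from mult_left_mono [OF this Z0]
    show "Z \<omega> * (exp \<bar>W s \<omega> - W a \<omega>\<bar> * exp (c / sqrt (t - s) * \<bar>W t \<omega> - W s \<omega>\<bar>)) ^ (2 * m) \<le>
        (1 / 2) * (Z \<omega> * exp (?p * \<bar>W s \<omega> - W a \<omega>\<bar>)) + (1 / 2) * (Z \<omega> * exp (?q * \<bar>W t \<omega> - W s \<omega>\<bar>))"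
      by (simp add: algebra_simps)
  qed
  also have "\<dots> = (1 / 2) * (\<integral>\<omega>. Z \<omega> * exp (?p * \<bar>W s \<omega> - W a \<omega>\<bar>) \<partial>M) + (1 / 2) * (\<integral>\<omega>. Z \<omega> * exp (?q * \<bar>W t \<omega> - W s \<omega>\<bar>) \<partial>M)"
    using P(2) Q(2) by (simp add: nice_integrable)
  also have "\<dots> \<le> (1 / 2) * (2 * exp (8 * (T + c\<^sup>2) * (real m)\<^sup>2) * (\<integral>\<omega>. Z \<omega> \<partial>M)) + (1 / 2) * (2 * exp (8 * (T + c\<^sup>2) * (real m)\<^sup>2) * (\<integral>\<omega>. Z \<omega> \<partial>M))"
  proof (intro add_mono mult_left_mono)
    have Z0: "0 \<le> (\<integral>\<omega>. Z \<omega> \<partial>M)" using Z(3) by (rule Bochner_Integration.integral_nonneg)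
    have "?p\<^sup>2 * (s - a) / 2 = 8 * (s - a) * (real m)\<^sup>2" by (simp add: power_mult_distrib)
    also have "\<dots> \<le> 8 * (T + c\<^sup>2) * (real m)\<^sup>2"
      using s by (intro mult_right_mono mult_left_mono) (auto intro: add_increasing2)
    finally have "exp (?p\<^sup>2 * (s - a) / 2) \<le> exp (8 * (T + c\<^sup>2) * (real m)\<^sup>2)" by simp
    then have "2 * exp (?p\<^sup>2 * (s - a) / 2) * (\<integral>\<omega>. Z \<omega> \<partial>M) \<le> 2 * exp (8 * (T + c\<^sup>2) * (real m)\<^sup>2) * (\<integral>\<omega>. Z \<omega> \<partial>M)"
      using Z0 by (intro mult_right_mono) auto
    then show "(\<integral>\<omega>. Z \<omega> * exp (?p * \<bar>W s \<omega> - W a \<omega>\<bar>) \<partial>M) \<le> 2 * exp (8 * (T + c\<^sup>2) * (real m)\<^sup>2) * (\<integral>\<omega>. Z \<omega> \<partial>M)"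
      using P(1) by simp
    have "?q\<^sup>2 * (t - s) / 2 = 8 * c\<^sup>2 * (real m)\<^sup>2" using s by (simp add: power_mult_distrib power_divide)
    also have "\<dots> \<le> 8 * (T + c\<^sup>2) * (real m)\<^sup>2"
      using T0 by (intro mult_right_mono mult_left_mono) auto
    finally have "exp (?q\<^sup>2 * (t - s) / 2) \<le> exp (8 * (T + c\<^sup>2) * (real m)\<^sup>2)" by simp
    then have "2 * exp (?q\<^sup>2 * (t - s) / 2) * (\<integral>\<omega>. Z \<omega> \<partial>M) \<le> 2 * exp (8 * (T + c\<^sup>2) * (real m)\<^sup>2) * (\<integral>\<omega>. Z \<omega> \<partial>M)"
      using Z0 by (intro mult_right_mono) auto
    with Q(1) show "(\<integral>\<omega>. Z \<omega> * exp (?q * \<bar>W t \<omega> - W s \<omega>\<bar>) \<partial>M) \<le> 2 * exp (8 * (T + c\<^sup>2) * (real m)\<^sup>2) * (\<integral>\<omega>. Z \<omega> \<partial>M)"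
      by (rule order_trans)
  qed simp_all
  finally show "(\<integral>\<omega>. Z \<omega> * (exp \<bar>W s \<omega> - W a \<omega>\<bar> * exp (c / sqrt (t - s) * \<bar>W t \<omega> - W s \<omega>\<bar>)) ^ (2 * m) \<partial>M) \<le>
     2 * exp (8 * (T + c\<^sup>2) * (real m)\<^sup>2) * (\<integral>\<omega>. Z \<omega> \<partial>M)" by (simp add: mult_ac)
qed

text \<open>The factor 4^(m^2) of the moment induction is itself of the form exp (c m^2) and can
  join the Gaussian factor. The 5 is 3 + 2, from 8 \<le> exp 3 and 4 \<le> exp 2.\<close>

lemma (in -) moment_constant:
  fixes c K :: real
  assumes m: "1 \<le> m" and K: "0 \<le> K"
  shows "4 * (4 ^ m * K) ^ m * (2 * exp (c * (real m)\<^sup>2)) \<le> exp ((c + 5) * (real m)\<^sup>2) * K ^ m"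
proof -
  have e: "(2::real) \<le> exp 1" using exp_ge_add_one_self [of 1] by simp
  have "(4::real) \<le> exp 2" using power_mono [OF e, of 2] by (simp add: exp_of_nat_mult [symmetric])
  then have "(4::real) ^ (m * m) \<le> exp 2 ^ (m * m)" by (rule power_mono) simp
  also have "\<dots> = exp (2 * (real m)\<^sup>2)" by (simp add: exp_of_nat_mult [symmetric] power2_eq_square mult_ac)
  finally have 4: "(4::real) ^ (m * m) \<le> exp (2 * (real m)\<^sup>2)" .
  have "(8::real) \<le> exp 3" using power_mono [OF e, of 3] by (simp add: exp_of_nat_mult [symmetric])
  also have "\<dots> \<le> exp (3 * (real m)\<^sup>2)" using m by (simp add: one_le_power)
  finally have 8: "8 \<le> exp (3 * (real m)\<^sup>2)" .
  have "4 * (4 ^ m * K) ^ m * (2 * exp (c * (real m)\<^sup>2)) = 8 * 4 ^ (m * m) * exp (c * (real m)\<^sup>2) * K ^ m"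
    by (simp add: power_mult_distrib power_mult)
  also have "\<dots> \<le> exp (3 * (real m)\<^sup>2) * exp (2 * (real m)\<^sup>2) * exp (c * (real m)\<^sup>2) * K ^ m"
    using 4 8 K by (intro mult_right_mono mult_mono) auto
  also have "exp (3 * (real m)\<^sup>2) * exp (2 * (real m)\<^sup>2) * exp (c * (real m)\<^sup>2) = exp ((c + 5) * (real m)\<^sup>2)"
    by (simp add: exp_add [symmetric] distrib_right)
  finally show ?thesis .
qed

text \<open>Dividing by the weight, which is known at time a, turns \<open>coef_net_sum\<close> into
  a deterministic bound of order 1 / n for the sum of the squared coefficients, as
  \<open>even_moment_bound\<close> requires.\<close>

lemma err_moment:
  "\<exists>C>0. \<forall>n i m Z. i < n \<longrightarrow> 1 \<le> m \<longrightarrow> nice Z \<longrightarrow> Z \<in> borel_measurable (F (net n i)) \<longrightarrow>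
     (\<forall>\<omega>\<in>space M. 0 \<le> Z \<omega>) \<longrightarrow>
     (\<integral>\<omega>. Z \<omega> * ((err n T \<omega> - err n (net n i) \<omega>) / weight (net n i) \<omega>) ^ (2 * m) \<partial>M) \<le>
       exp (C * (real m)\<^sup>2) * (C / real n) ^ m * (\<integral>\<omega>. Z \<omega> \<partial>M)"
proof -
  obtain C1 c where C1: "0 \<le> C1" and c: "0 \<le> c" and step: "\<And>s t \<omega>. 0 \<le> s \<Longrightarrow> s < t \<Longrightarrow> t \<le> T \<Longrightarrow>
     \<bar>X t \<omega> - X s \<omega> - V s \<omega> / Y s \<omega> * (Y t \<omega> - Y s \<omega>)\<bar>
       \<le> C1 * coef s t (W s \<omega>) * exp (c / sqrt (t - s) * \<bar>W t \<omega> - W s \<omega>\<bar>)"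
    using step_error_bound by blast
  obtain C2 where C2: "0 \<le> C2" and net_sum: "\<And>n x. 0 < n \<Longrightarrow> (\<Sum>i<n. (coef (net n i) (net n (Suc i)) x)\<^sup>2) \<le>
     C2 / real n * (max (exp x) (exp (\<theta> * x)))\<^sup>2"
    using coef_net_sum by blast
  \<comment> \<open>The summand 1 keeps the constant positive even when all coefficients vanish; exp
    T is the square of the factor in \<open>weight_ge\<close>.\<close>
  define C3 where "C3 = C1\<^sup>2 * C2 * exp T + 1"
  have C3: "0 < C3" using C2 by (auto simp: C3_def intro: add_nonneg_pos)
  define C where "C = C3 + (8 * (T + c\<^sup>2) + 5)"
  have C: "C3 \<le> C" "8 * (T + c\<^sup>2) + 5 \<le> C" "0 < C" using C3 T0 by (auto simp: C_def add_nonneg_nonneg add_pos_nonneg)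
  show ?thesis
  proof (intro exI [of _ C] conjI allI impI C(3))
    fix n i m :: nat and Z
    assume i: "i < n" and m: "1 \<le> m" and Z: "nice Z" "Z \<in> borel_measurable (F (net n i))" "\<forall>\<omega>\<in>space M. 0 \<le> Z \<omega>"
    have n: "0 < n" using i by simp
    let ?a = "net n i"
    have a: "0 \<le> ?a" "?a \<le> T" using net_bounds [OF n, of i] i by auto
    let ?t = "\<lambda>j. net n (i + j)"
    let ?N = "n - i"
    let ?cf = "\<lambda>j. coef (?t j) (?t (Suc j))"
    let ?k = "\<lambda>j \<omega>. C1 * ?cf j (W ?a \<omega>) * (1 / weight ?a \<omega>)"
    let ?S = "\<lambda>j \<omega>. (err n (?t j) \<omega> - err n ?a \<omega>) * (1 / weight ?a \<omega>)"
    let ?D = "\<lambda>j \<omega>. exp \<bar>W (?t j) \<omega> - W ?a \<omega>\<bar> * exp (c / sqrt (?t (Suc j) - ?t j) * \<bar>W (?t (Suc j)) \<omega> - W (?t j) \<omega>\<bar>)"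
    let ?K = "C3 / real n"
    have K: "0 < ?K" using C3 n by simp
    have t: "?a \<le> ?t j" "?t j < ?t (Suc j)" "?t (Suc j) \<le> T" "0 \<le> ?t j" if "j < ?N" for j
      using net_le [of i "i + j" n] theta_net_mono [of "i + j" "i + Suc j" n] net_bounds [OF n, of "i + j"] net_bounds [OF n, of "i + Suc j"] that
      by auto
    have tT: "?t j \<le> T" "0 \<le> ?t j" "?a \<le> ?t j" if "j \<le> ?N" for j
      using net_bounds [OF n, of "i + j"] net_le [of i "i + j" n] that i by auto
    note w = weight_inverse [OF a]
    have k: "nice (?k j)" "?k j \<in> borel_measurable (F ?a)" if j: "j < ?N" for j
      using coef_W [OF t(4) [OF j] less_imp_le [OF t(2) [OF j]] t(3) [OF j] a] w
      by (intro nice_mult nice_const borel_measurable_times borel_measurable_const; simp)+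
    have sum: "(\<Sum>j<?N. (?k j \<omega>)\<^sup>2) \<le> ?K" if "\<omega> \<in> space M" for \<omega>
    proof -
      let ?w = "weight ?a \<omega>" and ?x = "W ?a \<omega>"
      let ?M = "max (exp ?x) (exp (\<theta> * ?x))"
      have w0: "0 < ?w" by (rule weight_pos)
      have "(\<Sum>j<?N. (?cf j ?x)\<^sup>2) = (\<Sum>j\<in>{i..<n}. (coef (net n j) (net n (Suc j)) ?x)\<^sup>2)"
        by (rule sum.reindex_bij_witness [of _ "\<lambda>j. j - i" "\<lambda>j. i + j"]) auto
      also have "\<dots> \<le> (\<Sum>j<n. (coef (net n j) (net n (Suc j)) ?x)\<^sup>2)"
        by (rule sum_mono2) auto
      also have "\<dots> \<le> C2 / real n * ?M\<^sup>2" by (rule net_sum [OF n])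
      also have "\<dots> \<le> C2 / real n * (exp (T / 2) * ?w)\<^sup>2"
        using weight_ge [OF a, of \<omega>] C2 by (intro mult_left_mono power_mono) (auto simp: le_max_iff_disj)
      finally have 1: "(\<Sum>j<?N. (?cf j ?x)\<^sup>2) \<le> C2 / real n * (exp (T / 2) * ?w)\<^sup>2" .
      have "(\<Sum>j<?N. (?k j \<omega>)\<^sup>2) = (C1 / ?w)\<^sup>2 * (\<Sum>j<?N. (?cf j ?x)\<^sup>2)"
        by (simp add: sum_distrib_left power_mult_distrib power_divide)
      also have "\<dots> \<le> (C1 / ?w)\<^sup>2 * (C2 / real n * (exp (T / 2) * ?w)\<^sup>2)"
        using 1 by (rule mult_left_mono) simp
      also have "\<dots> = C1\<^sup>2 * C2 * (exp (T / 2))\<^sup>2 / real n" using w0 by (simp add: power_mult_distrib power_divide)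
      also have "(exp (T / 2))\<^sup>2 = exp T" by (simp add: exp_double [symmetric])
      also have "C1\<^sup>2 * C2 * exp T / real n \<le> ?K" by (simp add: C3_def divide_right_mono)
      finally show ?thesis .
    qed
    have S: "nice (?S j)" if "j \<le> ?N" for j
      using tT [OF that] a w err_nice [OF n] by (intro nice_mult nice_diff) auto
    have SF: "?S j \<in> borel_measurable (F (?t j))" if j: "j < ?N" for j
    proof -
      have "?t j \<le> T" using t(2,3) [OF j] by linarith
      note [measurable] = err_nice(2) [OF n t(4) [OF j] this]
        F_measurable_mono [OF t(1) [OF j] err_nice(2) [OF n a]] F_measurable_mono [OF t(1) [OF j] w(3)]
      show ?thesis by measurable
    qed
    have inc: "?S (Suc j) \<omega> - ?S j \<omega> = (1 / weight ?a \<omega>) * (err n (?t (Suc j)) \<omega> - err n (?t j) \<omega>)" for j \<omega>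
      by (simp add: diff_divide_distrib)
    have mds: "mds (?t j) (\<lambda>\<omega>. ?S (Suc j) \<omega> - ?S j \<omega>)" if "j < ?N" for j
      unfolding inc
      by (rule mds_mult [OF mds_err [OF n t(4) [OF that] less_imp_le [OF t(2) [OF that]] t(3) [OF that]] w(1)
            F_measurable_mono [OF t(1) [OF that] w(3)]])
    have d: "\<bar>?S (Suc j) \<omega> - ?S j \<omega>\<bar> \<le> ?k j \<omega> * ?D j \<omega>" if j: "j < ?N" for j \<omega>
    proof -
      have w0: "0 < weight ?a \<omega>" by (rule weight_pos)
      let ?E = "exp (c / sqrt (?t (Suc j) - ?t j) * \<bar>W (?t (Suc j)) \<omega> - W (?t j) \<omega>\<bar>)"
      have "\<bar>err n (?t (Suc j)) \<omega> - err n (?t j) \<omega>\<bar> \<le> C1 * ?cf j (W (?t j) \<omega>) * ?E"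
        using step [OF t(4) [OF j] t(2) [OF j] t(3) [OF j], of \<omega>] err_step [OF n, of "i + j" \<omega>] j by simp
      also have "\<dots> \<le> C1 * (exp \<bar>W (?t j) \<omega> - W ?a \<omega>\<bar> * ?cf j (W ?a \<omega>)) * ?E"
        using coef_exp_le [of "?t j" "?t (Suc j)" "W (?t j) \<omega>" "W ?a \<omega>"] t [OF j] C1
        by (intro mult_right_mono mult_left_mono) auto
      finally have "(1 / weight ?a \<omega>) * \<bar>err n (?t (Suc j)) \<omega> - err n (?t j) \<omega>\<bar> \<le>
          (1 / weight ?a \<omega>) * (C1 * (exp \<bar>W (?t j) \<omega> - W ?a \<omega>\<bar> * ?cf j (W ?a \<omega>)) * ?E)"
        using w0 by (intro mult_left_mono) auto
      then show ?thesis unfolding inc using w0 by (simp add: abs_mult mult_ac)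
    qed
    have B: "(\<integral>\<omega>. Z \<omega> * ?D j \<omega> ^ (2 * m) \<partial>M) \<le> (2 * exp (8 * (T + c\<^sup>2) * (real m)\<^sup>2)) * (\<integral>\<omega>. Z \<omega> \<partial>M)"
      if "j < ?N" "nice Z" "Z \<in> borel_measurable (F ?a)" "\<And>\<omega>. \<omega> \<in> space M \<Longrightarrow> 0 \<le> Z \<omega>" for j Z
      by (rule increment_moment(1) [OF a(1) t(1) [OF that(1)] t(2) [OF that(1)] t(3) [OF that(1)] c that(2-4)])
    have D: "nice (?D j)" if "j < ?N" for j
      by (rule increment_moment(2) [OF a(1) t(1) [OF that] t(2) [OF that] t(3) [OF that] c, of "\<lambda>_. 1"]) auto
    have "(\<integral>\<omega>. Z \<omega> * ?S ?N \<omega> ^ (2 * m) \<partial>M) \<le> 4 * (4 ^ m * ?K) ^ m * (2 * exp (8 * (T + c\<^sup>2) * (real m)\<^sup>2)) * (\<integral>\<omega>. Z \<omega> \<partial>M)"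
      by (rule even_moment_bound [where t = ?t and k = ?k and D = ?D and a = ?a, OF m K t(1) k sum _ S SF mds d D B _ Z(1,2)])
         (use Z(3) in auto)
    also have "\<dots> \<le> exp (C * (real m)\<^sup>2) * (C / real n) ^ m * (\<integral>\<omega>. Z \<omega> \<partial>M)"
    proof (rule mult_right_mono)
      have "4 * (4 ^ m * ?K) ^ m * (2 * exp (8 * (T + c\<^sup>2) * (real m)\<^sup>2)) \<le> exp ((8 * (T + c\<^sup>2) + 5) * (real m)\<^sup>2) * ?K ^ m"
        by (rule moment_constant [OF m]) (use K in simp)
      also have "\<dots> \<le> exp (C * (real m)\<^sup>2) * (C / real n) ^ m"
        using C C3 K by (intro mult_mono power_mono divide_right_mono) (auto intro: mult_right_mono)
      finally show "4 * (4 ^ m * ?K) ^ m * (2 * exp (8 * (T + c\<^sup>2) * (real m)\<^sup>2)) \<le> exp (C * (real m)\<^sup>2) * (C / real n) ^ m" .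
      show "0 \<le> (\<integral>\<omega>. Z \<omega> \<partial>M)" using Z(3) by (intro Bochner_Integration.integral_nonneg) auto
    qed
    finally show "(\<integral>\<omega>. Z \<omega> * ((err n T \<omega> - err n ?a \<omega>) / weight ?a \<omega>) ^ (2 * m) \<partial>M) \<le>
       exp (C * (real m)\<^sup>2) * (C / real n) ^ m * (\<integral>\<omega>. Z \<omega> \<partial>M)"
      using i n by (simp add: power_mult_distrib power_divide)
  qed
qed

end

subsection \<open>From conditional moments to the tail of the supremum\<close>

text \<open>Convexity: the even power lies above its tangent at v, by Bernoulli's inequality for u /
  v. In the maximal inequality it stands in for the conditional Jensen inequality.\<close>

lemma even_power_tangent_le:
  fixes u v :: real
  assumes m: "1 \<le> m"
  shows "v ^ (2 * m) + 2 * real m * v ^ (2 * m - 1) * (u - v) \<le> u ^ (2 * m)"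
proof (cases "v = 0")
  case True
  then have z: "v ^ (2 * m) = 0" "v ^ (2 * m - 1) = 0" using m by (simp_all add: zero_power)
  have "0 \<le> u ^ (2 * m)" by (simp add: power_mult)
  then show ?thesis unfolding z by simp
next
  case False
  have "1 + real (2 * m) * (u / v - 1) \<le> (1 + (u / v - 1)) ^ (2 * m)"
    by (rule Bernoulli_inequality_even) simp
  then have "v ^ (2 * m) * (1 + real (2 * m) * (u / v - 1)) \<le> v ^ (2 * m) * (u / v) ^ (2 * m)"
    by (intro mult_left_mono) (simp_all add: power_mult)
  also have "\<dots> = u ^ (2 * m)" using False by (simp add: power_divide)
  finally have le: "v ^ (2 * m) * (1 + real (2 * m) * (u / v - 1)) \<le> u ^ (2 * m)" .
  have "v ^ (2 * m) = v ^ (2 * m - 1) * v"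
    using m power_minus_mult [of "2 * m" v] by simp
  then have "v ^ (2 * m) * (1 + real (2 * m) * (u / v - 1)) = v ^ (2 * m) + 2 * real m * v ^ (2 * m - 1) * (u - v)"
    using False by (simp add: field_simps)
  with le show ?thesis by simp
qed

lemma dyadic_exceeds:
  fixes f :: "real \<Rightarrow> real"
  assumes f: "continuous_on {a..b} f" and t: "t \<in> {a..b}" "y < f t"
  shows "\<exists>k j. j \<le> 2 ^ k \<and> y < f (a + (b - a) * real j / 2 ^ k)"
proof -
  obtain j where j: "\<And>k. j k \<le> 2 ^ k" "(\<lambda>k. (b - a) * real (j k) / 2 ^ k) \<longlonglongrightarrow> t - a"
    using dyadic_approx [of "t - a" "b - a"] t by auto
  have "(\<lambda>k. a + (b - a) * real (j k) / 2 ^ k) \<longlonglongrightarrow> a + (t - a)" by (intro tendsto_add tendsto_const j)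
  then have lim: "(\<lambda>k. a + (b - a) * real (j k) / 2 ^ k) \<longlonglongrightarrow> t" by simp
  have "a + (b - a) * real (j k) / 2 ^ k \<in> {a..b}" for k
    using dyadic_mem [OF _ j(1)] t by simp
  then have "(\<lambda>k. f (a + (b - a) * real (j k) / 2 ^ k)) \<longlonglongrightarrow> f t"
    by (intro continuous_on_tendsto_compose [OF f lim t(1)]) simp
  then have "\<forall>\<^sub>F k in sequentially. y < f (a + (b - a) * real (j k) / 2 ^ k)"
    using t(2) by (rule order_tendstoD)
  then obtain k where "y < f (a + (b - a) * real (j k) / 2 ^ k)"
    using eventually_happens' [OF sequentially_bot] by blast
  with j(1) show ?thesis by blast
qed

text \<open>The supremum may be attained at a point that is not dyadic, hence the margins 1 / (p +
  1) and the strict inequalities. The right-hand side involves countably many times, which gives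
  measurability and access to maximal inequalities on finite grids.\<close>

lemma cSUP_ge_iff_dyadic:
  fixes f :: "real \<Rightarrow> real"
  assumes f: "continuous_on {a..b} f" and ab: "a \<le> b"
  shows "z \<le> (SUP t\<in>{a..b}. f t) \<longleftrightarrow>
    (\<forall>p::nat. \<exists>k j. j \<le> 2 ^ k \<and> z - inverse (real (Suc p)) < f (a + (b - a) * real j / 2 ^ k))"
proof -
  have bdd: "bdd_above (f ` {a..b})"
    using f by (intro bounded_imp_bdd_above compact_imp_bounded compact_continuous_image) auto
  have ne: "{a..b} \<noteq> {}" using ab by simp
  show ?thesis
  proof (intro iffI allI)
    fix p :: nat assume "z \<le> (SUP t\<in>{a..b}. f t)"
    moreover have "0 < inverse (real (Suc p))" by simp
    ultimately have "z - inverse (real (Suc p)) < (SUP t\<in>{a..b}. f t)" by linarith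
    then obtain t where "t \<in> {a..b}" "z - inverse (real (Suc p)) < f t"
      using less_cSUP_iff [OF ne bdd] by blast
    then show "\<exists>k j. j \<le> 2 ^ k \<and> z - inverse (real (Suc p)) < f (a + (b - a) * real j / 2 ^ k)"
      by (rule dyadic_exceeds [OF f])
  next
    assume *: "\<forall>p::nat. \<exists>k j. j \<le> 2 ^ k \<and> z - inverse (real (Suc p)) < f (a + (b - a) * real j / 2 ^ k)"
    have "z - inverse (real (Suc p)) \<le> (SUP t\<in>{a..b}. f t)" for p
    proof -
      obtain k j where j: "j \<le> 2 ^ k" "z - inverse (real (Suc p)) < f (a + (b - a) * real j / 2 ^ k)"
        using * by blast
      have "a + (b - a) * real j / 2 ^ k \<in> {a..b}" by (rule dyadic_mem [OF ab j(1)])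
      then have "f (a + (b - a) * real j / 2 ^ k) \<le> (SUP t\<in>{a..b}. f t)" by (rule cSUP_upper [OF _ bdd])
      with j(2) show ?thesis by linarith
    qed
    moreover have "(\<lambda>p. z - inverse (real (Suc p))) \<longlonglongrightarrow> z - 0"
      by (intro tendsto_diff tendsto_const LIMSEQ_inverse_real_of_nat)
    ultimately show "z \<le> (SUP t\<in>{a..b}. f t)" by (intro LIMSEQ_le_const2 [of _ "z"]) auto
  qed
qed

text \<open>With y = ln l and m about y / (2 C), the positive terms C m^2 + m ln C of the exponent
  are at most m y, half of the gain 2 m y. What remains, - m y, is at most - y^2 / (4 C). The
  threshold exp (2 C) for l ensures m \<ge> 1.\<close>

lemma gaussian_tail_choice:
  fixes C l :: real
  assumes C: "1 \<le> C" and l: "exp (2 * C) \<le> l"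
  shows "\<exists>m::nat. 1 \<le> m \<and> exp (C * (real m)\<^sup>2) * (C / l\<^sup>2) ^ m \<le> (1 + 4 * C) * exp (- ((ln l / (1 + 4 * C))\<^sup>2))"
proof -
  have l0: "0 < l" using l exp_gt_zero [of "2 * C"] by linarith
  define y where "y = ln l"
  have y: "2 * C \<le> y" unfolding y_def using l l0 by (simp add: ln_ge_iff)
  define m where "m = nat \<lfloor>y / (2 * C)\<rfloor>"
  have q: "1 \<le> y / (2 * C)" using y C by simp
  then have fl: "1 \<le> \<lfloor>y / (2 * C)\<rfloor>" by simp
  then have m1: "1 \<le> m" unfolding m_def by linarith
  have mr: "real m = of_int \<lfloor>y / (2 * C)\<rfloor>" unfolding m_def by (rule of_nat_nat) (use fl in linarith)
  have m2: "real m \<le> y / (2 * C)" unfolding mr by simp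
  have m3: "y / (4 * C) \<le> real m"
  proof -
    have "y / (2 * C) - 1 < real m" unfolding mr by linarith
    moreover have "1 \<le> real m" using m1 by simp
    ultimately have "y / (2 * C) \<le> 2 * real m" by linarith
    then show ?thesis using C by (simp add: field_simps)
  qed
  have "ln C \<le> C" using ln_le_minus_one [of C] C by simp
  then have "real m * ln C \<le> real m * C" by (rule mult_left_mono) simp
  also have "\<dots> \<le> real m * (C * real m)" using m1 C by (intro mult_left_mono) auto
  finally have 1: "real m * ln C \<le> C * (real m)\<^sup>2" by (simp add: power2_eq_square mult_ac)
  have "2 * C * real m \<le> y" using m2 C by (simp add: field_simps)
  then have "real m * (2 * C * real m) \<le> real m * y" by (rule mult_left_mono) simp
  then have 2: "2 * (C * (real m)\<^sup>2) \<le> real m * y" by (simp add: power2_eq_square mult_ac)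
  have "y / (4 * C) * y \<le> real m * y" using m3 y C by (intro mult_right_mono) auto
  then have 3: "y\<^sup>2 / (4 * C) \<le> real m * y" by (simp add: power2_eq_square)
  have "(C / l\<^sup>2) ^ m = exp (real m * (ln C - 2 * y))"
  proof -
    have "C / l\<^sup>2 = exp (ln C - 2 * y)"
      using C l0 by (simp add: exp_diff y_def exp_double)
    then show ?thesis by (simp add: exp_of_nat_mult)
  qed
  then have "exp (C * (real m)\<^sup>2) * (C / l\<^sup>2) ^ m = exp (C * (real m)\<^sup>2 + real m * (ln C - 2 * y))"
    by (simp add: exp_add)
  also have "\<dots> \<le> exp (- (y\<^sup>2 / (4 * C)))"
    using 1 2 3 by (simp add: right_diff_distrib)
  also have "\<dots> \<le> exp (- ((y / (1 + 4 * C))\<^sup>2))"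
  proof -
    \<comment> \<open>The single constant 1 + 4 C has to serve both as the prefactor and as the
      divisor of ln l.\<close>
    have "4 * C \<le> (1 + 4 * C)\<^sup>2" using C by (simp add: power2_eq_square algebra_simps)
    then have "y\<^sup>2 / (1 + 4 * C)\<^sup>2 \<le> y\<^sup>2 / (4 * C)" using C by (intro divide_left_mono) auto
    then show ?thesis by (simp add: power_divide)
  qed
  also have "\<dots> \<le> (1 + 4 * C) * exp (- ((y / (1 + 4 * C))\<^sup>2))" using C by simp
  finally show ?thesis using m1 unfolding y_def by blast
qed

section \<open>Doob's maximal inequality and conditional probabilities\<close>

context brownian
begin

text \<open>Doob's argument: the event is split by the first index j at which |R j| exceeds x, which
  is decided at time r j. There the tangent at R j bounds the power of U from below, and the linear
  term is orthogonal. The set B, known at time a, takes the place of conditioning.\<close>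

lemma maximal_inequality:
  fixes R :: "nat \<Rightarrow> 'a \<Rightarrow> real"
  assumes r: "\<And>i j. i \<le> j \<Longrightarrow> j \<le> N \<Longrightarrow> r i \<le> r j" "\<And>j. j \<le> N \<Longrightarrow> r j \<le> T" "a \<le> r 0"
    and R: "\<And>j. j \<le> N \<Longrightarrow> nice (R j)" "\<And>j. j \<le> N \<Longrightarrow> R j \<in> borel_measurable (F (r j))"
    and U: "nice U" "\<And>j. j \<le> N \<Longrightarrow> mds (r j) (\<lambda>\<omega>. U \<omega> - R j \<omega>)"
    and B: "B \<in> sets (F a)" and x: "0 < x" and m: "1 \<le> m"
  shows "prob {\<omega> \<in> B. \<exists>j\<le>N. x < \<bar>R j \<omega>\<bar>} \<le> (\<integral>\<omega>. indicator B \<omega> * U \<omega> ^ (2 * m) \<partial>M) / x ^ (2 * m)"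
proof -
  define E where "E j = {\<omega> \<in> B. x < \<bar>R j \<omega>\<bar> \<and> (\<forall>i<j. \<bar>R i \<omega>\<bar> \<le> x)}" for j
  have ra: "a \<le> r j" if "j \<le> N" for j using r(1) [of 0 j] r(3) that by simp
  have EF: "E j \<in> sets (F (r j))" if j: "j \<le> N" for j
  proof -
    have Bj: "B \<in> sets (F (r j))" using F_mono [OF ra [OF j]] B by blast
    have Ri: "R i \<in> borel_measurable (F (r j))" if "i \<le> j" for i
      by (rule F_measurable_mono [OF r(1) [OF that j] R(2)]) (use that j in simp)
    have "E j = B \<inter> ({\<omega> \<in> space (F (r j)). x < \<bar>R j \<omega>\<bar>} \<inter> {\<omega> \<in> space (F (r j)). \<forall>i\<in>{..<j}. \<bar>R i \<omega>\<bar> \<le> x})"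
      using sets.sets_into_space [OF Bj] by (auto simp: E_def)
    moreover have "{\<omega> \<in> space (F (r j)). x < \<bar>R j \<omega>\<bar>} \<in> sets (F (r j))"
      using Ri [OF order_refl] by measurable
    moreover have "{\<omega> \<in> space (F (r j)). \<forall>i\<in>{..<j}. \<bar>R i \<omega>\<bar> \<le> x} \<in> sets (F (r j))"
    proof (rule sets.sets_Collect_finite_All)
      fix i assume "i \<in> {..<j}"
      then have [measurable]: "R i \<in> borel_measurable (F (r j))" by (intro Ri) simp
      show "{\<omega> \<in> space (F (r j)). \<bar>R i \<omega>\<bar> \<le> x} \<in> sets (F (r j))" by measurable
    qed simp
    ultimately show ?thesis using Bj by auto
  qed
  have EM: "E j \<in> sets M" if "j \<le> N" for j using EF [OF that] F_subset [OF r(2) [OF that]] by blast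
  have BM: "B \<in> sets M" using B F_subset [of a] r(2) [of 0] r(3) by auto
  have un: "{\<omega> \<in> B. \<exists>j\<le>N. x < \<bar>R j \<omega>\<bar>} = (\<Union>j\<in>{..N}. E j)"
  proof (intro equalityI subsetI)
    fix \<omega> assume "\<omega> \<in> {\<omega> \<in> B. \<exists>j\<le>N. x < \<bar>R j \<omega>\<bar>}"
    then have \<omega>: "\<omega> \<in> B" and ex: "\<exists>j. j \<le> N \<and> x < \<bar>R j \<omega>\<bar>" by auto
    define j where "j = (LEAST j. j \<le> N \<and> x < \<bar>R j \<omega>\<bar>)"
    have j: "j \<le> N \<and> x < \<bar>R j \<omega>\<bar>" unfolding j_def by (rule LeastI_ex [OF ex])
    have "\<bar>R i \<omega>\<bar> \<le> x" if "i < j" for i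
      using not_less_Least [OF that [unfolded j_def]] that j by auto
    then show "\<omega> \<in> (\<Union>j\<in>{..N}. E j)" using \<omega> j by (auto simp: E_def)
  qed (auto simp: E_def)
  have disj: "disjoint_family_on E {..N}"
    unfolding disjoint_family_on_def
  proof (intro ballI impI)
    fix i j assume "i \<in> {..N}" "j \<in> {..N}" "i \<noteq> j"
    then consider "i < j" | "j < i" by linarith
    then show "E i \<inter> E j = {}" by cases (auto simp: E_def not_le [symmetric])
  qed
  have step: "x ^ (2 * m) * prob (E j) \<le> (\<integral>\<omega>. indicator (E j) \<omega> * U \<omega> ^ (2 * m) \<partial>M)" if j: "j \<le> N" for j
  proof -
    let ?\<zeta> = "\<lambda>\<omega>. indicator (E j) \<omega> * (2 * real m * R j \<omega> ^ (2 * m - 1))"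
    have nI: "nice (indicator (E j))" using EM [OF j] by (rule nice_indicator)
    have n\<zeta>: "nice ?\<zeta>" using nI R(1) [OF j] by (intro nice_mult nice_power nice_const)
    have "?\<zeta> \<in> borel_measurable (F (r j))"
      using EF [OF j] R(2) [OF j] by measurable
    then have zero: "(\<integral>\<omega>. ?\<zeta> \<omega> * (U \<omega> - R j \<omega>) \<partial>M) = 0"
      by (rule mds_orthogonal [OF U(2) [OF j] n\<zeta>])
    have i1: "integrable M (\<lambda>\<omega>. x ^ (2 * m) * indicator (E j) \<omega>)" using nI by (intro nice_integrable nice_mult nice_const)
    have i2: "integrable M (\<lambda>\<omega>. ?\<zeta> \<omega> * (U \<omega> - R j \<omega>))"
      by (intro nice_integrable nice_mult [OF n\<zeta>] nice_diff U(1) R(1) [OF j])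
    have i3: "integrable M (\<lambda>\<omega>. indicator (E j) \<omega> * U \<omega> ^ (2 * m))"
      using nI U(1) by (intro nice_integrable nice_mult nice_power)
    have "x ^ (2 * m) * prob (E j) = (\<integral>\<omega>. x ^ (2 * m) * indicator (E j) \<omega> \<partial>M)"
      using EM [OF j] by simp
    also have "\<dots> = (\<integral>\<omega>. x ^ (2 * m) * indicator (E j) \<omega> + ?\<zeta> \<omega> * (U \<omega> - R j \<omega>) \<partial>M)"
      using i1 i2 zero by simp
    also have "\<dots> \<le> (\<integral>\<omega>. indicator (E j) \<omega> * U \<omega> ^ (2 * m) \<partial>M)"
    proof (rule integral_mono)
      show "integrable M (\<lambda>\<omega>. x ^ (2 * m) * indicator (E j) \<omega> + ?\<zeta> \<omega> * (U \<omega> - R j \<omega>))" using i1 i2 by simp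
      fix \<omega>
      show "x ^ (2 * m) * indicator (E j) \<omega> + ?\<zeta> \<omega> * (U \<omega> - R j \<omega>) \<le> indicator (E j) \<omega> * U \<omega> ^ (2 * m)"
      proof (cases "\<omega> \<in> E j")
        case True
        then have "x ^ (2 * m) \<le> \<bar>R j \<omega>\<bar> ^ (2 * m)" using x by (intro power_mono) (auto simp: E_def)
        then have "x ^ (2 * m) \<le> R j \<omega> ^ (2 * m)" by (simp add: power_even_abs)
        then show ?thesis using True even_power_tangent_le [OF m, of "R j \<omega>" "U \<omega>"] by simp
      qed simp
    qed (rule i3)
    finally show ?thesis .
  qed
  have "x ^ (2 * m) * prob (\<Union>j\<in>{..N}. E j) = (\<Sum>j\<le>N. x ^ (2 * m) * prob (E j))"
    using EM disj by (subst finite_measure_finite_Union) (auto simp: sum_distrib_left)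
  also have "\<dots> \<le> (\<Sum>j\<le>N. \<integral>\<omega>. indicator (E j) \<omega> * U \<omega> ^ (2 * m) \<partial>M)"
    using step by (intro sum_mono) simp
  also have "\<dots> = (\<integral>\<omega>. (\<Sum>j\<le>N. indicator (E j) \<omega> * U \<omega> ^ (2 * m)) \<partial>M)"
    using EM U(1) by (intro Bochner_Integration.integral_sum [symmetric] nice_integrable nice_mult nice_power nice_indicator) auto
  also have "\<dots> \<le> (\<integral>\<omega>. indicator B \<omega> * U \<omega> ^ (2 * m) \<partial>M)"
  proof (rule integral_mono)
    show "integrable M (\<lambda>\<omega>. \<Sum>j\<le>N. indicator (E j) \<omega> * U \<omega> ^ (2 * m))"
      using EM U(1) by (intro nice_integrable nice_sum nice_mult nice_power nice_indicator) auto
    show "integrable M (\<lambda>\<omega>. indicator B \<omega> * U \<omega> ^ (2 * m))"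
      using BM U(1) by (intro nice_integrable nice_mult nice_power nice_indicator)
    fix \<omega>
    have "(\<Sum>j\<le>N. indicator (E j) \<omega>) = (indicator (\<Union>j\<in>{..N}. E j) \<omega> :: real)"
      by (rule indicator_UN_disjoint [OF _ disj, symmetric]) simp
    also have "\<dots> \<le> indicator B \<omega>" by (auto simp: indicator_def E_def)
    finally have "(\<Sum>j\<le>N. indicator (E j) \<omega>) * U \<omega> ^ (2 * m) \<le> indicator B \<omega> * U \<omega> ^ (2 * m)"
      by (rule mult_right_mono) (simp add: power_mult)
    then show "(\<Sum>j\<le>N. indicator (E j) \<omega> * U \<omega> ^ (2 * m)) \<le> indicator B \<omega> * U \<omega> ^ (2 * m)"
      by (simp add: sum_distrib_right)
  qed
  finally show ?thesis unfolding un using x by (simp add: pos_le_divide_eq mult.commute)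
qed

text \<open>Tested on the set where the conditional probability exceeds q: this set is in F a, and
  unless it is null the integral there would violate the assumed bound.\<close>

lemma real_cond_exp_indicator_le:
  assumes a: "0 \<le> a" "a \<le> T" and E: "E \<in> sets M"
    and le: "\<And>B. B \<in> sets (F a) \<Longrightarrow> prob (E \<inter> B) \<le> q * prob B"
  shows "AE \<omega> in M. real_cond_exp M (F a) (indicator E) \<omega> \<le> q"
proof -
  interpret finite_measure_subalgebra M "F a"
    by standard (use F_subset [OF a(2)] space_F in \<open>auto simp: subalgebra_def\<close>)
  define f where "f = real_cond_exp M (F a) (indicator E)"
  have fF [measurable]: "f \<in> borel_measurable (F a)" unfolding f_def by (rule borel_measurable_cond_exp)
  have fM: "f \<in> borel_measurable M" unfolding f_def by (rule borel_measurable_cond_exp2)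
  define B where "B = {\<omega> \<in> space (F a). q < f \<omega>}"
  have B: "B \<in> sets (F a)" unfolding B_def by measurable
  then have BM: "B \<in> sets M" using F_subset [OF a(2)] by blast
  have iE: "integrable M (indicator E :: 'a \<Rightarrow> real)" using E by (intro nice_integrable nice_indicator)
  have fi: "integrable M f" unfolding f_def by (rule real_cond_exp_int(1) [OF iE])
  have i1: "integrable M (\<lambda>\<omega>. indicator B \<omega> * f \<omega>)"
    using integrable_mult_indicator [OF BM fi] by simp
  have i2: "integrable M (\<lambda>\<omega>. indicator B \<omega> * q)" using BM by (intro nice_integrable nice_mult nice_indicator nice_const)
  have "(\<integral>\<omega>. indicator B \<omega> * f \<omega> \<partial>M) = (\<integral>\<omega>. indicator B \<omega> * indicator E \<omega> \<partial>M)"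
    using real_cond_exp_intA [OF iE B] by (simp add: set_lebesgue_integral_def f_def)
  also have "(\<lambda>\<omega>. indicator B \<omega> * indicator E \<omega> :: real) = indicator (E \<inter> B)"
    by (auto simp: fun_eq_iff indicator_def)
  also have "(\<integral>\<omega>. indicator (E \<inter> B) \<omega> \<partial>M) = prob (E \<inter> B)" using E BM by simp
  also have "\<dots> \<le> q * prob B" by (rule le [OF B])
  finally have "(\<integral>\<omega>. indicator B \<omega> * f \<omega> \<partial>M) \<le> q * prob B" .
  then have "(\<integral>\<omega>. indicator B \<omega> * f \<omega> - indicator B \<omega> * q \<partial>M) \<le> 0"
    using i1 i2 BM by (simp add: mult.commute)
  moreover have nn: "0 \<le> indicator B \<omega> * f \<omega> - indicator B \<omega> * q" for \<omega>
    by (auto simp: B_def indicator_def)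
  ultimately have "(\<integral>\<omega>. indicator B \<omega> * f \<omega> - indicator B \<omega> * q \<partial>M) = 0"
    by (intro antisym Bochner_Integration.integral_nonneg) auto
  then have "AE \<omega> in M. indicator B \<omega> * f \<omega> - indicator B \<omega> * q = 0"
    using i1 i2 nn by (subst (asm) integral_nonneg_eq_0_iff_AE) auto
  then show ?thesis
    unfolding f_def [symmetric] using AE_space
    by eventually_elim (auto simp: B_def indicator_def space_F split: if_splits)
qed

end

section \<open>The tail of the hedging error\<close>

context hedging
begin

lemma hedging_error_eq:
  "hedging_error M W T (\<lambda>x. g\<theta> x + g1 x) n (net n) t \<omega> = wealth t \<omega> - simple_integral Y n (net n) (\<lambda>i. H (net n i)) t \<omega>"
proof -
  have "hedge_process (net n i) \<omega> = H (net n i) \<omega>" if "i < n" for i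
    using net_bounds [of n i] that by (intro hedge_process_eq) auto
  then show ?thesis
    by (simp add: hedging_error_def wealth_def simple_integral_def sum.atLeast1_atMost_eq)
qed

abbreviation herr :: "nat \<Rightarrow> real \<Rightarrow> 'a \<Rightarrow> real" where
  "herr n \<equiv> hedging_error M W T (\<lambda>x. g\<theta> x + g1 x) n (net n)"

lemma herr_eq_err: "AE \<omega> in M. \<forall>t\<in>{0..T}. herr n t \<omega> = err n t \<omega>"
  using wealth_eq by eventually_elim (simp add: hedging_error_eq err_def)

lemma herr_continuous: "0 < n \<Longrightarrow> \<omega> \<in> space M \<Longrightarrow> continuous_on {0..T} (\<lambda>t. herr n t \<omega>)"
  using continuous_on_add [OF err_continuous continuous_on_diff [OF wealth_continuous X_continuous], of n \<omega> \<omega> \<omega>]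
  by (simp add: hedging_error_eq err_def)

lemma herr_measurable: "0 < n \<Longrightarrow> 0 \<le> t \<Longrightarrow> t \<le> T \<Longrightarrow> herr n t \<in> borel_measurable M"
proof -
  assume t: "0 < n" "0 \<le> t" "t \<le> T"
  have "(\<lambda>\<omega>. err n t \<omega> + (wealth t \<omega> - X t \<omega>)) \<in> borel_measurable M"
    using err_nice(1) [OF t] wealth_measurable [OF t(2,3)] nice_X [OF t(2,3)]
    by (intro borel_measurable_add borel_measurable_diff) (auto dest: nice_measurable)
  then show ?thesis by (simp add: hedging_error_eq [abs_def] err_def)
qed

text \<open>The maximal inequality is applied on the dyadic grid of each level, with a bound
  independent of the level, and continuity of the measure along increasing events passes to all
  levels.\<close>

lemma err_tail:
  "\<exists>C\<ge>1. \<forall>n i m B x. i < n \<longrightarrow> 1 \<le> m \<longrightarrow> B \<in> sets (F (net n i)) \<longrightarrow> 0 < x \<longrightarrow>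
     {\<omega> \<in> B. \<exists>k j. j \<le> 2 ^ k \<and>
        x < \<bar>(err n (net n i + (T - net n i) * real j / 2 ^ k) \<omega> - err n (net n i) \<omega>) / weight (net n i) \<omega>\<bar>} \<in> sets M \<and>
     prob {\<omega> \<in> B. \<exists>k j. j \<le> 2 ^ k \<and>
        x < \<bar>(err n (net n i + (T - net n i) * real j / 2 ^ k) \<omega> - err n (net n i) \<omega>) / weight (net n i) \<omega>\<bar>}
     \<le> exp (C * (real m)\<^sup>2) * (C / (real n * x\<^sup>2)) ^ m * prob B"
proof -
  obtain C where C: "0 < C" and mom: "\<And>n i m Z. i < n \<Longrightarrow> 1 \<le> m \<Longrightarrow> nice Z \<Longrightarrow> Z \<in> borel_measurable (F (net n i)) \<Longrightarrow>
     (\<forall>\<omega>\<in>space M. 0 \<le> Z \<omega>) \<Longrightarrow>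
     (\<integral>\<omega>. Z \<omega> * ((err n T \<omega> - err n (net n i) \<omega>) / weight (net n i) \<omega>) ^ (2 * m) \<partial>M) \<le>
       exp (C * (real m)\<^sup>2) * (C / real n) ^ m * (\<integral>\<omega>. Z \<omega> \<partial>M)"
    using err_moment by blast
  \<comment> \<open>\<open>gaussian_tail_choice\<close> asks for a constant of at least 1.\<close>
  define C' where "C' = max 1 C"
  have C': "1 \<le> C'" "C \<le> C'" by (simp_all add: C'_def)
  show ?thesis
  proof (intro exI [of _ C'] conjI allI impI C'(1))
    fix n i m :: nat and B and x :: real
    assume i: "i < n" and m: "1 \<le> m" and B: "B \<in> sets (F (net n i))" and x: "0 < x"
    have n: "0 < n" using i by simp
    define a where "a = net n i"
    have a: "0 \<le> a" "a \<le> T" using net_bounds [OF n, of i] i by (auto simp: a_def)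
    have B': "B \<in> sets (F a)" using B by (simp add: a_def)
    then have BM: "B \<in> sets M" using F_subset [OF a(2)] by blast
    define r where "r k j = a + (T - a) * real j / 2 ^ k" for k j :: nat
    have r: "a \<le> r k j" "r k j \<le> T" if "j \<le> 2 ^ k" for k j
      using dyadic_mem [OF a(2) that] by (auto simp: r_def)
    have rmono: "r k j \<le> r k j'" if "j \<le> j'" for k j j'
      using that a by (simp add: r_def divide_right_mono mult_left_mono)
    define R where "R t \<omega> = (err n t \<omega> - err n a \<omega>) * (1 / weight a \<omega>)" for t \<omega>
    note w = weight_inverse [OF a]
    have Rn: "nice (R t)" if "a \<le> t" "t \<le> T" for t
      unfolding R_def [abs_def] using err_nice(1) [OF n] that a w(1) by (intro nice_mult nice_diff) auto
    have RF: "R t \<in> borel_measurable (F t)" if "a \<le> t" "t \<le> T" for t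
    proof -
      have "0 \<le> t" using that a by simp
      note [measurable] = err_nice(2) [OF n this that(2)]
        F_measurable_mono [OF that(1) err_nice(2) [OF n a]] F_measurable_mono [OF that(1) w(3)]
      show ?thesis unfolding R_def [abs_def] by measurable
    qed
    have Rmds: "mds t (\<lambda>\<omega>. R T \<omega> - R t \<omega>)" if "a \<le> t" "t \<le> T" for t
    proof -
      have "mds t (\<lambda>\<omega>. (1 / weight a \<omega>) * (err n T \<omega> - err n t \<omega>))"
        by (rule mds_mult [OF mds_err [OF n _ that(2) order_refl] w(1) F_measurable_mono [OF that(1) w(3)]])
           (use a that in simp)
      moreover have "(1 / weight a \<omega>) * (err n T \<omega> - err n t \<omega>) = R T \<omega> - R t \<omega>" for \<omega>
        by (simp add: R_def diff_divide_distrib)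
      ultimately show ?thesis by simp
    qed
    define A where "A k = {\<omega> \<in> B. \<exists>j\<le>2 ^ k. x < \<bar>R (r k j) \<omega>\<bar>}" for k
    define q where "q = exp (C' * (real m)\<^sup>2) * (C' / (real n * x\<^sup>2)) ^ m * prob B"
    have bound: "prob (A k) \<le> q" for k
    proof -
      have "prob (A k) \<le> (\<integral>\<omega>. indicator B \<omega> * R T \<omega> ^ (2 * m) \<partial>M) / x ^ (2 * m)"
        unfolding A_def
        by (rule maximal_inequality [where r = "r k" and a = a, OF rmono r(2) _ Rn RF _ Rmds B' x m])
           (use r Rn a in auto)
      also have "(\<integral>\<omega>. indicator B \<omega> * R T \<omega> ^ (2 * m) \<partial>M) \<le> exp (C * (real m)\<^sup>2) * (C / real n) ^ m * (\<integral>\<omega>. indicator B \<omega> \<partial>M)"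
        using mom [OF i m nice_indicator [OF BM]] B by (simp add: R_def a_def)
      also have "\<dots> \<le> exp (C' * (real m)\<^sup>2) * (C' / real n) ^ m * prob B"
        using C C' BM by (simp add: mult_mono power_mono divide_right_mono)
      finally have "prob (A k) \<le> exp (C' * (real m)\<^sup>2) * (C' / real n) ^ m * prob B / x ^ (2 * m)"
        using x by (simp add: divide_right_mono)
      also have "\<dots> = q"
        by (simp add: q_def power_mult power_divide power_mult_distrib)
      finally show ?thesis .
    qed
    have AM: "A k \<in> sets M" for k
    proof -
      have "{\<omega> \<in> space M. x < \<bar>R (r k j) \<omega>\<bar>} \<in> sets M" if "j \<le> 2 ^ k" for j
        using nice_measurable [OF Rn [OF r [OF that]]] by measurable
      then have "{\<omega> \<in> space M. \<exists>j\<in>{..2 ^ k}. x < \<bar>R (r k j) \<omega>\<bar>} \<in> sets M"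
        by (intro sets.sets_Collect_finite_Ex) auto
      moreover have "A k = B \<inter> {\<omega> \<in> space M. \<exists>j\<in>{..2 ^ k}. x < \<bar>R (r k j) \<omega>\<bar>}"
        using sets.sets_into_space [OF BM] by (auto simp: A_def)
      ultimately show ?thesis using BM by auto
    qed
    \<comment> \<open>The grids are nested: point j of level k is point 2 j of level k + 1.\<close>
    have "incseq A"
    proof (rule incseq_SucI, rule subsetI)
      fix k \<omega> assume "\<omega> \<in> A k"
      then obtain j where j: "\<omega> \<in> B" "j \<le> 2 ^ k" "x < \<bar>R (r k j) \<omega>\<bar>" by (auto simp: A_def)
      have "r k j = r (Suc k) (2 * j)" by (simp add: r_def)
      then have "2 * j \<le> 2 ^ Suc k" "x < \<bar>R (r (Suc k) (2 * j)) \<omega>\<bar>" using j by simp_all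
      then show "\<omega> \<in> A (Suc k)" using j(1) unfolding A_def by blast
    qed
    then have "(\<lambda>k. prob (A k)) \<longlonglongrightarrow> prob (\<Union>k. A k)" using AM by (intro finite_Lim_measure_incseq) auto
    then have "prob (\<Union>k. A k) \<le> q" by (rule LIMSEQ_le_const2) (use bound in auto)
    moreover have "(\<Union>k. A k) \<in> sets M" using AM by blast
    moreover have eq: "(\<Union>k. A k) = {\<omega> \<in> B. \<exists>k j. j \<le> 2 ^ k \<and>
        x < \<bar>(err n (net n i + (T - net n i) * real j / 2 ^ k) \<omega> - err n (net n i) \<omega>) / weight (net n i) \<omega>\<bar>}"
      by (auto simp: A_def R_def r_def a_def)
    ultimately show "{\<omega> \<in> B. \<exists>k j. j \<le> 2 ^ k \<and>
        x < \<bar>(err n (net n i + (T - net n i) * real j / 2 ^ k) \<omega> - err n (net n i) \<omega>) / weight (net n i) \<omega>\<bar>} \<in> sets M"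
      "prob {\<omega> \<in> B. \<exists>k j. j \<le> 2 ^ k \<and>
        x < \<bar>(err n (net n i + (T - net n i) * real j / 2 ^ k) \<omega> - err n (net n i) \<omega>) / weight (net n i) \<omega>\<bar>}
      \<le> exp (C' * (real m)\<^sup>2) * (C' / (real n * x\<^sup>2)) ^ m * prob B"
      unfolding eq q_def by - assumption+
  qed
qed

text \<open>The event concerns the chosen version of the integral and is measurable by the dyadic
  description of the supremum. Almost surely it is contained in the event of
  \<open>err_tail\<close>, whose probability inside each F a-set B carries the factor prob B that
  \<open>real_cond_exp_indicator_le\<close> demands.\<close>

lemma conditional_tail:
  "\<exists>A>0. \<exists>c>0. \<exists>l0\<ge>1. \<forall>n\<ge>1. \<forall>a \<in> net n ` {0..n}. a < T \<longrightarrow>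
    (\<forall>l\<ge>l0. AE \<omega> in M.
       real_cond_exp M (F a)
         (indicator {\<omega>' \<in> space M.
            (SUP t\<in>{a..T}. \<bar>herr n t \<omega>' - herr n a \<omega>'\<bar>)
              \<ge> c * l * (max (Y a \<omega>') (Y a \<omega>' powr \<theta>) / sqrt (real n))}) \<omega>
         \<le> A * exp (- ((ln l / A)\<^sup>2)))"
proof -
  obtain C where C: "1 \<le> C" and tail: "\<And>n i m B x. i < n \<Longrightarrow> 1 \<le> m \<Longrightarrow> B \<in> sets (F (net n i)) \<Longrightarrow> 0 < x \<Longrightarrow>
     {\<omega> \<in> B. \<exists>k j. j \<le> 2 ^ k \<and>
        x < \<bar>(err n (net n i + (T - net n i) * real j / 2 ^ k) \<omega> - err n (net n i) \<omega>) / weight (net n i) \<omega>\<bar>} \<in> sets M \<and>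
     prob {\<omega> \<in> B. \<exists>k j. j \<le> 2 ^ k \<and>
        x < \<bar>(err n (net n i + (T - net n i) * real j / 2 ^ k) \<omega> - err n (net n i) \<omega>) / weight (net n i) \<omega>\<bar>}
     \<le> exp (C * (real m)\<^sup>2) * (C / (real n * x\<^sup>2)) ^ m * prob B"
    using err_tail by blast
  let ?A = "1 + 4 * C"
  have main: "AE \<omega> in M. real_cond_exp M (F a) (indicator {\<omega>' \<in> space M.
            (SUP t\<in>{a..T}. \<bar>herr n t \<omega>' - herr n a \<omega>'\<bar>)
              \<ge> 2 * l * (max (Y a \<omega>') (Y a \<omega>' powr \<theta>) / sqrt (real n))}) \<omega>
         \<le> ?A * exp (- ((ln l / ?A)\<^sup>2))"
    if n: "1 \<le> n" and a: "a \<in> net n ` {0..n}" "a < T" and l: "exp (2 * C) \<le> l" for n a l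
  proof -
    have n0: "0 < n" using n by simp
    obtain i where ai: "a = net n i" and "i \<le> n" using a(1) by auto
    then have i: "i < n" using a(2) theta_net_n [OF n0] by (cases "i = n") auto
    have a0: "0 \<le> a" "a \<le> T" using net_bounds [OF n0, of i] i ai by auto
    have l0: "0 < l" using l exp_gt_zero [of "2 * C"] by linarith
    obtain m where m: "1 \<le> m" "exp (C * (real m)\<^sup>2) * (C / l\<^sup>2) ^ m \<le> ?A * exp (- ((ln l / ?A)\<^sup>2))"
      using gaussian_tail_choice [OF C l] by blast
    define z where "z \<omega> = 2 * l * (weight a \<omega> / sqrt (real n))" for \<omega>
    define f where "f \<omega> t = \<bar>herr n t \<omega> - herr n a \<omega>\<bar>" for \<omega> t
    define r where "r k j = a + (T - a) * real j / 2 ^ k" for k j :: nat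
    have r: "a \<le> r k j" "r k j \<le> T" if "j \<le> 2 ^ k" for k j
      using dyadic_mem [OF a0(2) that] by (auto simp: r_def)
    define E where "E = {\<omega> \<in> space M. z \<omega> \<le> (SUP t\<in>{a..T}. f \<omega> t)}"
    have f: "continuous_on {a..T} (f \<omega>)" if "\<omega> \<in> space M" for \<omega>
      unfolding f_def [abs_def]
      by (intro continuous_intros continuous_on_subset [OF herr_continuous [OF n0 that]]) (use a0 in auto)
    have E_eq: "E = {\<omega> \<in> space M. \<forall>p::nat. \<exists>k j. j \<le> 2 ^ k \<and> z \<omega> - inverse (real (Suc p)) < f \<omega> (r k j)}"
      unfolding E_def r_def using cSUP_ge_iff_dyadic [OF f a0(2)] by blast
    have "weight a \<in> borel_measurable M" using weight_inverse(2) [OF a0] by (rule F_measurable [OF a0(2)])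
    then have [measurable]: "z \<in> borel_measurable M" unfolding z_def [abs_def] by measurable
    have "E \<in> sets M"
      unfolding E_eq
    proof (intro sets.sets_Collect_countable_All sets.sets_Collect_countable_Ex)
      fix p k j :: nat
      show "{\<omega> \<in> space M. j \<le> 2 ^ k \<and> z \<omega> - inverse (real (Suc p)) < f \<omega> (r k j)} \<in> sets M"
      proof (cases "j \<le> 2 ^ k")
        case True
        have [measurable]: "herr n (r k j) \<in> borel_measurable M" "herr n a \<in> borel_measurable M"
          using r [OF True] a0 by (auto intro!: herr_measurable [OF n0])
        show ?thesis using True unfolding f_def by measurable
      qed simp
    qed
    moreover have "prob (E \<inter> B) \<le> ?A * exp (- ((ln l / ?A)\<^sup>2)) * prob B" if B: "B \<in> sets (F a)" for B
    proof -
      \<comment> \<open>With this level n x^2 = l^2, so n disappears from the moment bound.\<close>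
      define x where "x = l / sqrt (real n)"
      have x: "0 < x" using l0 n by (simp add: x_def)
      define G where "G = {\<omega> \<in> B. \<exists>k j. j \<le> 2 ^ k \<and> x < \<bar>(err n (r k j) \<omega> - err n a \<omega>) / weight a \<omega>\<bar>}"
      have "G \<in> sets M \<and> prob G \<le> exp (C * (real m)\<^sup>2) * (C / (real n * x\<^sup>2)) ^ m * prob B"
        unfolding G_def r_def ai by (rule tail [OF i m(1) B [unfolded ai] x])
      then have G: "G \<in> sets M" "prob G \<le> exp (C * (real m)\<^sup>2) * (C / (real n * x\<^sup>2)) ^ m * prob B" by simp_all
      have "prob (E \<inter> B) \<le> prob G"
      proof (rule finite_measure_mono_AE [OF _ G(1)])
        show "AE \<omega> in M. \<omega> \<in> E \<inter> B \<longrightarrow> \<omega> \<in> G"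
          using herr_eq_err [of n]
        proof eventually_elim
          case (elim \<omega>)
          show ?case
          proof
            assume \<omega>: "\<omega> \<in> E \<inter> B"
            have w: "0 < weight a \<omega>" by (rule weight_pos)
            \<comment> \<open>The constant c = 2 pays for this: half of the threshold absorbs the
              margin lost at dyadic points, the other half is the level of \<open>err_tail\<close>
              times the weight.\<close>
            then have "0 < z \<omega> / 2" using l0 n by (simp add: z_def)
            then obtain p :: nat where p: "inverse (real (Suc p)) < z \<omega> / 2" using reals_Archimedean by blast
            obtain k j where j: "j \<le> 2 ^ k" "z \<omega> - inverse (real (Suc p)) < f \<omega> (r k j)"
              using \<omega> unfolding E_eq by blast
            have "f \<omega> (r k j) = \<bar>err n (r k j) \<omega> - err n a \<omega>\<bar>"
              using elim r [OF j(1)] a0 by (simp add: f_def)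
            then have "z \<omega> / 2 < \<bar>err n (r k j) \<omega> - err n a \<omega>\<bar>" using j(2) p by linarith
            moreover have "z \<omega> / 2 = x * weight a \<omega>" by (simp add: z_def x_def)
            ultimately have "x < \<bar>(err n (r k j) \<omega> - err n a \<omega>) / weight a \<omega>\<bar>"
              using w by (simp add: pos_less_divide_eq)
            then show "\<omega> \<in> G" using \<omega> j(1) unfolding G_def by blast
          qed
        qed
      qed
      also have "\<dots> \<le> exp (C * (real m)\<^sup>2) * (C / l\<^sup>2) ^ m * prob B"
        using G(2) n0 by (simp add: x_def power_divide)
      also have "\<dots> \<le> ?A * exp (- ((ln l / ?A)\<^sup>2)) * prob B"
        using m(2) by (rule mult_right_mono) simp
      finally show ?thesis .
    qed
    ultimately have "AE \<omega> in M. real_cond_exp M (F a) (indicator E) \<omega> \<le> ?A * exp (- ((ln l / ?A)\<^sup>2))"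
      by (rule real_cond_exp_indicator_le [OF a0])
    then show ?thesis unfolding E_def z_def f_def weight_def .
  qed
  show ?thesis
  proof (rule exI [of _ ?A], rule conjI, use C in simp, rule exI [of _ 2], rule conjI, simp,
      rule exI [of _ "exp (2 * C)"], rule conjI, use C in simp, intro allI impI ballI)
  qed (rule main)
qed

end

theorem theorem7:
  fixes M :: "'a measure" and W :: "real \<Rightarrow> 'a \<Rightarrow> real"
    and T \<theta> :: real and g g\<theta> g1 :: "real \<Rightarrow> real"
  assumes "T > 0" and "0 < \<theta>" and "\<theta> < 1"
    and "complete_measure M"
    and "std_brownian_motion M T W"
    and "sets M = sets (augmented_filtration M W T)"
    and "g\<theta> \<in> Hol2 \<theta>"
    and "\<exists>L. L-lipschitz_on UNIV g1"
    and "g = (\<lambda>x. g\<theta> x + g1 x)"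
  shows "\<exists>A>0. \<exists>c>0. \<exists>l0\<ge>1. \<forall>n\<ge>1. \<forall>a \<in> theta_net T \<theta> n ` {0..n}. a < T \<longrightarrow>
    (\<forall>l\<ge>l0. AE \<omega> in M.
       real_cond_exp M (augmented_filtration M W a)
         (indicator {\<omega>' \<in> space M.
            (SUP t\<in>{a..T}. \<bar>hedging_error M W T g n (theta_net T \<theta> n) t \<omega>'
                           - hedging_error M W T g n (theta_net T \<theta> n) a \<omega>'\<bar>)
              \<ge> c * l * (max (geom_bm W a \<omega>') (geom_bm W a \<omega>' powr \<theta>) / sqrt (real n))}) \<omega>
         \<le> A * exp (- ((ln l / A)\<^sup>2)))"
proof -
  obtain L where L: "L-lipschitz_on UNIV g1" using assms(8) by blast
  interpret prob_space M using assms(5) by (simp add: std_brownian_motion_def)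
  interpret hedging M W T \<theta> L g\<theta> g1
    by (intro hedging.intro brownian.intro brownian_axioms.intro hedging_payoff.intro prob_space_axioms assms L)
  show ?thesis unfolding assms(9) by (rule conditional_tail)
qed

end
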